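(* The bilinear form $a\colon\mathcal{U}\times\mathcal{U}\to\mathbb{R}$ defined in the context is symmetric, bounded and coercive with respect to the norm $|\cdot|_{\mathcal{U}}$. That is, for all $\boldsymbol{u},\boldsymbol{v}\in\mathcal{U}$ one has $a(\boldsymbol{u},\boldsymbol{v})=a(\boldsymbol{v},\boldsymbol{u})$, and there exist constants $C_1,C_2>0$ such that $$|a(\boldsymbol{u},\boldsymbol{v})|\le C_1\,|\boldsymbol{u}|_{\mathcal{U}}\,|\boldsymbol{v}|_{\mathcal{U}}\quad\text{for all }\boldsymbol{u},\boldsymbol{v}\in\mathcal{U},\qquad |\boldsymbol{u}|_{\mathcal{U}}^2\le C_2\,a(\boldsymbol{u},\boldsymbol{u})\quad\text{for all }\boldsymbol{u}\in\mathcal{U}.$$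
   Context: Setting: $d\in\{1,2,3\}$, $\Omega\subset\mathbb{R}^d$ is a bounded Lipschitz domain, $T>0$, $Q=(0,T)\times\Omega$. Let $\mathcal{V}=L^2((0,T);H_0^1(\Omega))$ with norm $\|v\|_{\mathcal{V}}=\|\nabla_{\boldsymbol{x}}v\|_{L^2(Q)}$, $\mathcal{V}^*=L^2((0,T);H^{-1}(\Omega))$ its dual, with duality pairing $\langle\cdot,\cdot\rangle_{\mathcal{V}^*\times\mathcal{V}}$ extending the $L^2(Q)$ inner product, and $\mathcal{W}=\mathcal{V}\cap H^1((0,T);H^{-1}(\Omega))$, which embeds continuously into $C^0([0,T];L^2(\Omega))$. For $(v,\boldsymbol{\tau})\in L^2(Q)^{1+d}$ set $\operatorname{div}_{t,\boldsymbol{x}}(v,\boldsymbol{\tau})=\partial_t v+\operatorname{div}_{\boldsymbol{x}}\boldsymbol{\tau}$ (distributional). Coefficients: $\boldsymbol{A}=\boldsymbol{A}^\top\in L^\infty(Q)^{d\times d}$, $\boldsymbol{b}\in L^\infty(Q)^d$, $c\in L^\infty(Q)$, $-\tfrac12\operatorname{div}_{\boldsymbol{x}}\boldsymbol{b}+c\in L^\infty(Q)$ with $-\tfrac12\operatorname{div}_{\boldsymbol{x}}\boldsymbol{b}+c\ge 0$, and there is $\alpha>0$ with $\boldsymbol{y}\cdot\boldsymbol{A}\boldsymbol{y}\ge\alpha|\boldsymbol{y}|^2$ for all $\boldsymbol{y}\in\mathbb{R}^d$, a.e. in $Q$. Let $c_F>0$ be the smallest constant with $\|v\|_{L^2(Q)}\le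 c_F\|\nabla_{\boldsymbol{x}}v\|_{L^2(Q)}$ for all $v\in\mathcal{V}$, and fix some $\Lambda\ge c_F^2$. Define $$\mathcal{U}=\{(v,\boldsymbol{\tau},\mu)\in\mathcal{V}\times L^2(Q)^d\times\mathcal{V}^*:\operatorname{div}_{t,\boldsymbol{x}}(v,\boldsymbol{\tau})-\mu\in L^2(Q)\}.$$ For $(u,\boldsymbol{\sigma},\lambda)\in\mathcal{U}$ one has $u\in\mathcal{W}$, so $u(0),u(T)\in L^2(\Omega)$ are defined. The norm $|\cdot|_{\mathcal{U}}$ is given by $$|(u,\boldsymbol{\sigma},\lambda)|_{\mathcal{U}}^2=\|u\|_{\mathcal{V}}^2+\|u(0)\|_{L^2(\Omega)}^2+\|u(T)\|_{L^2(\Omega)}^2+\|\boldsymbol{\sigma}\|_{L^2(Q)}^2+\|\operatorname{div}_{t,\boldsymbol{x}}(u,\boldsymbol{\sigma})-\lambda\|_{L^2(Q)}^2.$$ The bilinear form $a$ is defined, for $\boldsymbol{u}=(u,\boldsymbol{\sigma},\lambda)$, $\boldsymbol{v}=(v,\boldsymbol{\tau},\mu)\in\mathcal{U}$, by $$\begin{aligned}a(\boldsymbol{u},\boldsymbol{v})&=\alpha^{-1}\Lambda\,(\operatorname{div}_{t,\boldsymbol{x}}(u,\boldsymbol{\sigma})+\boldsymbol{b}\cdot\nabla_{\boldsymbol{x}}u+cu-\lambda,\ \operatorname{div}_{t,\boldsymbol{x}}(v,\boldsymbol{\tau})+\boldsymbol{b}\cdot\nabla_{\boldsymbol{x}}v+cv-\mu)_{L^2(Q)}\\&\quad+(\boldsymbol{A}^{-1/2}\boldsymbol{\sigma}+\boldsymbol{A}^{1/2}\nabla_{\boldsymbol{x}}u,\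 \boldsymbol{A}^{-1/2}\boldsymbol{\tau}+\boldsymbol{A}^{1/2}\nabla_{\boldsymbol{x}}v)_{L^2(Q)}+(u(0),v(0))_{L^2(\Omega)}\\&\quad+\tfrac12\langle\lambda,v\rangle_{\mathcal{V}^*\times\mathcal{V}}+\tfrac12\langle\mu,u\rangle_{\mathcal{V}^*\times\mathcal{V}}.\end{aligned}$$ The constants $C_1,C_2$ are independent of $\boldsymbol{u},\boldsymbol{v}$ (they may depend on $\Omega$, $T$, $\Lambda$ and the coefficients $\boldsymbol{A},\boldsymbol{b},c$). *)

theory Defs
  imports "HOL-Analysis.Analysis"
begin

text \<open>
  Elements of Lebesgue and Sobolev spaces are represented by functions on the whole type; only
  their values on the domain, up to null sets, matter. A point of space-time is a pair
  \<open>(t, x)\<close>, and a space-time vector field is a function with values in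
  \<open>real \<times> (real ^ 'd)\<close>, the first component being the one in time.
\<close>

text \<open>
  Near each boundary point, the domain is the part above the graph, in some unit direction
  \<open>n\<close>, of a Lipschitz function \<open>\<gamma>\<close> on the hyperplane orthogonal to \<open>n\<close>.
\<close>

definition bounded_lipschitz_domain :: "'a::euclidean_space set \<Rightarrow> bool" where
  "bounded_lipschitz_domain \<Omega> \<longleftrightarrow>
     open \<Omega> \<and> connected \<Omega> \<and> \<Omega> \<noteq> {} \<and> bounded \<Omega> \<and>
     (\<forall>x0 \<in> frontier \<Omega>. \<exists>r>0. \<exists>n. norm n = 1 \<and>
        (\<exists>\<gamma> L. L-lipschitz_on {y. y \<bullet> n = 0} \<gamma> \<and>
           \<Omega> \<inter> ball x0 r = {x \<in> ball x0 r. \<gamma> (x - (x \<bullet> n) *\<^sub>R n) < x \<bullet> n}))"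

definition L2 :: "'a::euclidean_space set \<Rightarrow> ('a \<Rightarrow> 'b::euclidean_space) \<Rightarrow> bool" where
  "L2 S f \<longleftrightarrow> f \<in> borel_measurable (lebesgue_on S) \<and> integrable (lebesgue_on S) (\<lambda>x. (norm (f x))\<^sup>2)"

definition l2inner ::
  "'a::euclidean_space set \<Rightarrow> ('a \<Rightarrow> 'b::euclidean_space) \<Rightarrow> ('a \<Rightarrow> 'b) \<Rightarrow> real" where
  "l2inner S f g = integral\<^sup>L (lebesgue_on S) (\<lambda>x. f x \<bullet> g x)"

definition l2norm :: "'a::euclidean_space set \<Rightarrow> ('a \<Rightarrow> 'b::euclidean_space) \<Rightarrow> real" where
  "l2norm S f = sqrt (integral\<^sup>L (lebesgue_on S) (\<lambda>x. (norm (f x))\<^sup>2))"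

definition Linf :: "'a::euclidean_space set \<Rightarrow> ('a \<Rightarrow> 'b::euclidean_space) \<Rightarrow> bool" where
  "Linf S f \<longleftrightarrow> f \<in> borel_measurable (lebesgue_on S) \<and> (\<exists>C. AE x in lebesgue_on S. norm (f x) \<le> C)"

primrec Ck :: "nat \<Rightarrow> ('a::euclidean_space \<Rightarrow> real) \<Rightarrow> bool" where
  "Ck 0 f \<longleftrightarrow> continuous_on UNIV f"
| "Ck (Suc k) f \<longleftrightarrow> (\<forall>x. f differentiable at x) \<and>
     (\<forall>i\<in>Basis. Ck k (\<lambda>x. frechet_derivative f (at x) i))"

definition grad :: "('a::euclidean_space \<Rightarrow> real) \<Rightarrow> 'a \<Rightarrow> 'a" where
  "grad f x = (\<Sum>i\<in>Basis. frechet_derivative f (at x) i *\<^sub>R i)"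

definition test_functions :: "'a::euclidean_space set \<Rightarrow> ('a \<Rightarrow> real) set" where
  "test_functions S = {\<phi>. (\<forall>k. Ck k \<phi>) \<and>
     compact (closure {x. \<phi> x \<noteq> 0}) \<and> closure {x. \<phi> x \<noteq> 0} \<subseteq> S}"

definition distr_div ::
  "'a::euclidean_space set \<Rightarrow> ('a \<Rightarrow> 'a) \<Rightarrow> ('a \<Rightarrow> real) \<Rightarrow> real" where
  "distr_div S F \<phi> = - l2inner S F (grad \<phi>)"

definition represents ::
  "'a::euclidean_space set \<Rightarrow> ('a \<Rightarrow> real) \<Rightarrow> (('a \<Rightarrow> real) \<Rightarrow> real) \<Rightarrow> bool" where
  "represents S f D \<longleftrightarrow> (\<forall>\<phi>\<in>test_functions S. D \<phi> = l2inner S f \<phi>)"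

definition weak_gradient ::
  "'a::euclidean_space set \<Rightarrow> ('a \<Rightarrow> real) \<Rightarrow> ('a \<Rightarrow> 'a) \<Rightarrow> bool" where
  "weak_gradient S u g \<longleftrightarrow> (\<forall>\<phi>\<in>test_functions S.
     integral\<^sup>L (lebesgue_on S) (\<lambda>x. u x *\<^sub>R grad \<phi> x) =
     - integral\<^sup>L (lebesgue_on S) (\<lambda>x. \<phi> x *\<^sub>R g x))"

text \<open>\<open>H\<^sub>0\<^sup>1(S)\<close>: the closure of the test functions in \<open>H\<^sup>1(S)\<close>.\<close>

definition H10 :: "'a::euclidean_space set \<Rightarrow> ('a \<Rightarrow> real) set" where
  "H10 S = {u. L2 S u \<and> (\<exists>g. L2 S g \<and> weak_gradient S u g \<and>
     (\<exists>\<phi>. (\<forall>n::nat. \<phi> n \<in> test_functions S) \<and>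
        (\<lambda>n. l2norm S (\<lambda>x. \<phi> n x - u x)) \<longlonglongrightarrow> 0 \<and>
        (\<lambda>n. l2norm S (\<lambda>x. grad (\<phi> n) x - g x)) \<longlonglongrightarrow> 0))}"

definition cylinder :: "real \<Rightarrow> 'a set \<Rightarrow> (real \<times> 'a) set" where
  "cylinder T \<Omega> = {0<..<T} \<times> \<Omega>"

definition is_grad_x ::
  "real \<Rightarrow> (real ^ 'd) set \<Rightarrow> (real \<times> (real ^ 'd) \<Rightarrow> real) \<Rightarrow> (real \<times> (real ^ 'd) \<Rightarrow> real ^ 'd) \<Rightarrow> bool"
  where
  "is_grad_x T \<Omega> v g \<longleftrightarrow> L2 (cylinder T \<Omega>) g \<and>
     (AE t in lebesgue_on {0<..<T}. weak_gradient \<Omega> (\<lambda>x. v (t, x)) (\<lambda>x. g (t, x)))"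

text \<open>
  \<open>L\<^sup>2((0,T); H\<^sub>0\<^sup>1(\<Omega>))\<close>, with \<open>L\<^sup>2((0,T); L\<^sup>2(\<Omega>))\<close> identified with
  \<open>L\<^sup>2((0,T) \<times> \<Omega>)\<close>. Bochner measurability as a function with values in the separable
  space \<open>H\<^sub>0\<^sup>1(\<Omega>)\<close> is joint measurability of \<open>v\<close> and of its slicewise gradient, and
  square integrability of the \<open>H\<^sup>1\<close>-norm is membership of both in \<open>L\<^sup>2((0,T) \<times> \<Omega>)\<close>.
\<close>

definition V_space :: "real \<Rightarrow> (real ^ 'd) set \<Rightarrow> (real \<times> (real ^ 'd) \<Rightarrow> real) set" where
  "V_space T \<Omega> = {v. L2 (cylinder T \<Omega>) v \<and>
     (AE t in lebesgue_on {0<..<T}. (\<lambda>x. v (t, x)) \<in> H10 \<Omega>) \<and> (\<exists>g. is_grad_x T \<Omega> v g)}"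

definition grad_x ::
  "real \<Rightarrow> (real ^ 'd) set \<Rightarrow> (real \<times> (real ^ 'd) \<Rightarrow> real) \<Rightarrow> real \<times> (real ^ 'd) \<Rightarrow> real ^ 'd" where
  "grad_x T \<Omega> v = (SOME g. is_grad_x T \<Omega> v g)"

definition V_norm :: "real \<Rightarrow> (real ^ 'd) set \<Rightarrow> (real \<times> (real ^ 'd) \<Rightarrow> real) \<Rightarrow> real" where
  "V_norm T \<Omega> v = l2norm (cylinder T \<Omega>) (grad_x T \<Omega> v)"

text \<open>
  The dual space, so the duality pairing is application. A function \<open>f\<close> in
  \<open>L\<^sup>2((0,T) \<times> \<Omega>)\<close> corresponds to the functional \<open>l2inner (cylinder T \<Omega>) f\<close>.
\<close>

definition V_dual ::
  "real \<Rightarrow> (real ^ 'd) set \<Rightarrow> ((real \<times> (real ^ 'd) \<Rightarrow> real) \<Rightarrow> real) set" where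
  "V_dual T \<Omega> = {\<mu>.
     (\<forall>v\<in>V_space T \<Omega>. \<forall>w\<in>V_space T \<Omega>. \<mu> (\<lambda>z. v z + w z) = \<mu> v + \<mu> w) \<and>
     (\<forall>r. \<forall>v\<in>V_space T \<Omega>. \<mu> (\<lambda>z. r * v z) = r * \<mu> v) \<and>
     (\<exists>C. \<forall>v\<in>V_space T \<Omega>. \<bar>\<mu> v\<bar> \<le> C * V_norm T \<Omega> v)}"

definition friedrichs_constant :: "real \<Rightarrow> (real ^ 'd) set \<Rightarrow> real \<Rightarrow> bool" where
  "friedrichs_constant T \<Omega> C \<longleftrightarrow>
     0 < C \<and> (\<forall>v\<in>V_space T \<Omega>. l2norm (cylinder T \<Omega>) v \<le> C * l2norm (cylinder T \<Omega>) (grad_x T \<Omega> v))"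

text \<open>
  The value at time \<open>s \<in> [0,T]\<close> of the representative of \<open>u\<close> in
  \<open>C\<^sup>0([0,T]; L\<^sup>2(\<Omega>))\<close>.
\<close>

definition is_cont_rep ::
  "real \<Rightarrow> (real ^ 'd) set \<Rightarrow> (real \<times> (real ^ 'd) \<Rightarrow> real) \<Rightarrow> (real \<Rightarrow> real ^ 'd \<Rightarrow> real) \<Rightarrow> bool" where
  "is_cont_rep T \<Omega> u w \<longleftrightarrow>
     (\<forall>t\<in>{0..T}. L2 \<Omega> (w t)) \<and>
     (\<forall>t\<in>{0..T}. ((\<lambda>s. l2norm \<Omega> (\<lambda>x. w s x - w t x)) \<longlongrightarrow> 0) (at t within {0..T})) \<and>
     (AE t in lebesgue_on {0<..<T}. AE x in lebesgue_on \<Omega>. w t x = u (t, x))"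

definition time_value ::
  "real \<Rightarrow> (real ^ 'd) set \<Rightarrow> (real \<times> (real ^ 'd) \<Rightarrow> real) \<Rightarrow> real \<Rightarrow> real ^ 'd \<Rightarrow> real" where
  "time_value T \<Omega> u = (SOME w. is_cont_rep T \<Omega> u w)"

type_synonym 'd triple =
  "(real \<times> (real ^ 'd) \<Rightarrow> real) \<times> (real \<times> (real ^ 'd) \<Rightarrow> real ^ 'd) \<times>
   ((real \<times> (real ^ 'd) \<Rightarrow> real) \<Rightarrow> real)"

text \<open>\<open>f\<close> is the function \<open>div\<^sub>t\<^sub>,\<^sub>x (v, \<tau>) - \<mu>\<close> in \<open>L\<^sup>2((0,T) \<times> \<Omega>)\<close>.\<close>

fun is_div_residual ::
  "real \<Rightarrow> (real ^ 'd) set \<Rightarrow> 'd triple \<Rightarrow> (real \<times> (real ^ 'd) \<Rightarrow> real) \<Rightarrow> bool" where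
  "is_div_residual T \<Omega> (v, \<tau>, \<mu>) f \<longleftrightarrow> L2 (cylinder T \<Omega>) f \<and>
     represents (cylinder T \<Omega>) f
       (\<lambda>\<phi>. distr_div (cylinder T \<Omega>) (\<lambda>z. (v z, \<tau> z)) \<phi> - \<mu> \<phi>)"

definition div_residual ::
  "real \<Rightarrow> (real ^ 'd) set \<Rightarrow> 'd triple \<Rightarrow> real \<times> (real ^ 'd) \<Rightarrow> real" where
  "div_residual T \<Omega> w = (SOME f. is_div_residual T \<Omega> w f)"

definition U_space :: "real \<Rightarrow> (real ^ 'd) set \<Rightarrow> 'd triple set" where
  "U_space T \<Omega> = {(v, \<tau>, \<mu>). v \<in> V_space T \<Omega> \<and> L2 (cylinder T \<Omega>) \<tau> \<and> \<mu> \<in> V_dual T \<Omega> \<and>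
     (\<exists>f. is_div_residual T \<Omega> (v, \<tau>, \<mu>) f)}"

fun U_norm :: "real \<Rightarrow> (real ^ 'd) set \<Rightarrow> 'd triple \<Rightarrow> real" where
  "U_norm T \<Omega> (u, \<sigma>, l) = sqrt (
     (V_norm T \<Omega> u)\<^sup>2 + (l2norm \<Omega> (time_value T \<Omega> u 0))\<^sup>2 + (l2norm \<Omega> (time_value T \<Omega> u T))\<^sup>2 +
     (l2norm (cylinder T \<Omega>) \<sigma>)\<^sup>2 + (l2norm (cylinder T \<Omega>) (div_residual T \<Omega> (u, \<sigma>, l)))\<^sup>2)"

definition mat_sqrt :: "real ^ 'd ^ 'd \<Rightarrow> real ^ 'd ^ 'd" where
  "mat_sqrt M = (THE B. transpose B = B \<and> (\<forall>y. 0 \<le> y \<bullet> (B *v y)) \<and> B ** B = M)"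

text \<open>\<open>div\<^sub>t\<^sub>,\<^sub>x (u, \<sigma>) + b \<cdot> \<nabla>\<^sub>x u + c u - l\<close>\<close>

fun residual ::
  "real \<Rightarrow> (real ^ 'd) set \<Rightarrow> (real \<times> (real ^ 'd) \<Rightarrow> real ^ 'd) \<Rightarrow> (real \<times> (real ^ 'd) \<Rightarrow> real) \<Rightarrow>
   'd triple \<Rightarrow> real \<times> (real ^ 'd) \<Rightarrow> real" where
  "residual T \<Omega> b c (u, \<sigma>, l) z =
     div_residual T \<Omega> (u, \<sigma>, l) z + b z \<bullet> grad_x T \<Omega> u z + c z * u z"

text \<open>\<open>A\<^sup>-\<^sup>1\<^sup>/\<^sup>2 \<sigma> + A\<^sup>1\<^sup>/\<^sup>2 \<nabla>\<^sub>x u\<close>\<close>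

fun flux_residual ::
  "real \<Rightarrow> (real ^ 'd) set \<Rightarrow> (real \<times> (real ^ 'd) \<Rightarrow> real ^ 'd ^ 'd) \<Rightarrow>
   'd triple \<Rightarrow> real \<times> (real ^ 'd) \<Rightarrow> real ^ 'd" where
  "flux_residual T \<Omega> A (u, \<sigma>, l) z =
     matrix_inv (mat_sqrt (A z)) *v \<sigma> z + mat_sqrt (A z) *v grad_x T \<Omega> u z"

fun a_form ::
  "real \<Rightarrow> (real ^ 'd) set \<Rightarrow> (real \<times> (real ^ 'd) \<Rightarrow> real ^ 'd ^ 'd) \<Rightarrow>
   (real \<times> (real ^ 'd) \<Rightarrow> real ^ 'd) \<Rightarrow> (real \<times> (real ^ 'd) \<Rightarrow> real) \<Rightarrow> real \<Rightarrow> real \<Rightarrow>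
   'd triple \<Rightarrow> 'd triple \<Rightarrow> real" where
  "a_form T \<Omega> A b c \<alpha> \<Lambda> (u, \<sigma>, l) (v, \<tau>, \<mu>) =
     inverse \<alpha> * \<Lambda> *
       l2inner (cylinder T \<Omega>) (residual T \<Omega> b c (u, \<sigma>, l)) (residual T \<Omega> b c (v, \<tau>, \<mu>)) +
     l2inner (cylinder T \<Omega>) (flux_residual T \<Omega> A (u, \<sigma>, l)) (flux_residual T \<Omega> A (v, \<tau>, \<mu>)) +
     l2inner \<Omega> (time_value T \<Omega> u 0) (time_value T \<Omega> v 0) +
     1 / 2 * l v + 1 / 2 * \<mu> u"

end

theory Submission
  imports Defs
begin

text \<open>
  By Riesz representation in the closure of the gradients, \<open>l v\<close> is the inner product of \<open>\<nabla>\<^sub>x v\<close> with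
  some \<open>G\<close> in \<open>L\<^sup>2(Q)\<close>, so that an element of \<open>U\<close> satisfies \<open>\<partial>\<^sub>t u = f - div\<^sub>x (\<sigma> + G)\<close>. Tested with
  products \<open>\<psi>(t) \<phi>(x)\<close>, this determines the increments \<open>u(t) - u(s)\<close> for almost all \<open>s\<close>, \<open>t\<close>; time
  averages make the exceptional null set independent of \<open>\<phi>\<close>. Difference quotients in time then give
  the derivative of \<open>(u(t), v(t))\<close>, hence the representative in \<open>C\<^sup>0([0,T]; L\<^sup>2(\<Omega>))\<close> and
  \<open>l v + m u = (u(T), v(T)) - (u(0), v(0)) - (f, v) - (h, u) - (\<sigma>, \<nabla>\<^sub>x v) - (\<tau>, \<nabla>\<^sub>x u)\<close>,
  where \<open>f\<close> and \<open>h\<close> are the residuals of the divergence. Boundedness follows from Cauchy-Schwarz.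

  For coercivity take \<open>v = u\<close>. Since \<open>(A\<^sup>-\<^sup>1\<^sup>/\<^sup>2 \<sigma>, A\<^sup>1\<^sup>/\<^sup>2 \<nabla>\<^sub>x u) = (\<sigma>, \<nabla>\<^sub>x u)\<close>, the squared norm of the
  flux residual exceeds \<open>(\<sigma>, \<nabla>\<^sub>x u)\<close> by half of \<open>|A\<^sup>-\<^sup>1\<^sup>/\<^sup>2 \<sigma>|\<^sup>2 + |A\<^sup>1\<^sup>/\<^sup>2 \<nabla>\<^sub>x u|\<^sup>2\<close> at least, and
  \<open>(f, u)\<close> is at most the inner product of the full residual with \<open>u\<close> because
  \<open>(b \<cdot> \<nabla>\<^sub>x u + c u, u) = ((- 1/2 div\<^sub>x b + c) u, u) \<ge> 0\<close>. By Friedrichs' and Young's inequalities with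
  \<open>\<Lambda> \<ge> c\<^sub>F\<^sup>2\<close> this inner product is absorbed.
\<close>

section \<open>Test functions\<close>

text \<open>The norm of U contains no norm of the dual variable, so l v and m u cannot be bounded
  one by one; the symmetric combination in the form is the one that the product rule in time turns
  into boundary values and controlled terms. This is why the evolution equation has to be derived
  for every element of U before anything is estimated. Elements of the spaces are Lebesgue
  measurable functions known up to null sets, and \<open>grad_x\<close>, \<open>div_residual\<close>
  and \<open>time_value\<close> are choices, so linearity and uniqueness hold only almost
  everywhere. Fubini and translations are therefore applied to Borel representatives that vanish
  outside the domain. A value u(t) and its gradient are treated as one pair in the L2-closure of the
  pairs (\<phi>, \<nabla>\<phi>). Thus a single abstract equation covers residual, flux and dual
  variable, and no density theorem for products \<psi>(t) \<phi>(x) enters. The square root of A is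
  given by a definite description; an explicit convergent iteration yields its existence, its
  uniqueness and its measurability in z.\<close>

lemma Ck_SucI:
  fixes f :: "'a::euclidean_space \<Rightarrow> real"
  assumes "\<And>x. (f has_derivative f' x) (at x)" and "\<And>i. i \<in> Basis \<Longrightarrow> Ck k (\<lambda>x. f' x i)"
  shows "Ck (Suc k) f"
proof -
  have "frechet_derivative f (at x) = f' x" for x
    using frechet_derivative_at[OF assms(1)] by simp
  then show ?thesis
    using assms by (auto simp: differentiable_def)
qed

lemma Ck_Suc_has_derivative:
  assumes "Ck (Suc k) f"
  shows "(f has_derivative frechet_derivative f (at x)) (at x)"
  using assms by (simp add: frechet_derivative_works)

lemma Ck_Suc_lower: "Ck (Suc k) f \<Longrightarrow> Ck k f"
proof (induction k arbitrary: f)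
  case 0
  then show ?case
    by (auto intro: continuous_at_imp_continuous_on differentiable_imp_continuous_within)
qed simp

lemma Ck_imp_continuous_on: "Ck k f \<Longrightarrow> continuous_on S f"
proof (induction k)
  case 0
  then show ?case using continuous_on_subset by auto
next
  case (Suc k)
  then show ?case using Ck_Suc_lower by blast
qed

lemma Ck_const: "Ck k (\<lambda>x. r)"
proof (induction k arbitrary: r)
  case (Suc k)
  show ?case by (rule Ck_SucI[where f' = "\<lambda>x h. 0"]) (auto simp: Suc)
qed simp

lemma Ck_add: "Ck k f \<Longrightarrow> Ck k g \<Longrightarrow> Ck k (\<lambda>x. f x + g x)"
proof (induction k arbitrary: f g)
  case 0
  then show ?case by (auto intro: continuous_intros)
next
  case (Suc k)
  show ?case
  proof (rule Ck_SucI)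
    show "((\<lambda>x. f x + g x) has_derivative
        (\<lambda>h. frechet_derivative f (at x) h + frechet_derivative g (at x) h)) (at x)" for x
      by (intro derivative_intros Ck_Suc_has_derivative[OF Suc.prems(1)] Ck_Suc_has_derivative[OF Suc.prems(2)])
  qed (use Suc in auto)
qed

lemma Ck_sum: "finite I \<Longrightarrow> (\<And>i. i \<in> I \<Longrightarrow> Ck k (f i)) \<Longrightarrow> Ck k (\<lambda>x. \<Sum>i\<in>I. f i x)"
  by (induction I rule: finite_induct) (auto simp: Ck_const Ck_add)

lemma Ck_mult: "Ck k f \<Longrightarrow> Ck k g \<Longrightarrow> Ck k (\<lambda>x. f x * g x)"
proof (induction k arbitrary: f g)
  case 0
  then show ?case by (auto intro: continuous_intros)
next
  case (Suc k)
  show ?case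
  proof (rule Ck_SucI)
    show "((\<lambda>x. f x * g x) has_derivative
        (\<lambda>h. f x * frechet_derivative g (at x) h + frechet_derivative f (at x) h * g x)) (at x)" for x
      by (intro derivative_intros Ck_Suc_has_derivative[OF Suc.prems(1)] Ck_Suc_has_derivative[OF Suc.prems(2)])
    show "Ck k (\<lambda>x. f x * frechet_derivative g (at x) i + frechet_derivative f (at x) i * g x)"
      if "i \<in> Basis" for i
      using Suc that Ck_Suc_lower by (intro Ck_add Suc.IH) auto
  qed
qed

lemma Ck_prod: "finite I \<Longrightarrow> (\<And>i. i \<in> I \<Longrightarrow> Ck k (f i)) \<Longrightarrow> Ck k (\<lambda>x. \<Prod>i\<in>I. f i x)"
  by (induction I rule: finite_induct) (auto simp: Ck_const Ck_mult)

text \<open>\<open>Ck\<close> constrains derivatives along basis vectors only. After composition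
  other directions such as \<open>L i\<close> occur; this expansion turns them into sums of products
  to which the induction on k applies.\<close>

lemma frechet_derivative_basis_sum:
  fixes f :: "'a::euclidean_space \<Rightarrow> real"
  assumes "f differentiable at x"
  shows "frechet_derivative f (at x) h = (\<Sum>j\<in>Basis. (h \<bullet> j) * frechet_derivative f (at x) j)"
proof -
  interpret linear "frechet_derivative f (at x)"
    using assms linear_frechet_derivative by blast
  have "frechet_derivative f (at x) h = frechet_derivative f (at x) (\<Sum>j\<in>Basis. (h \<bullet> j) *\<^sub>R j)"
    by (simp add: euclidean_representation)
  then show ?thesis by (simp only: sum scale) simp
qed

lemma Ck_compose_affine:
  fixes f :: "'b::euclidean_space \<Rightarrow> real" and L :: "'a::euclidean_space \<Rightarrow> 'b"
  assumes L: "bounded_linear L"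
  shows "Ck k f \<Longrightarrow> Ck k (\<lambda>x. f (L x + c))"
proof (induction k arbitrary: f)
  case 0
  have "continuous_on UNIV L" using L linear_continuous_on by blast
  then show ?case using 0
    by (auto intro!: continuous_on_compose2[of UNIV f] continuous_intros)
next
  case (Suc k)
  have d: "f differentiable at y" for y using Suc.prems by simp
  show ?case
  proof (rule Ck_SucI)
    show "((\<lambda>x. f (L x + c)) has_derivative (\<lambda>h. frechet_derivative f (at (L x + c)) (L h))) (at x)" for x
    proof (rule has_derivative_compose[where g = f])
      show "((\<lambda>x. L x + c) has_derivative L) (at x)"
        using bounded_linear.has_derivative[OF L has_derivative_ident] by (auto intro!: derivative_eq_intros)
    qed (rule Ck_Suc_has_derivative[OF Suc.prems])
    show "Ck k (\<lambda>x. frechet_derivative f (at (L x + c)) (L i))" if "i \<in> Basis" for i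
      unfolding frechet_derivative_basis_sum[OF d, of _ "L i"]
      using Suc by (intro Ck_sum Ck_mult Ck_const) auto
  qed
qed

lemma Ck_compose_real:
  fixes f :: "'a::euclidean_space \<Rightarrow> real" and g :: "real \<Rightarrow> real"
  shows "Ck k f \<Longrightarrow> Ck k g \<Longrightarrow> Ck k (\<lambda>x. g (f x))"
proof (induction k arbitrary: g)
  case 0
  then show ?case by (auto intro!: continuous_on_compose2[of UNIV g])
next
  case (Suc k)
  have d: "g differentiable at y" for y using Suc.prems by simp
  show ?case
  proof (rule Ck_SucI)
    show "((\<lambda>x. g (f x)) has_derivative
        (\<lambda>h. frechet_derivative g (at (f x)) (frechet_derivative f (at x) h))) (at x)" for x
      by (rule has_derivative_compose[where g = g])
        (auto intro: Ck_Suc_has_derivative[OF Suc.prems(1)] Ck_Suc_has_derivative[OF Suc.prems(2)])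
    show "Ck k (\<lambda>x. frechet_derivative g (at (f x)) (frechet_derivative f (at x) i))" if "i \<in> Basis" for i
      unfolding frechet_derivative_basis_sum[OF d, of _ "frechet_derivative f (at _) i"]
      using Suc Ck_Suc_lower that by (intro Ck_sum Ck_mult Ck_const) auto
  qed
qed

lemma Ck_real_SucI:
  fixes f :: "real \<Rightarrow> real"
  assumes "\<And>x. (f has_real_derivative f' x) (at x)" and "Ck k f'"
  shows "Ck (Suc k) f"
  by (rule Ck_SucI[where f' = "\<lambda>x h. f' x * h"]) (use assms in \<open>auto simp: has_field_derivative_def\<close>)

lemma Ck_exp: "Ck k (exp :: real \<Rightarrow> real)"
proof (induction k)
  case (Suc k)
  show ?case by (rule Ck_real_SucI[where f' = exp]) (auto intro: Suc DERIV_exp)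
qed (auto intro: continuous_intros)

text \<open>The smooth function exp(-1/x), together with its quotients by powers: differentiation
  raises n by 1 and 2 and so stays in the family. Smoothness of all members follows by one
  simultaneous induction, without a formula for the k-th derivative.\<close>

definition flat_exp :: "nat \<Rightarrow> real \<Rightarrow> real" where
  "flat_exp n x = (if 0 < x then exp (- (1 / x)) / x ^ n else 0)"

lemma flat_exp_tendsto_0: "(flat_exp n \<longlongrightarrow> 0) (at 0)"
proof -
  have "((\<lambda>y::real. y ^ n / exp y) \<longlongrightarrow> 0) at_top"
    by (rule tendsto_power_div_exp_0)
  \<comment> \<open>Substitution y = 1/x: the exponential beats every power of y.\<close>
  then have "((\<lambda>x::real. (inverse x) ^ n / exp (inverse x)) \<longlongrightarrow> 0) (at_right 0)"
    using filterlim_inverse_at_top_right by (rule filterlim_compose)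
  then have "(flat_exp n \<longlongrightarrow> 0) (at_right 0)"
    by (rule Lim_transform_eventually)
      (auto simp: flat_exp_def eventually_at_right_field exp_minus field_simps power_inverse intro!: exI[of _ 1])
  moreover have "(flat_exp n \<longlongrightarrow> 0) (at_left 0)"
    by (rule tendsto_eventually) (auto simp: flat_exp_def eventually_at_left_field intro!: exI[of _ "-1"])
  ultimately show ?thesis by (simp add: filterlim_split_at)
qed

lemma flat_exp_has_derivative:
  "(flat_exp n has_real_derivative flat_exp (n + 2) x - real n * flat_exp (n + 1) x) (at x)"
proof -
  consider "x > 0" | "x < 0" | "x = 0" by linarith
  then show ?thesis
  proof cases
    case 1
    have "((\<lambda>x. exp (- (1 / x)) / x ^ n) has_real_derivative
        flat_exp (n + 2) x - real n * flat_exp (n + 1) x) (at x)"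
      using 1 by (cases n)
        (auto intro!: derivative_eq_intros simp: flat_exp_def field_simps power2_eq_square,
          metis One_nat_def power_eq_if)
    then show ?thesis
      by (rule has_field_derivative_transform_within_open[where S = "{0<..}"])
        (use 1 in \<open>auto simp: flat_exp_def\<close>)
  next
    case 2
    have "((\<lambda>x. 0) has_real_derivative 0) (at x)" by simp
    then have "(flat_exp n has_real_derivative 0) (at x)"
      by (rule has_field_derivative_transform_within_open[where S = "{..<0}"])
        (use 2 in \<open>auto simp: flat_exp_def\<close>)
    then show ?thesis using 2 by (simp add: flat_exp_def)
  next
    case 3
    \<comment> \<open>The difference quotient at 0 is \<open>flat_exp (n + 1) h\<close>, which tends
      to 0.\<close>
    have "((\<lambda>h. (flat_exp n (0 + h) - flat_exp n 0) / h) \<longlongrightarrow> 0) (at 0)"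
      by (rule Lim_transform_eventually[OF flat_exp_tendsto_0[of "n + 1"]])
        (auto simp: flat_exp_def eventually_at field_simps intro!: exI[of _ 1])
    then show ?thesis using 3 by (simp add: flat_exp_def DERIV_def)
  qed
qed

lemma Ck_flat_exp: "Ck k (flat_exp n)"
proof (induction k arbitrary: n)
  case 0
  have "isCont (flat_exp n) x" for x
    using flat_exp_has_derivative by (rule DERIV_isCont)
  then show ?case by (simp add: continuous_at_imp_continuous_on)
next
  case (Suc k)
  have "Ck k (\<lambda>x. flat_exp (n + 2) x + (- real n) * flat_exp (n + 1) x)"
    by (intro Ck_add Ck_mult Ck_const Suc)
  then show ?case
    by (intro Ck_real_SucI[where f' = "\<lambda>x. flat_exp (n + 2) x - real n * flat_exp (n + 1) x"]
        flat_exp_has_derivative) simp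
qed

section \<open>Gradients, supports and products of test functions\<close>

lemma grad_inner:
  fixes f :: "'a::euclidean_space \<Rightarrow> real"
  assumes "f differentiable at x"
  shows "frechet_derivative f (at x) h = grad f x \<bullet> h"
  unfolding grad_def frechet_derivative_basis_sum[OF assms, of h] inner_sum_left
  by (intro sum.cong refl) (simp add: inner_commute[of _ h])

lemma has_derivative_grad:
  fixes f :: "'a::euclidean_space \<Rightarrow> real"
  assumes "f differentiable at x"
  shows "(f has_derivative (\<lambda>h. grad f x \<bullet> h)) (at x)"
proof -
  have "(f has_derivative frechet_derivative f (at x)) (at x)"
    using assms by (simp add: frechet_derivative_works)
  moreover have "frechet_derivative f (at x) = (\<lambda>h. grad f x \<bullet> h)"
    using grad_inner[OF assms] by auto
  ultimately show ?thesis by simp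
qed

lemma grad_eqI:
  fixes f :: "'a::euclidean_space \<Rightarrow> real"
  assumes "(f has_derivative (\<lambda>h. g \<bullet> h)) (at x)"
  shows "grad f x = g"
proof -
  have "frechet_derivative f (at x) = (\<lambda>h. g \<bullet> h)"
    using frechet_derivative_at[OF assms] by simp
  then show ?thesis by (simp add: grad_def euclidean_representation)
qed

lemma grad_real_eqI:
  fixes f :: "real \<Rightarrow> real"
  assumes "(f has_real_derivative d) (at x)"
  shows "grad f x = d"
  using assms by (intro grad_eqI) (simp add: has_field_derivative_def)

lemma continuous_on_grad: "Ck (Suc k) f \<Longrightarrow> continuous_on S (grad f)"
  unfolding grad_def by (intro continuous_intros Ck_imp_continuous_on[of k]) simp

lemma test_functionsD:
  assumes "\<phi> \<in> test_functions S"
  shows "Ck k \<phi>" "\<phi> differentiable at x" "continuous_on X \<phi>" "continuous_on X (grad \<phi>)"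
    "(\<phi> has_derivative (\<lambda>h. grad \<phi> x \<bullet> h)) (at x)"
    "compact (closure {x. \<phi> x \<noteq> 0})" "closure {x. \<phi> x \<noteq> 0} \<subseteq> S"
    "x \<notin> S \<Longrightarrow> \<phi> x = 0"
proof -
  have Ck: "Ck k \<phi>" for k using assms by (simp add: test_functions_def)
  then show "Ck k \<phi>" .
  show "continuous_on X \<phi>" using Ck_imp_continuous_on Ck by blast
  show "continuous_on X (grad \<phi>)" using continuous_on_grad Ck by blast
  show d: "\<phi> differentiable at x" using Ck[of "Suc 0"] by simp
  show "(\<phi> has_derivative (\<lambda>h. grad \<phi> x \<bullet> h)) (at x)" by (rule has_derivative_grad[OF d])
  show "compact (closure {x. \<phi> x \<noteq> 0})" and s: "closure {x. \<phi> x \<noteq> 0} \<subseteq> S"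
    using assms by (auto simp: test_functions_def)
  show "\<phi> x = 0" if "x \<notin> S"
    using s closure_subset[of "{x. \<phi> x \<noteq> 0}"] that by auto
qed

lemma grad_eq_0_outside:
  fixes f :: "'a::euclidean_space \<Rightarrow> real"
  assumes "x \<notin> closure {x. f x \<noteq> 0}"
  shows "grad f x = 0"
proof (rule grad_eqI)
  have "((\<lambda>x. 0) has_derivative (\<lambda>h. 0 \<bullet> h)) (at x)" by simp
  then show "(f has_derivative (\<lambda>h. 0 \<bullet> h)) (at x)"
    by (rule has_derivative_transform_within_open[where s = "- closure {x. f x \<noteq> 0}"])
      (use assms closure_subset[of "{x. f x \<noteq> 0}"] in auto)
qed

lemma test_functions_support:
  assumes "\<phi> \<in> test_functions S"
  obtains K where "compact K" "K \<subseteq> S" "\<And>x. x \<notin> K \<Longrightarrow> \<phi> x = 0" "\<And>x. x \<notin> K \<Longrightarrow> grad \<phi> x = 0"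
proof (rule that)
  show "\<phi> x = 0" if "x \<notin> closure {x. \<phi> x \<noteq> 0}" for x
    using that closure_subset[of "{x. \<phi> x \<noteq> 0}"] by auto
  show "grad \<phi> x = 0" if "x \<notin> closure {x. \<phi> x \<noteq> 0}" for x
    using that by (rule grad_eq_0_outside)
  show "compact (closure {x. \<phi> x \<noteq> 0})" by (rule test_functionsD(6)[OF assms])
  show "closure {x. \<phi> x \<noteq> 0} \<subseteq> S" by (rule test_functionsD(7)[OF assms])
qed

lemma test_functions_outside:
  assumes "\<phi> \<in> test_functions S" "x \<notin> S"
  shows "\<phi> x = 0" "grad \<phi> x = 0"
  using test_functionsD(7,8)[OF assms(1)] assms(2) grad_eq_0_outside by blast+

lemma test_functionsI:
  assumes "\<And>k. Ck k \<phi>" and "compact K" "K \<subseteq> S" and "\<And>x. x \<notin> K \<Longrightarrow> \<phi> x = 0"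
  shows "\<phi> \<in> test_functions S"
proof -
  have "closure {x. \<phi> x \<noteq> 0} \<subseteq> K"
    using assms compact_imp_closed by (intro closure_minimal) auto
  then show ?thesis
    using assms compact_Int_closed[OF assms(2) closed_closure, of "{x. \<phi> x \<noteq> 0}"]
    unfolding test_functions_def by (auto simp: Int_absorb1)
qed

lemma test_functions_mult:
  assumes "\<phi> \<in> test_functions S" and "\<And>k. Ck k f"
  shows "(\<lambda>x. f x * \<phi> x) \<in> test_functions S"
proof -
  obtain K where K: "compact K" "K \<subseteq> S" "\<And>x. x \<notin> K \<Longrightarrow> \<phi> x = 0"
    using test_functions_support[OF assms(1)] by metis
  show ?thesis
    by (rule test_functionsI[OF _ K(1,2)]) (use K(3) assms test_functionsD(1) in \<open>auto intro!: Ck_mult\<close>)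
qed

lemma test_functions_scale:
  "\<phi> \<in> test_functions S \<Longrightarrow> (\<lambda>x. r * \<phi> x) \<in> test_functions S"
  using test_functions_mult Ck_const by blast

lemma test_functions_add:
  assumes "\<phi> \<in> test_functions S" "\<eta> \<in> test_functions S"
  shows "(\<lambda>x. \<phi> x + \<eta> x) \<in> test_functions S"
proof -
  obtain K where K: "compact K" "K \<subseteq> S" "\<And>x. x \<notin> K \<Longrightarrow> \<phi> x = 0"
    using test_functions_support[OF assms(1)] by metis
  obtain L where L: "compact L" "L \<subseteq> S" "\<And>x. x \<notin> L \<Longrightarrow> \<eta> x = 0"
    using test_functions_support[OF assms(2)] by metis
  show ?thesis
    by (rule test_functionsI[where K = "K \<union> L"])
      (use K L assms test_functionsD(1) in \<open>auto intro!: Ck_add\<close>)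
qed

lemma grad_add:
  assumes "f differentiable at x" "g differentiable at x"
  shows "grad (\<lambda>x. f x + g x) x = grad f x + grad g x"
  using has_derivative_add[OF has_derivative_grad[OF assms(1)] has_derivative_grad[OF assms(2)]]
  by (intro grad_eqI) (simp add: inner_add_left)

lemma grad_mult:
  assumes "f differentiable at x" "g differentiable at x"
  shows "grad (\<lambda>x. f x * g x) x = f x *\<^sub>R grad g x + g x *\<^sub>R grad f x"
  using has_derivative_mult[OF has_derivative_grad[OF assms(1)] has_derivative_grad[OF assms(2)]]
  by (intro grad_eqI) (simp add: inner_add_left mult.commute)

lemma grad_scale:
  assumes "f differentiable at x"
  shows "grad (\<lambda>x. r * f x) x = r *\<^sub>R grad f x"
  using has_derivative_mult_right[OF has_derivative_grad[OF assms], of r]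
  by (intro grad_eqI) simp

text \<open>Products \<psi>(t) \<phi>(x) are the space-time test functions with which the equation
  is tested; the pair form of the gradient separates the time derivative from the space
  derivative.\<close>

lemma test_functions_tensor:
  assumes \<psi>: "\<psi> \<in> test_functions I" and \<phi>: "\<phi> \<in> test_functions S"
  shows "(\<lambda>z. \<psi> (fst z) * \<phi> (snd z)) \<in> test_functions (I \<times> S)"
    and "grad (\<lambda>z. \<psi> (fst z) * \<phi> (snd z)) z = (\<phi> (snd z) *\<^sub>R grad \<psi> (fst z), \<psi> (fst z) *\<^sub>R grad \<phi> (snd z))"
proof -
  obtain K where K: "compact K" "K \<subseteq> I" "\<And>x. x \<notin> K \<Longrightarrow> \<psi> x = 0"
    using test_functions_support[OF \<psi>] by metis
  obtain L where L: "compact L" "L \<subseteq> S" "\<And>x. x \<notin> L \<Longrightarrow> \<phi> x = 0"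
    using test_functions_support[OF \<phi>] by metis
  show "(\<lambda>z. \<psi> (fst z) * \<phi> (snd z)) \<in> test_functions (I \<times> S)"
  proof (rule test_functionsI[where K = "K \<times> L"])
    show "Ck k (\<lambda>z. \<psi> (fst z) * \<phi> (snd z))" for k
      using Ck_compose_affine[OF bounded_linear_fst test_functionsD(1)[OF \<psi>], of k 0]
        Ck_compose_affine[OF bounded_linear_snd test_functionsD(1)[OF \<phi>], of k 0]
      by (intro Ck_mult) auto
    show "\<psi> (fst z) * \<phi> (snd z) = 0" if "z \<notin> K \<times> L" for z
      using that K(3) L(3) by (cases z) auto
  qed (use K L in \<open>auto intro!: compact_Times\<close>)
  have "((\<lambda>z. \<psi> (fst z)) has_derivative (\<lambda>h. grad \<psi> (fst z) \<bullet> fst h)) (at z)"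
    by (rule has_derivative_compose[where g = \<psi>, OF has_derivative_fst[OF has_derivative_ident]
          test_functionsD(5)[OF \<psi>]])
  moreover have "((\<lambda>z. \<phi> (snd z)) has_derivative (\<lambda>h. grad \<phi> (snd z) \<bullet> snd h)) (at z)"
    by (rule has_derivative_compose[where g = \<phi>, OF has_derivative_snd[OF has_derivative_ident]
          test_functionsD(5)[OF \<phi>]])
  ultimately have "((\<lambda>z. \<psi> (fst z) * \<phi> (snd z)) has_derivative
      (\<lambda>h. \<psi> (fst z) * (grad \<phi> (snd z) \<bullet> snd h) + (grad \<psi> (fst z) \<bullet> fst h) * \<phi> (snd z))) (at z)"
    by (rule has_derivative_mult)
  also have "(\<lambda>h. \<psi> (fst z) * (grad \<phi> (snd z) \<bullet> snd h) + (grad \<psi> (fst z) \<bullet> fst h) * \<phi> (snd z)) =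
      (\<lambda>h. (\<phi> (snd z) *\<^sub>R grad \<psi> (fst z), \<psi> (fst z) *\<^sub>R grad \<phi> (snd z)) \<bullet> h)"
    by (auto simp: inner_prod_def fun_eq_iff)
  finally show "grad (\<lambda>z. \<psi> (fst z) * \<phi> (snd z)) z =
      (\<phi> (snd z) *\<^sub>R grad \<psi> (fst z), \<psi> (fst z) *\<^sub>R grad \<phi> (snd z))"
    by (rule grad_eqI)
qed

section \<open>Integrals of continuous functions with compact support\<close>

lemma integrable_compact_support:
  fixes f :: "'a::euclidean_space \<Rightarrow> 'b::{banach, second_countable_topology}"
  assumes "continuous_on UNIV f" "compact K" "\<And>x. x \<notin> K \<Longrightarrow> f x = 0"
  shows "integrable lborel f"
proof -
  have "integrable lborel (\<lambda>x. indicator K x *\<^sub>R f x)"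
    by (intro borel_integrable_compact continuous_on_subset[OF assms(1)] assms(2)) simp
  moreover have "(\<lambda>x. indicator K x *\<^sub>R f x) = f"
    using assms(3) by (auto simp: indicator_def fun_eq_iff)
  ultimately show ?thesis by simp
qed

lemma bounded_compact_support:
  fixes f :: "'a::euclidean_space \<Rightarrow> 'b::real_normed_vector"
  assumes "continuous_on UNIV f" "compact K" "\<And>x. x \<notin> K \<Longrightarrow> f x = 0"
  obtains B where "B > 0" "\<And>x. norm (f x) \<le> B"
proof -
  have "bounded (f ` K)"
    by (intro compact_imp_bounded compact_continuous_image continuous_on_subset[OF assms(1)] assms(2)) simp
  then obtain B where B: "B > 0" "\<And>x. x \<in> K \<Longrightarrow> norm (f x) \<le> B"
    unfolding bounded_pos by auto
  have "norm (f x) \<le> B" for x using B assms(3)[of x] by (cases "x \<in> K") auto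
  then show ?thesis using that B(1) by blast
qed

lemma integral_lborel_translation:
  fixes f :: "'a::euclidean_space \<Rightarrow> 'b::{banach, second_countable_topology}"
  assumes [measurable]: "f \<in> borel_measurable borel"
  shows "(LBINT x. f (x + a)) = integral\<^sup>L lborel f"
    and "integrable lborel (\<lambda>x. f (x + a)) = integrable lborel f"
proof -
  have e: "distr lborel borel ((+) a) = lborel" by (rule lborel_distr_plus)
  have m: "(+) a \<in> measurable lborel borel" by simp
  have "integral\<^sup>L (distr lborel borel ((+) a)) f = (LBINT x. f (a + x))"
    by (rule integral_distr[OF m]) simp
  then show "(LBINT x. f (x + a)) = integral\<^sup>L lborel f" unfolding e by (simp add: add.commute)
  have "integrable (distr lborel borel ((+) a)) f = integrable lborel (\<lambda>x. f (a + x))"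
    by (rule integrable_distr_eq[OF m]) simp
  then show "integrable lborel (\<lambda>x. f (x + a)) = integrable lborel f" unfolding e by (simp add: add.commute)
qed

lemma test_functions_bounds:
  assumes "\<psi> \<in> test_functions S"
  obtains B where "B > 0" "\<And>x. \<bar>\<psi> x\<bar> \<le> B" "\<And>x. norm (grad \<psi> x) \<le> B"
    "\<psi> \<in> borel_measurable borel" "grad \<psi> \<in> borel_measurable borel" "\<And>x y. \<bar>\<psi> x - \<psi> y\<bar> \<le> B * norm (x - y)"
proof -
  obtain K where K: "compact K" "\<And>x. x \<notin> K \<Longrightarrow> \<psi> x = 0" "\<And>x. x \<notin> K \<Longrightarrow> grad \<psi> x = 0"
    using test_functions_support[OF assms] by metis
  obtain B where B: "B > 0" "\<And>x. norm (\<psi> x) \<le> B"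
    using bounded_compact_support[OF test_functionsD(3)[OF assms] K(1,2)] by metis
  obtain C where C: "C > 0" "\<And>x. norm (grad \<psi> x) \<le> C"
    using bounded_compact_support[OF test_functionsD(4)[OF assms] K(1,3)] by metis
  have lip: "norm (\<psi> x - \<psi> y) \<le> C * norm (x - y)" for x y
  proof (rule differentiable_bound[where f' = "\<lambda>x h. grad \<psi> x \<bullet> h" and S = UNIV])
    fix z
    have "norm (grad \<psi> z \<bullet> k) \<le> C * norm k" for k
      using Cauchy_Schwarz_ineq2[of "grad \<psi> z" k] mult_right_mono[OF C(2)[of z], of "norm k"] by simp
    then show "onorm (\<lambda>h. grad \<psi> z \<bullet> h) \<le> C" using C(1) by (intro onorm_bound) auto
    show "(\<psi> has_derivative (\<lambda>h. grad \<psi> z \<bullet> h)) (at z within UNIV)"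
      using test_functionsD(5)[OF assms] by simp
  qed auto
  show ?thesis
  proof (rule that[of "B + C"])
    show "\<bar>\<psi> x - \<psi> y\<bar> \<le> (B + C) * norm (x - y)" for x y
      using lip[of x y] mult_right_mono[of C "B + C" "norm (x - y)"] B(1) by simp
    show "\<bar>\<psi> x\<bar> \<le> B + C" for x using B(2)[of x] C(1) by simp
    show "norm (grad \<psi> x) \<le> B + C" for x using C(2)[of x] B(1) by linarith
    show "\<psi> \<in> borel_measurable borel" "grad \<psi> \<in> borel_measurable borel"
      by (intro borel_measurable_continuous_onI test_functionsD(3,4)[OF assms])+
  qed (use B C in auto)
qed

text \<open>Translation invariance of Lebesgue measure makes the integral of every difference
  quotient vanish, and the quotients converge dominatedly to the directional derivative. No Fubini
  argument or boundary term is involved.\<close>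

lemma integral_grad_eq_0:
  assumes \<phi>: "\<phi> \<in> test_functions S"
  shows "(LBINT x. grad \<phi> x \<bullet> h) = 0"
proof -
  obtain K where K: "compact K" and z: "\<And>x. x \<notin> K \<Longrightarrow> \<phi> x = 0"
    using test_functions_support[OF \<phi>] by metis
  obtain B where B: "B > 0" and [measurable]: "\<phi> \<in> borel_measurable borel" "grad \<phi> \<in> borel_measurable borel"
    and lip: "\<And>x y. \<bar>\<phi> x - \<phi> y\<bar> \<le> B * norm (x - y)"
    using test_functions_bounds[OF \<phi>] by metis
  obtain R where R: "\<And>x. x \<in> K \<Longrightarrow> norm x \<le> R"
    using K compact_imp_bounded bounded_iff by metis
  define q where "q n x = (\<phi> (x + inverse (Suc n) *\<^sub>R h) - \<phi> x) / inverse (Suc n)" for n :: nat and x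
  have int\<phi>: "integrable lborel \<phi>"
    using integrable_compact_support[OF test_functionsD(3)[OF \<phi>] K z] .
  have q0: "integral\<^sup>L lborel (q n) = 0" for n
    unfolding q_def using int\<phi> integral_lborel_translation[of \<phi> "inverse (Suc n) *\<^sub>R h"] by simp
  have "(\<lambda>n. integral\<^sup>L lborel (q n)) \<longlonglongrightarrow> (LBINT x. grad \<phi> x \<bullet> h)"
  \<comment> \<open>The enlarged ball contains the support together with its translates by steps of
    length at most |h|; the Lipschitz constant B bounds the quotients by B |h|.\<close>
  proof (rule integral_dominated_convergence[where w = "\<lambda>x. indicator (cball 0 (R + norm h)) x * (B * norm h)"])
    show "integrable lborel (\<lambda>x::'a. indicator (cball 0 (R + norm h)) x * (B * norm h))"
      using emeasure_bounded_finite[OF bounded_cball[of "0::'a" "R + norm h"]]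
      by (intro integrable_mult_left integrable_real_indicator) simp_all
    show "AE x in lborel. (\<lambda>n. q n x) \<longlonglongrightarrow> grad \<phi> x \<bullet> h"
    proof (rule AE_I2)
      fix x
      have "((\<lambda>r. \<phi> (x + r *\<^sub>R h)) has_derivative (\<lambda>r. grad \<phi> x \<bullet> (r *\<^sub>R h))) (at 0)"
        by (rule has_derivative_compose[where g = \<phi>])
          (auto intro!: derivative_eq_intros test_functionsD(5)[OF \<phi>, of x])
      then have "((\<lambda>r. \<phi> (x + r *\<^sub>R h)) has_real_derivative grad \<phi> x \<bullet> h) (at 0)"
        by (simp add: has_field_derivative_def mult.commute[of _ "grad \<phi> x \<bullet> h"])
      then have "((\<lambda>r. (\<phi> (x + r *\<^sub>R h) - \<phi> x) / r) \<longlongrightarrow> grad \<phi> x \<bullet> h) (at 0)"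
        by (simp add: DERIV_def)
      moreover have "filterlim (\<lambda>n. inverse (real (Suc n))) (at 0) sequentially"
        using LIMSEQ_inverse_real_of_nat by (auto simp: filterlim_at)
      ultimately show "(\<lambda>n. q n x) \<longlonglongrightarrow> grad \<phi> x \<bullet> h"
        unfolding q_def by (rule filterlim_compose)
    qed
    show "AE x in lborel. norm (q n x) \<le> indicator (cball 0 (R + norm h)) x * (B * norm h)" for n
    proof (rule AE_I2)
      fix x
      let ?y = "x + inverse (Suc n) *\<^sub>R h"
      have i: "norm (inverse (real (Suc n)) *\<^sub>R h) \<le> norm h"
        by (simp add: mult_left_le_one_le inverse_le_1_iff del: of_nat_Suc)
      show "norm (q n x) \<le> indicator (cball 0 (R + norm h)) x * (B * norm h)"
      proof (cases "x \<in> cball 0 (R + norm h)")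
        case True
        have "norm (q n x) = \<bar>\<phi> ?y - \<phi> x\<bar> / inverse (Suc n)"
          unfolding q_def by (simp add: abs_divide abs_mult)
        also have "\<dots> \<le> (B * norm (?y - x)) / inverse (Suc n)"
          by (intro divide_right_mono lip) simp
        also have "\<dots> = B * norm h" by (simp add: field_simps)
        finally show ?thesis using True by simp
      next
        case False
        then have "norm x > R + norm h" by simp
        then have "norm x > R" "norm ?y > R"
          using i norm_triangle_ineq2[of x "- inverse (real (Suc n)) *\<^sub>R h"] norm_ge_zero[of h]
          by (auto simp del: of_nat_Suc norm_ge_zero)
        then have "x \<notin> K" "?y \<notin> K" using R by force+
        then show ?thesis using z B unfolding q_def by (simp add: indicator_def)
      qed
    qed
  qed (auto simp: q_def[abs_def])
  then show ?thesis using q0 by (simp add: LIMSEQ_const_iff)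
qed

text \<open>The passage from the measure of the definitions, \<open>lebesgue_on S\<close>, to
  \<open>lborel\<close>, whose product structure and translation invariance are used
  throughout.\<close>

lemma integral_lebesgue_on_eq_lborel:
  fixes f :: "'a::euclidean_space \<Rightarrow> 'b::{banach, second_countable_topology}"
  assumes "S \<in> sets borel" "f \<in> borel_measurable borel" "\<And>x. x \<notin> S \<Longrightarrow> f x = 0"
  shows "integral\<^sup>L (lebesgue_on S) f = integral\<^sup>L lborel f"
    and "integrable (lebesgue_on S) f = integrable lborel f"
proof -
  have e: "(\<lambda>x. indicator S x *\<^sub>R f x) = f"
    using assms(3) by (auto simp: indicator_def fun_eq_iff)
  have S: "S \<inter> space lebesgue \<in> sets lebesgue" using assms(1) by simp
  show "integral\<^sup>L (lebesgue_on S) f = integral\<^sup>L lborel f"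
    using integral_restrict_space[OF S, of f] e integral_completion[of f lborel] assms(2) by simp
  show "integrable (lebesgue_on S) f = integrable lborel f"
    using integrable_restrict_space[OF S, of f] e integrable_completion[of f lborel] assms(2) by simp
qed

section \<open>The fundamental lemma of the calculus of variations\<close>

definition box_bump :: "'a::euclidean_space \<Rightarrow> 'a \<Rightarrow> 'a \<Rightarrow> real" where
  "box_bump a b x = (\<Prod>i\<in>Basis. flat_exp 0 (x \<bullet> i - a \<bullet> i) * flat_exp 0 (b \<bullet> i - x \<bullet> i))"

lemma flat_exp_pos_iff: "0 < flat_exp 0 x \<longleftrightarrow> 0 < x"
  by (auto simp: flat_exp_def)

lemma box_bump_pos: "x \<in> box a b \<Longrightarrow> 0 < box_bump a b x"
  unfolding box_bump_def by (intro prod_pos) (auto simp: flat_exp_pos_iff mem_box)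

lemma box_bump_eq_0: "x \<notin> box a b \<Longrightarrow> box_bump a b x = 0"
  unfolding box_bump_def
  by (intro prod_zero) (auto simp: mem_box flat_exp_def)

lemma Ck_box_bump: "Ck k (box_bump a b)"
proof -
  have "Ck k (\<lambda>x. flat_exp 0 (x \<bullet> i - a \<bullet> i))" for i
    using Ck_compose_affine[OF bounded_linear_inner_left[of i] Ck_flat_exp[of k 0], of "- (a \<bullet> i)"] by simp
  moreover have "Ck k (\<lambda>x. flat_exp 0 (b \<bullet> i - x \<bullet> i))" for i
    using Ck_compose_affine[OF bounded_linear_minus[OF bounded_linear_inner_left[of i]] Ck_flat_exp[of k 0], of "b \<bullet> i"]
    by simp
  ultimately show ?thesis unfolding box_bump_def[abs_def] by (intro Ck_prod Ck_mult) auto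
qed

text \<open>As r grows, these functions increase to the indicator of the open box while staying
  between 0 and 1: the bump is positive exactly there. They are smooth approximations of indicators
  with an immediate dominating bound.\<close>

lemma test_function_box:
  fixes a b :: "'a::euclidean_space"
  assumes "cbox a b \<subseteq> S"
  shows "(\<lambda>x. 1 - exp (- (r * box_bump a b x))) \<in> test_functions S"
proof (rule test_functionsI[where K = "cbox a b"])
  show "Ck k (\<lambda>x. 1 - exp (- (r * box_bump a b x)))" for k
  proof -
    have "Ck k (\<lambda>x. 1 + (-1) * exp ((- r) * box_bump a b x))"
      by (intro Ck_add Ck_mult Ck_const Ck_compose_real[OF _ Ck_exp] Ck_box_bump)
    then show ?thesis by simp
  qed
  show "1 - exp (- (r * box_bump a b x)) = 0" if "x \<notin> cbox a b" for x
    using that box_bump_eq_0[of x a b] box_subset_cbox by auto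
qed (use assms in auto)

lemma integral_box_eq_0:
  fixes g :: "'a::euclidean_space \<Rightarrow> real"
  assumes g: "integrable lborel g" and ab: "cbox a b \<subseteq> S"
    and orth: "\<And>\<phi>. \<phi> \<in> test_functions S \<Longrightarrow> (LBINT x. \<phi> x * g x) = 0"
  shows "(LBINT x. indicator (box a b) x * g x) = 0"
proof -
  define \<phi> where "\<phi> n x = 1 - exp (- (real n * box_bump a b x))" for n x
  have nn: "0 \<le> box_bump a b x" for x
    using box_bump_pos[of x a b] box_bump_eq_0[of x a b] by (cases "x \<in> box a b") auto
  have [measurable]: "g \<in> borel_measurable borel" using g by auto
  have [measurable]: "\<phi> n \<in> borel_measurable borel" for n
    using test_functionsD(3)[OF test_function_box[OF ab, of "real n"], of UNIV]
    unfolding \<phi>_def[abs_def] by (intro borel_measurable_continuous_onI) auto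
  have "(\<lambda>n. (LBINT x. \<phi> n x * g x)) \<longlonglongrightarrow>
      (LBINT x. indicator (box a b) x * g x)"
  proof (rule integral_dominated_convergence[where w = "\<lambda>x. norm (g x)"])
    show "AE x in lborel. (\<lambda>n. \<phi> n x * g x) \<longlonglongrightarrow> indicator (box a b) x * g x"
    proof (rule AE_I2)
      fix x
      have "(\<lambda>n. \<phi> n x) \<longlonglongrightarrow> indicator (box a b) x"
      proof (cases "x \<in> box a b")
        case True
        have "filterlim (\<lambda>n. box_bump a b x * real n) at_top sequentially"
          using box_bump_pos[OF True]
          by (intro filterlim_tendsto_pos_mult_at_top[OF tendsto_const _ filterlim_real_sequentially])
        then have "(\<lambda>n. exp (- (real n * box_bump a b x))) \<longlonglongrightarrow> 0"
          by (intro filterlim_compose[OF exp_at_bot]) (simp add: filterlim_uminus_at_bot mult.commute)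
        then have "(\<lambda>n. 1 - exp (- (real n * box_bump a b x))) \<longlonglongrightarrow> 1 - 0"
          by (intro tendsto_intros)
        then show ?thesis using True by (simp add: \<phi>_def)
      next
        case False
        then show ?thesis by (simp add: \<phi>_def box_bump_eq_0)
      qed
      then show "(\<lambda>n. \<phi> n x * g x) \<longlonglongrightarrow> indicator (box a b) x * g x"
        by (intro tendsto_intros)
    qed
    show "AE x in lborel. norm (\<phi> n x * g x) \<le> norm (g x)" for n
      using nn by (intro AE_I2) (auto simp: \<phi>_def abs_mult intro!: mult_left_le_one_le)
  qed (use g in auto)
  moreover have "(LBINT x. \<phi> n x * g x) = 0" for n
    unfolding \<phi>_def by (rule orth[OF test_function_box[OF ab]])
  ultimately show ?thesis by (simp add: LIMSEQ_const_iff)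
qed

text \<open>Open boxes are stable under intersection and generate the Borel sets, so the vanishing
  of the integrals spreads from boxes to all Borel sets by induction over the generated
  \<sigma>-algebra. The sets where the function is nonnegative or negative then give the
  claim.\<close>

lemma AE_eq_0_on_box:
  fixes g :: "'a::euclidean_space \<Rightarrow> real"
  assumes g: "integrable lborel g" and ab: "cbox a b \<subseteq> S"
    and orth: "\<And>\<phi>. \<phi> \<in> test_functions S \<Longrightarrow> (LBINT x. \<phi> x * g x) = 0"
  shows "AE x in lborel. x \<in> box a b \<longrightarrow> g x = 0"
proof -
  \<comment> \<open>Cutting off to one box makes the integral over the whole space vanish too, which
    the complement case of the induction needs.\<close>
  define h where "h x = indicator (box a b) x * g x" for x
  have [measurable]: "g \<in> borel_measurable borel" using g by auto
  have h: "integrable lborel h"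
    unfolding h_def using integrable_mult_indicator[OF _ g, of "box a b"] by simp
  have [measurable]: "h \<in> borel_measurable borel" using h by auto
  have ih: "integrable lborel (\<lambda>x. indicator A x * h x)" if "A \<in> sets borel" for A
    using integrable_mult_indicator[OF _ h, of A] that by simp
  have zero: "(LBINT x. indicator A x * h x) = 0" if "A \<in> sets borel" for A
  proof -
    have "Int_stable (range (\<lambda>(a, b). box a b :: 'a set))"
      by (auto simp: Int_stable_def Int_interval box_Int_box)
    moreover have "range (\<lambda>(a, b). box a b :: 'a set) \<subseteq> Pow UNIV" by simp
    moreover have "A \<in> sigma_sets UNIV (range (\<lambda>(a, b). box a b))"
      using that unfolding borel_eq_box by simp
    ultimately show ?thesis
    proof (induction rule: sigma_sets_induct_disjoint)
      case (basic A)
      then obtain c d where A: "A = box c d" by auto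
      define l where "l = (\<Sum>i\<in>Basis. max (c \<bullet> i) (a \<bullet> i) *\<^sub>R i)"
      define u where "u = (\<Sum>i\<in>Basis. min (d \<bullet> i) (b \<bullet> i) *\<^sub>R i)"
      have e: "box c d \<inter> box a b = box l u" unfolding l_def u_def by (rule box_Int_box)
      have s: "cbox l u \<subseteq> cbox a b"
        unfolding l_def u_def subset_iff mem_box by simp
      have "(LBINT x. indicator (box l u) x * g x) = 0"
        by (rule integral_box_eq_0[OF g _ orth]) (use ab s in auto)
      moreover have "indicator A x * h x = indicator (box l u) x * g x" for x
        unfolding A h_def e[symmetric] by (auto simp: indicator_def)
      ultimately show ?case by simp
    next
      case empty
      show ?case by simp
    next
      case (compl A)
      have A: "A \<in> sets borel" using compl(1) by (simp add: borel_eq_box)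
      have "integral\<^sup>L lborel h = 0"
        using integral_box_eq_0[OF g ab orth] by (simp add: h_def[abs_def])
      moreover have "indicator (UNIV - A) x * h x = h x - indicator A x * h x" for x
        by (auto simp: indicator_def)
      ultimately show ?case using compl(2) ih[OF A] h by simp
    next
      case (union A)
      have A: "A i \<in> sets borel" for i using union(2) by (auto simp: borel_eq_box)
      have "(\<lambda>n. (LBINT x. indicator (\<Union>i<n. A i) x * h x)) \<longlonglongrightarrow>
          (LBINT x. indicator (\<Union>i. A i) x * h x)"
      proof (rule integral_dominated_convergence[where w = "\<lambda>x. norm (h x)"])
        show "AE x in lborel. (\<lambda>n. indicator (\<Union>i<n. A i) x * h x) \<longlonglongrightarrow> indicator (\<Union>i. A i) x * h x"
          by (intro AE_I2 tendsto_mult tendsto_const LIMSEQ_indicator_UN)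
        show "AE x in lborel. norm (indicator (\<Union>i<n. A i) x * h x) \<le> norm (h x)" for n
          by (auto simp: indicator_def)
      qed (use A h in auto)
      moreover have "(LBINT x. indicator (\<Union>i<n. A i) x * h x) = 0" for n
      proof -
        have "indicator (\<Union>i<n. A i) x * h x = (\<Sum>i<n. indicator (A i) x * h x)" for x
          unfolding sum_distrib_right[symmetric] using union(1)
          by (subst indicator_UN_disjoint) (auto simp: disjoint_family_on_def)
        then show ?thesis using union(3) ih[OF A] by (simp only: Bochner_Integration.integral_sum) simp
      qed
      ultimately show ?case by (simp add: LIMSEQ_const_iff)
    qed
  qed
  have "AE x in lborel. h x = 0"
  proof -
    have "(LBINT x. \<bar>h x\<bar>) = 0"
    proof -
      \<comment> \<open>The absolute value is split along the sign sets, over both of which h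
        integrates to 0.\<close>
      have "\<bar>h x\<bar> = indicator {x. h x \<ge> 0} x * h x - indicator {x. h x < 0} x * h x" for x
        by (auto simp: indicator_def)
      then show ?thesis using zero ih by simp
    qed
    then show ?thesis
      using integral_nonneg_eq_0_iff_AE[of lborel "\<lambda>x. \<bar>h x\<bar>"] h by simp
  qed
  then show ?thesis by eventually_elim (auto simp: h_def)
qed

text \<open>An open set is a countable union of closed boxes; the local result covers their
  interiors, and their boundaries are null.\<close>

lemma fundamental_lemma:
  fixes g :: "'a::euclidean_space \<Rightarrow> real"
  assumes g: "integrable lborel g" and S: "open S"
    and orth: "\<And>\<phi>. \<phi> \<in> test_functions S \<Longrightarrow> (LBINT x. \<phi> x * g x) = 0"
  shows "AE x in lborel. x \<in> S \<longrightarrow> g x = 0"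
proof -
  obtain D where D: "countable D" "D \<subseteq> Pow S" "\<And>X. X \<in> D \<Longrightarrow> \<exists>a b. X = cbox a b" "\<Union>D = S"
    using open_countable_Union_open_cbox[OF S] by blast
  have "AE x in lborel. x \<in> X \<longrightarrow> g x = 0" if X: "X \<in> D" for X
  proof -
    obtain a b where ab: "X = cbox a b" using D(3) X by blast
    have "cbox a b \<subseteq> S" using D(2) X ab by auto
    then have "AE x in lborel. x \<in> box a b \<longrightarrow> g x = 0"
      using AE_eq_0_on_box[OF g _ orth] by blast
    moreover have "AE x in lborel. x \<notin> cbox a b - box a b"
      using AE_not_in[of "cbox a b - box a b" lebesgue] negligible_frontier_interval[of a b]
      by (simp add: negligible_iff_null_sets AE_completion_iff)
    ultimately show ?thesis by eventually_elim (auto simp: ab)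
  qed
  then have "AE x in lborel. \<forall>X\<in>D. x \<in> X \<longrightarrow> g x = 0"
    by (subst AE_ball_countable[OF D(1)]) blast
  then show ?thesis by eventually_elim (use D(4) in blast)
qed

text \<open>The lemma of du Bois-Reymond. A test function with integral 0 is the derivative of a
  test function; subtracting from \<eta> its integral times a fixed \<rho> of integral 1 produces
  such a function, so m minus the constant c is orthogonal to every \<eta>.\<close>

lemma weakly_constant:
  fixes m :: "real \<Rightarrow> real"
  assumes m: "integrable lborel m" and ab: "a < b"
    and orth: "\<And>\<psi>. \<psi> \<in> test_functions {a<..<b} \<Longrightarrow> (LBINT t. grad \<psi> t * m t) = 0"
  obtains c where "AE t in lborel. t \<in> {a<..<b} \<longrightarrow> m t = c"
proof -
  have mb: "test \<in> borel_measurable borel" "integrable lborel test" "integrable lborel (\<lambda>x. test x * m x)"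
    if t: "test \<in> test_functions {a<..<b}" for test
  proof -
    obtain K where K: "compact K" and z: "\<And>x. x \<notin> K \<Longrightarrow> test x = 0"
      using test_functions_support[OF t] by metis
    obtain B where B: "\<And>x. norm (test x) \<le> B"
      using bounded_compact_support[OF test_functionsD(3)[OF t] K z] by metis
    show *: "test \<in> borel_measurable borel" "integrable lborel test"
      using test_functionsD(3)[OF t, of UNIV] integrable_compact_support[OF _ K z]
      by (auto intro: borel_measurable_continuous_onI)
    show "integrable lborel (\<lambda>x. test x * m x)"
      by (rule Bochner_Integration.integrable_bound[where f = "\<lambda>x. B * m x"])
        (use m * B in \<open>auto simp: abs_mult intro!: AE_I2 mult_right_mono intro: order_trans[OF _ abs_ge_self]\<close>)
  qed
  \<comment> \<open>The middle third of the interval, so that the closed box carrying \<theta> lies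
    strictly inside.\<close>
  define l where "l = (2 * a + b) / 3"
  define u where "u = (a + 2 * b) / 3"
  have lu: "a < l" "l < u" "u < b" using ab by (auto simp: l_def u_def field_simps)
  define \<theta> where "\<theta> x = 1 - exp (- (1 * box_bump l u x))" for x
  have \<theta>: "\<theta> \<in> test_functions {a<..<b}"
    unfolding \<theta>_def[abs_def] by (rule test_function_box) (use lu in auto)
  have \<theta>nn: "0 \<le> \<theta> x" for x
    using box_bump_pos[of x l u] box_bump_eq_0[of x l u] unfolding \<theta>_def
    by (cases "x \<in> box l u") auto
  have "integral\<^sup>L lborel \<theta> \<noteq> 0"
  proof
    assume "integral\<^sup>L lborel \<theta> = 0"
    then have "AE x in lborel. \<theta> x = 0"
      using integral_nonneg_eq_0_iff_AE[of lborel \<theta>] mb(2)[OF \<theta>] \<theta>nn by simp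
    moreover have "x \<notin> box l u" if "\<theta> x = 0" for x
      using that box_bump_pos[of x l u] by (auto simp: \<theta>_def)
    ultimately have "AE x in lborel. x \<notin> box l u"
      by (auto elim: AE_mp)
    then have "box l u \<in> null_sets lborel" by (subst AE_iff_null_sets) auto
    then show False using lu by (auto simp: null_sets_def)
  qed
  define k where "k = integral\<^sup>L lborel \<theta>"
  have k: "k \<noteq> 0" unfolding k_def by fact
  define \<rho> where "\<rho> x = (1 / k) * \<theta> x" for x
  have \<rho>: "\<rho> \<in> test_functions {a<..<b}" unfolding \<rho>_def[abs_def] by (rule test_functions_scale[OF \<theta>])
  have \<rho>1: "integral\<^sup>L lborel \<rho> = 1" unfolding \<rho>_def using k by (simp add: k_def)
  define c where "c = (LBINT t. \<rho> t * m t)"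
  have eta: "(LBINT t. \<eta> t * m t) = c * integral\<^sup>L lborel \<eta>"
    if \<eta>: "\<eta> \<in> test_functions {a<..<b}" for \<eta>
  proof -
    define s where "s = integral\<^sup>L lborel \<eta>"
    define \<zeta> where "\<zeta> x = \<eta> x + (- s) * \<rho> x" for x
    have \<zeta>: "\<zeta> \<in> test_functions {a<..<b}"
      unfolding \<zeta>_def[abs_def] by (intro test_functions_add \<eta> test_functions_scale \<rho>)
    have \<zeta>0: "integral\<^sup>L lborel \<zeta> = 0"
      unfolding \<zeta>_def using mb(2)[OF \<eta>] mb(2)[OF \<rho>] \<rho>1 by (simp add: s_def)
    have "\<exists>F. \<forall>x::real. -\<infinity> < ereal x \<longrightarrow> ereal x < \<infinity> \<longrightarrow> (F has_vector_derivative \<zeta> x) (at x)"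
      using test_functionsD(3)[OF \<zeta>, of UNIV]
      by (intro einterval_antiderivative) (auto simp: continuous_on_eq_continuous_at)
    then obtain F where F: "\<And>x. (F has_real_derivative \<zeta> x) (at x)"
      by (auto simp: has_real_derivative_iff_has_vector_derivative)
    have "\<exists>l u. a < l \<and> l < u \<and> u < b \<and> (\<forall>x. x \<notin> {l..u} \<longrightarrow> \<zeta> x = 0)"
    proof -
      \<comment> \<open>The midpoint keeps the set nonempty when \<zeta> is identically 0, so that a
        least and a greatest element exist.\<close>
      let ?K = "closure {x. \<zeta> x \<noteq> 0} \<union> {(a + b) / 2}"
      have K: "compact ?K" "?K \<noteq> {}" "?K \<subseteq> {a<..<b}"
        using test_functionsD(6,7)[OF \<zeta>] ab by auto
      obtain p where p: "p \<in> ?K" "\<And>x. x \<in> ?K \<Longrightarrow> p \<le> x" using compact_attains_inf[OF K(1,2)] by blast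
      obtain q where q: "q \<in> ?K" "\<And>x. x \<in> ?K \<Longrightarrow> x \<le> q" using compact_attains_sup[OF K(1,2)] by blast
      have "a < p" "q < b" "p \<le> q" using p q K(3) by auto
      moreover have "\<zeta> x = 0" if "x \<notin> {p..q}" for x
        using that p(2)[of x] q(2)[of x] closure_subset[of "{x. \<zeta> x \<noteq> 0}"] by auto
      ultimately show ?thesis
        \<comment> \<open>Moving the ends halfway outwards gives l < u even if p = q.\<close>
        by (intro exI[of _ "(a + p) / 2"] exI[of _ "(q + b) / 2"]) auto
    qed
    then obtain l u where lu: "a < l" "l < u" "u < b" "\<And>x. x \<notin> {l..u} \<Longrightarrow> \<zeta> x = 0" by blast
    define \<psi> where "\<psi> x = F x - F l" for x
    have \<psi>': "(\<psi> has_real_derivative \<zeta> x) (at x)" for x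
      unfolding \<psi>_def[abs_def] by (auto intro!: derivative_eq_intros F)
    have e: "(\<lambda>x. indicator {l..u} x *\<^sub>R \<zeta> x) = \<zeta>"
      using lu(4) by (auto simp: indicator_def fun_eq_iff)
    have "(LBINT x. indicator {l..u} x *\<^sub>R \<zeta> x) = \<psi> u - \<psi> l"
      using test_functionsD(3)[OF \<zeta>, of UNIV] lu(2) \<psi>'
      by (intro integral_FTC_atLeastAtMost)
        (auto intro: continuous_on_subset has_vector_derivative_at_within
          simp: has_real_derivative_iff_has_vector_derivative)
    then have u0: "\<psi> u = 0" unfolding e using \<zeta>0 by (simp add: \<psi>_def)
    \<comment> \<open>Outside the interval the derivative \<zeta> vanishes, so \<psi> keeps its end
      values: 0 at l by the choice of the primitive, 0 at u because \<zeta> has integral 0.\<close>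
    have "\<psi> x = 0" if x: "x \<notin> {l..u}" for x
    proof -
      have *: "\<psi> x = \<psi> y" if "x < y \<and> y = l \<or> y < x \<and> y = u" for y
        using that
      proof
        assume "x < y \<and> y = l"
        then obtain z where "x < z" "z < y" "\<psi> y - \<psi> x = (y - x) * \<zeta> z"
          using MVT2[of x y \<psi> \<zeta>] \<psi>' by blast
        then show ?thesis using lu(4)[of z] \<open>x < y \<and> y = l\<close> by auto
      next
        assume "y < x \<and> y = u"
        then obtain z where "y < z" "z < x" "\<psi> x - \<psi> y = (x - y) * \<zeta> z"
          using MVT2[of y x \<psi> \<zeta>] \<psi>' by blast
        then show ?thesis using lu(4)[of z] \<open>y < x \<and> y = u\<close> by auto
      qed
      show ?thesis using *[of l] *[of u] x u0 by (auto simp: \<psi>_def)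
    qed
    moreover have "Ck k \<psi>" for k
      using Ck_Suc_lower[OF Ck_real_SucI[OF \<psi>' test_functionsD(1)[OF \<zeta>, of k]]] .
    ultimately have "\<psi> \<in> test_functions {a<..<b}"
      by (intro test_functionsI[where K = "{l..u}"]) (use lu in auto)
    then have "(LBINT t. grad \<psi> t * m t) = 0" by (rule orth)
    then have "(LBINT t. \<zeta> t * m t) = 0" using grad_real_eqI[OF \<psi>'] by simp
    moreover have "(LBINT t. \<zeta> t * m t) =
        (LBINT t. \<eta> t * m t) + (- s) * (LBINT t. \<rho> t * m t)"
      unfolding \<zeta>_def using mb(3)[OF \<eta>] mb(3)[OF \<rho>] by (simp add: algebra_simps)
    ultimately show ?thesis by (simp add: c_def s_def)
  qed
  define g where "g t = m t - indicator {a<..<b} t * c" for t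
  have "AE t in lborel. t \<in> {a<..<b} \<longrightarrow> g t = 0"
  proof (rule fundamental_lemma)
    show "integrable lborel g" unfolding g_def using ab
      by (intro Bochner_Integration.integrable_diff m integrable_mult_left integrable_real_indicator) auto
    fix \<eta> assume \<eta>: "\<eta> \<in> test_functions {a<..<b}"
    have "\<eta> t * g t = \<eta> t * m t - c * \<eta> t" for t
      using test_functionsD(8)[OF \<eta>, of t] by (auto simp: g_def indicator_def algebra_simps)
    then show "(LBINT x. \<eta> x * g x) = 0"
      using mb(2,3)[OF \<eta>] eta[OF \<eta>] by simp
  qed simp
  then have "AE t in lborel. t \<in> {a<..<b} \<longrightarrow> m t = c"
    by eventually_elim (auto simp: g_def)
  then show ?thesis by (rule that)
qed

section \<open>Square integrable functions\<close>

text \<open>The measure is a parameter here: the same estimates serve \<open>lebesgue_on S\<close>,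
  in which the spaces are defined, and \<open>lborel\<close>, in which slices and translations are
  taken.\<close>

definition sq_integrable :: "'a measure \<Rightarrow> ('a \<Rightarrow> 'b::euclidean_space) \<Rightarrow> bool" where
  "sq_integrable M f \<longleftrightarrow> f \<in> borel_measurable M \<and> integrable M (\<lambda>x. (norm (f x))\<^sup>2)"

definition norm2 :: "'a measure \<Rightarrow> ('a \<Rightarrow> 'b::euclidean_space) \<Rightarrow> real" where
  "norm2 M f = sqrt ((LINT x|M. (norm (f x))\<^sup>2))"

lemma L2_iff: "L2 S f \<longleftrightarrow> sq_integrable (lebesgue_on S) f"
  by (simp add: L2_def sq_integrable_def)

lemma l2norm_eq: "l2norm S f = norm2 (lebesgue_on S) f"
  by (simp add: l2norm_def norm2_def)

lemma sq_integrableD: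
  assumes "sq_integrable M f"
  shows "f \<in> borel_measurable M" "integrable M (\<lambda>x. (norm (f x))\<^sup>2)"
  using assms by (auto simp: sq_integrable_def)

lemma sq_integrable_inner:
  assumes "sq_integrable M f" "sq_integrable M g"
  shows "integrable M (\<lambda>x. f x \<bullet> g x)" "integrable M (\<lambda>x. norm (f x) * norm (g x))"
proof -
  note [measurable] = sq_integrableD(1)[OF assms(1)] sq_integrableD(1)[OF assms(2)]
  have i: "integrable M (\<lambda>x. (norm (f x))\<^sup>2 + (norm (g x))\<^sup>2)"
    by (intro Bochner_Integration.integrable_add sq_integrableD(2) assms)
  have b: "norm (f x) * norm (g x) \<le> (norm (f x))\<^sup>2 + (norm (g x))\<^sup>2" for x
    using sum_squares_bound[of "norm (f x)" "norm (g x)"]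
      mult_nonneg_nonneg[of "norm (f x)" "norm (g x)"] by (simp del: mult_nonneg_nonneg)
  have c: "\<bar>f x \<bullet> g x\<bar> \<le> (norm (f x))\<^sup>2 + (norm (g x))\<^sup>2" for x
    using Cauchy_Schwarz_ineq2[of "f x" "g x"] b[of x] by linarith
  show "integrable M (\<lambda>x. f x \<bullet> g x)"
    using c by (intro Bochner_Integration.integrable_bound[OF i]) (auto simp: abs_of_nonneg)
  show "integrable M (\<lambda>x. norm (f x) * norm (g x))"
    using b by (intro Bochner_Integration.integrable_bound[OF i]) (auto simp: abs_of_nonneg)
qed

lemma sq_integrable_scaleR: "sq_integrable M f \<Longrightarrow> sq_integrable M (\<lambda>x. r *\<^sub>R f x)"
  by (auto simp: sq_integrable_def power_mult_distrib)

lemma sq_integrable_mult: "sq_integrable M f \<Longrightarrow> sq_integrable M (\<lambda>x. r * f x :: real)"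
  using sq_integrable_scaleR[of M f r] by simp

lemma sq_integrable_minus: "sq_integrable M f \<Longrightarrow> sq_integrable M (\<lambda>x. - f x)"
  using sq_integrable_scaleR[of M f "-1"] by simp

lemma sq_integrable_bound:
  assumes "sq_integrable M f" "g \<in> borel_measurable M" "AE x in M. norm (g x) \<le> norm (f x)"
  shows "sq_integrable M g"
proof -
  have "integrable M (\<lambda>x. (norm (g x))\<^sup>2)"
  proof (rule Bochner_Integration.integrable_bound[OF sq_integrableD(2)[OF assms(1)]])
    show "(\<lambda>x. (norm (g x))\<^sup>2) \<in> borel_measurable M" using assms(2) by measurable
    show "AE x in M. norm ((norm (g x))\<^sup>2) \<le> norm ((norm (f x))\<^sup>2)"
      using assms(3) by eventually_elim (simp add: power_mono)
  qed
  then show ?thesis using assms(2) by (simp add: sq_integrable_def)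
qed

lemma sq_integrable_add:
  assumes "sq_integrable M f" "sq_integrable M g"
  shows "sq_integrable M (\<lambda>x. f x + g x)"
proof -
  note [measurable] = sq_integrableD(1)[OF assms(1)] sq_integrableD(1)[OF assms(2)]
  have "(\<lambda>x. (norm (f x + g x))\<^sup>2) = (\<lambda>x. (norm (f x))\<^sup>2 + (norm (g x))\<^sup>2 + 2 * (f x \<bullet> g x))"
    by (auto simp: power2_norm_eq_inner inner_simps inner_commute)
  moreover have "integrable M (\<lambda>x. (norm (f x))\<^sup>2 + (norm (g x))\<^sup>2 + 2 * (f x \<bullet> g x))"
    by (intro Bochner_Integration.integrable_add integrable_mult_right sq_integrable_inner sq_integrableD(2) assms)
  ultimately show ?thesis by (simp add: sq_integrable_def)
qed

lemma sq_integrable_diff: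
  "sq_integrable M f \<Longrightarrow> sq_integrable M g \<Longrightarrow> sq_integrable M (\<lambda>x. f x - g x)"
  using sq_integrable_add[OF _ sq_integrable_minus, of M f g] by simp

lemma sq_integrable_zero: "sq_integrable M (\<lambda>x. 0)"
  by (simp add: sq_integrable_def)

lemma norm2_cong_AE:
  assumes "f \<in> borel_measurable M" "g \<in> borel_measurable M" "AE x in M. f x = g x"
  shows "norm2 M f = norm2 M g"
  unfolding norm2_def
  by (intro arg_cong[where f = sqrt] integral_cong_AE) (use assms in auto)

lemma norm2_nonneg: "0 \<le> norm2 M f"
  unfolding norm2_def by (intro real_sqrt_ge_zero integral_nonneg) auto

lemma norm2_power2: "(norm2 M f)\<^sup>2 = (LINT x|M. (norm (f x))\<^sup>2)"
  unfolding norm2_def by (simp add: integral_nonneg)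

lemma norm2_power2_inner: "(norm2 M f)\<^sup>2 = (LINT x|M. f x \<bullet> f x)"
  unfolding norm2_power2 by (simp add: power2_norm_eq_inner)

lemma norm2_scaleR: "norm2 M (\<lambda>x. r *\<^sub>R f x) = \<bar>r\<bar> * norm2 M f"
  unfolding norm2_def by (simp add: power_mult_distrib real_sqrt_mult)

lemma norm2_uminus: "norm2 M (\<lambda>x. - f x) = norm2 M f"
  unfolding norm2_def by simp

lemma norm2_minus_commute: "norm2 M (\<lambda>x. f x - g x) = norm2 M (\<lambda>x. g x - f x)"
  unfolding norm2_def by (simp add: norm_minus_commute)

text \<open>The discriminant criterion, including c = 0, since \<open>norm2\<close> is only a
  seminorm on functions. It gives Cauchy-Schwarz, and in the Riesz lemma it shows that
  near-minimisers almost satisfy the Euler equation.\<close>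

lemma quadratic_nonneg_imp:
  fixes a b c :: real
  assumes "\<And>t. 0 \<le> a + 2 * b * t + c * t\<^sup>2"
  shows "b\<^sup>2 \<le> a * c"
proof (cases "c = 0")
  case True
  have "b = 0"
  proof (rule ccontr)
    assume "b \<noteq> 0"
    then show False using assms[of "- (a + 1) / (2 * b)"] True by simp
  qed
  then show ?thesis using True by simp
next
  case False
  have "c > 0"
  proof (rule ccontr)
    assume "\<not> c > 0"
    then have c: "c < 0" using False by simp
    \<comment> \<open>A point s \<ge> 1 at which the negative quadratic term outweighs the two
      others.\<close>
    define s where "s = (\<bar>a\<bar> + 2 * \<bar>b\<bar> + 1) / (- c) + 1"
    have s1: "s \<ge> 1" using c divide_nonneg_pos[of "\<bar>a\<bar> + 2 * \<bar>b\<bar> + 1" "- c"] by (simp add: s_def)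
    have "- c * s = \<bar>a\<bar> + 2 * \<bar>b\<bar> + 1 - c" using c by (simp add: s_def field_simps)
    then have cs: "- c * s \<ge> \<bar>a\<bar> + 2 * \<bar>b\<bar> + 1" using c by linarith
    have "b * s \<le> \<bar>b\<bar> * s" using s1 by (intro mult_right_mono) auto
    moreover have "\<bar>a\<bar> * 1 \<le> \<bar>a\<bar> * s" using s1 by (intro mult_left_mono) auto
    moreover have "(\<bar>a\<bar> + 2 * \<bar>b\<bar> + 1) * s \<le> (- c * s) * s" using cs s1 by (intro mult_right_mono) auto
    then have "\<bar>a\<bar> * s + 2 * (\<bar>b\<bar> * s) + s \<le> - (c * s\<^sup>2)" by (simp add: power2_eq_square algebra_simps)
    moreover have "2 * b * s = 2 * (b * s)" by simp
    ultimately have "a + 2 * b * s + c * s\<^sup>2 < 0" using s1 abs_ge_self[of a] by linarith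
    then show False using assms[of s] by linarith
  qed
  have "0 \<le> a + 2 * b * (- b / c) + c * (- b / c)\<^sup>2" by (rule assms)
  also have "\<dots> = a - b\<^sup>2 / c" using \<open>c > 0\<close> by (simp add: field_simps power2_eq_square)
  finally show ?thesis using \<open>c > 0\<close> by (simp add: field_simps)
qed

lemma norm2_add_scaleR_power2:
  assumes "sq_integrable M f" "sq_integrable M g"
  shows "(norm2 M (\<lambda>x. f x + t *\<^sub>R g x))\<^sup>2 =
    (norm2 M f)\<^sup>2 + 2 * t * (LINT x|M. f x \<bullet> g x) + t\<^sup>2 * (norm2 M g)\<^sup>2"
proof -
  have "(norm (f x + t *\<^sub>R g x))\<^sup>2 = (norm (f x))\<^sup>2 + 2 * t * (f x \<bullet> g x) + t\<^sup>2 * (norm (g x))\<^sup>2" for x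
    unfolding power2_norm_eq_inner
    by (simp add: inner_simps inner_commute[of "g x" "f x"] power2_eq_square algebra_simps)
  then show ?thesis
    unfolding norm2_power2
    using sq_integrable_inner(1)[OF assms] sq_integrableD(2)[OF assms(1)] sq_integrableD(2)[OF assms(2)]
    by simp
qed

lemma norm2_diff_power2:
  assumes "sq_integrable M f" "sq_integrable M g"
  shows "(norm2 M (\<lambda>x. f x - g x))\<^sup>2 =
    (norm2 M f)\<^sup>2 - 2 * (LINT x|M. f x \<bullet> g x) + (norm2 M g)\<^sup>2"
  using norm2_add_scaleR_power2[OF assms, of "-1"] by simp

lemma Cauchy_Schwarz_norm2:
  assumes "sq_integrable M f" "sq_integrable M g"
  shows "\<bar>(LINT x|M. f x \<bullet> g x)\<bar> \<le> norm2 M f * norm2 M g"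
proof -
  have "0 \<le> (norm2 M f)\<^sup>2 + 2 * (LINT x|M. f x \<bullet> g x) * t + (norm2 M g)\<^sup>2 * t\<^sup>2" for t
  proof -
    have "(norm2 M f)\<^sup>2 + 2 * (LINT x|M. f x \<bullet> g x) * t + (norm2 M g)\<^sup>2 * t\<^sup>2 =
        (norm2 M (\<lambda>x. f x + t *\<^sub>R g x))\<^sup>2"
      unfolding norm2_add_scaleR_power2[OF assms] by (simp add: mult_ac)
    then show ?thesis by simp
  qed
  then have "((LINT x|M. f x \<bullet> g x))\<^sup>2 \<le> (norm2 M f)\<^sup>2 * (norm2 M g)\<^sup>2"
    by (rule quadratic_nonneg_imp)
  then have "((LINT x|M. f x \<bullet> g x))\<^sup>2 \<le> (norm2 M f * norm2 M g)\<^sup>2"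
    by (simp add: power_mult_distrib)
  then have "\<bar>(LINT x|M. f x \<bullet> g x)\<bar> \<le> \<bar>norm2 M f * norm2 M g\<bar>"
    by (simp only: abs_le_square_iff)
  then show ?thesis by (simp add: norm2_nonneg)
qed

lemma Cauchy_Schwarz_norm2_real:
  assumes "sq_integrable M f" "sq_integrable M g"
  shows "\<bar>(LINT x|M. f x * g x :: real)\<bar> \<le> norm2 M f * norm2 M g"
  using Cauchy_Schwarz_norm2[OF assms] by simp

lemma norm2_triangle:
  assumes "sq_integrable M f" "sq_integrable M g"
  shows "norm2 M (\<lambda>x. f x + g x) \<le> norm2 M f + norm2 M g"
proof -
  have "(norm2 M (\<lambda>x. f x + g x))\<^sup>2 \<le> (norm2 M f + norm2 M g)\<^sup>2"
    using norm2_add_scaleR_power2[OF assms, of 1] Cauchy_Schwarz_norm2[OF assms]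
    by (simp add: power2_sum)
  then show ?thesis by (rule power2_le_imp_le) (simp add: norm2_nonneg)
qed

lemma norm2_triangle_diff:
  assumes "sq_integrable M f" "sq_integrable M g"
  shows "norm2 M (\<lambda>x. f x - g x) \<le> norm2 M f + norm2 M g"
  using norm2_triangle[OF assms(1) sq_integrable_minus[OF assms(2)]] by (simp add: norm2_uminus)

lemma norm2_triangle_via:
  assumes "sq_integrable M f" "sq_integrable M g" "sq_integrable M h"
  shows "norm2 M (\<lambda>x. f x - h x) \<le> norm2 M (\<lambda>x. f x - g x) + norm2 M (\<lambda>x. g x - h x)"
  using norm2_triangle[OF sq_integrable_diff[OF assms(1,2)] sq_integrable_diff[OF assms(2,3)]] by simp

lemma norm2_diff_abs:
  assumes "sq_integrable M f" "sq_integrable M g"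
  shows "\<bar>norm2 M f - norm2 M g\<bar> \<le> norm2 M (\<lambda>x. f x - g x)"
  using norm2_triangle[OF sq_integrable_diff[OF assms] assms(2)]
    norm2_triangle[OF sq_integrable_diff[OF assms(2,1)] assms(1)]
  by (simp add: norm2_minus_commute[of M f g])

lemma tendsto_norm2:
  assumes "\<And>n. sq_integrable M (f n)" "sq_integrable M g"
    and "((\<lambda>n. norm2 M (\<lambda>x. f n x - g x)) \<longlongrightarrow> 0) F"
  shows "((\<lambda>n. norm2 M (f n)) \<longlongrightarrow> norm2 M g) F"
proof -
  have "((\<lambda>n. norm2 M (f n) - norm2 M g) \<longlongrightarrow> 0) F"
    by (rule tendsto_0_le[OF assms(3), of _ 1])
      (auto simp: norm2_nonneg intro!: always_eventually norm2_diff_abs assms)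
  then show ?thesis by (simp add: LIM_zero_iff)
qed

lemma tendsto_integral_inner:
  assumes f: "\<And>n. sq_integrable M (f n)" "sq_integrable M f'"
    and g: "\<And>n. sq_integrable M (g n)" "sq_integrable M g'"
    and lf: "((\<lambda>n. norm2 M (\<lambda>x. f n x - f' x)) \<longlongrightarrow> 0) F"
    and lg: "((\<lambda>n. norm2 M (\<lambda>x. g n x - g' x)) \<longlongrightarrow> 0) F"
  shows "((\<lambda>n. (LINT x|M. f n x \<bullet> g n x)) \<longlongrightarrow> (LINT x|M. f' x \<bullet> g' x)) F"
proof -
  have e: "(LINT x|M. f n x \<bullet> g n x) - (LINT x|M. f' x \<bullet> g' x) =
      (LINT x|M. (f n x - f' x) \<bullet> g n x) + (LINT x|M. f' x \<bullet> (g n x - g' x))" for n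
    by (simp add: inner_diff_left inner_diff_right sq_integrable_inner(1) f g)
  have "((\<lambda>n. norm2 M (\<lambda>x. f n x - f' x) * norm2 M (g n) + norm2 M f' * norm2 M (\<lambda>x. g n x - g' x)) \<longlongrightarrow>
      0 * norm2 M g' + norm2 M f' * 0) F"
    by (intro tendsto_intros lf lg tendsto_norm2[OF g])
  then have lim: "((\<lambda>n. norm2 M (\<lambda>x. f n x - f' x) * norm2 M (g n) + norm2 M f' * norm2 M (\<lambda>x. g n x - g' x)) \<longlongrightarrow> 0) F"
    by simp
  have b: "norm ((LINT x|M. f n x \<bullet> g n x) - (LINT x|M. f' x \<bullet> g' x)) \<le>
      norm2 M (\<lambda>x. f n x - f' x) * norm2 M (g n) + norm2 M f' * norm2 M (\<lambda>x. g n x - g' x)" for n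
    unfolding e using Cauchy_Schwarz_norm2[OF sq_integrable_diff[OF f(1)[of n] f(2)] g(1)[of n]]
      Cauchy_Schwarz_norm2[OF f(2) sq_integrable_diff[OF g(1)[of n] g(2)]] by simp
  have "((\<lambda>n. (LINT x|M. f n x \<bullet> g n x) - (LINT x|M. f' x \<bullet> g' x)) \<longlongrightarrow> 0) F"
    by (rule Lim_null_comparison[OF always_eventually lim]) (use b in blast)
  then show ?thesis by (simp add: LIM_zero_iff)
qed

lemma sq_integrable_const_tendsto:
  assumes "\<And>n. sq_integrable M (f n)" "sq_integrable M f'" "sq_integrable M g"
    and "((\<lambda>n. norm2 M (\<lambda>x. f n x - f' x)) \<longlongrightarrow> 0) F"
  shows "((\<lambda>n. (LINT x|M. f n x \<bullet> g x)) \<longlongrightarrow> (LINT x|M. f' x \<bullet> g x)) F"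
  by (rule tendsto_integral_inner) (use assms in \<open>auto simp: norm2_def\<close>)

lemma nn_integral_norm2:
  assumes "sq_integrable M f"
  shows "(\<integral>\<^sup>+ x. ennreal ((norm (f x))\<^sup>2) \<partial>M) = ennreal ((norm2 M f)\<^sup>2)"
  unfolding norm2_power2 by (rule nn_integral_eq_integral[OF sq_integrableD(2)[OF assms]]) auto

lemma sq_integrable_nn:
  assumes "f \<in> borel_measurable M" "(\<integral>\<^sup>+ x. ennreal ((norm (f x))\<^sup>2) \<partial>M) \<le> ennreal (c\<^sup>2)" "0 \<le> c"
  shows "sq_integrable M f" "norm2 M f \<le> c"
proof -
  have "integrable M (\<lambda>x. (norm (f x))\<^sup>2)"
    by (rule integrableI_bounded) (use assms in \<open>auto simp: less_top[symmetric] top_unique intro: le_less_trans\<close>)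
  then show s: "sq_integrable M f" using assms(1) by (simp add: sq_integrable_def)
  have "(norm2 M f)\<^sup>2 \<le> c\<^sup>2"
    using assms(2) unfolding nn_integral_norm2[OF s] by simp
  then show "norm2 M f \<le> c" using assms(3) by (rule power2_le_imp_le)
qed

text \<open>The Riesz-Fischer theorem. Along a rapidly Cauchy subsequence the squared increments,
  even with growing weights, have an integrable sum, so the increments decay geometrically at almost
  every point; Fatou's lemma carries the norm bounds over to the pointwise limit.\<close>

lemma norm2_complete:
  fixes f :: "nat \<Rightarrow> 'a \<Rightarrow> 'b::euclidean_space"
  assumes f: "\<And>n. sq_integrable M (f n)"
    and Cauchy: "\<And>e. 0 < e \<Longrightarrow> \<exists>N. \<forall>m\<ge>N. \<forall>n\<ge>N. norm2 M (\<lambda>x. f m x - f n x) \<le> e"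
  obtains g where "sq_integrable M g" "(\<lambda>n. norm2 M (\<lambda>x. f n x - g x)) \<longlonglongrightarrow> 0"
proof -
  note [measurable] = sq_integrableD(1)[OF f]
  have "\<exists>N. \<forall>k. \<forall>m\<ge>N k. \<forall>n\<ge>N k. norm2 M (\<lambda>x. f m x - f n x) \<le> (1 / 4) ^ k"
    by (rule choice) (auto intro!: Cauchy)
  then obtain N where N: "\<And>k m n. m \<ge> N k \<Longrightarrow> n \<ge> N k \<Longrightarrow> norm2 M (\<lambda>x. f m x - f n x) \<le> (1 / 4) ^ k"
    by blast
  define r where "r k = (\<Sum>i\<le>k. N i)" for k
  have r: "N k \<le> r k" "N k \<le> r (Suc k)" for k
  proof -
    show "N k \<le> r k" unfolding r_def by (rule member_le_sum) auto
    show "N k \<le> r (Suc k)" unfolding r_def by (rule member_le_sum) auto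
  qed
  define d where "d k x = f (r (Suc k)) x - f (r k) x" for k x
  have d: "sq_integrable M (d k)" "norm2 M (d k) \<le> (1 / 4) ^ k" for k
    unfolding d_def using N[OF r(2) r(1)] by (auto intro: sq_integrable_diff f)
  have [measurable]: "d k \<in> borel_measurable M" for k using d(1) by (rule sq_integrableD)
  \<comment> \<open>The weight 4^k against the bound 16^(-k) still leaves a convergent geometric
    series, and it yields pointwise decay like 2^(-k).\<close>
  have "(\<integral>\<^sup>+ x. (\<Sum>k. ennreal (4 ^ k * (norm (d k x))\<^sup>2)) \<partial>M) =
      (\<Sum>k. (\<integral>\<^sup>+ x. ennreal (4 ^ k * (norm (d k x))\<^sup>2) \<partial>M))"
    by (rule nn_integral_suminf) simp
  also have "\<dots> \<le> (\<Sum>k. ennreal ((1 / 4) ^ k))"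
  proof (intro suminf_le allI)
    fix k
    have "(\<integral>\<^sup>+ x. ennreal (4 ^ k * (norm (d k x))\<^sup>2) \<partial>M) = ennreal (4 ^ k) * ennreal ((norm2 M (d k))\<^sup>2)"
      using nn_integral_norm2[OF d(1)[of k]] by (simp add: ennreal_mult nn_integral_cmult)
    also have "\<dots> = ennreal (4 ^ k * (norm2 M (d k))\<^sup>2)" by (simp add: ennreal_mult)
    also have "\<dots> \<le> ennreal (4 ^ k * ((1 / 4) ^ k)\<^sup>2)"
      using d(2)[of k] by (intro ennreal_leI mult_left_mono power_mono) (auto simp: norm2_nonneg)
    also have "4 ^ k * ((1 / 4) ^ k)\<^sup>2 = (1 / 4 :: real) ^ k"
      by (simp add: power2_eq_square power_divide field_simps)
    finally show "(\<integral>\<^sup>+ x. ennreal (4 ^ k * (norm (d k x))\<^sup>2) \<partial>M) \<le> ennreal ((1 / 4) ^ k)" .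
  qed auto
  also have "\<dots> = ennreal (\<Sum>k. (1 / 4) ^ k)"
    by (rule suminf_ennreal2) (auto intro: summable_geometric)
  finally have "(\<integral>\<^sup>+ x. (\<Sum>k. ennreal (4 ^ k * (norm (d k x))\<^sup>2)) \<partial>M) \<noteq> \<infinity>"
    by (auto simp: top_unique)
  then have ae: "AE x in M. (\<Sum>k. ennreal (4 ^ k * (norm (d k x))\<^sup>2)) \<noteq> \<infinity>"
    by (intro nn_integral_noteq_infinite) auto
  define g where "g x = lim (\<lambda>k. f (r k) x)" for x
  have gm [measurable]: "g \<in> borel_measurable M"
    unfolding g_def[abs_def] by (rule borel_measurable_lim_metric) simp
  have conv: "AE x in M. (\<lambda>k. f (r k) x) \<longlonglongrightarrow> g x"
    using ae
  proof eventually_elim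
    case (elim x)
    have s: "summable (\<lambda>k. 4 ^ k * (norm (d k x))\<^sup>2)"
      using elim by (intro summable_suminf_not_top) auto
    have "(\<lambda>k. 4 ^ k * (norm (d k x))\<^sup>2) \<longlonglongrightarrow> 0" by (rule summable_LIMSEQ_zero[OF s])
    then have "Bseq (\<lambda>k. 4 ^ k * (norm (d k x))\<^sup>2)" using convergentI convergent_imp_Bseq by blast
    then obtain C where C: "C > 0" "\<And>k. norm (4 ^ k * (norm (d k x))\<^sup>2) \<le> C"
      unfolding Bseq_def by blast
    have b: "norm (d k x) \<le> sqrt C * (1 / 2) ^ k" for k
    proof (rule power2_le_imp_le)
      have "(norm (d k x))\<^sup>2 \<le> C * (1 / 4) ^ k" using C(2)[of k] by (simp add: field_simps)
      also have "(1 / 4 :: real) ^ k = ((1 / 2) ^ k)\<^sup>2" by (simp add: power2_eq_square flip: power_mult_distrib)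
      finally show "(norm (d k x))\<^sup>2 \<le> (sqrt C * (1 / 2) ^ k)\<^sup>2"
        using C(1) by (simp add: power_mult_distrib)
    qed (use C in auto)
    have "summable (\<lambda>k. d k x)"
      by (rule summable_comparison_test'[of "\<lambda>k. sqrt C * (1 / 2) ^ k" 0]) (auto intro: b summable_mult summable_geometric)
    then have "convergent (\<lambda>n. f (r 0) x + (\<Sum>k<n. d k x))"
      by (intro convergentI[OF tendsto_add[OF tendsto_const summable_LIMSEQ]])
    moreover have "f (r 0) x + (\<Sum>k<n. d k x) = f (r n) x" for n
      unfolding d_def using sum_lessThan_telescope[of "\<lambda>k. f (r k) x" n] by simp
    ultimately show "(\<lambda>k. f (r k) x) \<longlonglongrightarrow> g x"
      unfolding g_def by (simp add: convergent_LIMSEQ_iff)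
  qed
  have close: "norm2 M (\<lambda>x. f n x - g x) \<le> (1 / 4) ^ k \<and> sq_integrable M (\<lambda>x. f n x - g x)" if n: "n \<ge> N k" for n k
  proof -
    \<comment> \<open>Fatou along the subsequence; n itself need not belong to it, so the whole
      sequence converges.\<close>
    have "(\<integral>\<^sup>+ x. ennreal ((norm (f n x - g x))\<^sup>2) \<partial>M) =
        (\<integral>\<^sup>+ x. liminf (\<lambda>j. ennreal ((norm (f n x - f (r j) x))\<^sup>2)) \<partial>M)"
    proof (rule nn_integral_cong_AE, use conv in eventually_elim)
      case (elim x)
      have "(\<lambda>j. ennreal ((norm (f n x - f (r j) x))\<^sup>2)) \<longlonglongrightarrow> ennreal ((norm (f n x - g x))\<^sup>2)"
        by (intro tendsto_intros elim tendsto_ennrealI)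
      then show ?case using lim_imp_Liminf[OF sequentially_bot] by metis
    qed
    also have "\<dots> \<le> liminf (\<lambda>j. \<integral>\<^sup>+ x. ennreal ((norm (f n x - f (r j) x))\<^sup>2) \<partial>M)"
      by (rule nn_integral_liminf) simp
    also have "\<dots> \<le> ennreal (((1 / 4) ^ k)\<^sup>2)"
    proof (rule Liminf_le)
      have "N k \<le> r j" if "k \<le> j" for j
        unfolding r_def by (rule member_le_sum) (use that in auto)
      then show "\<forall>\<^sub>F j in sequentially. (\<integral>\<^sup>+ x. ennreal ((norm (f n x - f (r j) x))\<^sup>2) \<partial>M) \<le> ennreal (((1 / 4) ^ k)\<^sup>2)"
        unfolding eventually_sequentially using N[OF n]
        by (intro exI[of _ k] allI impI, subst nn_integral_norm2)
          (auto intro!: sq_integrable_diff f ennreal_leI power_mono simp: norm2_nonneg)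
    qed simp
    finally show ?thesis using sq_integrable_nn[of "\<lambda>x. f n x - g x" M "(1 / 4) ^ k"] by simp
  qed
  have g: "sq_integrable M g"
    using sq_integrable_diff[OF f[of "N 0"] conjunct2[OF close[of 0 "N 0"]]] by simp
  have "(\<lambda>n. norm2 M (\<lambda>x. f n x - g x)) \<longlonglongrightarrow> 0"
  proof (rule LIMSEQ_I)
    fix e :: real assume "e > 0"
    then obtain k where k: "(1 / 4) ^ k < e" using real_arch_pow_inv[of e "1 / 4"] by auto
    show "\<exists>no. \<forall>n\<ge>no. norm (norm2 M (\<lambda>x. f n x - g x) - 0) < e"
      using close[of k] k by (intro exI[of _ "N k"]) (auto simp: norm2_nonneg intro: le_less_trans)
  qed
  then show ?thesis using that g by blast
qed

lemma tendsto_norm2_AE_subseq: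
  fixes f :: "nat \<Rightarrow> 'a \<Rightarrow> 'b::euclidean_space"
  assumes f: "\<And>n. integrable M (f n)" and lim: "(\<lambda>n. (LINT x|M. norm (f n x))) \<longlonglongrightarrow> 0"
  obtains r where "strict_mono r" "AE x in M. (\<lambda>n. f (r n) x) \<longlonglongrightarrow> 0"
  using tendsto_L1_AE_subseq[OF f lim] by blast

text \<open>X is a set with abstract operations and D is linear only almost everywhere, because the
  intended D is the chosen gradient on V. The functional |D v|^2 / 2 - L v is minimised: the
  gradients of a minimising sequence are Cauchy by the parallelogram law, and G is their limit. It
  may lie outside the range of D, so no completeness of X enters.\<close>

lemma Riesz_representation:
  fixes D :: "'v \<Rightarrow> 'a \<Rightarrow> 'b::euclidean_space" and L :: "'v \<Rightarrow> real"
  assumes ne: "X \<noteq> {}"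
    and add: "\<And>v w. v \<in> X \<Longrightarrow> w \<in> X \<Longrightarrow> pls v w \<in> X" and scl: "\<And>r v. v \<in> X \<Longrightarrow> scl r v \<in> X"
    and D: "\<And>v. v \<in> X \<Longrightarrow> sq_integrable M (D v)"
    and D_add: "\<And>v w. v \<in> X \<Longrightarrow> w \<in> X \<Longrightarrow> AE x in M. D (pls v w) x = D v x + D w x"
    and D_scale: "\<And>r v. v \<in> X \<Longrightarrow> AE x in M. D (scl r v) x = r *\<^sub>R D v x"
    and L_add: "\<And>v w. v \<in> X \<Longrightarrow> w \<in> X \<Longrightarrow> L (pls v w) = L v + L w"
    and L_scale: "\<And>r v. v \<in> X \<Longrightarrow> L (scl r v) = r * L v"
    and L_bound: "\<And>v. v \<in> X \<Longrightarrow> \<bar>L v\<bar> \<le> C * norm2 M (D v)"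
  obtains G where "sq_integrable M G" "\<And>v. v \<in> X \<Longrightarrow> L v = (LINT x|M. G x \<bullet> D v x)"
proof -
  define J where "J v = (norm2 M (D v))\<^sup>2 / 2 - L v" for v
  have J_line: "J (pls v (scl t w)) = J v + t * ((LINT x|M. D v x \<bullet> D w x) - L w) + t\<^sup>2 / 2 * (norm2 M (D w))\<^sup>2"
    if vw: "v \<in> X" "w \<in> X" for v w t
  proof -
    have "AE x in M. D (pls v (scl t w)) x = D v x + t *\<^sub>R D w x"
      using D_add[OF vw(1) scl[OF vw(2)], of t] D_scale[OF vw(2), of t] by eventually_elim simp
    then have "norm2 M (D (pls v (scl t w))) = norm2 M (\<lambda>x. D v x + t *\<^sub>R D w x)"
      by (intro norm2_cong_AE sq_integrableD(1) D add scl sq_integrable_add sq_integrable_scaleR vw)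
    then show ?thesis
      unfolding J_def using norm2_add_scaleR_power2[OF D[OF vw(1)] D[OF vw(2)], of t]
      by (simp add: L_add L_scale scl vw algebra_simps)
  qed
  have J_low: "- (C\<^sup>2 / 2) \<le> J v" if v: "v \<in> X" for v
  proof -
    have "L v \<le> C * norm2 M (D v)" using L_bound[OF v] by linarith
    also have "\<dots> \<le> (C\<^sup>2 + (norm2 M (D v))\<^sup>2) / 2"
      using sum_squares_bound[of C "norm2 M (D v)"] by simp
    finally show ?thesis unfolding J_def by simp
  qed
  define m where "m = Inf (J ` X)"
  have bdd: "bdd_below (J ` X)" using J_low by (auto intro!: bdd_belowI)
  have m: "m \<le> J v" if "v \<in> X" for v
    unfolding m_def using that bdd by (auto intro: cInf_lower)
  have "\<exists>v\<in>X. J v < m + inverse (Suc n)" for n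
    using cInf_lessD[of "J ` X" "m + inverse (Suc n)"] ne unfolding m_def by auto
  then obtain v where v: "\<And>n. v n \<in> X" "\<And>n. J (v n) < m + inverse (Suc n)" by metis
  have near: "(norm2 M (\<lambda>x. D (v i) x - D (v j) x))\<^sup>2 \<le> 4 * (inverse (Suc i) + inverse (Suc j))" for i j
  proof -
    define p where "p = (LINT x|M. D (v i) x \<bullet> D (v j) x)"
    define A where "A = (norm2 M (D (v i)))\<^sup>2"
    define B where "B = (norm2 M (D (v j)))\<^sup>2"
    \<comment> \<open>The midpoint of two near-minimisers; its value is at least m.\<close>
    define z where "z = scl (1 / 2) (pls (v i) (scl 1 (v j)))"
    have z: "z \<in> X" unfolding z_def by (intro scl add v)
    have "AE x in M. D z x = (1 / 2) *\<^sub>R (D (v i) x + 1 *\<^sub>R D (v j) x)"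
      unfolding z_def
      using D_scale[OF add[OF v(1)[of i] scl[OF v(1)[of j], of 1]], of "1 / 2"]
        D_add[OF v(1)[of i] scl[OF v(1)[of j], of 1]] D_scale[OF v(1)[of j], of 1]
      by eventually_elim simp
    then have "norm2 M (D z) = norm2 M (\<lambda>x. (1 / 2) *\<^sub>R (D (v i) x + 1 *\<^sub>R D (v j) x))"
      by (intro norm2_cong_AE sq_integrableD(1) D z sq_integrable_scaleR sq_integrable_add v)
    then have nz: "norm2 M (D z) = norm2 M (\<lambda>x. D (v i) x + 1 *\<^sub>R D (v j) x) / 2"
      unfolding norm2_scaleR by simp
    have Dz: "(norm2 M (D z))\<^sup>2 = (A + 2 * p + B) / 4"
      unfolding nz power_divide using norm2_add_scaleR_power2[OF D[OF v(1)[of i]] D[OF v(1)[of j]], of 1]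
      by (simp add: power_divide A_def B_def p_def)
    have Lz: "L z = (L (v i) + L (v j)) / 2"
      unfolding z_def by (simp add: L_scale L_add add scl v)
    have Jz: "J z = (A + 2 * p + B) / 8 - (L (v i) + L (v j)) / 2" unfolding J_def Dz Lz by simp
    have "(norm2 M (\<lambda>x. D (v i) x - D (v j) x))\<^sup>2 = A - 2 * p + B"
      using norm2_diff_power2[OF D[OF v(1)[of i]] D[OF v(1)[of j]]] by (simp add: A_def B_def p_def)
    \<comment> \<open>The parallelogram identity; the linear parts cancel because L z is the mean of
      the two values.\<close>
    also have "\<dots> = 4 * (J (v i) + J (v j) - 2 * J z)"
      unfolding Jz by (simp add: J_def A_def[symmetric] B_def[symmetric] field_simps)
    also have "\<dots> \<le> 4 * (inverse (Suc i) + inverse (Suc j))"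
    proof -
      have "J (v i) + J (v j) \<le> (m + inverse (Suc i)) + (m + inverse (Suc j))"
        by (intro add_mono less_imp_le v(2))
      then show ?thesis using m[OF z] by (simp add: algebra_simps)
    qed
    finally show ?thesis .
  qed
  obtain G where G: "sq_integrable M G" "(\<lambda>n. norm2 M (\<lambda>x. D (v n) x - G x)) \<longlonglongrightarrow> 0"
  proof (rule norm2_complete[of M "\<lambda>n. D (v n)"])
    fix e :: real assume e: "0 < e"
    obtain N where N: "inverse (Suc N) < e\<^sup>2 / 8" using reals_Archimedean[of "e\<^sup>2 / 8"] e by auto
    have "norm2 M (\<lambda>x. D (v i) x - D (v j) x) \<le> e" if ij: "i \<ge> N" "j \<ge> N" for i j
    proof (rule power2_le_imp_le)
      have "inverse (real (Suc k)) \<le> e\<^sup>2 / 8" if "N \<le> k" for k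
        by (rule order_trans[OF le_imp_inverse_le less_imp_le[OF N]]) (use that in auto)
      then have "4 * (inverse (real (Suc i)) + inverse (real (Suc j))) \<le> 4 * (e\<^sup>2 / 8 + e\<^sup>2 / 8)"
        using ij by (intro mult_left_mono add_mono) auto
      then show "(norm2 M (\<lambda>x. D (v i) x - D (v j) x))\<^sup>2 \<le> e\<^sup>2"
        using order_trans[OF near[of i j]] by simp
    qed (use e in simp)
    then show "\<exists>N. \<forall>i\<ge>N. \<forall>j\<ge>N. norm2 M (\<lambda>x. D (v i) x - D (v j) x) \<le> e" by blast
  qed (auto intro: D v)
  have "L w = (LINT x|M. G x \<bullet> D w x)" if w: "w \<in> X" for w
  proof -
    define \<beta> where "\<beta> n = (LINT x|M. D (v n) x \<bullet> D w x) - L w" for n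
    have "\<beta> \<longlonglongrightarrow> (LINT x|M. G x \<bullet> D w x) - L w"
      unfolding \<beta>_def[abs_def]
      by (intro tendsto_intros sq_integrable_const_tendsto D v w G)
    moreover have "\<beta> \<longlonglongrightarrow> 0"
    proof -
      \<comment> \<open>For every t the value at \<open>v n\<close> plus t times w is at least m,
        while that at \<open>v n\<close> exceeds m by less than 1 / (n + 1). The discriminant of
        this quadratic in t bounds the defect in the Euler equation.\<close>
      have bn: "(\<beta> n / 2)\<^sup>2 \<le> inverse (Suc n) * ((norm2 M (D w))\<^sup>2 / 2)" for n
      proof (rule quadratic_nonneg_imp)
        fix t
        have "m \<le> J (pls (v n) (scl t w))" by (intro m add scl v w)
        then show "0 \<le> inverse (Suc n) + 2 * (\<beta> n / 2) * t + (norm2 M (D w))\<^sup>2 / 2 * t\<^sup>2"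
          unfolding J_line[OF v(1) w] \<beta>_def[symmetric] using v(2)[of n] by (simp add: mult_ac)
      qed
      have bn2: "norm ((\<beta> n)\<^sup>2) \<le> inverse (Suc n) * (2 * (norm2 M (D w))\<^sup>2)" for n
        using bn[of n] by (simp add: power_divide field_simps)
      have lim: "(\<lambda>n. inverse (real (Suc n)) * (2 * (norm2 M (D w))\<^sup>2)) \<longlonglongrightarrow> 0"
        by (intro tendsto_mult_left_zero LIMSEQ_inverse_real_of_nat)
      have "(\<lambda>n. (\<beta> n)\<^sup>2) \<longlonglongrightarrow> 0"
        by (rule Lim_null_comparison[OF always_eventually lim]) (use bn2 in blast)
      then show ?thesis using tendsto_real_sqrt[of "\<lambda>n. (\<beta> n)\<^sup>2" 0] by (simp add: tendsto_rabs_zero_iff)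
    qed
    ultimately have "(LINT x|M. G x \<bullet> D w x) - L w = 0" by (rule LIMSEQ_unique)
    then show ?thesis by simp
  qed
  then show ?thesis using that G(1) by blast
qed

section \<open>Translations and time averages\<close>

lemma tendsto_norm2_dominated:
  fixes f :: "nat \<Rightarrow> 'a \<Rightarrow> 'b::euclidean_space"
  assumes f: "\<And>n. f n \<in> borel_measurable M" and g: "g \<in> borel_measurable M"
    and w: "integrable M w"
    and lim: "AE x in M. (\<lambda>n. f n x) \<longlonglongrightarrow> g x"
    and bound: "\<And>n. AE x in M. (norm (f n x - g x))\<^sup>2 \<le> w x"
  shows "(\<lambda>n. norm2 M (\<lambda>x. f n x - g x)) \<longlonglongrightarrow> 0"
proof -
  note [measurable] = f g
  have "(\<lambda>n. (LINT x|M. (norm (f n x - g x))\<^sup>2)) \<longlonglongrightarrow> (LINT x|M. 0 :: real)"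
  proof (rule integral_dominated_convergence[where w = w])
    show "AE x in M. (\<lambda>n. (norm (f n x - g x))\<^sup>2) \<longlonglongrightarrow> 0"
      using lim
    proof eventually_elim
      case (elim x)
      have "(\<lambda>n. (norm (f n x - g x))\<^sup>2) \<longlonglongrightarrow> (norm (g x - g x))\<^sup>2"
        by (intro tendsto_intros elim)
      then show ?case by simp
    qed
  qed (use w bound in auto)
  then have "(\<lambda>n. sqrt ((LINT x|M. (norm (f n x - g x))\<^sup>2))) \<longlonglongrightarrow> sqrt 0"
    by (intro tendsto_real_sqrt) simp
  then show ?thesis by (simp add: norm2_def)
qed

lemma tendsto_0_ex_less:
  fixes f :: "nat \<Rightarrow> real"
  assumes "f \<longlonglongrightarrow> 0" "0 < e"
  shows "\<exists>n. f n < e"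
  using order_tendstoD(2)[OF assms] by (auto simp: eventually_sequentially)

lemma integrable_indicator_bounded:
  fixes S :: "'a::euclidean_space set"
  assumes "S \<in> sets borel" "bounded S"
  shows "integrable lborel (\<lambda>x. indicator S x * (c::real))"
  using assms emeasure_bounded_finite[OF assms(2)]
  by (intro integrable_mult_left integrable_real_indicator) auto

lemma truncation_dense:
  fixes f :: "'a::euclidean_space \<Rightarrow> 'b::euclidean_space"
  assumes f: "sq_integrable lborel f"
  shows "(\<lambda>n. norm2 lborel (\<lambda>x. (if norm x \<le> real n \<and> norm (f x) \<le> real n then f x else 0) - f x)) \<longlonglongrightarrow> 0"
proof (rule tendsto_norm2_dominated)
  note [measurable] = sq_integrableD(1)[OF f]
  show "integrable lborel (\<lambda>x. (norm (f x))\<^sup>2)" by (rule sq_integrableD(2)[OF f])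
  show "(\<lambda>x. if norm x \<le> real n \<and> norm (f x) \<le> real n then f x else 0) \<in> borel_measurable lborel" for n
    by measurable
  show "AE x in lborel. (\<lambda>n. if norm x \<le> real n \<and> norm (f x) \<le> real n then f x else 0) \<longlonglongrightarrow> f x"
  proof (rule AE_I2)
    fix x
    obtain N :: nat where N: "max (norm x) (norm (f x)) \<le> real N" using real_arch_simple by blast
    show "(\<lambda>n. if norm x \<le> real n \<and> norm (f x) \<le> real n then f x else 0) \<longlonglongrightarrow> f x"
    proof (rule tendsto_eventually)
      have "norm x \<le> real n \<and> norm (f x) \<le> real n" if "n \<ge> N" for n
        using N that by (auto intro: order_trans[of _ "real N"])
      then show "\<forall>\<^sub>F n in sequentially. (if norm x \<le> real n \<and> norm (f x) \<le> real n then f x else 0) = f x"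
        unfolding eventually_sequentially by (intro exI[of _ N]) auto
    qed
  qed
qed (use sq_integrableD(1)[OF f] in auto)

text \<open>Measurability supplies continuous functions converging almost everywhere, but without
  bounds. The nearest-point projection onto the ball of radius R and a continuous cut-off bound them
  in value and support without changing the limit, and dominated convergence applies.\<close>

lemma continuous_dense_bounded:
  fixes f :: "'a::euclidean_space \<Rightarrow> 'b::euclidean_space"
  assumes f: "f \<in> borel_measurable borel" and R: "0 \<le> R"
    and b: "\<And>x. norm (f x) \<le> R" and z: "\<And>x. norm x > R \<Longrightarrow> f x = 0" and e: "0 < e"
  obtains g where "continuous_on UNIV g" "\<And>x. x \<notin> cball 0 (R + 1) \<Longrightarrow> g x = 0"
    "norm2 lborel (\<lambda>x. g x - f x) < e"
proof -
  have "f measurable_on UNIV"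
    using measurable_completion[of f lborel borel] f
    by (intro lebesgue_measurable_imp_measurable_on) simp_all
  then obtain N g where N: "negligible N" and g: "\<And>n. continuous_on UNIV (g n)"
    and lim: "\<And>x. x \<notin> N \<Longrightarrow> (\<lambda>n. g n x) \<longlonglongrightarrow> f x"
    unfolding measurable_on_def by auto
  have aeN: "AE x in lborel. x \<notin> N"
    using AE_not_in[of N lebesgue] N by (simp add: negligible_iff_null_sets AE_completion_iff)
  define p where "p = closest_point (cball (0::'b) R)"
  have p: "continuous_on UNIV p" "\<And>y. norm (p y) \<le> R" "\<And>y. norm y \<le> R \<Longrightarrow> p y = y"
  proof -
    show "continuous_on UNIV p"
      unfolding p_def using R by (intro continuous_on_closest_point) auto
    show "norm (p y) \<le> R" for y
      using closest_point_in_set[of "cball (0::'b) R" y] R by (simp add: p_def)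
    show "p y = y" if "norm y \<le> R" for y
      unfolding p_def using that by (intro closest_point_self) auto
  qed
  define \<eta> where "\<eta> x = max 0 (min 1 (R + 1 - norm x))" for x :: 'a
  have \<eta>: "continuous_on UNIV \<eta>" "\<And>x. 0 \<le> \<eta> x" "\<And>x. \<eta> x \<le> 1"
    "\<And>x. norm x \<le> R \<Longrightarrow> \<eta> x = 1" "\<And>x. norm x > R + 1 \<Longrightarrow> \<eta> x = 0"
    unfolding \<eta>_def[abs_def] by (auto intro!: continuous_intros)
  define h where "h n x = \<eta> x *\<^sub>R p (g n x)" for n x
  have hc: "continuous_on UNIV (h n)" for n
    unfolding h_def[abs_def]
    by (intro continuous_on_scaleR \<eta>(1) continuous_on_compose2[OF p(1) g]) auto
  have hb: "norm (h n x) \<le> R" for n x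
    unfolding h_def using \<eta>(2,3)[of x] p(2)[of "g n x"] mult_mono[of "\<eta> x" 1 "norm (p (g n x))" R] R by simp
  have hz: "h n x = 0" if "x \<notin> cball 0 (R + 1)" for n x
    using that \<eta>(5)[of x] by (simp add: h_def)
  have "(\<lambda>n. norm2 lborel (\<lambda>x. h n x - f x)) \<longlonglongrightarrow> 0"
  proof (rule tendsto_norm2_dominated)
    show "h n \<in> borel_measurable lborel" for n
      using borel_measurable_continuous_onI[OF hc[of n]] by simp
    show "f \<in> borel_measurable lborel" using f by simp
    show "integrable lborel (\<lambda>x::'a. indicator (cball 0 (R + 1)) x * (2 * R)\<^sup>2)"
      by (rule integrable_indicator_bounded) auto
    show "AE x in lborel. (\<lambda>n. h n x) \<longlonglongrightarrow> f x"
      using aeN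
    proof eventually_elim
      case (elim x)
      have "isCont p (f x)" using p(1) by (simp add: continuous_on_eq_continuous_at)
      then have "(\<lambda>n. p (g n x)) \<longlonglongrightarrow> p (f x)"
        using lim[OF elim] by (rule isCont_tendsto_compose)
      then have "(\<lambda>n. h n x) \<longlonglongrightarrow> \<eta> x *\<^sub>R p (f x)"
        unfolding h_def by (intro tendsto_intros)
      moreover have "\<eta> x *\<^sub>R p (f x) = f x"
        using p(3)[OF b[of x]] \<eta>(4)[of x] z[of x] by (cases "norm x \<le> R") auto
      ultimately show ?case by simp
    qed
    show "AE x in lborel. (norm (h n x - f x))\<^sup>2 \<le> indicator (cball 0 (R + 1)) x * (2 * R)\<^sup>2" for n
    proof (rule AE_I2)
      fix x
      have "norm (h n x - f x) \<le> 2 * R"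
        using norm_triangle_ineq4[of "h n x" "f x"] hb[of n x] b[of x] by linarith
      then have "(norm (h n x - f x))\<^sup>2 \<le> (2 * R)\<^sup>2" by (intro power_mono) auto
      then show "(norm (h n x - f x))\<^sup>2 \<le> indicator (cball 0 (R + 1)) x * (2 * R)\<^sup>2"
        using hz[of x n] z[of x] by (cases "x \<in> cball 0 (R + 1)") auto
    qed
  qed
  then obtain n where "norm2 lborel (\<lambda>x. h n x - f x) < e"
    using tendsto_0_ex_less e by blast
  then show ?thesis using that[of "h n"] hc hz by blast
qed

lemma continuous_dense_sq_integrable:
  fixes f :: "'a::euclidean_space \<Rightarrow> 'b::euclidean_space"
  assumes f: "sq_integrable lborel f" and e: "0 < e"
  obtains g R where "continuous_on UNIV g" "\<And>x. x \<notin> cball 0 R \<Longrightarrow> g x = 0"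
    "sq_integrable lborel g" "norm2 lborel (\<lambda>x. g x - f x) < e"
proof -
  note [measurable] = sq_integrableD(1)[OF f]
  define t where "t n x = (if norm x \<le> real n \<and> norm (f x) \<le> real n then f x else 0)" for n :: nat and x
  have "(\<lambda>n. norm2 lborel (\<lambda>x. t n x - f x)) \<longlonglongrightarrow> 0"
    unfolding t_def by (rule truncation_dense[OF f])
  then obtain n where n: "norm2 lborel (\<lambda>x. t n x - f x) < e / 2"
    using tendsto_0_ex_less[of _ "e / 2"] e by force
  have tm [measurable]: "t n \<in> borel_measurable borel" unfolding t_def[abs_def] by measurable
  have t: "sq_integrable lborel (t n)"
    by (rule sq_integrable_bound[OF f]) (auto simp: t_def)
  obtain g where g: "continuous_on UNIV g" "\<And>x. x \<notin> cball 0 (real n + 1) \<Longrightarrow> g x = 0"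
    "norm2 lborel (\<lambda>x. g x - t n x) < e / 2"
    by (rule continuous_dense_bounded[OF tm, of "real n" "e / 2"]) (use e in \<open>auto simp: t_def\<close>)
  have gs: "sq_integrable lborel g"
  proof -
    have "integrable lborel (\<lambda>x. (norm (g x))\<^sup>2)"
      by (rule integrable_compact_support[of _ "cball 0 (real n + 1)"])
        (use g in \<open>auto intro!: continuous_intros\<close>)
    then show ?thesis using borel_measurable_continuous_onI[OF g(1)] by (simp add: sq_integrable_def)
  qed
  have "norm2 lborel (\<lambda>x. g x - f x) < e"
    using norm2_triangle_via[OF gs t f] n g(3) by linarith
  then show ?thesis using that g(1,2) gs by blast
qed

lemma norm2_translation:
  fixes f :: "'a::euclidean_space \<Rightarrow> 'b::euclidean_space"
  assumes "sq_integrable lborel f"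
  shows "sq_integrable lborel (\<lambda>x. f (x + h))" "norm2 lborel (\<lambda>x. f (x + h)) = norm2 lborel f"
proof -
  have [measurable]: "f \<in> borel_measurable borel" using sq_integrableD(1)[OF assms] by simp
  have "(\<lambda>x. (norm (f x))\<^sup>2) \<in> borel_measurable borel" by measurable
  note t = integral_lborel_translation[OF this, of h]
  show "sq_integrable lborel (\<lambda>x. f (x + h))"
    using sq_integrableD(2)[OF assms] t(2) by (simp add: sq_integrable_def)
  show "norm2 lborel (\<lambda>x. f (x + h)) = norm2 lborel f"
    unfolding norm2_def using t(1) by simp
qed

lemma translation_continuous_aux:
  fixes g :: "'a::euclidean_space \<Rightarrow> 'b::euclidean_space"
  assumes g: "continuous_on UNIV g" "\<And>x. x \<notin> cball 0 R \<Longrightarrow> g x = 0" and h: "h \<longlonglongrightarrow> 0" "\<And>n. norm (h n) \<le> 1"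
  shows "(\<lambda>n. norm2 lborel (\<lambda>x. g (x + h n) - g x)) \<longlonglongrightarrow> 0"
proof -
  have [measurable]: "g \<in> borel_measurable borel" using g(1) by (rule borel_measurable_continuous_onI)
  obtain B where B: "\<And>x. norm (g x) \<le> B"
    using bounded_compact_support[OF g(1) compact_cball g(2)] by metis
  show ?thesis
  proof (rule tendsto_norm2_dominated)
    show "integrable lborel (\<lambda>x::'a. indicator (cball 0 (R + 1)) x * (2 * B)\<^sup>2)"
      by (rule integrable_indicator_bounded) auto
    show "AE x in lborel. (\<lambda>n. g (x + h n)) \<longlonglongrightarrow> g x"
    proof (rule AE_I2)
      fix x
      have "(\<lambda>n. x + h n) \<longlonglongrightarrow> x + 0" by (intro tendsto_intros h)
      moreover have "isCont g (x + 0)" using g(1) by (simp add: continuous_on_eq_continuous_at)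
      ultimately have "(\<lambda>n. g (x + h n)) \<longlonglongrightarrow> g (x + 0)"
        by (intro isCont_tendsto_compose[where g = g])
      then show "(\<lambda>n. g (x + h n)) \<longlonglongrightarrow> g x" by simp
    qed
    show "AE x in lborel. (norm (g (x + h n) - g x))\<^sup>2 \<le> indicator (cball 0 (R + 1)) x * (2 * B)\<^sup>2" for n
    proof (rule AE_I2)
      fix x
      show "(norm (g (x + h n) - g x))\<^sup>2 \<le> indicator (cball 0 (R + 1)) x * (2 * B)\<^sup>2"
      proof (cases "x \<in> cball 0 (R + 1)")
        case True
        have "norm (g (x + h n) - g x) \<le> 2 * B"
          using norm_triangle_ineq4[of "g (x + h n)" "g x"] B[of x] B[of "x + h n"] by linarith
        then show ?thesis using True power_mono[of "norm (g (x + h n) - g x)" "2 * B" 2] by simp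
      next
        case False
        then have "norm x > R + 1" by simp
        then have "norm (x + h n) > R" "norm x > R"
          using norm_triangle_ineq2[of x "- h n"] h(2)[of n] by auto
        then show ?thesis using g(2)[of x] g(2)[of "x + h n"] by simp
      qed
    qed
  qed auto
qed

text \<open>The three-epsilon argument: translations are isometries, so it suffices to treat a
  continuous, compactly supported approximation, for which dominated convergence works.\<close>

lemma translation_continuous:
  fixes f :: "'a::euclidean_space \<Rightarrow> 'b::euclidean_space"
  assumes f: "sq_integrable lborel f" and e: "0 < e"
  obtains d where "0 < d" "\<And>h. norm h < d \<Longrightarrow> norm2 lborel (\<lambda>x. f (x + h) - f x) < e"
proof -
  obtain g R where g: "continuous_on UNIV g" "\<And>x. x \<notin> cball 0 R \<Longrightarrow> g x = 0"
    "sq_integrable lborel g" "norm2 lborel (\<lambda>x. g x - f x) < e / 3"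
    using continuous_dense_sq_integrable[OF f, of "e / 3"] e by auto
  have "\<exists>d>0. \<forall>h. norm h < d \<longrightarrow> norm2 lborel (\<lambda>x. g (x + h) - g x) < e / 3"
  \<comment> \<open>The dominated convergence theorem speaks of sequences, so a failure of the
    uniform statement is turned into a sequence of shifts tending to 0.\<close>
  proof (rule ccontr)
    assume "\<not> ?thesis"
    then have "\<exists>h. norm h < inverse (Suc n) \<and> \<not> norm2 lborel (\<lambda>x. g (x + h) - g x) < e / 3" for n
      by (metis inverse_positive_iff_positive of_nat_0_less_iff zero_less_Suc)
    then obtain h where h: "\<And>n. norm (h n) < inverse (Suc n)"
      "\<And>n. \<not> norm2 lborel (\<lambda>x. g (x + h n) - g x) < e / 3" by metis
    have "h \<longlonglongrightarrow> 0"
      by (rule Lim_null_comparison[OF always_eventually LIMSEQ_inverse_real_of_nat])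
        (use h(1) in \<open>auto intro: less_imp_le\<close>)
    moreover have "norm (h n) \<le> 1" for n
      using h(1)[of n] inverse_le_1_iff[of "real (Suc n)"] by (simp del: of_nat_Suc)
    ultimately have "(\<lambda>n. norm2 lborel (\<lambda>x. g (x + h n) - g x)) \<longlonglongrightarrow> 0"
      by (intro translation_continuous_aux[OF g(1,2)])
    then have "\<exists>n. norm2 lborel (\<lambda>x. g (x + h n) - g x) < e / 3"
      using e by (intro tendsto_0_ex_less) auto
    then show False using h(2) by blast
  qed
  then obtain d where d: "d > 0" "\<And>h. norm h < d \<Longrightarrow> norm2 lborel (\<lambda>x. g (x + h) - g x) < e / 3" by blast
  have "norm2 lborel (\<lambda>x. f (x + h) - f x) < e" if "norm h < d" for h
  proof -
    note gh = norm2_translation(1)[OF g(3), of h] and fh = norm2_translation(1)[OF f, of h]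
    have "norm2 lborel (\<lambda>x. f (x + h) - g (x + h)) = norm2 lborel (\<lambda>x. f x - g x)"
      using norm2_translation(2)[OF sq_integrable_diff[OF f g(3)], of h] by simp
    then have "norm2 lborel (\<lambda>x. f (x + h) - g (x + h)) < e / 3"
      using g(4) by (simp add: norm2_minus_commute[of lborel f g])
    then show ?thesis
      using norm2_triangle_via[OF fh gh f] norm2_triangle_via[OF gh g(3) f] d(2)[OF that] g(4) by linarith
  qed
  then show ?thesis using that d(1) by blast
qed

section \<open>Slices in time and Steklov averages\<close>

lemma slice_integrable:
  fixes F :: "'t::euclidean_space \<times> 'x::euclidean_space \<Rightarrow> 'b::{banach, second_countable_topology}"
  assumes "integrable lborel F"
  shows "AE t in lborel. integrable lborel (\<lambda>x. F (t, x))"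
    and "integrable lborel (\<lambda>t. (LBINT x. F (t, x)))"
    and "(LBINT t. (LBINT x. F (t, x))) = integral\<^sup>L lborel F"
proof -
  have F: "integrable (lborel \<Otimes>\<^sub>M lborel) F" using assms by (simp add: lborel_prod)
  show "AE t in lborel. integrable lborel (\<lambda>x. F (t, x))"
    by (rule lborel_pair.AE_integrable_fst'[OF F])
  show "integrable lborel (\<lambda>t. (LBINT x. F (t, x)))"
    by (rule lborel_pair.integrable_fst'[OF F])
  show "(LBINT t. (LBINT x. F (t, x))) = integral\<^sup>L lborel F"
    using lborel_pair.integral_fst'[OF F] by (simp add: lborel_prod)
qed

lemma nn_integral_slice:
  fixes F :: "'t::euclidean_space \<times> 'x::euclidean_space \<Rightarrow> ennreal"
  assumes "F \<in> borel_measurable borel"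
  shows "(\<integral>\<^sup>+ t. (\<integral>\<^sup>+ x. F (t, x) \<partial>lborel) \<partial>lborel) = (\<integral>\<^sup>+ z. F z \<partial>lborel)"
    and "(\<integral>\<^sup>+ x. (\<integral>\<^sup>+ t. F (t, x) \<partial>lborel) \<partial>lborel) = (\<integral>\<^sup>+ z. F z \<partial>lborel)"
proof -
  have F: "F \<in> borel_measurable (lborel \<Otimes>\<^sub>M lborel)" using assms by (simp add: lborel_prod)
  show "(\<integral>\<^sup>+ t. (\<integral>\<^sup>+ x. F (t, x) \<partial>lborel) \<partial>lborel) = (\<integral>\<^sup>+ z. F z \<partial>lborel)"
    using lborel.nn_integral_fst[OF F] by (simp add: lborel_prod)
  show "(\<integral>\<^sup>+ x. (\<integral>\<^sup>+ t. F (t, x) \<partial>lborel) \<partial>lborel) = (\<integral>\<^sup>+ z. F z \<partial>lborel)"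
    using lborel_pair.nn_integral_snd[OF F] by (simp add: lborel_prod)
qed

lemma slice_sq_integrable:
  fixes f :: "'t::euclidean_space \<times> 'x::euclidean_space \<Rightarrow> 'b::euclidean_space"
  assumes f: "sq_integrable lborel f"
  shows "AE t in lborel. sq_integrable lborel (\<lambda>x. f (t, x))"
    and "integrable lborel (\<lambda>t. (norm2 lborel (\<lambda>x. f (t, x)))\<^sup>2)"
    and "(LBINT t. (norm2 lborel (\<lambda>x. f (t, x)))\<^sup>2) = (norm2 lborel f)\<^sup>2"
proof -
  have [measurable]: "f \<in> borel_measurable borel" using sq_integrableD(1)[OF f] by simp
  note s = slice_integrable[OF sq_integrableD(2)[OF f]]
  show "AE t in lborel. sq_integrable lborel (\<lambda>x. f (t, x))"
    using s(1) by eventually_elim (simp add: sq_integrable_def)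
  show "integrable lborel (\<lambda>t. (norm2 lborel (\<lambda>x. f (t, x)))\<^sup>2)"
    "(LBINT t. (norm2 lborel (\<lambda>x. f (t, x)))\<^sup>2) = (norm2 lborel f)\<^sup>2"
    using s(2,3) by (simp_all add: norm2_power2)
qed

text \<open>The Steklov average. It looks forward in time only, matching increments from t to t + h
  divided by h.\<close>

definition time_average :: "real \<Rightarrow> (real \<times> 'x::euclidean_space \<Rightarrow> 'b::euclidean_space) \<Rightarrow> real \<times> 'x \<Rightarrow> 'b" where
  "time_average h f z = (1 / h) *\<^sub>R (LBINT r. indicator {0..h} r *\<^sub>R f (fst z + r, snd z))"

text \<open>Cauchy-Schwarz against the indicator of the interval. In extended nonnegative reals it
  needs no integrability: if the square is not integrable, the right-hand side is infinite. It can
  thus be integrated over further variables before slices are known to be integrable.\<close>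

lemma integral_Icc_norm_power2_le:
  fixes g :: "real \<Rightarrow> 'b::euclidean_space"
  assumes [measurable]: "g \<in> borel_measurable borel" and h: "0 < h"
  shows "ennreal ((norm ((LBINT r. indicator {0..h} r *\<^sub>R g r)))\<^sup>2) \<le>
    ennreal h * (\<integral>\<^sup>+ r. indicator {0..h} r * ennreal ((norm (g r))\<^sup>2) \<partial>lborel)"
proof -
  define G where "G r = indicator {0..h} r *\<^sub>R g r" for r
  have [measurable]: "G \<in> borel_measurable borel" unfolding G_def[abs_def] by measurable
  have e: "(\<integral>\<^sup>+ r. indicator {0..h} r * ennreal ((norm (g r))\<^sup>2) \<partial>lborel) = (\<integral>\<^sup>+ r. ennreal ((norm (G r))\<^sup>2) \<partial>lborel)"
    unfolding G_def by (intro nn_integral_cong) (auto simp: indicator_def)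
  show ?thesis
  proof (cases "sq_integrable lborel G")
    case True
    define \<iota> where "\<iota> r = indicat_real {0..h} r" for r
    have sq: "(norm (\<iota> r))\<^sup>2 = indicator {0..h} r * 1" for r by (auto simp: \<iota>_def indicator_def)
    have "integrable lborel (\<lambda>r. (norm (\<iota> r))\<^sup>2)"
      unfolding sq by (rule integrable_indicator_bounded) auto
    then have \<iota>: "sq_integrable lborel \<iota>" by (simp add: sq_integrable_def \<iota>_def[abs_def])
    have n\<iota>: "(norm2 lborel \<iota>)\<^sup>2 = h" unfolding norm2_power2 sq using h by simp
    have nG: "sq_integrable lborel (\<lambda>r. norm (G r))" using True by (simp add: sq_integrable_def)
    have "norm (integral\<^sup>L lborel G) \<le> (LBINT r. norm (G r))"
      by (rule integral_norm_bound)
    also have "\<dots> = (LBINT r. \<iota> r * norm (G r))"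
      by (intro Bochner_Integration.integral_cong refl) (auto simp: G_def \<iota>_def indicator_def)
    also have "\<dots> \<le> norm2 lborel \<iota> * norm2 lborel (\<lambda>r. norm (G r))"
      using Cauchy_Schwarz_norm2_real[OF \<iota> nG] by linarith
    also have "norm2 lborel (\<lambda>r. norm (G r)) = norm2 lborel G" by (simp add: norm2_def)
    finally have "(norm (integral\<^sup>L lborel G))\<^sup>2 \<le> (norm2 lborel \<iota> * norm2 lborel G)\<^sup>2"
      by (intro power_mono) auto
    also have "\<dots> = h * (norm2 lborel G)\<^sup>2" by (simp add: power_mult_distrib n\<iota>)
    finally have "(norm (integral\<^sup>L lborel G))\<^sup>2 \<le> h * (norm2 lborel G)\<^sup>2" .
    then show ?thesis
      unfolding e nn_integral_norm2[OF True] using h unfolding G_def[abs_def]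
      by (simp add: ennreal_mult[symmetric] ennreal_leI)
  next
    case False
    then have "\<not> integrable lborel (\<lambda>r. (norm (G r))\<^sup>2)" by (simp add: sq_integrable_def)
    then have "(\<integral>\<^sup>+ r. ennreal ((norm (G r))\<^sup>2) \<partial>lborel) = \<infinity>"
      by (subst (asm) integrable_iff_bounded) (auto simp: less_top[symmetric])
    then show ?thesis unfolding e using h by (simp add: ennreal_mult_top)
  qed
qed

text \<open>The exceptional null set of points x does not depend on the interval: square
  integrability in time, which fails only on one null set, gives integrability on every bounded
  interval.\<close>

lemma slice_snd_Icc_integrable:
  fixes f :: "real \<times> 'x::euclidean_space \<Rightarrow> 'b::euclidean_space"
  assumes f: "sq_integrable lborel f"
  shows "AE x in lborel. \<forall>a b. integrable lborel (\<lambda>r. indicator {a..b} r *\<^sub>R f (r, x))"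
proof -
  have [measurable]: "f \<in> borel_measurable borel" using sq_integrableD(1)[OF f] by simp
  have "(\<integral>\<^sup>+ x. (\<integral>\<^sup>+ t. ennreal ((norm (f (t, x)))\<^sup>2) \<partial>lborel) \<partial>lborel) = ennreal ((norm2 lborel f)\<^sup>2)"
    by (subst nn_integral_slice(2)) (auto simp: nn_integral_norm2[OF f])
  then have "AE x in lborel. (\<integral>\<^sup>+ t. ennreal ((norm (f (t, x)))\<^sup>2) \<partial>lborel) \<noteq> \<infinity>"
    by (intro nn_integral_noteq_infinite) auto
  then show ?thesis
  proof eventually_elim
    case (elim x)
    have i: "integrable lborel (\<lambda>t. (norm (f (t, x)))\<^sup>2)"
      using elim by (intro integrableI_bounded) (auto simp: less_top)
    show ?case
    proof (intro allI)
      fix a b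
      have j: "integrable lborel (\<lambda>t. indicator {a..b} t * 1 + (norm (f (t, x)))\<^sup>2)"
        by (intro Bochner_Integration.integrable_add i integrable_indicator_bounded) auto
      have k: "norm y \<le> 1 + (norm y)\<^sup>2" for y :: 'b
      proof -
        have "norm y + norm y \<le> 1 + (norm y)\<^sup>2" using sum_squares_bound[of 1 "norm y"] by simp
        then show ?thesis using norm_ge_zero[of y] by linarith
      qed
      show "integrable lborel (\<lambda>r. indicator {a..b} r *\<^sub>R f (r, x))"
        by (rule Bochner_Integration.integrable_bound[OF j])
          (use k in \<open>auto simp: indicator_def abs_of_nonneg\<close>)
    qed
  qed
qed

lemma time_average_measurable [measurable]:
  fixes f :: "real \<times> 'x::euclidean_space \<Rightarrow> 'b::euclidean_space"
  assumes [measurable]: "f \<in> borel_measurable borel"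
  shows "time_average h f \<in> borel_measurable borel"
proof -
  have [measurable]: "f \<in> borel_measurable (borel \<Otimes>\<^sub>M borel)" using assms by (simp add: borel_prod)
  have "(\<lambda>z. (1 / h) *\<^sub>R (LBINT r. indicator {0..h} r *\<^sub>R f (fst z + r, snd z))) \<in>
      borel_measurable (borel \<Otimes>\<^sub>M borel)"
    by measurable
  then show ?thesis unfolding time_average_def[abs_def] by (simp add: borel_prod)
qed

text \<open>The difference of average and function is the mean of translation differences.
  Cauchy-Schwarz in the shift r and an exchange of integrals bound its norm by the largest
  translation difference.\<close>

lemma norm2_time_average_diff:
  fixes f :: "real \<times> 'x::euclidean_space \<Rightarrow> 'b::euclidean_space"
  assumes f: "sq_integrable lborel f" and h: "0 < h" and e: "0 \<le> e"
    and close: "\<And>r. 0 \<le> r \<Longrightarrow> r \<le> h \<Longrightarrow> norm2 lborel (\<lambda>z. f (z + (r, 0)) - f z) \<le> e"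
  shows "sq_integrable lborel (time_average h f)" "norm2 lborel (\<lambda>z. time_average h f z - f z) \<le> e"
proof -
  have fm [measurable]: "f \<in> borel_measurable borel" using sq_integrableD(1)[OF f] by simp
  then have [measurable]: "f \<in> borel_measurable (borel \<Otimes>\<^sub>M borel)" by (simp add: borel_prod)
  \<comment> \<open>Integrability in time is known for almost every x; a property of x alone holds
    for almost every (t, x).\<close>
  have "AE z in (lborel :: real measure) \<Otimes>\<^sub>M lborel. \<forall>a b. integrable lborel (\<lambda>r. indicator {a..b} r *\<^sub>R f (r, snd z))"
  proof -
    obtain N where N: "N \<in> null_sets lborel"
      "{x. \<not> (\<forall>a b. integrable lborel (\<lambda>r. indicator {a..b} r *\<^sub>R f (r, x)))} \<subseteq> N"
      using slice_snd_Icc_integrable[OF f] unfolding eventually_ae_filter by auto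
    have [measurable]: "N \<in> sets borel" using N by auto
    have "AE x in lborel. x \<notin> N" using N AE_not_in by blast
    then have "AE t in (lborel :: real measure). AE x in lborel. snd (t, x) \<notin> N" by simp
    moreover have "{z \<in> space ((lborel :: real measure) \<Otimes>\<^sub>M lborel). snd z \<notin> N} \<in> sets ((lborel :: real measure) \<Otimes>\<^sub>M lborel)"
      by measurable
    ultimately have "AE z in (lborel :: real measure) \<Otimes>\<^sub>M lborel. snd z \<notin> N"
      by (intro lborel_pair.AE_pair_measure)
    then show ?thesis by eventually_elim (use N in blast)
  qed
  then have ae: "AE z in (lborel :: (real \<times> 'x) measure). \<forall>a b. integrable lborel (\<lambda>r. indicator {a..b} r *\<^sub>R f (r, snd z))"
    unfolding lborel_prod .
  have pt: "AE z in lborel. ennreal ((norm (time_average h f z - f z))\<^sup>2) \<le>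
      ennreal (1 / h) * (\<integral>\<^sup>+ r. indicator {0..h} r * ennreal ((norm (f (fst z + r, snd z) - f z))\<^sup>2) \<partial>lborel)"
    using ae
  proof eventually_elim
    case (elim z)
    have "integrable lborel (\<lambda>r. indicator {fst z..fst z + h} (r + fst z) *\<^sub>R f (r + fst z, snd z))"
      using elim integral_lborel_translation(2)[of "\<lambda>r. indicator {fst z..fst z + h} r *\<^sub>R f (r, snd z)" "fst z"]
      by simp
    moreover have "indicator {fst z..fst z + h} (r + fst z) = (indicator {0..h} r :: real)" for r
      by (auto simp: indicator_def)
    ultimately have i: "integrable lborel (\<lambda>r. indicator {0..h} r *\<^sub>R f (fst z + r, snd z))"
      by (simp add: add.commute)
    have i2: "integrable lborel (\<lambda>r. indicator {0..h} r *\<^sub>R f z)"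
      using h by (intro integrable_scaleR_left integrable_real_indicator) auto
    have c: "(LBINT r. indicator {0..h} r *\<^sub>R f z) = h *\<^sub>R f z" using h by simp
    have "time_average h f z - f z = (1 / h) *\<^sub>R ((LBINT r. indicator {0..h} r *\<^sub>R f (fst z + r, snd z)) - h *\<^sub>R f z)"
      unfolding time_average_def using h by (simp add: scaleR_diff_right)
    also have "\<dots> = (1 / h) *\<^sub>R (LBINT r. indicator {0..h} r *\<^sub>R (f (fst z + r, snd z) - f z))"
      unfolding c[symmetric] scaleR_diff_right Bochner_Integration.integral_diff[OF i i2] by simp
    finally have "(norm (time_average h f z - f z))\<^sup>2 =
        (1 / h)\<^sup>2 * (norm ((LBINT r. indicator {0..h} r *\<^sub>R (f (fst z + r, snd z) - f z))))\<^sup>2"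
      by (simp add: power_divide)
    then have "ennreal ((norm (time_average h f z - f z))\<^sup>2) =
        ennreal ((1 / h)\<^sup>2) * ennreal ((norm ((LBINT r. indicator {0..h} r *\<^sub>R (f (fst z + r, snd z) - f z))))\<^sup>2)"
      by (simp add: ennreal_mult)
    also have "\<dots> \<le> ennreal ((1 / h)\<^sup>2) * (ennreal h * (\<integral>\<^sup>+ r. indicator {0..h} r * ennreal ((norm (f (fst z + r, snd z) - f z))\<^sup>2) \<partial>lborel))"
      using h by (intro mult_left_mono integral_Icc_norm_power2_le) auto
    also have "\<dots> = ennreal ((1 / h)\<^sup>2 * h) * (\<integral>\<^sup>+ r. indicator {0..h} r * ennreal ((norm (f (fst z + r, snd z) - f z))\<^sup>2) \<partial>lborel)"
      using h by (subst ennreal_mult) (auto simp: mult.assoc)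
    also have "(1 / h)\<^sup>2 * h = 1 / h" using h by (simp add: power2_eq_square)
    finally show ?case .
  qed
  have [measurable]: "(\<lambda>z. f (snd z + (fst z, 0)) - f (snd z)) \<in> borel_measurable (lborel \<Otimes>\<^sub>M lborel)"
    by measurable
  have "(\<integral>\<^sup>+ z. ennreal ((norm (time_average h f z - f z))\<^sup>2) \<partial>lborel) \<le>
      (\<integral>\<^sup>+ z. ennreal (1 / h) * (\<integral>\<^sup>+ r. indicator {0..h} r * ennreal ((norm (f (z + (r, 0)) - f z))\<^sup>2) \<partial>lborel) \<partial>lborel)"
    using pt by (intro nn_integral_mono_AE, eventually_elim) (simp add: plus_prod_def)
  also have "\<dots> = ennreal (1 / h) * (\<integral>\<^sup>+ z. (\<integral>\<^sup>+ r. indicator {0..h} r * ennreal ((norm (f (z + (r, 0)) - f z))\<^sup>2) \<partial>lborel) \<partial>lborel)"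
    by (rule nn_integral_cmult) measurable
  also have "(\<integral>\<^sup>+ z. (\<integral>\<^sup>+ r. indicator {0..h} r * ennreal ((norm (f (z + (r, 0)) - f z))\<^sup>2) \<partial>lborel) \<partial>lborel) =
      (\<integral>\<^sup>+ r. (\<integral>\<^sup>+ z. indicator {0..h} r * ennreal ((norm (f (z + (r, 0)) - f z))\<^sup>2) \<partial>lborel) \<partial>lborel)"
    by (rule lborel_pair.Fubini'[symmetric]) measurable
  also have "\<dots> \<le> (\<integral>\<^sup>+ r. indicator {0..h} r * ennreal (e\<^sup>2) \<partial>lborel)"
  proof (rule nn_integral_mono)
    fix r :: real
    have "(\<integral>\<^sup>+ z. ennreal ((norm (f (z + (r, 0)) - f z))\<^sup>2) \<partial>lborel) \<le> ennreal (e\<^sup>2)" if "r \<in> {0..h}"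
      using that close[of r] by (subst nn_integral_norm2)
        (auto intro!: sq_integrable_diff f norm2_translation(1) ennreal_leI power_mono norm2_nonneg)
    then show "(\<integral>\<^sup>+ z. indicator {0..h} r * ennreal ((norm (f (z + (r, 0)) - f z))\<^sup>2) \<partial>lborel) \<le> indicator {0..h} r * ennreal (e\<^sup>2)"
      by (auto simp: indicator_def)
  qed
  also have "\<dots> = ennreal (e\<^sup>2) * ennreal h"
    using h by (simp add: nn_integral_multc mult.commute)
  also have "ennreal (1 / h) * (ennreal (e\<^sup>2) * ennreal h) = ennreal (e\<^sup>2)"
    using h by (simp add: ennreal_mult[symmetric])
  finally have "(\<integral>\<^sup>+ z. ennreal ((norm (time_average h f z - f z))\<^sup>2) \<partial>lborel) \<le> ennreal (e\<^sup>2)"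
    by (simp add: mult_left_mono)
  then have s: "sq_integrable lborel (\<lambda>z. time_average h f z - f z)"
    and n: "norm2 lborel (\<lambda>z. time_average h f z - f z) \<le> e"
    using sq_integrable_nn[of "\<lambda>z. time_average h f z - f z" lborel e] e by auto
  show "norm2 lborel (\<lambda>z. time_average h f z - f z) \<le> e" by (rule n)
  show "sq_integrable lborel (time_average h f)" using sq_integrable_add[OF s f] by simp
qed

lemma AE_lborel_translate:
  fixes a :: "'a::euclidean_space"
  assumes "AE x in lborel. P x"
  shows "AE x in lborel. P (a + x)"
proof -
  obtain N where N: "N \<in> null_sets lborel" "{x \<in> space lborel. \<not> P x} \<subseteq> N"
    using assms unfolding eventually_ae_filter by auto
  then have [measurable]: "N \<in> sets borel" by auto
  have "AE x in distr lborel borel ((+) a). x \<notin> N"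
    unfolding lborel_distr_plus using AE_not_in[OF N(1)] .
  then have "AE x in lborel. a + x \<notin> N"
    by (subst (asm) AE_distr_iff) auto
  then show ?thesis by eventually_elim (use N(2) in auto)
qed

lemma tensor_integrable:
  fixes f :: "'t::euclidean_space \<Rightarrow> real" and g :: "'x::euclidean_space \<Rightarrow> real"
  assumes f: "integrable lborel f" and g: "integrable lborel g"
  shows "integrable lborel (\<lambda>z. f (fst z) * g (snd z))"
proof -
  have [measurable]: "f \<in> borel_measurable borel" "g \<in> borel_measurable borel" using f g by auto
  have "integrable (lborel \<Otimes>\<^sub>M lborel) (\<lambda>z. f (fst z) * g (snd z))"
  proof (rule lborel_pair.Fubini_integrable)
    show "integrable lborel (\<lambda>x. LINT y|lborel. norm (f (fst (x, y)) * g (snd (x, y))))"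
      using f by (simp add: abs_mult)
    show "AE x in lborel. integrable lborel (\<lambda>y. f (fst (x, y)) * g (snd (x, y)))"
      using g by simp
  qed measurable
  then show ?thesis unfolding lborel_prod .
qed

lemma tensor_sq_integrable:
  fixes f :: "'t::euclidean_space \<Rightarrow> real" and g :: "'x::euclidean_space \<Rightarrow> 'b::euclidean_space"
  assumes f: "sq_integrable lborel f" and g: "sq_integrable lborel g"
  shows "sq_integrable lborel (\<lambda>z. f (fst z) *\<^sub>R g (snd z))"
proof -
  have [measurable]: "f \<in> borel_measurable borel" "g \<in> borel_measurable borel"
    using sq_integrableD(1)[OF f] sq_integrableD(1)[OF g] by auto
  have "(\<lambda>z. f (fst z) *\<^sub>R g (snd z)) \<in> borel_measurable (lborel \<Otimes>\<^sub>M lborel)" by measurable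
  then have "(\<lambda>z. f (fst z) *\<^sub>R g (snd z)) \<in> borel_measurable lborel" unfolding lborel_prod .
  then show ?thesis
    using tensor_integrable[OF sq_integrableD(2)[OF f] sq_integrableD(2)[OF g]]
    by (simp add: sq_integrable_def power_mult_distrib)
qed

lemma indicator_sq_integrable:
  fixes S :: "'a::euclidean_space set"
  assumes "S \<in> sets borel" "bounded S"
  shows "sq_integrable lborel (\<lambda>x. indicat_real S x)"
proof -
  have "(norm (indicat_real S x))\<^sup>2 = indicator S x * 1" for x by (simp add: indicator_def)
  then show ?thesis
    using integrable_indicator_bounded[OF assms, of 1] assms by (simp add: sq_integrable_def)
qed

section \<open>Slices of square integrable functions\<close>

definition time_integral :: "real \<Rightarrow> real \<Rightarrow> (real \<times> 'x::euclidean_space \<Rightarrow> 'b::euclidean_space) \<Rightarrow> 'x \<Rightarrow> 'b" where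
  "time_integral a b f x = (LBINT r. indicator {a..b} r *\<^sub>R f (r, x))"

lemma time_average_eq: "time_average h f (t, x) = (1 / h) *\<^sub>R time_integral t (t + h) f x"
  if "f \<in> borel_measurable borel"
proof -
  have [measurable]: "f \<in> borel_measurable (borel \<Otimes>\<^sub>M borel)" using that by (simp add: borel_prod)
  have "(\<lambda>r. indicator {t..t + h} r *\<^sub>R f (r, x)) \<in> borel_measurable borel" by measurable
  then have "(LBINT r. indicator {t..t + h} (r + t) *\<^sub>R f (r + t, x)) = time_integral t (t + h) f x"
    unfolding time_integral_def by (rule integral_lborel_translation)
  moreover have "indicator {t..t + h} (r + t) = (indicator {0..h} r :: real)" for r
    by (auto simp: indicator_def)
  ultimately show ?thesis by (simp add: time_average_def add.commute)
qed

lemma time_integral_measurable: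
  assumes "f \<in> borel_measurable borel"
  shows "time_integral a b f \<in> borel_measurable borel"
    "(\<lambda>z. time_integral a (fst z) f (snd z)) \<in> borel_measurable borel"
proof -
  have [measurable]: "f \<in> borel_measurable (borel \<Otimes>\<^sub>M borel)" using assms by (simp add: borel_prod)
  show "time_integral a b f \<in> borel_measurable borel"
    unfolding time_integral_def[abs_def] by measurable
  have "(\<lambda>z. (LBINT r. indicator {a..fst z} r *\<^sub>R f (r, snd z))) \<in> borel_measurable (borel \<Otimes>\<^sub>M borel)"
    unfolding indicator_def atLeastAtMost_iff by measurable
  then show "(\<lambda>z. time_integral a (fst z) f (snd z)) \<in> borel_measurable borel"
    unfolding time_integral_def borel_prod .
qed

lemma time_integral_power2_le:
  assumes f: "f \<in> borel_measurable borel" and ab: "a \<le> b"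
  shows "ennreal ((norm (time_integral a b f x))\<^sup>2) \<le>
    ennreal (b - a) * (\<integral>\<^sup>+ r. indicator {a..b} r * ennreal ((norm (f (r, x)))\<^sup>2) \<partial>lborel)"
proof (cases "a = b")
  case True
  have "time_integral a b f x = integral\<^sup>L lborel (\<lambda>r::real. 0)"
    unfolding time_integral_def
  proof (rule Bochner_Integration.integral_cong_AE)
    have [measurable]: "f \<in> borel_measurable (borel \<Otimes>\<^sub>M borel)" using f by (simp add: borel_prod)
    show "(\<lambda>r. indicator {a..b} r *\<^sub>R f (r, x)) \<in> borel_measurable lborel" by measurable
    show "AE r in lborel. indicator {a..b} r *\<^sub>R f (r, x) = 0"
      using AE_lborel_singleton[of a] by eventually_elim (use True in \<open>auto simp: indicator_def\<close>)
  qed simp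
  then show ?thesis by simp
next
  case False
  have [measurable]: "f \<in> borel_measurable (borel \<Otimes>\<^sub>M borel)" using f by (simp add: borel_prod)
  have i: "indicator {a..b} (a + r) = (indicator {0..b - a} r :: 'z::zero_neq_one)" for r
    by (auto simp: indicator_def)
  have "time_integral a b f x = (LBINT r. indicator {a..b} (r + a) *\<^sub>R f (r + a, x))"
    unfolding time_integral_def by (rule integral_lborel_translation[symmetric]) measurable
  then have e: "time_integral a b f x = (LBINT r. indicator {0..b - a} r *\<^sub>R f (a + r, x))"
    by (simp add: i add.commute[of _ a])
  have "(\<integral>\<^sup>+ r. indicator {a..b} r * ennreal ((norm (f (r, x)))\<^sup>2) \<partial>distr lborel borel ((+) a)) =
      (\<integral>\<^sup>+ r. indicator {a..b} (a + r) * ennreal ((norm (f (a + r, x)))\<^sup>2) \<partial>lborel)"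
    by (rule nn_integral_distr) measurable
  then have e2: "(\<integral>\<^sup>+ r. indicator {a..b} r * ennreal ((norm (f (r, x)))\<^sup>2) \<partial>lborel) =
      (\<integral>\<^sup>+ r. indicator {0..b - a} r * ennreal ((norm (f (a + r, x)))\<^sup>2) \<partial>lborel)"
    unfolding lborel_distr_plus i .
  show ?thesis
    unfolding e e2 by (rule integral_Icc_norm_power2_le) (use False ab in auto)
qed

lemma nn_integral_Icc_slices:
  fixes f :: "real \<times> 'x::euclidean_space \<Rightarrow> 'b::euclidean_space"
  assumes f: "sq_integrable lborel f"
  shows "(\<integral>\<^sup>+ x. (\<integral>\<^sup>+ r. indicator {a..b} r * ennreal ((norm (f (r, x)))\<^sup>2) \<partial>lborel) \<partial>lborel) =
    ennreal ((LBINT t. indicator {a..b} t * (norm2 lborel (\<lambda>x. f (t, x)))\<^sup>2))"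
proof -
  have [measurable]: "f \<in> borel_measurable borel" using sq_integrableD(1)[OF f] by simp
  then have [measurable]: "f \<in> borel_measurable (borel \<Otimes>\<^sub>M borel)" by (simp add: borel_prod)
  have "(\<lambda>z. indicator {a..b} (fst z) * ennreal ((norm (f z))\<^sup>2)) \<in> borel_measurable (borel \<Otimes>\<^sub>M borel)"
    by measurable
  then have m: "(\<lambda>z. indicator {a..b} (fst z) * ennreal ((norm (f z))\<^sup>2)) \<in> borel_measurable borel"
    unfolding borel_prod .
  have "(\<integral>\<^sup>+ x. (\<integral>\<^sup>+ r. indicator {a..b} r * ennreal ((norm (f (r, x)))\<^sup>2) \<partial>lborel) \<partial>lborel) =
      (\<integral>\<^sup>+ r. (\<integral>\<^sup>+ x. indicator {a..b} r * ennreal ((norm (f (r, x)))\<^sup>2) \<partial>lborel) \<partial>lborel)"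
    using nn_integral_slice[OF m] by simp
  also have "\<dots> = (\<integral>\<^sup>+ r. ennreal (indicator {a..b} r * (norm2 lborel (\<lambda>x. f (r, x)))\<^sup>2) \<partial>lborel)"
  proof (rule nn_integral_cong_AE, use slice_sq_integrable(1)[OF f] in eventually_elim)
    case (elim r)
    then show ?case
      using nn_integral_norm2[OF elim] by (auto simp: indicator_def)
  qed
  also have "\<dots> = ennreal ((LBINT t. indicator {a..b} t * (norm2 lborel (\<lambda>x. f (t, x)))\<^sup>2))"
  proof (rule nn_integral_eq_integral)
    show "integrable lborel (\<lambda>t. indicator {a..b} t * (norm2 lborel (\<lambda>x. f (t, x)))\<^sup>2)"
      using integrable_mult_indicator[OF _ slice_sq_integrable(2)[OF f], of "{a..b}"] by simp
  qed auto
  finally show ?thesis .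
qed

text \<open>The factor b - a comes from Cauchy-Schwarz in time; it is what makes the increments of a
  solution small over short intervals.\<close>

lemma time_integral_sq_integrable:
  assumes f: "sq_integrable lborel f" and ab: "a \<le> b"
  shows "sq_integrable lborel (time_integral a b f)"
    "(norm2 lborel (time_integral a b f))\<^sup>2 \<le>
      (b - a) * (LBINT t. indicator {a..b} t * (norm2 lborel (\<lambda>x. f (t, x)))\<^sup>2)"
proof -
  have fm [measurable]: "f \<in> borel_measurable borel" using sq_integrableD(1)[OF f] by simp
  then have [measurable]: "f \<in> borel_measurable (borel \<Otimes>\<^sub>M borel)" by (simp add: borel_prod)
  let ?I = "(LBINT t. indicator {a..b} t * (norm2 lborel (\<lambda>x. f (t, x)))\<^sup>2)"
  have I: "0 \<le> ?I" by (intro Bochner_Integration.integral_nonneg) auto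
  have "(\<integral>\<^sup>+ x. ennreal ((norm (time_integral a b f x))\<^sup>2) \<partial>lborel) \<le>
      (\<integral>\<^sup>+ x. ennreal (b - a) * (\<integral>\<^sup>+ r. indicator {a..b} r * ennreal ((norm (f (r, x)))\<^sup>2) \<partial>lborel) \<partial>lborel)"
    by (intro nn_integral_mono time_integral_power2_le fm ab)
  also have "\<dots> = ennreal (b - a) * ennreal ?I"
    unfolding nn_integral_Icc_slices[OF f, symmetric] by (rule nn_integral_cmult) measurable
  also have "\<dots> = ennreal ((sqrt ((b - a) * ?I))\<^sup>2)"
    using ab I by (simp add: ennreal_mult)
  finally have le: "(\<integral>\<^sup>+ x. ennreal ((norm (time_integral a b f x))\<^sup>2) \<partial>lborel) \<le> ennreal ((sqrt ((b - a) * ?I))\<^sup>2)" .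
  have m: "time_integral a b f \<in> borel_measurable lborel" using time_integral_measurable(1)[OF fm] by simp
  note * = sq_integrable_nn[OF m le]
  show "sq_integrable lborel (time_integral a b f)" using *(1) ab I by simp
  have "norm2 lborel (time_integral a b f) \<le> sqrt ((b - a) * ?I)" using *(2) ab I by simp
  then have "(norm2 lborel (time_integral a b f))\<^sup>2 \<le> (sqrt ((b - a) * ?I))\<^sup>2"
    by (intro power_mono norm2_nonneg)
  then show "(norm2 lborel (time_integral a b f))\<^sup>2 \<le> (b - a) * ?I" using ab I by simp
qed

lemma integral_time_integral_inner:
  assumes f: "sq_integrable lborel f" and \<kappa>: "sq_integrable lborel \<kappa>"
  shows "(LBINT x. time_integral a b f x \<bullet> \<kappa> x) =
    (LBINT r. indicator {a..b} r * (LBINT x. f (r, x) \<bullet> \<kappa> x))"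
proof -
  have fm [measurable]: "f \<in> borel_measurable borel" using sq_integrableD(1)[OF f] by simp
  then have [measurable]: "f \<in> borel_measurable (borel \<Otimes>\<^sub>M borel)" by (simp add: borel_prod)
  have [measurable]: "\<kappa> \<in> borel_measurable borel" using sq_integrableD(1)[OF \<kappa>] by simp
  have "integrable lborel (\<lambda>z. f z \<bullet> (indicator {a..b} (fst z) *\<^sub>R \<kappa> (snd z)))"
    by (intro sq_integrable_inner(1)[OF f] tensor_sq_integrable indicator_sq_integrable \<kappa>) auto
  then have i: "integrable (lborel \<Otimes>\<^sub>M lborel) (\<lambda>(r, x). indicator {a..b} r * (f (r, x) \<bullet> \<kappa> x))"
    unfolding lborel_prod case_prod_beta by simp
  have "(LBINT x. time_integral a b f x \<bullet> \<kappa> x) =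
      (LBINT x. (LBINT r. indicator {a..b} r * (f (r, x) \<bullet> \<kappa> x)))"
  proof (rule integral_cong_AE)
    show "(\<lambda>x. time_integral a b f x \<bullet> \<kappa> x) \<in> borel_measurable lborel"
      using time_integral_measurable(1)[OF fm] by measurable
    show "AE x in lborel. time_integral a b f x \<bullet> \<kappa> x =
        (LBINT r. indicator {a..b} r * (f (r, x) \<bullet> \<kappa> x))"
      using slice_snd_Icc_integrable[OF f]
    proof eventually_elim
      case (elim x)
      then have "integrable lborel (\<lambda>r. indicator {a..b} r *\<^sub>R f (r, x))" by blast
      then have "(LBINT r. (indicator {a..b} r *\<^sub>R f (r, x)) \<bullet> \<kappa> x) = time_integral a b f x \<bullet> \<kappa> x"
        unfolding time_integral_def by (intro integral_inner_left)
      then show ?case by simp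
    qed
  qed measurable
  also have "\<dots> = (LBINT r. (LBINT x. indicator {a..b} r * (f (r, x) \<bullet> \<kappa> x)))"
    by (rule lborel_pair.Fubini_integral[OF i])
  finally show ?thesis by simp
qed

lemma time_average_sq_integrable:
  assumes f: "sq_integrable lborel f" and h: "0 < h"
  shows "sq_integrable lborel (time_average h f)"
\<comment> \<open>The crude bound for translation differences suffices for integrability.\<close>
proof (rule norm2_time_average_diff(1)[OF f h, of "2 * norm2 lborel f"])
  show "norm2 lborel (\<lambda>z. f (z + (r, 0)) - f z) \<le> 2 * norm2 lborel f" for r
    using norm2_triangle_diff[OF norm2_translation(1)[OF f, of "(r, 0)"] f] norm2_translation(2)[OF f, of "(r, 0)"]
    by simp
qed (simp add: norm2_nonneg)

lemma time_average_tendsto: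
  assumes f: "sq_integrable lborel f"
  shows "(\<lambda>n. norm2 lborel (\<lambda>z. time_average (inverse (Suc n)) f z - f z)) \<longlonglongrightarrow> 0"
proof (rule LIMSEQ_I)
  fix e :: real assume e: "0 < e"
  obtain d where d: "d > 0" "\<And>h. norm h < d \<Longrightarrow> norm2 lborel (\<lambda>z. f (z + h) - f z) < e / 2"
    using translation_continuous[OF f, of "e / 2"] e by auto
  obtain N where N: "inverse (real (Suc N)) < d" using reals_Archimedean[OF d(1)] by blast
  have "norm2 lborel (\<lambda>z. time_average (inverse (Suc n)) f z - f z) \<le> e / 2" if "n \<ge> N" for n
  proof (rule norm2_time_average_diff(2)[OF f])
    fix r :: real assume r: "0 \<le> r" "r \<le> inverse (real (Suc n))"
    have "inverse (real (Suc n)) \<le> inverse (real (Suc N))" using that by (intro le_imp_inverse_le) auto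
    then have "norm (r, 0::'a) < d" using order_le_less_trans[OF order_trans[OF r(2)] N] r(1) by (simp add: norm_Pair del: of_nat_Suc)
    then show "norm2 lborel (\<lambda>z. f (z + (r, 0)) - f z) \<le> e / 2" using d(2) by (intro less_imp_le)
  qed (use e in auto)
  then show "\<exists>N. \<forall>n\<ge>N. norm (norm2 lborel (\<lambda>z. time_average (inverse (Suc n)) f z - f z) - 0) < e"
    using e by (intro exI[of _ N]) (force simp: norm2_nonneg)
qed

text \<open>The squared slice norms of the error have integral equal to the squared space-time norm,
  so they tend to 0 in L1 of the time line, and a subsequence tends to 0 at almost every
  time.\<close>

lemma time_average_slices:
  assumes f: "sq_integrable lborel f"
  obtains r :: "nat \<Rightarrow> nat" where "strict_mono r"
    "AE t in lborel. sq_integrable lborel (\<lambda>x. f (t, x)) \<and>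
      (\<lambda>n. norm2 lborel (\<lambda>x. time_average (inverse (Suc (r n))) f (t, x) - f (t, x))) \<longlonglongrightarrow> 0"
proof -
  define d where "d n z = time_average (inverse (real (Suc n))) f z - f z" for n z
  have d: "sq_integrable lborel (d n)" for n
    unfolding d_def by (intro sq_integrable_diff time_average_sq_integrable f) simp
  define g where "g n t = (norm2 lborel (\<lambda>x. d n (t, x)))\<^sup>2" for n t
  have "(\<lambda>n. (LBINT t. norm (g n t))) \<longlonglongrightarrow> 0"
  proof -
    have "(LBINT t. norm (g n t)) = (norm2 lborel (d n))\<^sup>2" for n
      using slice_sq_integrable(3)[OF d, of n] by (simp add: g_def)
    moreover have "(\<lambda>n. (norm2 lborel (d n))\<^sup>2) \<longlonglongrightarrow> 0\<^sup>2"
      using time_average_tendsto[OF f] unfolding d_def by (intro tendsto_power)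
    ultimately show ?thesis by simp
  qed
  moreover have "integrable lborel (g n)" for n
    unfolding g_def using slice_sq_integrable(2)[OF d] by simp
  ultimately obtain r where r: "strict_mono r" "AE t in lborel. (\<lambda>n. g (r n) t) \<longlonglongrightarrow> 0"
    using tendsto_norm2_AE_subseq[of lborel g] by blast
  have "AE t in lborel. sq_integrable lborel (\<lambda>x. f (t, x)) \<and>
      (\<lambda>n. norm2 lborel (\<lambda>x. time_average (inverse (Suc (r n))) f (t, x) - f (t, x))) \<longlonglongrightarrow> 0"
    using r(2) slice_sq_integrable(1)[OF f]
  proof eventually_elim
    case (elim t)
    have "(\<lambda>n. sqrt (g (r n) t)) \<longlonglongrightarrow> sqrt 0" using elim(1) by (rule tendsto_real_sqrt)
    then have "(\<lambda>n. norm2 lborel (\<lambda>x. d (r n) (t, x))) \<longlonglongrightarrow> 0"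
      by (simp add: g_def norm2_nonneg)
    then show ?case using elim(2) by (simp add: d_def del: of_nat_Suc)
  qed
  then show ?thesis using that r(1) by blast
qed

text \<open>The time averages of \<open>G\<close> satisfy the hypothesis for all \<open>\<kappa>\<close> at every time, and at
  almost every time they converge to \<open>G t\<close>: this makes the null set independent of \<open>\<kappa>\<close>.\<close>

lemma slice_constant:
  fixes G :: "real \<times> 'x::euclidean_space \<Rightarrow> 'b::euclidean_space"
  assumes G: "sq_integrable lborel G" and K: "\<And>\<kappa>. \<kappa> \<in> K \<Longrightarrow> sq_integrable lborel \<kappa>"
    and c: "\<And>\<kappa>. \<kappa> \<in> K \<Longrightarrow> AE t in lborel. t \<in> {a<..<b} \<longrightarrow> (LBINT x. G (t, x) \<bullet> \<kappa> x) = c \<kappa>"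
  shows "AE t in lborel. t \<in> {a<..<b} \<longrightarrow> (\<forall>\<kappa>\<in>K. (LBINT x. G (t, x) \<bullet> \<kappa> x) = c \<kappa>)"
proof -
  have Gm: "G \<in> borel_measurable borel" using sq_integrableD(1)[OF G] by simp
  then have [measurable]: "G \<in> borel_measurable (borel \<Otimes>\<^sub>M borel)" by (simp add: borel_prod)
  obtain r :: "nat \<Rightarrow> nat" where r: "strict_mono r" and
    ae: "AE t in lborel. sq_integrable lborel (\<lambda>x. G (t, x)) \<and>
      (\<lambda>n. norm2 lborel (\<lambda>x. time_average (inverse (Suc (r n))) G (t, x) - G (t, x))) \<longlonglongrightarrow> 0"
    using time_average_slices[OF G] by blast
  show ?thesis
    using ae
  proof eventually_elim
    case (elim t)
    show ?case
    proof (intro impI ballI)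
      fix \<kappa> assume t: "t \<in> {a<..<b}" and \<kappa>: "\<kappa> \<in> K"
      note [measurable] = sq_integrableD(1)[OF K[OF \<kappa>], simplified]
      define h where "h n = inverse (real (Suc (r n)))" for n
      have h: "h n > 0" for n by (simp add: h_def)
      have ta: "time_average (h n) G (t, x) = (1 / h n) *\<^sub>R time_integral t (t + h n) G x" for n x
        by (rule time_average_eq[OF Gm])
      have "(\<lambda>n. (LBINT x. time_average (h n) G (t, x) \<bullet> \<kappa> x)) \<longlonglongrightarrow> (LBINT x. G (t, x) \<bullet> \<kappa> x)"
      proof (rule sq_integrable_const_tendsto)
        show "sq_integrable lborel (\<lambda>x. time_average (h n) G (t, x))" for n
          unfolding ta using h[of n] by (intro sq_integrable_scaleR time_integral_sq_integrable G) simp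
        show "(\<lambda>n. norm2 lborel (\<lambda>x. time_average (h n) G (t, x) - G (t, x))) \<longlonglongrightarrow> 0"
          using elim by (simp add: h_def)
      qed (use elim K[OF \<kappa>] in auto)
      moreover have "(\<lambda>n. (LBINT x. time_average (h n) G (t, x) \<bullet> \<kappa> x)) \<longlonglongrightarrow> c \<kappa>"
      proof (rule tendsto_eventually)
        have "h \<longlonglongrightarrow> 0"
          using LIMSEQ_subseq_LIMSEQ[OF LIMSEQ_inverse_real_of_nat r] by (simp add: h_def[abs_def] o_def)
        \<comment> \<open>Eventually the averaging interval from t to t + h stays inside (a, b),
          where the hypothesis on \<kappa> is available.\<close>
        then have "\<forall>\<^sub>F n in sequentially. h n < b - t"
          by (rule order_tendstoD) (use t in simp)
        then show "\<forall>\<^sub>F n in sequentially. (LBINT x. time_average (h n) G (t, x) \<bullet> \<kappa> x) = c \<kappa>"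
        proof eventually_elim
          case (elim n)
          have "(LBINT x. time_average (h n) G (t, x) \<bullet> \<kappa> x) =
              (1 / h n) * (LBINT x. time_integral t (t + h n) G x \<bullet> \<kappa> x)"
            unfolding ta by simp
          also have "(LBINT x. time_integral t (t + h n) G x \<bullet> \<kappa> x) =
              (LBINT r. indicator {t..t + h n} r * (LBINT x. G (r, x) \<bullet> \<kappa> x))"
            by (rule integral_time_integral_inner[OF G K[OF \<kappa>]])
          also have "\<dots> = (LBINT r. indicator {t..t + h n} r * c \<kappa>)"
          proof (rule integral_cong_AE)
            show "AE r in lborel. indicator {t..t + h n} r * (LBINT x. G (r, x) \<bullet> \<kappa> x) =
                indicator {t..t + h n} r * c \<kappa>"
              using c[OF \<kappa>] by eventually_elim (use t elim in \<open>auto simp: indicator_def\<close>)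
          qed measurable
          also have "\<dots> = h n * c \<kappa>" using h[of n] by simp
          finally show ?case using h[of n] by simp
        qed
      qed
      ultimately show "(LBINT x. G (t, x) \<bullet> \<kappa> x) = c \<kappa>" by (rule LIMSEQ_unique)
    qed
  qed
qed

text \<open>A function \<kappa> of x alone is not square integrable over the unbounded time line. As
  G vanishes outside (a, b), the indicator of that interval may be inserted before Cauchy-Schwarz
  and Fubini are used.\<close>

lemma integral_slice_inner:
  fixes G :: "real \<times> 'x::euclidean_space \<Rightarrow> 'b::euclidean_space"
  assumes G: "sq_integrable lborel G" and z: "\<And>t x. t \<notin> {a<..<b} \<Longrightarrow> G (t, x) = 0" and \<kappa>: "sq_integrable lborel \<kappa>"
  shows "integrable lborel (\<lambda>t. (LBINT x. G (t, x) \<bullet> \<kappa> x))"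
proof -
  have "integrable lborel (\<lambda>z. G z \<bullet> (indicator {a<..<b} (fst z) *\<^sub>R \<kappa> (snd z)))"
    by (intro sq_integrable_inner(1)[OF G] tensor_sq_integrable indicator_sq_integrable \<kappa>) auto
  moreover have "G z \<bullet> (indicator {a<..<b} (fst z) *\<^sub>R \<kappa> (snd z)) = G z \<bullet> \<kappa> (snd z)" for z
    using z[of "fst z" "snd z"] by (cases "fst z \<in> {a<..<b}") auto
  ultimately have "integrable lborel (\<lambda>z. G z \<bullet> \<kappa> (snd z))" by (simp only:)
  from slice_integrable(2)[OF this] show ?thesis by simp
qed

lemma slice_orthogonal:
  fixes G :: "real \<times> 'x::euclidean_space \<Rightarrow> 'b::euclidean_space"
  assumes G: "sq_integrable lborel G" and z: "\<And>t x. t \<notin> {a<..<b} \<Longrightarrow> G (t, x) = 0"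
    and K: "\<And>\<kappa>. \<kappa> \<in> K \<Longrightarrow> sq_integrable lborel \<kappa>"
    and orth: "\<And>\<kappa> \<psi>. \<kappa> \<in> K \<Longrightarrow> \<psi> \<in> test_functions {a<..<b} \<Longrightarrow>
      (LBINT t. \<psi> t * (LBINT x. G (t, x) \<bullet> \<kappa> x)) = 0"
  shows "AE t in lborel. t \<in> {a<..<b} \<longrightarrow> (\<forall>\<kappa>\<in>K. (LBINT x. G (t, x) \<bullet> \<kappa> x) = 0)"
proof (rule slice_constant[OF G K])
  fix \<kappa> assume \<kappa>: "\<kappa> \<in> K"
  show "AE t in lborel. t \<in> {a<..<b} \<longrightarrow> (LBINT x. G (t, x) \<bullet> \<kappa> x) = 0"
  proof (rule fundamental_lemma)
    show "integrable lborel (\<lambda>t. (LBINT x. G (t, x) \<bullet> \<kappa> x))"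
      by (rule integral_slice_inner[OF G z K[OF \<kappa>]])
  qed (auto intro: orth[OF \<kappa>])
qed

lemma slice_weakly_constant:
  fixes G :: "real \<times> 'x::euclidean_space \<Rightarrow> 'b::euclidean_space"
  assumes G: "sq_integrable lborel G" and z: "\<And>t x. t \<notin> {a<..<b} \<Longrightarrow> G (t, x) = 0" and ab: "a < b"
    and K: "\<And>\<kappa>. \<kappa> \<in> K \<Longrightarrow> sq_integrable lborel \<kappa>"
    and orth: "\<And>\<kappa> \<psi>. \<kappa> \<in> K \<Longrightarrow> \<psi> \<in> test_functions {a<..<b} \<Longrightarrow>
      (LBINT t. grad \<psi> t * (LBINT x. G (t, x) \<bullet> \<kappa> x)) = 0"
  obtains c where "AE t in lborel. t \<in> {a<..<b} \<longrightarrow> (\<forall>\<kappa>\<in>K. (LBINT x. G (t, x) \<bullet> \<kappa> x) = c \<kappa>)"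
proof -
  have "\<exists>c. AE t in lborel. t \<in> {a<..<b} \<longrightarrow> (LBINT x. G (t, x) \<bullet> \<kappa> x) = c" if \<kappa>: "\<kappa> \<in> K" for \<kappa>
  proof -
    obtain c where "AE t in lborel. t \<in> {a<..<b} \<longrightarrow> (LBINT x. G (t, x) \<bullet> \<kappa> x) = c"
      by (rule weakly_constant[OF integral_slice_inner[OF G z K[OF \<kappa>]] ab orth[OF \<kappa>]])
    then show ?thesis ..
  qed
  then have "\<forall>\<kappa>\<in>K. \<exists>c. AE t in lborel. t \<in> {a<..<b} \<longrightarrow> (LBINT x. G (t, x) \<bullet> \<kappa> x) = c"
    by (rule ballI)
  then have "\<exists>c. \<forall>\<kappa>\<in>K. AE t in lborel. t \<in> {a<..<b} \<longrightarrow> (LBINT x. G (t, x) \<bullet> \<kappa> x) = c \<kappa>"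
    by (rule bchoice)
  then obtain c where c: "\<forall>\<kappa>\<in>K. AE t in lborel. t \<in> {a<..<b} \<longrightarrow> (LBINT x. G (t, x) \<bullet> \<kappa> x) = c \<kappa>" ..
  show ?thesis by (rule that[OF slice_constant[OF G K bspec[OF c]]])
qed

text \<open>Instead of differentiating the primitive of an integrable D, the integrals over the
  region 0 \<le> r \<le> t are exchanged; the inner integral of the derivative of \<psi> from r to T
  is - \<psi>(r), since \<psi> vanishes at T.\<close>

lemma integral_by_parts_primitive:
  fixes D :: "real \<Rightarrow> real"
  assumes D: "integrable lborel D" and \<psi>: "\<psi> \<in> test_functions {0<..<T}"
  shows "(LBINT t. grad \<psi> t * (LBINT r. indicator {0..t} r * D r)) =
    - (LBINT t. \<psi> t * D t)"
proof -
  have [measurable]: "D \<in> borel_measurable borel" using D by auto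
  have gc: "continuous_on UNIV (grad \<psi>)" by (rule test_functionsD(4)[OF \<psi>])
  then have [measurable]: "grad \<psi> \<in> borel_measurable borel" by (rule borel_measurable_continuous_onI)
  obtain K where K: "compact K" "\<And>x. x \<notin> K \<Longrightarrow> grad \<psi> x = 0"
    using test_functions_support[OF \<psi>] by metis
  have gi: "integrable lborel (grad \<psi>)" by (rule integrable_compact_support[OF gc K])
  have "integrable lborel (\<lambda>z. grad \<psi> (fst z) * D (snd z))" by (rule tensor_integrable[OF gi D])
  then have "integrable lborel (\<lambda>z. indicator {z. 0 \<le> snd z \<and> snd z \<le> fst z} z *\<^sub>R (grad \<psi> (fst z) * D (snd z)))"
    by (rule integrable_mult_indicator[rotated])
      (auto intro!: borel_closed closed_Collect_conj closed_Collect_le continuous_intros)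
  then have i: "integrable (lborel \<Otimes>\<^sub>M lborel) (\<lambda>(t, r). grad \<psi> t * (indicator {0..t} r * D r))"
    unfolding lborel_prod by (rule Bochner_Integration.integrable_cong[THEN iffD1, rotated -1]) (auto simp: indicator_def)
  have "(LBINT t. grad \<psi> t * (LBINT r. indicator {0..t} r * D r)) =
      (LBINT t. (LBINT r. grad \<psi> t * (indicator {0..t} r * D r)))" by simp
  also have "\<dots> = (LBINT r. (LBINT t. grad \<psi> t * (indicator {0..t} r * D r)))"
    by (rule lborel_pair.Fubini_integral[OF i, symmetric])
  also have "\<dots> = (LBINT r. - (\<psi> r * D r))"
  proof (rule Bochner_Integration.integral_cong[OF refl])
    fix r :: real
    show "(LBINT t. grad \<psi> t * (indicator {0..t} r * D r)) = - (\<psi> r * D r)"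
    proof (cases "0 \<le> r \<and> r \<le> T")
      case True
      have "(LBINT t. grad \<psi> t * (indicator {0..t} r * D r)) =
          (LBINT t. (indicator {r..T} t *\<^sub>R grad \<psi> t) * D r)"
        by (intro Bochner_Integration.integral_cong refl)
          (use True test_functions_outside(2)[OF \<psi>] in \<open>auto simp: indicator_def\<close>)
      also have "\<dots> = (LBINT t. indicator {r..T} t *\<^sub>R grad \<psi> t) * D r" by simp
      also have "(LBINT t. indicator {r..T} t *\<^sub>R grad \<psi> t) = \<psi> T - \<psi> r"
      proof (rule integral_FTC_atLeastAtMost)
        show "(\<psi> has_vector_derivative grad \<psi> x) (at x within {r..T})" for x
        proof -
          have "(\<psi> has_derivative (\<lambda>h. h *\<^sub>R grad \<psi> x)) (at x)"
            using test_functionsD(5)[OF \<psi>, of x] by (simp add: mult.commute)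
          then have "(\<psi> has_vector_derivative grad \<psi> x) (at x)"
            unfolding has_vector_derivative_def .
          then show ?thesis by (rule has_vector_derivative_at_within)
        qed
      qed (use True continuous_on_subset[OF gc] in auto)
      also have "\<psi> T = 0" using test_functions_outside(1)[OF \<psi>] by simp
      finally show ?thesis by simp
    next
      case False
      then have "grad \<psi> t * (indicator {0..t} r * D r) = 0" for t
        using test_functions_outside(2)[OF \<psi>, of t] by (auto simp: indicator_def)
      moreover have "\<psi> r = 0" using False test_functions_outside(1)[OF \<psi>, of r] by auto
      ultimately show ?thesis by (simp only:) simp
    qed
  qed
  finally show ?thesis by simp
qed

section \<open>Weak evolution equations and the energy identity\<close>

text \<open>For the pairs (\<phi>, \<nabla>\<phi>) this closure is the graph of the gradient on
  H_0^1, in a form that mentions neither the domain nor weak derivatives.\<close>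

definition in_closure :: "('x::euclidean_space \<Rightarrow> 'b::euclidean_space) set \<Rightarrow> ('x \<Rightarrow> 'b) \<Rightarrow> bool" where
  "in_closure K w \<longleftrightarrow> sq_integrable lborel w \<and>
     (\<exists>\<kappa>. (\<forall>n::nat. \<kappa> n \<in> K) \<and> (\<lambda>n. norm2 lborel (\<lambda>x. \<kappa> n x - w x)) \<longlonglongrightarrow> 0)"

text \<open>\<open>U = (u, \<nabla>u)\<close> and \<open>k = (f, S)\<close> encode \<open>\<partial>\<^sub>t u = f - div S\<close>, tested with the
  pairs \<open>(\<phi>, \<nabla>\<phi>)\<close> in \<open>K\<close>.\<close>

definition weak_evolution ::
  "real \<Rightarrow> ('x::euclidean_space \<Rightarrow> real \<times> 'e::euclidean_space) set \<Rightarrow>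
   (real \<times> 'x \<Rightarrow> real \<times> 'e) \<Rightarrow> (real \<times> 'x \<Rightarrow> real \<times> 'e) \<Rightarrow> bool" where
  "weak_evolution T K U k \<longleftrightarrow> 0 < T \<and> (\<forall>\<kappa>\<in>K. sq_integrable lborel \<kappa>) \<and>
     sq_integrable lborel U \<and> sq_integrable lborel k \<and>
     (\<forall>t x. t \<notin> {0<..<T} \<longrightarrow> U (t, x) = 0 \<and> k (t, x) = 0) \<and>
     (AE t in lborel. t \<in> {0<..<T} \<longrightarrow> in_closure K (\<lambda>x. U (t, x))) \<and>
     (\<forall>\<kappa>\<in>K. \<forall>\<psi>\<in>test_functions {0<..<T}.
        (LBINT t. grad \<psi> t * (LBINT x. fst (U (t, x)) * fst (\<kappa> x))) =
        - (LBINT t. \<psi> t * (LBINT x. k (t, x) \<bullet> \<kappa> x)))"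

lemma sq_integrable_fst:
  assumes "sq_integrable M f"
  shows "sq_integrable M (\<lambda>x. fst (f x))"
proof (rule sq_integrable_bound[OF assms])
  have [measurable]: "f \<in> borel_measurable M" by (rule sq_integrableD[OF assms])
  have "continuous_on UNIV (fst :: 'b \<times> 'c \<Rightarrow> 'b)" by (intro continuous_intros)
  from borel_measurable_continuous_onI[OF this] show "(\<lambda>x. fst (f x)) \<in> borel_measurable M" by measurable
  show "AE x in M. norm (fst (f x)) \<le> norm (f x)"
  proof (rule AE_I2)
    fix x show "norm (fst (f x)) \<le> norm (f x)"
      using norm_fst_le[of "fst (f x)" "snd (f x)"] by simp
  qed
qed

lemma sq_integrable_snd:
  assumes "sq_integrable M f"
  shows "sq_integrable M (\<lambda>x. snd (f x))"
proof (rule sq_integrable_bound[OF assms])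
  have [measurable]: "f \<in> borel_measurable M" by (rule sq_integrableD[OF assms])
  have "continuous_on UNIV (snd :: 'b \<times> 'c \<Rightarrow> 'c)" by (intro continuous_intros)
  from borel_measurable_continuous_onI[OF this] show "(\<lambda>x. snd (f x)) \<in> borel_measurable M" by measurable
  show "AE x in M. norm (snd (f x)) \<le> norm (f x)"
  proof (rule AE_I2)
    fix x show "norm (snd (f x)) \<le> norm (f x)"
      using norm_snd_le[of "snd (f x)" "fst (f x)"] by simp
  qed
qed

lemma sq_integrable_Pair:
  assumes f: "sq_integrable M f" and g: "sq_integrable M g"
  shows "sq_integrable M (\<lambda>x. (f x, g x))" "(norm2 M (\<lambda>x. (f x, g x)))\<^sup>2 = (norm2 M f)\<^sup>2 + (norm2 M g)\<^sup>2"
proof -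
  note [measurable] = sq_integrableD(1)[OF f] sq_integrableD(1)[OF g]
  have "(\<lambda>x. (f x, g x)) \<in> M \<rightarrow>\<^sub>M borel \<Otimes>\<^sub>M borel" by measurable
  then have m: "(\<lambda>x. (f x, g x)) \<in> borel_measurable M" by (simp add: borel_prod)
  have e: "(norm (f x, g x))\<^sup>2 = (norm (f x))\<^sup>2 + (norm (g x))\<^sup>2" for x
    by (simp add: norm_Pair)
  show "sq_integrable M (\<lambda>x. (f x, g x))"
    unfolding sq_integrable_def e
    by (intro conjI m Bochner_Integration.integrable_add sq_integrableD(2)[OF f] sq_integrableD(2)[OF g])
  show "(norm2 M (\<lambda>x. (f x, g x)))\<^sup>2 = (norm2 M f)\<^sup>2 + (norm2 M g)\<^sup>2"
    unfolding norm2_power2 e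
    by (intro Bochner_Integration.integral_add sq_integrableD(2)[OF f] sq_integrableD(2)[OF g])
qed

lemma norm2_fst_le:
  assumes "sq_integrable M f"
  shows "norm2 M (\<lambda>x. fst (f x)) \<le> norm2 M f"
proof (rule power2_le_imp_le)
  have "(norm2 M f)\<^sup>2 = (norm2 M (\<lambda>x. fst (f x)))\<^sup>2 + (norm2 M (\<lambda>x. snd (f x)))\<^sup>2"
    using sq_integrable_Pair(2)[OF sq_integrable_fst[OF assms] sq_integrable_snd[OF assms]] by simp
  then show "(norm2 M (\<lambda>x. fst (f x)))\<^sup>2 \<le> (norm2 M f)\<^sup>2" by simp
qed (rule norm2_nonneg)

lemma sq_integrable_mult_bounded:
  fixes g :: "'a \<Rightarrow> real" and f :: "'a \<Rightarrow> 'b::euclidean_space"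
  assumes f: "sq_integrable M f" and g: "g \<in> borel_measurable M" and b: "AE x in M. \<bar>g x\<bar> \<le> B"
  shows "sq_integrable M (\<lambda>x. g x *\<^sub>R f x)"
proof (rule sq_integrable_bound[OF sq_integrable_scaleR[OF f, of B]])
  show "(\<lambda>x. g x *\<^sub>R f x) \<in> borel_measurable M" using g sq_integrableD(1)[OF f] by measurable
  show "AE x in M. norm (g x *\<^sub>R f x) \<le> norm (B *\<^sub>R f x)"
    using b by eventually_elim (auto intro: mult_right_mono)
qed

lemma integrable_mult_bounded:
  fixes g m :: "'a \<Rightarrow> real"
  assumes m: "integrable M m" and g: "g \<in> borel_measurable M" and b: "\<And>x. \<bar>g x\<bar> \<le> B"
  shows "integrable M (\<lambda>x. g x * m x)"
proof (rule Bochner_Integration.integrable_bound[OF integrable_mult_right[OF m, of B]])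
  show "(\<lambda>x. g x * m x) \<in> borel_measurable M" using g m by measurable
  show "AE x in M. norm (g x * m x) \<le> norm (B * m x)"
  proof (rule AE_I2)
    fix x
    have "\<bar>g x\<bar> \<le> \<bar>B\<bar>" using b[of x] by linarith
    then show "norm (g x * m x) \<le> norm (B * m x)" by (simp add: abs_mult mult_right_mono)
  qed
qed

lemma in_closure_tendsto:
  assumes w: "in_closure K w" and K: "\<And>\<kappa>. \<kappa> \<in> K \<Longrightarrow> sq_integrable lborel \<kappa>"
    and f: "sq_integrable lborel f" and g: "sq_integrable lborel g"
    and eq: "\<And>\<kappa>. \<kappa> \<in> K \<Longrightarrow> (LBINT x. f x \<bullet> \<kappa> x) = (LBINT x. g x \<bullet> \<kappa> x)"
  shows "(LBINT x. f x \<bullet> w x) = (LBINT x. g x \<bullet> w x)"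
proof -
  obtain \<kappa> where \<kappa>: "\<And>n::nat. \<kappa> n \<in> K" and lim: "(\<lambda>n. norm2 lborel (\<lambda>x. \<kappa> n x - w x)) \<longlonglongrightarrow> 0"
    and ws: "sq_integrable lborel w"
    using w unfolding in_closure_def by blast
  have "(\<lambda>n. (LBINT x. \<kappa> n x \<bullet> f x)) \<longlonglongrightarrow> (LBINT x. w x \<bullet> f x)"
    by (rule sq_integrable_const_tendsto[OF K[OF \<kappa>] ws f lim])
  moreover have "(\<lambda>n. (LBINT x. \<kappa> n x \<bullet> g x)) \<longlonglongrightarrow> (LBINT x. w x \<bullet> g x)"
    by (rule sq_integrable_const_tendsto[OF K[OF \<kappa>] ws g lim])
  moreover have "(LBINT x. \<kappa> n x \<bullet> f x) = (LBINT x. \<kappa> n x \<bullet> g x)" for n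
    using eq[OF \<kappa>[of n]] by (simp add: inner_commute)
  ultimately have "(LBINT x. w x \<bullet> f x) = (LBINT x. w x \<bullet> g x)"
    by (simp add: LIMSEQ_unique)
  then show ?thesis by (simp add: inner_commute)
qed

lemma time_integral_Icc_diff:
  assumes f: "sq_integrable lborel f" and st: "0 \<le> s" "s \<le> t"
  shows "AE x in lborel. time_integral 0 t f x - time_integral 0 s f x = time_integral s t f x"
  using slice_snd_Icc_integrable[OF f]
proof eventually_elim
  case (elim x)
  have f: "(\<lambda>r. f (r, x)) = (\<lambda>r. f (r, x))" ..
  have "time_integral 0 t f x - time_integral 0 s f x =
      (LBINT r. indicator {0..t} r *\<^sub>R f (r, x) - indicator {0..s} r *\<^sub>R f (r, x))"
    unfolding time_integral_def using elim by (intro Bochner_Integration.integral_diff[symmetric]) blast+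
  also have "\<dots> = time_integral s t f x"
    unfolding time_integral_def
  proof (rule integral_cong_AE)
    have i: "integrable lborel (\<lambda>r. indicator {a..b} r *\<^sub>R f (r, x))" for a b using elim by blast
    note [measurable] = borel_measurable_integrable[OF i]
    show "(\<lambda>r. indicator {0..t} r *\<^sub>R f (r, x) - indicator {0..s} r *\<^sub>R f (r, x)) \<in> borel_measurable lborel"
      by measurable
    show "AE r in lborel. indicator {0..t} r *\<^sub>R f (r, x) - indicator {0..s} r *\<^sub>R f (r, x) = indicator {s..t} r *\<^sub>R f (r, x)"
      using AE_lborel_singleton[of s] by eventually_elim (use st in \<open>auto simp: indicator_def\<close>)
    show "(\<lambda>r. indicator {s..t} r *\<^sub>R f (r, x)) \<in> borel_measurable lborel" by measurable
  qed
  finally show ?case .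
qed

lemma time_integral_indicator_sq_integrable:
  fixes k :: "real \<times> 'x::euclidean_space \<Rightarrow> 'b::euclidean_space"
  assumes k: "sq_integrable lborel k" and T: "0 < T"
  shows "sq_integrable lborel (\<lambda>z. indicator {0<..<T} (fst z) *\<^sub>R time_integral 0 (fst z) k (snd z))"
proof -
  have km: "k \<in> borel_measurable borel" using sq_integrableD(1)[OF k] by simp
  define H where "H z = indicator {0<..<T} (fst z) *\<^sub>R time_integral 0 (fst z) k (snd z)" for z
  have "(\<lambda>z. indicator {0<..<T} (fst z) *\<^sub>R time_integral 0 (fst z) k (snd z)) \<in> borel_measurable (borel \<Otimes>\<^sub>M borel)"
    using time_integral_measurable(2)[OF km, of 0] unfolding borel_prod[symmetric] by measurable
  then have m [measurable]: "H \<in> borel_measurable borel"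
    unfolding borel_prod H_def[abs_def] .
  define C where "C = T * (norm2 lborel k)\<^sup>2"
  have C: "0 \<le> C" unfolding C_def using T by simp
  have "(\<integral>\<^sup>+ z. ennreal ((norm (H z))\<^sup>2) \<partial>lborel) = (\<integral>\<^sup>+ t. (\<integral>\<^sup>+ x. ennreal ((norm (H (t, x)))\<^sup>2) \<partial>lborel) \<partial>lborel)"
    by (rule nn_integral_slice(1)[symmetric]) measurable
  also have "\<dots> \<le> (\<integral>\<^sup>+ t. ennreal C * indicator {0<..<T} t \<partial>lborel)"
  proof (rule nn_integral_mono)
    fix t :: real
    show "(\<integral>\<^sup>+ x. ennreal ((norm (H (t, x)))\<^sup>2) \<partial>lborel) \<le> ennreal C * indicator {0<..<T} t"
    proof (cases "t \<in> {0<..<T}")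
      case True
      then have t: "0 \<le> t" "t \<le> T" by auto
      note ti = time_integral_sq_integrable[OF k t(1)]
      have "(LBINT r. indicator {0..t} r * (norm2 lborel (\<lambda>x. k (r, x)))\<^sup>2) \<le>
          (LBINT r. (norm2 lborel (\<lambda>x. k (r, x)))\<^sup>2)"
        by (rule integral_mono[OF _ slice_sq_integrable(2)[OF k]])
          (use integrable_mult_indicator[OF _ slice_sq_integrable(2)[OF k], of "{0..t}"] in \<open>auto simp: indicator_def\<close>)
      also have "\<dots> = (norm2 lborel k)\<^sup>2" by (rule slice_sq_integrable(3)[OF k])
      finally have "t * (LBINT r. indicator {0..t} r * (norm2 lborel (\<lambda>x. k (r, x)))\<^sup>2) \<le> C"
        unfolding C_def using t by (intro mult_mono Bochner_Integration.integral_nonneg) auto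
      then have "(norm2 lborel (time_integral 0 t k))\<^sup>2 \<le> C" using ti(2) by simp
      then show ?thesis using True nn_integral_norm2[OF ti(1)] by (simp add: ennreal_leI H_def)
    next
      case False
      then show ?thesis by (simp add: H_def)
    qed
  qed
  also have "\<dots> = ennreal (C * T)" using C T by (simp add: nn_integral_cmult_indicator ennreal_mult)
  also have "\<dots> = ennreal ((sqrt (C * T))\<^sup>2)" using C T by simp
  finally have "sq_integrable lborel H" using m by (intro sq_integrable_nn(1)[of H lborel "sqrt (C * T)"]) (use C T in auto)
  then show ?thesis unfolding H_def[abs_def] .
qed

lemma weak_evolutionD:
  assumes "weak_evolution T K U k"
  shows "0 < T" "\<And>\<kappa>. \<kappa> \<in> K \<Longrightarrow> sq_integrable lborel \<kappa>" "sq_integrable lborel U" "sq_integrable lborel k"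
    "\<And>t x. t \<notin> {0<..<T} \<Longrightarrow> U (t, x) = 0" "\<And>t x. t \<notin> {0<..<T} \<Longrightarrow> k (t, x) = 0"
    "AE t in lborel. t \<in> {0<..<T} \<longrightarrow> in_closure K (\<lambda>x. U (t, x))"
    "\<And>\<kappa> \<psi>. \<kappa> \<in> K \<Longrightarrow> \<psi> \<in> test_functions {0<..<T} \<Longrightarrow>
        (LBINT t. grad \<psi> t * (LBINT x. fst (U (t, x)) * fst (\<kappa> x))) =
        - (LBINT t. \<psi> t * (LBINT x. k (t, x) \<bullet> \<kappa> x))"
  using assms unfolding weak_evolution_def by simp_all

text \<open>One full-measure set of times on which the integrated equation holds for all pairs of
  times and all w in the closure simultaneously. The slices of U and V, which change with time, can
  then be inserted for w.\<close>

definition good_times ::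
  "real \<Rightarrow> ('x::euclidean_space \<Rightarrow> real \<times> 'e::euclidean_space) set \<Rightarrow>
   (real \<times> 'x \<Rightarrow> real \<times> 'e) \<Rightarrow> (real \<times> 'x \<Rightarrow> real \<times> 'e) \<Rightarrow> real set \<Rightarrow> bool" where
  "good_times T K U k Good \<longleftrightarrow> (AE t in lborel. t \<in> {0<..<T} \<longrightarrow> t \<in> Good) \<and> Good \<subseteq> {0<..<T} \<and>
     (\<forall>t\<in>Good. in_closure K (\<lambda>x. U (t, x))) \<and>
     (\<forall>s\<in>Good. \<forall>t\<in>Good. \<forall>w. s \<le> t \<longrightarrow> in_closure K w \<longrightarrow>
       (LBINT x. (fst (U (t, x)) - fst (U (s, x))) * fst (w x)) =
       (LBINT x. time_integral s t k x \<bullet> w x))"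

lemma good_timesD:
  assumes "good_times T K U k Good"
  shows "AE t in lborel. t \<in> {0<..<T} \<longrightarrow> t \<in> Good" "Good \<subseteq> {0<..<T}"
    "\<And>t. t \<in> Good \<Longrightarrow> in_closure K (\<lambda>x. U (t, x))"
    "\<And>s t w. s \<in> Good \<Longrightarrow> t \<in> Good \<Longrightarrow> s \<le> t \<Longrightarrow> in_closure K w \<Longrightarrow>
      (LBINT x. (fst (U (t, x)) - fst (U (s, x))) * fst (w x)) =
      (LBINT x. time_integral s t k x \<bullet> w x)"
    "\<And>t. t \<in> Good \<Longrightarrow> sq_integrable lborel (\<lambda>x. U (t, x))"
  using assms unfolding good_times_def by (simp_all add: in_closure_def)

text \<open>The difference of u and the primitive of k has zero weak time derivative against each
  \<kappa>, so its product with \<kappa> is a constant c \<kappa>, off a null set common to all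
  \<kappa>. Comparing two times removes the constant, and density extends the relation from K to its
  closure.\<close>

lemma weak_evolution_increments:
  fixes U k :: "real \<times> 'x::euclidean_space \<Rightarrow> real \<times> 'e::euclidean_space"
  assumes ev: "weak_evolution T K U k"
  obtains Good where "good_times T K U k Good"
proof -
  note T = weak_evolutionD(1)[OF ev] and K = weak_evolutionD(2)[OF ev] and U = weak_evolutionD(3)[OF ev]
    and k = weak_evolutionD(4)[OF ev] and zU = weak_evolutionD(5)[OF ev] and zk = weak_evolutionD(6)[OF ev]
    and cl = weak_evolutionD(7)[OF ev] and weak = weak_evolutionD(8)[OF ev]
  \<comment> \<open>Only u carries the time derivative; the zero component lets it be paired with
    the same \<kappa> as the primitive of k.\<close>
  define P where "P z = (fst (U z), 0 :: 'e)" for z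
  define H where "H z = indicator {0<..<T} (fst z) *\<^sub>R time_integral 0 (fst z) k (snd z)" for z
  define G where "G z = P z - H z" for z
  have P: "sq_integrable lborel P"
    unfolding P_def by (intro sq_integrable_Pair(1) sq_integrable_fst U sq_integrable_zero)
  have H: "sq_integrable lborel H"
    unfolding H_def by (rule time_integral_indicator_sq_integrable[OF k T])
  have G: "sq_integrable lborel G" unfolding G_def by (intro sq_integrable_diff P H)
  have zP: "P (t, x) = 0" if "t \<notin> {0<..<T}" for t x using zU[OF that] by (simp add: P_def zero_prod_def)
  have zH: "H (t, x) = 0" if "t \<notin> {0<..<T}" for t x using that by (simp add: H_def)
  have zG: "G (t, x) = 0" if "t \<notin> {0<..<T}" for t x using zP[OF that] zH[OF that] by (simp add: G_def)
  have Gi: "AE t in lborel. sq_integrable lborel (\<lambda>x. P (t, x)) \<and> sq_integrable lborel (\<lambda>x. H (t, x)) \<and>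
      (\<forall>\<kappa>\<in>K. (LBINT x. G (t, x) \<bullet> \<kappa> x) =
      (LBINT x. P (t, x) \<bullet> \<kappa> x) - (LBINT x. H (t, x) \<bullet> \<kappa> x))"
    using slice_sq_integrable(1)[OF P] slice_sq_integrable(1)[OF H]
    by eventually_elim (simp add: G_def inner_diff_left sq_integrable_inner(1) K)
  have orth: "(LBINT t. grad \<psi> t * (LBINT x. G (t, x) \<bullet> \<kappa> x)) = 0"
    if \<kappa>: "\<kappa> \<in> K" and \<psi>: "\<psi> \<in> test_functions {0<..<T}" for \<kappa> \<psi>
  proof -
    obtain B where B: "\<And>x. norm (grad \<psi> x) \<le> B" and [measurable]: "grad \<psi> \<in> borel_measurable borel"
      using test_functions_bounds[OF \<psi>] by metis
    have iP: "integrable lborel (\<lambda>t. grad \<psi> t * (LBINT x. P (t, x) \<bullet> \<kappa> x))"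
      by (rule integrable_mult_bounded[OF integral_slice_inner[OF P zP K[OF \<kappa>]]]) (use B in auto)
    have iH: "integrable lborel (\<lambda>t. grad \<psi> t * (LBINT x. H (t, x) \<bullet> \<kappa> x))"
      by (rule integrable_mult_bounded[OF integral_slice_inner[OF H zH K[OF \<kappa>]]]) (use B in auto)
    have iG: "integrable lborel (\<lambda>t. grad \<psi> t * (LBINT x. G (t, x) \<bullet> \<kappa> x))"
      by (rule integrable_mult_bounded[OF integral_slice_inner[OF G zG K[OF \<kappa>]]]) (use B in auto)
    have "(LBINT t. grad \<psi> t * (LBINT x. G (t, x) \<bullet> \<kappa> x)) =
        (LBINT t. grad \<psi> t * (LBINT x. P (t, x) \<bullet> \<kappa> x) -
          grad \<psi> t * (LBINT x. H (t, x) \<bullet> \<kappa> x))"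
    proof (rule integral_cong_AE)
      show "AE t in lborel. grad \<psi> t * (LBINT x. G (t, x) \<bullet> \<kappa> x) =
          grad \<psi> t * (LBINT x. P (t, x) \<bullet> \<kappa> x) - grad \<psi> t * (LBINT x. H (t, x) \<bullet> \<kappa> x)"
        using Gi by eventually_elim (use \<kappa> in \<open>simp add: right_diff_distrib\<close>)
    qed (use borel_measurable_integrable[OF iG] borel_measurable_integrable[OF iP] borel_measurable_integrable[OF iH] in auto)
    also have "\<dots> = (LBINT t. grad \<psi> t * (LBINT x. P (t, x) \<bullet> \<kappa> x)) -
        (LBINT t. grad \<psi> t * (LBINT x. H (t, x) \<bullet> \<kappa> x))"
      by (rule Bochner_Integration.integral_diff[OF iP iH])
    also have "(LBINT t. grad \<psi> t * (LBINT x. P (t, x) \<bullet> \<kappa> x)) =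
        - (LBINT t. \<psi> t * (LBINT x. k (t, x) \<bullet> \<kappa> x))"
      using weak[OF \<kappa> \<psi>] by (simp add: P_def inner_prod_def)
    also have "(LBINT t. grad \<psi> t * (LBINT x. H (t, x) \<bullet> \<kappa> x)) =
        (LBINT t. grad \<psi> t * (LBINT r. indicator {0..t} r * (LBINT x. k (r, x) \<bullet> \<kappa> x)))"
    proof (rule Bochner_Integration.integral_cong[OF refl])
      fix t :: real
      show "grad \<psi> t * (LBINT x. H (t, x) \<bullet> \<kappa> x) =
          grad \<psi> t * (LBINT r. indicator {0..t} r * (LBINT x. k (r, x) \<bullet> \<kappa> x))"
      proof (cases "t \<in> {0<..<T}")
        case True
        then show ?thesis using integral_time_integral_inner[OF k K[OF \<kappa>], of 0 t] by (simp add: H_def)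
      next
        case False
        then show ?thesis using test_functions_outside(2)[OF \<psi> False] by simp
      qed
    qed
    also have "\<dots> = - (LBINT t. \<psi> t * (LBINT x. k (t, x) \<bullet> \<kappa> x))"
      by (rule integral_by_parts_primitive[OF integral_slice_inner[OF k zk K[OF \<kappa>]] \<psi>])
    finally show ?thesis by simp
  qed
  obtain c where c: "AE t in lborel. t \<in> {0<..<T} \<longrightarrow> (\<forall>\<kappa>\<in>K. (LBINT x. G (t, x) \<bullet> \<kappa> x) = c \<kappa>)"
    by (rule slice_weakly_constant[OF G zG T K orth])
  \<comment> \<open>Square integrability of both slices is recorded as well, so that the inner
    products at two good times may be subtracted.\<close>
  define Good where "Good = {t \<in> {0<..<T}. in_closure K (\<lambda>x. U (t, x)) \<and>
      sq_integrable lborel (\<lambda>x. P (t, x)) \<and> sq_integrable lborel (\<lambda>x. H (t, x)) \<and>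
      (\<forall>\<kappa>\<in>K. (LBINT x. P (t, x) \<bullet> \<kappa> x) - (LBINT x. H (t, x) \<bullet> \<kappa> x) = c \<kappa>)}"
  show ?thesis
  proof (rule that[of Good], unfold good_times_def, intro conjI ballI allI impI)
    show "AE t in lborel. t \<in> {0<..<T} \<longrightarrow> t \<in> Good"
      using c cl Gi by eventually_elim (auto simp: Good_def)
    show "Good \<subseteq> {0<..<T}" by (auto simp: Good_def)
    show "in_closure K (\<lambda>x. U (t, x))" if "t \<in> Good" for t using that by (simp add: Good_def)
  next
    fix s t w assume s: "s \<in> Good" and t: "t \<in> Good" and st: "s \<le> t" and w: "in_closure K w"
    have s0: "0 \<le> s" using s by (auto simp: Good_def)
    have Hs: "H (r, x) = time_integral 0 r k x" if "r \<in> Good" for r x using that by (simp add: H_def Good_def)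
    have sq: "sq_integrable lborel (\<lambda>x. P (r, x))" "sq_integrable lborel (\<lambda>x. H (r, x))" if "r \<in> Good" for r
      using that by (simp_all add: Good_def)
    have ti: "sq_integrable lborel (time_integral s t k)" by (rule time_integral_sq_integrable[OF k st])
    have tiH: "(LBINT x. time_integral s t k x \<bullet> \<kappa> x) =
        (LBINT x. H (t, x) \<bullet> \<kappa> x) - (LBINT x. H (s, x) \<bullet> \<kappa> x)"
      if \<kappa>: "sq_integrable lborel \<kappa>" for \<kappa>
    proof -
      have "(LBINT x. time_integral s t k x \<bullet> \<kappa> x) = (LBINT x. (H (t, x) - H (s, x)) \<bullet> \<kappa> x)"
      proof (rule integral_cong_AE)
        note [measurable] = sq_integrableD(1)[OF \<kappa>] sq_integrableD(1)[OF ti] sq_integrableD(1)[OF sq(2)[OF s]] sq_integrableD(1)[OF sq(2)[OF t]]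
        show "(\<lambda>x. time_integral s t k x \<bullet> \<kappa> x) \<in> borel_measurable lborel"
          "(\<lambda>x. (H (t, x) - H (s, x)) \<bullet> \<kappa> x) \<in> borel_measurable lborel" by measurable
        show "AE x in lborel. time_integral s t k x \<bullet> \<kappa> x = (H (t, x) - H (s, x)) \<bullet> \<kappa> x"
          using time_integral_Icc_diff[OF k s0 st] by eventually_elim (simp add: Hs s t)
      qed
      then show ?thesis using sq_integrable_inner(1)[OF sq(2)[OF s] \<kappa>] sq_integrable_inner(1)[OF sq(2)[OF t] \<kappa>]
        by (simp add: inner_diff_left)
    qed
    have "(LBINT x. (P (t, x) - P (s, x)) \<bullet> w x) = (LBINT x. time_integral s t k x \<bullet> w x)"
    proof (rule in_closure_tendsto[OF w K])
      show "sq_integrable lborel (\<lambda>x. P (t, x) - P (s, x))" by (intro sq_integrable_diff sq s t)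
      fix \<kappa> assume \<kappa>: "\<kappa> \<in> K"
      have "(LBINT x. P (r, x) \<bullet> \<kappa> x) - (LBINT x. H (r, x) \<bullet> \<kappa> x) = c \<kappa>" if "r \<in> Good" for r
        using that \<kappa> by (simp add: Good_def)
      from this[OF s] this[OF t] show "(LBINT x. (P (t, x) - P (s, x)) \<bullet> \<kappa> x) = (LBINT x. time_integral s t k x \<bullet> \<kappa> x)"
        unfolding tiH[OF K[OF \<kappa>]]
        using sq_integrable_inner(1)[OF sq(1)[OF s] K[OF \<kappa>]] sq_integrable_inner(1)[OF sq(1)[OF t] K[OF \<kappa>]]
        by (simp add: inner_diff_left)
    qed (auto intro: ti)
    then show "(LBINT x. (fst (U (t, x)) - fst (U (s, x))) * fst (w x)) =
        (LBINT x. time_integral s t k x \<bullet> w x)"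
      by (simp add: P_def inner_prod_def)
  qed
qed

lemma norm2_mult_bounded:
  fixes g :: "'a \<Rightarrow> real" and f :: "'a \<Rightarrow> 'b::euclidean_space"
  assumes f: "sq_integrable M f" and g: "g \<in> borel_measurable M" and b: "\<And>x. \<bar>g x\<bar> \<le> B"
  shows "norm2 M (\<lambda>x. g x *\<^sub>R f x) \<le> \<bar>B\<bar> * norm2 M f"
proof (rule power2_le_imp_le)
  have s: "sq_integrable M (\<lambda>x. g x *\<^sub>R f x)"
    by (rule sq_integrable_mult_bounded[OF f g, of B]) (use b in auto)
  have "(norm2 M (\<lambda>x. g x *\<^sub>R f x))\<^sup>2 \<le> (norm2 M (\<lambda>x. B *\<^sub>R f x))\<^sup>2"
    unfolding norm2_power2
  proof (rule integral_mono[OF sq_integrableD(2)[OF s] sq_integrableD(2)[OF sq_integrable_scaleR[OF f]]])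
    fix x
    have "\<bar>g x\<bar> \<le> \<bar>B\<bar>" using b[of x] by linarith
    then have "norm (g x *\<^sub>R f x) \<le> norm (B *\<^sub>R f x)" by (simp add: mult_right_mono)
    then show "(norm (g x *\<^sub>R f x))\<^sup>2 \<le> (norm (B *\<^sub>R f x))\<^sup>2" by (intro power_mono) auto
  qed
  then show "(norm2 M (\<lambda>x. g x *\<^sub>R f x))\<^sup>2 \<le> (\<bar>B\<bar> * norm2 M f)\<^sup>2" by (simp add: norm2_scaleR)
qed (simp add: norm2_nonneg)

lemma translation_tendsto:
  fixes f :: "'a::euclidean_space \<Rightarrow> 'b::euclidean_space"
  assumes f: "sq_integrable lborel f" and h: "h \<longlonglongrightarrow> 0"
  shows "(\<lambda>n. norm2 lborel (\<lambda>x. f (x + h n) - f x)) \<longlonglongrightarrow> 0"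
proof (rule LIMSEQ_I)
  fix e :: real assume "0 < e"
  then obtain d where d: "d > 0" "\<And>h. norm h < d \<Longrightarrow> norm2 lborel (\<lambda>x. f (x + h) - f x) < e"
    using translation_continuous[OF f] by blast
  obtain N where N: "\<And>n. n \<ge> N \<Longrightarrow> norm (h n - 0) < d" using LIMSEQ_D[OF h d(1)] by blast
  show "\<exists>N. \<forall>n\<ge>N. norm (norm2 lborel (\<lambda>x. f (x + h n) - f x) - 0) < e"
    using N d(2) by (intro exI[of _ N]) (simp add: norm2_nonneg)
qed

section \<open>The product (u(t), v(t)) and its weak derivative\<close>

definition energy :: "(real \<times> 'x::euclidean_space \<Rightarrow> real \<times> 'e::euclidean_space) \<Rightarrow> (real \<times> 'x \<Rightarrow> real \<times> 'e) \<Rightarrow> real \<Rightarrow> real" where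
  "energy U V t = (LBINT x. fst (U (t, x)) * fst (V (t, x)))"

definition slice_inner :: "(real \<times> 'x::euclidean_space \<Rightarrow> 'b::euclidean_space) \<Rightarrow> (real \<times> 'x \<Rightarrow> 'b) \<Rightarrow> real \<Rightarrow> real" where
  "slice_inner k V t = (LBINT x. k (t, x) \<bullet> V (t, x))"

lemma slice_inner_integrable:
  assumes "sq_integrable lborel k" "sq_integrable lborel V"
  shows "integrable lborel (slice_inner k V)" "integral\<^sup>L lborel (slice_inner k V) = (LBINT z. k z \<bullet> V z)"
  using slice_integrable(2,3)[OF sq_integrable_inner(1)[OF assms]] by (simp_all add: slice_inner_def[abs_def])

lemma energy_integrable:
  assumes U: "sq_integrable lborel U" and V: "sq_integrable lborel V"
  shows "integrable lborel (energy U V)"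
  using slice_integrable(2)[OF sq_integrable_inner(1)[OF sq_integrable_fst[OF U] sq_integrable_fst[OF V]]]
  by (simp add: energy_def[abs_def])

text \<open>The discrete product rule in its asymmetric form: the increment of u is tested with v at
  the later time and that of v with u at the earlier one. Each test function is thus a slice at one
  of the two times and lies in the closure.\<close>

lemma energy_increment:
  assumes U: "sq_integrable lborel (\<lambda>x. U (s, x))" "sq_integrable lborel (\<lambda>x. U (t, x))"
    and V: "sq_integrable lborel (\<lambda>x. V (s, x))" "sq_integrable lborel (\<lambda>x. V (t, x))"
  shows "energy U V t - energy U V s =
    (LBINT x. (fst (U (t, x)) - fst (U (s, x))) * fst (V (t, x))) +
    (LBINT x. (fst (V (t, x)) - fst (V (s, x))) * fst (U (s, x)))"
proof -
  have i: "integrable lborel (\<lambda>x. fst (U (a, x)) * fst (V (b, x)))" if "a \<in> {s, t}" "b \<in> {s, t}" for a b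
    using sq_integrable_inner(1)[OF sq_integrable_fst sq_integrable_fst, of lborel "\<lambda>x. U (a, x)" "\<lambda>x. V (b, x)"]
      that U V by auto
  show ?thesis
    unfolding energy_def by (simp add: left_diff_distrib i mult.commute[of "fst (V _)"])
qed

text \<open>Room is needed at the upper end, since the shifts go forward in time.\<close>

lemma compact_subset_interval_margin:
  fixes K :: "real set"
  assumes "compact K" "K \<subseteq> {0<..<T}"
  obtains d where "0 < d" "\<And>x. x \<in> K \<Longrightarrow> x + d < T"
proof (cases "K = {}")
  case True
  then show ?thesis using that[of 1] by simp
next
  case False
  then obtain q where q: "q \<in> K" "\<And>x. x \<in> K \<Longrightarrow> x \<le> q"
    using compact_attains_sup[OF assms(1)] by blast
  show ?thesis
  proof (rule that[of "(T - q) / 2"])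
    show "0 < (T - q) / 2" using q(1) assms(2) by auto
    fix x assume "x \<in> K"
    then have "x \<le> q" "q < T" using q assms(2) by auto
    then show "x + (T - q) / 2 < T" by (simp add: field_simps)
  qed
qed

text \<open>Discrete integration by parts: a change of variables moves the difference quotient from
  the merely integrable F to \<psi>, where it is bounded by the Lipschitz constant and converges
  everywhere.\<close>

lemma test_function_difference_quotient:
  fixes \<psi> :: "real \<Rightarrow> real"
  assumes \<psi>: "\<psi> \<in> test_functions S" and F: "integrable lborel F"
    and h: "h \<longlonglongrightarrow> 0" "\<And>n. h n \<noteq> 0"
  shows "(\<lambda>n. (LBINT t. \<psi> t * ((F (t + h n) - F t) / h n))) \<longlonglongrightarrow>
    - (LBINT t. grad \<psi> t * F t)"
proof -
  have [measurable]: "F \<in> borel_measurable borel" using F by auto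
  obtain B where B: "\<And>x. \<bar>\<psi> x\<bar> \<le> B" "\<And>x y. \<bar>\<psi> x - \<psi> y\<bar> \<le> B * norm (x - y)"
    and [measurable]: "\<psi> \<in> borel_measurable borel" "grad \<psi> \<in> borel_measurable borel"
    using test_functions_bounds[OF \<psi>] by metis
  \<comment> \<open>The shift changes direction when it passes to \<psi>, hence the backward
    quotient.\<close>
  define q where "q n t = (\<psi> (t + (- h n)) - \<psi> t) / (- h n)" for n t
  have qm [measurable]: "q n \<in> borel_measurable borel" for n unfolding q_def[abs_def] by measurable
  have e: "(LBINT t. \<psi> t * ((F (t + h n) - F t) / h n)) = (LBINT t. - (q n t * F t))" for n
  proof -
    have Fh: "integrable lborel (\<lambda>t. F (t + h n))" using integral_lborel_translation(2)[of F "h n"] F by simp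
    have i1: "integrable lborel (\<lambda>t. \<psi> t * F (t + h n))"
      by (rule integrable_mult_bounded[OF Fh]) (use B in auto)
    have i2: "integrable lborel (\<lambda>t. \<psi> t * F t)"
      by (rule integrable_mult_bounded[OF F]) (use B in auto)
    have i3: "integrable lborel (\<lambda>t. \<psi> (t + (- h n)) * F t)"
      by (rule integrable_mult_bounded[OF F]) (use B in auto)
    have "(LBINT t. \<psi> (t + (- h n)) * F ((t + (- h n)) + h n)) = (LBINT t. \<psi> t * F (t + h n))"
      using integral_lborel_translation(1)[of "\<lambda>t. \<psi> t * F (t + h n)" "- h n"] by simp
    then have i4: "(LBINT t. \<psi> t * F (t + h n)) = (LBINT t. \<psi> (t + (- h n)) * F t)" by simp
    have "(LBINT t. \<psi> t * ((F (t + h n) - F t) / h n)) =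
        (LBINT t. (\<psi> t * F (t + h n) - \<psi> t * F t) / h n)"
      by (simp add: right_diff_distrib)
    also have "\<dots> = ((LBINT t. \<psi> (t + (- h n)) * F t) - (LBINT t. \<psi> t * F t)) / h n"
      using i1 i2 i4 by simp
    also have "\<dots> = (LBINT t. (\<psi> (t + (- h n)) * F t - \<psi> t * F t) / h n)"
      using i3 i2 by simp
    also have "\<dots> = (LBINT t. - (q n t * F t))"
      using h(2)[of n] by (intro Bochner_Integration.integral_cong refl) (simp add: q_def field_simps)
    finally show ?thesis .
  qed
  have "(\<lambda>n. (LBINT t. - (q n t * F t))) \<longlonglongrightarrow> (LBINT t. - (grad \<psi> t * F t))"
  proof (rule integral_dominated_convergence[where w = "\<lambda>t. B * \<bar>F t\<bar>"])
    show "integrable lborel (\<lambda>t. B * \<bar>F t\<bar>)" using F by simp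
    show "AE t in lborel. (\<lambda>n. - (q n t * F t)) \<longlonglongrightarrow> - (grad \<psi> t * F t)"
    proof (rule AE_I2)
      fix t
      have "(\<psi> has_real_derivative grad \<psi> t) (at t)"
        using test_functionsD(5)[OF \<psi>, of t] by (simp add: has_field_derivative_def)
      then have "((\<lambda>r. (\<psi> (t + r) - \<psi> t) / r) \<longlongrightarrow> grad \<psi> t) (at 0)" by (simp add: DERIV_def)
      moreover have "filterlim (\<lambda>n. - h n) (at 0) sequentially"
        using tendsto_minus[OF h(1)] h(2) by (simp add: filterlim_at)
      ultimately have "(\<lambda>n. q n t) \<longlonglongrightarrow> grad \<psi> t"
        unfolding q_def by (rule filterlim_compose)
      then show "(\<lambda>n. - (q n t * F t)) \<longlonglongrightarrow> - (grad \<psi> t * F t)" by (intro tendsto_intros)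
    qed
    show "AE t in lborel. norm (- (q n t * F t)) \<le> B * \<bar>F t\<bar>" for n
    proof (rule AE_I2)
      fix t
      have "\<bar>q n t\<bar> \<le> B"
        using B(2)[of "t + (- h n)" t] h(2)[of n] by (simp add: q_def abs_divide field_simps)
      then show "norm (- (q n t * F t)) \<le> B * \<bar>F t\<bar>" by (simp add: abs_mult mult_right_mono)
    qed
  qed measurable
  then show ?thesis unfolding e by simp
qed

text \<open>The difference quotients of the energy pair time averages of \<open>k\<close> and \<open>l\<close> with translates of
  \<open>V\<close> and \<open>U\<close>, so no regularity of the slices in time is needed.\<close>

lemma energy_weak_derivative:
  fixes U V k l :: "real \<times> 'x::euclidean_space \<Rightarrow> real \<times> 'e::euclidean_space"
  assumes ev: "weak_evolution T K U k" and ev': "weak_evolution T K V l" and \<psi>: "\<psi> \<in> test_functions {0<..<T}"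
  shows "(LBINT t. grad \<psi> t * energy U V t) =
    - (LBINT t. \<psi> t * (slice_inner k V t + slice_inner l U t))"
proof -
  note U = weak_evolutionD(3)[OF ev] and k = weak_evolutionD(4)[OF ev]
    and V = weak_evolutionD(3)[OF ev'] and l = weak_evolutionD(4)[OF ev']
  have [measurable]: "k \<in> borel_measurable borel" "l \<in> borel_measurable borel"
    using sq_integrableD(1)[OF k] sq_integrableD(1)[OF l] by auto
  obtain GU where "good_times T K U k GU" by (rule weak_evolution_increments[OF ev])
  note GU = good_timesD[OF this]
  obtain GV where "good_times T K V l GV" by (rule weak_evolution_increments[OF ev'])
  note GV = good_timesD[OF this]
  note sqU = GU(5) and sqV = GV(5)
  obtain B where B: "\<And>x. \<bar>\<psi> x\<bar> \<le> B" and \<psi>m [measurable]: "\<psi> \<in> borel_measurable borel"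
    using test_functions_bounds[OF \<psi>] by metis
  obtain C where C: "compact C" "C \<subseteq> {0<..<T}" "\<And>x. x \<notin> C \<Longrightarrow> \<psi> x = 0"
    using test_functions_support[OF \<psi>] by metis
  obtain d where d: "d > 0" "\<And>x. x \<in> C \<Longrightarrow> x + d < T" using compact_subset_interval_margin[OF C(1,2)] by blast
  define h where "h n = inverse (real (Suc n))" for n
  have h: "h \<longlonglongrightarrow> 0" "\<And>n. h n > 0" unfolding h_def[abs_def] using LIMSEQ_inverse_real_of_nat by auto
  \<comment> \<open>V appears at time t + h and U at time t, as in the discrete product rule; the
    shifted V converges by continuity of translations.\<close>
  define Vh where "Vh n z = \<psi> (fst z) *\<^sub>R V (z + (h n, 0))" for n z
  define \<psi>U where "\<psi>U z = \<psi> (fst z) *\<^sub>R U z" for z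
  define \<psi>V where "\<psi>V z = \<psi> (fst z) *\<^sub>R V z" for z
  define R where "R n t = slice_inner (time_average (h n) k) (Vh n) t + slice_inner (time_average (h n) l) \<psi>U t" for n t
  have \<psi>f: "(\<lambda>z::real \<times> 'x. \<psi> (fst z)) \<in> borel_measurable lborel"
  proof -
    have "(\<lambda>z. \<psi> (fst z)) \<in> borel_measurable (borel \<Otimes>\<^sub>M (borel :: 'x measure))" by measurable
    then show ?thesis by (simp add: borel_prod)
  qed
  have sq: "sq_integrable lborel (Vh n)" "sq_integrable lborel \<psi>U" "sq_integrable lborel \<psi>V" for n
    unfolding Vh_def \<psi>U_def \<psi>V_def
    by (rule sq_integrable_mult_bounded[OF _ \<psi>f, of _ B]; use B norm2_translation(1)[OF V] U V in simp)+
  have ta: "sq_integrable lborel (time_average (h n) k)" "sq_integrable lborel (time_average (h n) l)" for n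
    by (intro time_average_sq_integrable k l h)+
  \<comment> \<open>On the support of \<psi> both t and t + h lie in (0, T) and, for almost every t,
    are good times for both equations; off the support both sides vanish.\<close>
  have eq: "AE t in lborel. \<psi> t * ((energy U V (t + h n) - energy U V t) / h n) = R n t" if n: "h n < d" for n
  proof -
    have "AE t in lborel. h n + t \<in> {0<..<T} \<longrightarrow> h n + t \<in> GU"
      by (rule AE_lborel_translate[OF GU(1)])
    moreover have "AE t in lborel. h n + t \<in> {0<..<T} \<longrightarrow> h n + t \<in> GV"
      by (rule AE_lborel_translate[OF GV(1)])
    ultimately show ?thesis using GU(1) GV(1)
    proof eventually_elim
      case (elim t)
      have Rt: "R n t = \<psi> t * ((1 / h n) * ((LBINT x. time_integral t (t + h n) k x \<bullet> V (t + h n, x)) +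
          (LBINT x. time_integral t (t + h n) l x \<bullet> U (t, x))))"
        unfolding R_def slice_inner_def Vh_def \<psi>U_def
        by (simp add: time_average_eq ring_distribs)
      show ?case
      proof (cases "t \<in> C")
        case False
        then show ?thesis unfolding Rt using C(3)[OF False] by simp
      next
        case True
        then have "t \<in> {0<..<T}" "t + h n \<in> {0<..<T}" using C(2) d(2)[OF True] n h(2)[of n] by auto
        then have g: "t \<in> GU" "t \<in> GV" "t + h n \<in> GU" "t + h n \<in> GV" using elim by (auto simp: add.commute)
        have "energy U V (t + h n) - energy U V t =
            (LBINT x. time_integral t (t + h n) k x \<bullet> V (t + h n, x)) +
            (LBINT x. time_integral t (t + h n) l x \<bullet> U (t, x))"
          unfolding energy_increment[OF sqU[OF g(1)] sqU[OF g(3)] sqV[OF g(2)] sqV[OF g(4)]]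
          using GU(4)[OF g(1,3) _ GV(3)[OF g(4)]] GV(4)[OF g(2,4) _ GU(3)[OF g(1)]] h(2)[of n] by simp
        then show ?thesis unfolding Rt by simp
      qed
    qed
  qed
  have "(\<lambda>n. integral\<^sup>L lborel (R n)) \<longlonglongrightarrow> (LBINT z. k z \<bullet> \<psi>V z) + (LBINT z. l z \<bullet> \<psi>U z)"
  proof -
    have "integral\<^sup>L lborel (R n) = (LBINT z. time_average (h n) k z \<bullet> Vh n z) +
        (LBINT z. time_average (h n) l z \<bullet> \<psi>U z)" for n
      unfolding R_def using slice_inner_integrable[OF ta(1)[of n] sq(1)[of n]] slice_inner_integrable[OF ta(2)[of n] sq(2)]
      by simp
    moreover have "(\<lambda>n. (LBINT z. time_average (h n) k z \<bullet> Vh n z)) \<longlonglongrightarrow> (LBINT z. k z \<bullet> \<psi>V z)"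
    proof (rule tendsto_integral_inner[OF ta(1) k sq(1) sq(3)])
      show "(\<lambda>n. norm2 lborel (\<lambda>z. time_average (h n) k z - k z)) \<longlonglongrightarrow> 0"
        using time_average_tendsto[OF k] by (simp add: h_def)
      have lim: "(\<lambda>n. \<bar>B\<bar> * norm2 lborel (\<lambda>z. V (z + (h n, 0)) - V z)) \<longlonglongrightarrow> 0"
      proof -
        have "(\<lambda>n. (h n, 0 :: 'x)) \<longlonglongrightarrow> (0, 0)" by (intro tendsto_Pair h tendsto_const)
        then have "(\<lambda>n. norm2 lborel (\<lambda>z. V (z + (h n, 0)) - V z)) \<longlonglongrightarrow> 0"
          by (intro translation_tendsto[OF V]) (simp add: zero_prod_def)
        then show ?thesis by (rule tendsto_mult_right_zero)
      qed
      have "norm2 lborel (\<lambda>z. Vh n z - \<psi>V z) \<le> \<bar>B\<bar> * norm2 lborel (\<lambda>z. V (z + (h n, 0)) - V z)" for n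
        using norm2_mult_bounded[OF sq_integrable_diff[OF norm2_translation(1)[OF V] V] \<psi>f B, of "(h n, 0)"]
        by (simp add: Vh_def \<psi>V_def scaleR_diff_right)
      then show "(\<lambda>n. norm2 lborel (\<lambda>z. Vh n z - \<psi>V z)) \<longlonglongrightarrow> 0"
        by (intro Lim_null_comparison[OF always_eventually lim]) (simp add: norm2_nonneg)
    qed
    moreover have "(\<lambda>n. (LBINT z. time_average (h n) l z \<bullet> \<psi>U z)) \<longlonglongrightarrow> (LBINT z. l z \<bullet> \<psi>U z)"
      by (rule sq_integrable_const_tendsto[OF ta(2) l sq(2)])
        (use time_average_tendsto[OF l] in \<open>simp add: h_def\<close>)
    ultimately show ?thesis by (simp add: tendsto_add)
  qed
  moreover have "(LBINT z. k z \<bullet> \<psi>V z) + (LBINT z. l z \<bullet> \<psi>U z) =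
      (LBINT t. \<psi> t * (slice_inner k V t + slice_inner l U t))"
  proof -
    have 1: "slice_inner k \<psi>V = (\<lambda>t. \<psi> t * slice_inner k V t)" "slice_inner l \<psi>U = (\<lambda>t. \<psi> t * slice_inner l U t)"
      by (auto simp: slice_inner_def \<psi>V_def \<psi>U_def fun_eq_iff)
    note i = slice_inner_integrable[OF k sq(3)] slice_inner_integrable[OF l sq(2)]
    show ?thesis unfolding i(2,4)[symmetric] using i(1,3) unfolding 1 by (simp add: distrib_left)
  qed
  ultimately have 1: "(\<lambda>n. integral\<^sup>L lborel (R n)) \<longlonglongrightarrow> (LBINT t. \<psi> t * (slice_inner k V t + slice_inner l U t))" by simp
  have "(\<lambda>n. (LBINT t. \<psi> t * ((energy U V (t + h n) - energy U V t) / h n))) \<longlonglongrightarrow>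
      (LBINT t. \<psi> t * (slice_inner k V t + slice_inner l U t))"
  proof (rule Lim_transform_eventually[OF 1])
    have "\<forall>\<^sub>F n in sequentially. h n < d" by (rule order_tendstoD(2)[OF h(1) d(1)])
    then show "\<forall>\<^sub>F n in sequentially. integral\<^sup>L lborel (R n) = (LBINT t. \<psi> t * ((energy U V (t + h n) - energy U V t) / h n))"
    proof eventually_elim
      case (elim n)
      have [measurable]: "energy U V \<in> borel_measurable borel" using energy_integrable[OF U V] by auto
      have "R n \<in> borel_measurable lborel"
        unfolding R_def using slice_inner_integrable(1)[OF ta(1)[of n] sq(1)[of n]] slice_inner_integrable(1)[OF ta(2)[of n] sq(2)]
        by auto
      then show ?case using eq[OF elim] by (intro integral_cong_AE) auto
    qed
  qed
  from LIMSEQ_unique[OF this test_function_difference_quotient[OF \<psi> energy_integrable[OF U V] h(1)]] h(2)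
  show ?thesis by (metis less_irrefl minus_equation_iff)
qed

text \<open>The energy minus the primitive of its weak derivative is weakly constant. The constant c
  becomes the value at time 0 once continuity is known.\<close>

lemma energy_identity:
  fixes U V k l :: "real \<times> 'x::euclidean_space \<Rightarrow> real \<times> 'e::euclidean_space"
  assumes ev: "weak_evolution T K U k" and ev': "weak_evolution T K V l"
  obtains c where "AE t in lborel. t \<in> {0<..<T} \<longrightarrow>
    energy U V t = c + (LBINT r. indicator {0..t} r * (slice_inner k V r + slice_inner l U r))"
proof -
  note T = weak_evolutionD(1)[OF ev] and U = weak_evolutionD(3)[OF ev] and k = weak_evolutionD(4)[OF ev]
    and V = weak_evolutionD(3)[OF ev'] and l = weak_evolutionD(4)[OF ev']
  define D where "D r = slice_inner k V r + slice_inner l U r" for r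
  have D: "integrable lborel D"
    unfolding D_def by (intro Bochner_Integration.integrable_add slice_inner_integrable U V k l)
  have [measurable]: "D \<in> borel_measurable borel" using D by auto
  define DD where "DD t = (LBINT r. indicator {0..t} r * D r)" for t
  have DDm [measurable]: "DD \<in> borel_measurable borel"
    unfolding DD_def[abs_def] indicator_def atLeastAtMost_iff by measurable
  have DDb: "\<bar>DD t\<bar> \<le> (LBINT r. \<bar>D r\<bar>)" for t
  proof -
    have "\<bar>DD t\<bar> \<le> (LBINT r. norm (indicator {0..t} r * D r))"
      unfolding DD_def using integral_norm_bound[of lborel "\<lambda>r. indicator {0..t} r * D r"] by simp
    also have "\<dots> \<le> (LBINT r. \<bar>D r\<bar>)"
      by (rule integral_mono)
        (use D integrable_mult_indicator[OF _ D, of "{0..t}"] in \<open>auto simp: indicator_def\<close>)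
    finally show ?thesis .
  qed
  \<comment> \<open>The primitive is bounded but not integrable over the line; the cut-off repairs
    this and is invisible to derivatives of test functions in (0, T).\<close>
  define m where "m t = indicator {0<..<T} t * (energy U V t - DD t)" for t
  have E: "integrable lborel (energy U V)" by (rule energy_integrable[OF U V])
  have [measurable]: "energy U V \<in> borel_measurable borel" using E by auto
  have iDD: "integrable lborel (\<lambda>t. indicator {0<..<T} t * DD t)"
    by (rule Bochner_Integration.integrable_bound[OF integrable_indicator_bounded[of "{0<..<T}" "(LBINT r. \<bar>D r\<bar>)"]])
      (use DDb in \<open>auto simp: indicator_def intro!: AE_I2 intro: order_trans[OF _ abs_ge_self]\<close>)
  have m: "integrable lborel m"
  proof -
    have "integrable lborel (\<lambda>t. indicator {0<..<T} t * energy U V t)"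
      using integrable_mult_indicator[OF _ E, of "{0<..<T}"] by simp
    then show ?thesis unfolding m_def right_diff_distrib using iDD by (rule Bochner_Integration.integrable_diff)
  qed
  obtain c where c: "AE t in lborel. t \<in> {0<..<T} \<longrightarrow> m t = c"
  proof (rule weakly_constant[OF m T])
    fix \<psi> assume \<psi>: "\<psi> \<in> test_functions {0<..<T}"
    obtain B where B: "\<And>x. norm (grad \<psi> x) \<le> B" and [measurable]: "grad \<psi> \<in> borel_measurable borel"
      using test_functions_bounds[OF \<psi>] by metis
    have i1: "integrable lborel (\<lambda>t. grad \<psi> t * energy U V t)"
      by (rule integrable_mult_bounded[OF E]) (use B in auto)
    have "integrable lborel (\<lambda>t. grad \<psi> t * (indicator {0<..<T} t * DD t))"
      by (rule integrable_mult_bounded[OF iDD]) (use B in auto)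
    moreover have s: "grad \<psi> t * (indicator {0<..<T} t * y) = grad \<psi> t * y" for t y
      using test_functions_outside(2)[OF \<psi>, of t] by (auto simp: indicator_def)
    ultimately have i2: "integrable lborel (\<lambda>t. grad \<psi> t * DD t)" by (simp only: s)
    have "(LBINT t. grad \<psi> t * m t) =
        (LBINT t. grad \<psi> t * energy U V t) - (LBINT t. grad \<psi> t * DD t)"
      unfolding m_def s right_diff_distrib by (rule Bochner_Integration.integral_diff[OF i1 i2])
    also have "\<dots> = 0"
      using energy_weak_derivative[OF ev ev' \<psi>] integral_by_parts_primitive[OF D \<psi>] by (simp add: DD_def D_def)
    finally show "(LBINT t. grad \<psi> t * m t) = 0" .
  qed
  have "AE t in lborel. t \<in> {0<..<T} \<longrightarrow> energy U V t = c + DD t"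
    using c by eventually_elim (auto simp: m_def)
  then show ?thesis using that[of c] by (simp add: DD_def D_def)
qed

section \<open>The continuous representative\<close>

lemma small_interval_integral:
  fixes J :: "real \<Rightarrow> real"
  assumes J: "integrable lborel J" and e: "0 < e" "0 < T"
  obtains d where "0 < d" "d < T" "(LBINT r. indicator {t0 - d..t0 + d} r * J r) < e"
proof -
  define d where "d n = inverse (real (Suc n))" for n
  have d: "d \<longlonglongrightarrow> 0" "\<And>n. d n > 0" unfolding d_def[abs_def] using LIMSEQ_inverse_real_of_nat by auto
  have [measurable]: "J \<in> borel_measurable borel" using J by auto
  have "(\<lambda>n. (LBINT r. indicator {t0 - d n..t0 + d n} r * J r)) \<longlonglongrightarrow> integral\<^sup>L lborel (\<lambda>r::real. 0)"
  proof (rule integral_dominated_convergence[where w = "\<lambda>r. \<bar>J r\<bar>"])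
    show "AE r in lborel. (\<lambda>n. indicator {t0 - d n..t0 + d n} r * J r) \<longlonglongrightarrow> 0"
      using AE_lborel_singleton[of t0]
    proof eventually_elim
      case (elim r)
      have "\<forall>\<^sub>F n in sequentially. d n < \<bar>r - t0\<bar>"
        by (rule order_tendstoD(2)[OF d(1)]) (use elim in simp)
      then show ?case
        by (intro tendsto_eventually, eventually_elim) (auto simp: indicator_def)
    qed
    show "AE r in lborel. norm (indicator {t0 - d n..t0 + d n} r * J r) \<le> \<bar>J r\<bar>" for n
      by (auto simp: indicator_def)
  qed (use J in auto)
  then have "\<forall>\<^sub>F n in sequentially. (LBINT r. indicator {t0 - d n..t0 + d n} r * J r) < e"
    by (intro order_tendstoD(2)[where y = "integral\<^sup>L lborel (\<lambda>r::real. 0 :: real)"]) (use e in auto)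
  moreover have "\<forall>\<^sub>F n in sequentially. d n < T" by (rule order_tendstoD(2)[OF d(1) e(2)])
  ultimately have "\<forall>\<^sub>F n in sequentially. (LBINT r. indicator {t0 - d n..t0 + d n} r * J r) < e \<and> d n < T"
    by (rule eventually_conj)
  from eventually_happens'[OF sequentially_bot this]
  obtain n where "(LBINT r. indicator {t0 - d n..t0 + d n} r * J r) < e \<and> d n < T" ..
  then show ?thesis using that[of "d n"] d(2)[of n] by simp
qed

lemma AE_interval_ex:
  fixes a b :: real
  assumes "AE t in lborel. t \<in> {a<..<b} \<longrightarrow> P t" "a < b"
  obtains t where "t \<in> {a<..<b}" "P t"
proof -
  have "\<exists>t\<in>{a<..<b}. P t"
  proof (rule ccontr)
    assume "\<not> ?thesis"
    then have "AE t in lborel. t \<notin> {a<..<b}" using assms(1) by (auto elim: AE_mp)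
    then have "{a<..<b} \<in> null_sets lborel" by (subst AE_iff_null_sets) auto
    then show False using assms(2) by (simp add: null_sets_def)
  qed
  then show ?thesis using that by blast
qed

text \<open>In \<open>|u(t) - u(s)|\<^sup>2 = |u(t)|\<^sup>2 - |u(s)|\<^sup>2 - 2 (u(t) - u(s), u(s))\<close> the energy identity controls the
  difference of the first two terms, and the evolution equation the last one if \<open>U(s)\<close> is not
  too large.\<close>

lemma energy_oscillation:
  fixes U k :: "real \<times> 'x::euclidean_space \<Rightarrow> real \<times> 'e::euclidean_space"
  assumes U: "sq_integrable lborel U" and k: "sq_integrable lborel k" and good: "good_times T K U k Good"
    and E: "\<And>t. t \<in> Good \<Longrightarrow> energy U U t = c + (LBINT r. indicator {0..t} r * D r)"
    and D: "integrable lborel D"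
    and s: "s \<in> Good" "s \<in> {a..b}" and t: "t \<in> Good" "t \<in> {a..b}"
    and J: "(LBINT r. indicator {a..b} r * (\<bar>D r\<bar> + (norm2 lborel (\<lambda>x. k (r, x)))\<^sup>2)) \<le> \<eta>"
    and sU: "(b - a) * (norm2 lborel (\<lambda>x. U (s, x)))\<^sup>2 \<le> 2 * \<eta>"
  shows "(norm2 lborel (\<lambda>x. fst (U (t, x)) - fst (U (s, x))))\<^sup>2 \<le> 4 * \<eta>"
proof -
  note G = good_timesD[OF good]
  have [measurable]: "D \<in> borel_measurable borel" using D by auto
  note fs = sq_integrable_fst[OF G(5)[OF s(1)]] and ft = sq_integrable_fst[OF G(5)[OF t(1)]]
  note k2 = slice_sq_integrable(2)[OF k]
  have iD: "integrable lborel (\<lambda>r. indicator {p..q} r * \<bar>D r\<bar>)" for p q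
    using integrable_mult_indicator[OF _ integrable_abs[OF D], of "{p..q}"] by simp
  have iD': "integrable lborel (\<lambda>r. indicator {p..q} r * D r)" for p q
    using integrable_mult_indicator[OF _ D, of "{p..q}"] by simp
  have ik: "integrable lborel (\<lambda>r. indicator {p..q} r * (norm2 lborel (\<lambda>x. k (r, x)))\<^sup>2)" for p q
    using integrable_mult_indicator[OF _ k2, of "{p..q}"] by simp
  have Jsplit: "(LBINT r. indicator {a..b} r * \<bar>D r\<bar>) +
      (LBINT r. indicator {a..b} r * (norm2 lborel (\<lambda>x. k (r, x)))\<^sup>2) \<le> \<eta>"
    using J iD[of a b] ik[of a b] by (simp add: distrib_left)
  have D0: "0 \<le> (LBINT r. indicator {a..b} r * \<bar>D r\<bar>)"
    and k0: "0 \<le> (LBINT r. indicator {a..b} r * (norm2 lborel (\<lambda>x. k (r, x)))\<^sup>2)"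
    by (intro Bochner_Integration.integral_nonneg; simp)+
  have \<eta>: "0 \<le> \<eta>" using Jsplit D0 k0 by linarith
  have ED: "\<bar>energy U U t - energy U U s\<bar> \<le> \<eta>"
  proof -
    have "energy U U t - energy U U s = (LBINT r. indicator {0..t} r * D r - indicator {0..s} r * D r)"
      unfolding E[OF s(1)] E[OF t(1)] using iD' by simp
    also have "\<bar>\<dots>\<bar> \<le> (LBINT r. norm (indicator {0..t} r * D r - indicator {0..s} r * D r))"
      using integral_norm_bound[of lborel "\<lambda>r. indicator {0..t} r * D r - indicator {0..s} r * D r"] by simp
    also have "\<dots> \<le> (LBINT r. indicator {a..b} r * \<bar>D r\<bar>)"
    proof (rule integral_mono[OF _ iD])
      show "integrable lborel (\<lambda>r. norm (indicator {0..t} r * D r - indicator {0..s} r * D r))"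
        by (intro integrable_norm Bochner_Integration.integrable_diff iD')
      show "norm (indicator {0..t} r * D r - indicator {0..s} r * D r) \<le> indicator {a..b} r * \<bar>D r\<bar>" for r
        using s t by (auto simp: indicator_def)
    qed
    finally show ?thesis using Jsplit k0 by linarith
  qed
  \<comment> \<open>The integrated equation is oriented from the earlier to the later time; general
    p \<le> q allows s to be either of them.\<close>
  have cross: "\<bar>(LBINT x. (fst (U (q, x)) - fst (U (p, x))) * fst (U (s, x)))\<bar> \<le> 3 / 2 * \<eta>"
    if p: "p \<in> Good" "p \<in> {a..b}" and q: "q \<in> Good" "q \<in> {a..b}" and pq: "p \<le> q" for p q
  proof -
    note ti = time_integral_sq_integrable[OF k pq]
    have "(LBINT r. indicator {p..q} r * (norm2 lborel (\<lambda>x. k (r, x)))\<^sup>2) \<le>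
        (LBINT r. indicator {a..b} r * (norm2 lborel (\<lambda>x. k (r, x)))\<^sup>2)"
      by (rule integral_mono[OF ik ik]) (use p q in \<open>auto simp: indicator_def\<close>)
    also have "\<dots> \<le> \<eta>" using Jsplit D0 by linarith
    finally have "(q - p) * (LBINT r. indicator {p..q} r * (norm2 lborel (\<lambda>x. k (r, x)))\<^sup>2) \<le> (b - a) * \<eta>"
      using p q pq \<eta> by (intro mult_mono Bochner_Integration.integral_nonneg) auto
    then have tk: "(norm2 lborel (time_integral p q k))\<^sup>2 \<le> (b - a) * \<eta>" using ti(2) by linarith
    have "\<bar>(LBINT x. (fst (U (q, x)) - fst (U (p, x))) * fst (U (s, x)))\<bar> =
        \<bar>(LBINT x. time_integral p q k x \<bullet> U (s, x))\<bar>"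
      using G(4)[OF p(1) q(1) pq G(3)[OF s(1)]] by simp
    also have "\<dots> \<le> norm2 lborel (time_integral p q k) * norm2 lborel (\<lambda>x. U (s, x))"
      by (rule Cauchy_Schwarz_norm2[OF ti(1) G(5)[OF s(1)]])
    also have "\<dots> \<le> 3 / 2 * \<eta>"
    proof (rule power2_le_imp_le)
      have "(norm2 lborel (time_integral p q k) * norm2 lborel (\<lambda>x. U (s, x)))\<^sup>2 \<le>
          ((b - a) * \<eta>) * (norm2 lborel (\<lambda>x. U (s, x)))\<^sup>2"
        unfolding power_mult_distrib by (intro mult_right_mono tk) simp
      also have "\<dots> = ((b - a) * (norm2 lborel (\<lambda>x. U (s, x)))\<^sup>2) * \<eta>" by (simp add: mult_ac)
      also have "\<dots> \<le> (2 * \<eta>) * \<eta>" by (intro mult_right_mono sU \<eta>)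
      \<comment> \<open>The rational number 3/2 replaces the square root of 2.\<close>
      also have "\<dots> \<le> (3 / 2 * \<eta>)\<^sup>2" by (simp add: power2_eq_square)
      finally show "(norm2 lborel (time_integral p q k) * norm2 lborel (\<lambda>x. U (s, x)))\<^sup>2 \<le> (3 / 2 * \<eta>)\<^sup>2" .
    qed (use \<eta> in simp)
    finally show ?thesis .
  qed
  have cr: "\<bar>(LBINT x. (fst (U (t, x)) - fst (U (s, x))) * fst (U (s, x)))\<bar> \<le> 3 / 2 * \<eta>"
  proof (cases "s \<le> t")
    case True
    then show ?thesis by (rule cross[OF s t])
  next
    case False
    have "(LBINT x. (fst (U (t, x)) - fst (U (s, x))) * fst (U (s, x))) =
        - (LBINT x. (fst (U (s, x)) - fst (U (t, x))) * fst (U (s, x)))"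
      unfolding Bochner_Integration.integral_minus[symmetric] by (simp add: algebra_simps)
    then show ?thesis using cross[OF t s] False by simp
  qed
  have en: "energy U U r = (norm2 lborel (\<lambda>x. fst (U (r, x))))\<^sup>2" for r
    unfolding energy_def norm2_power2 by (simp add: power2_eq_square)
  have i: "integrable lborel (\<lambda>x. fst (U (t, x)) * fst (U (s, x)))" "integrable lborel (\<lambda>x. fst (U (s, x)) * fst (U (s, x)))"
    using sq_integrable_inner(1)[OF ft fs] sq_integrable_inner(1)[OF fs fs] by auto
  \<comment> \<open>One \<eta> from the energies and twice 3/2 \<eta> from the cross term give the
    factor 4.\<close>
  have "(norm2 lborel (\<lambda>x. fst (U (t, x)) - fst (U (s, x))))\<^sup>2 =
      energy U U t - energy U U s - 2 * (LBINT x. (fst (U (t, x)) - fst (U (s, x))) * fst (U (s, x)))"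
    unfolding norm2_diff_power2[OF ft fs] left_diff_distrib Bochner_Integration.integral_diff[OF i] en
    by (simp add: energy_def[symmetric] en)
  then show ?thesis using ED cr by linarith
qed

text \<open>Near every time t0, endpoints included, u is uniformly Cauchy along good times: all of
  them are compared with one reference time s at which U(s) is not large. Completeness defines w(t0)
  as the limit along good times, which makes w continuous on the closed interval.\<close>

lemma continuous_representative:
  fixes U k :: "real \<times> 'x::euclidean_space \<Rightarrow> real \<times> 'e::euclidean_space"
  assumes ev: "weak_evolution T K U k"
  obtains w where "\<And>t. t \<in> {0..T} \<Longrightarrow> sq_integrable lborel (w t)"
    "\<And>t. t \<in> {0..T} \<Longrightarrow> ((\<lambda>s. norm2 lborel (\<lambda>x. w s x - w t x)) \<longlongrightarrow> 0) (at t within {0..T})"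
    "AE t in lborel. t \<in> {0<..<T} \<longrightarrow> (AE x in lborel. w t x = fst (U (t, x)))"
proof -
  note T = weak_evolutionD(1)[OF ev] and U = weak_evolutionD(3)[OF ev] and k = weak_evolutionD(4)[OF ev]
  obtain Good0 where good0: "good_times T K U k Good0" by (rule weak_evolution_increments[OF ev])
  define D where "D r = slice_inner k U r + slice_inner k U r" for r
  have D: "integrable lborel D"
    unfolding D_def by (intro Bochner_Integration.integrable_add slice_inner_integrable U k)
  obtain c where c: "AE t in lborel. t \<in> {0<..<T} \<longrightarrow> energy U U t = c + (LBINT r. indicator {0..t} r * D r)"
    using energy_identity[OF ev ev] unfolding D_def by blast
  define Good where "Good = {t \<in> Good0. energy U U t = c + (LBINT r. indicator {0..t} r * D r)}"
  have aeG: "AE t in lborel. t \<in> {0<..<T} \<longrightarrow> t \<in> Good"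
    using good_timesD(1)[OF good0] c by eventually_elim (auto simp: Good_def)
  have good: "good_times T K U k Good"
    using good0 aeG unfolding good_times_def Good_def by auto
  have E: "energy U U t = c + (LBINT r. indicator {0..t} r * D r)" if "t \<in> Good" for t
    using that by (simp add: Good_def)
  note G = good_timesD[OF good]
  define u where "u t x = fst (U (t, x))" for t x
  have us: "sq_integrable lborel (u t)" if "t \<in> Good" for t
    unfolding u_def by (rule sq_integrable_fst[OF G(5)[OF that]])
  have near: "\<exists>d>0. \<forall>t\<in>Good. \<forall>t'\<in>Good. \<bar>t - t0\<bar> < d \<longrightarrow> \<bar>t' - t0\<bar> < d \<longrightarrow> norm2 lborel (\<lambda>x. u t x - u t' x) \<le> e"
    if t0: "t0 \<in> {0..T}" and e: "0 < e" for t0 e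
  proof -
    \<comment> \<open>Then 4 \<eta> is the square of e / 2, one half for each comparison with the
      reference time.\<close>
    define \<eta> where "\<eta> = (e / 4)\<^sup>2"
    have \<eta>: "\<eta> > 0" using e by (simp add: \<eta>_def)
    \<comment> \<open>One density collects everything that must have a small integral near t0: the
      change of energy, the right-hand side, and U itself for the choice of s.\<close>
    define Z where "Z r = \<bar>D r\<bar> + (norm2 lborel (\<lambda>x. k (r, x)))\<^sup>2 + (norm2 lborel (\<lambda>x. U (r, x)))\<^sup>2" for r
    have Z: "integrable lborel Z"
      unfolding Z_def by (intro Bochner_Integration.integrable_add integrable_abs D slice_sq_integrable(2) k U)
    obtain d where d: "0 < d" "d < T" "(LBINT r. indicator {t0 - d..t0 + d} r * Z r) < \<eta>"
      by (rule small_interval_integral[OF Z \<eta> T])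
    let ?I = "{t0 - d..t0 + d}"
    have iZ: "integrable lborel (\<lambda>r. indicator ?I r * Z r)"
      using integrable_mult_indicator[OF _ Z, of ?I] by simp
    have i1: "integrable lborel (\<lambda>r. indicator ?I r * (\<bar>D r\<bar> + (norm2 lborel (\<lambda>x. k (r, x)))\<^sup>2))"
      using integrable_mult_indicator[OF _ Bochner_Integration.integrable_add[OF integrable_abs[OF D] slice_sq_integrable(2)[OF k]], of ?I] by simp
    have J: "(LBINT r. indicator ?I r * (\<bar>D r\<bar> + (norm2 lborel (\<lambda>x. k (r, x)))\<^sup>2)) \<le> \<eta>"
    proof -
      have "(LBINT r. indicator ?I r * (\<bar>D r\<bar> + (norm2 lborel (\<lambda>x. k (r, x)))\<^sup>2)) \<le>
          (LBINT r. indicator ?I r * Z r)"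
        by (rule integral_mono[OF i1 iZ]) (auto simp: indicator_def Z_def)
      then show ?thesis using d(3) by linarith
    qed
    \<comment> \<open>Near an endpoint the interval is cut, but because d < T it keeps length at
      least d.\<close>
    define a where "a = max 0 (t0 - d)"
    define b where "b = min T (t0 + d)"
    have ab: "d \<le> b - a" "{a<..<b} \<subseteq> {0<..<T}" "{a<..<b} \<subseteq> ?I"
      using t0 d(1,2) by (auto simp: a_def b_def)
    \<comment> \<open>Chebyshev's argument: if the squared norm of U exceeded \<eta> / d at every
      good time, its integral over an interval of length at least d would reach \<eta>.\<close>
    have "\<exists>s\<in>Good. s \<in> ?I \<and> (norm2 lborel (\<lambda>x. U (s, x)))\<^sup>2 \<le> \<eta> / d"
    proof (rule ccontr)
      assume neg: "\<not> ?thesis"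
      have i2: "integrable lborel (\<lambda>r. indicator {a<..<b} r * (\<eta> / d))"
        by (rule integrable_indicator_bounded) auto
      have "\<eta> \<le> (b - a) * (\<eta> / d)" using mult_right_mono[OF ab(1), of "\<eta> / d"] \<eta> d(1) by simp
      also have "\<dots> = (LBINT r. indicator {a<..<b} r * (\<eta> / d))" using ab(1) d(1) by simp
      also have "\<dots> \<le> (LBINT r. indicator ?I r * Z r)"
      proof (rule integral_mono_AE[OF i2 iZ])
        show "AE r in lborel. indicator {a<..<b} r * (\<eta> / d) \<le> indicator ?I r * Z r"
          using aeG
        proof eventually_elim
          case (elim r)
          show ?case
          proof (cases "r \<in> {a<..<b}")
            case True
            then have "r \<in> Good" "r \<in> ?I" using ab elim by auto
            then have "\<eta> / d \<le> (norm2 lborel (\<lambda>x. U (r, x)))\<^sup>2" using neg by (metis linear)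
            also have "\<dots> \<le> Z r" unfolding Z_def by simp
            finally show ?thesis using True \<open>r \<in> ?I\<close> by simp
          next
            case False
            then show ?thesis by (simp add: Z_def)
          qed
        qed
      qed
      finally show False using d(3) by linarith
    qed
    then obtain s where s: "s \<in> Good" "s \<in> ?I" "(norm2 lborel (\<lambda>x. U (s, x)))\<^sup>2 \<le> \<eta> / d" by blast
    have sU: "((t0 + d) - (t0 - d)) * (norm2 lborel (\<lambda>x. U (s, x)))\<^sup>2 \<le> 2 * \<eta>"
      using s(3) d(1) by (simp add: field_simps)
    have step: "norm2 lborel (\<lambda>x. u t x - u s x) \<le> e / 2" if t: "t \<in> Good" "\<bar>t - t0\<bar> < d" for t
    proof (rule power2_le_imp_le)
      have tI: "t \<in> ?I" using t(2) by auto
      have "(norm2 lborel (\<lambda>x. u t x - u s x))\<^sup>2 \<le> 4 * \<eta>"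
        unfolding u_def by (rule energy_oscillation[OF U k good E D s(1,2) t(1) tI J sU])
      also have "4 * \<eta> = (e / 2)\<^sup>2" by (simp add: \<eta>_def power2_eq_square)
      finally show "(norm2 lborel (\<lambda>x. u t x - u s x))\<^sup>2 \<le> (e / 2)\<^sup>2" .
    qed (use e in simp)
    have "norm2 lborel (\<lambda>x. u t x - u t' x) \<le> e" if t: "t \<in> Good" "\<bar>t - t0\<bar> < d" and t': "t' \<in> Good" "\<bar>t' - t0\<bar> < d" for t t'
      using norm2_triangle_via[OF us[OF t(1)] us[OF s(1)] us[OF t'(1)]] step[OF t] step[OF t']
        norm2_minus_commute[of lborel "u s" "u t'"] by linarith
    then show ?thesis using d(1) by blast
  qed
  have dense: "\<exists>t\<in>Good. \<bar>t - t0\<bar> < d" if t0: "t0 \<in> {0..T}" and d: "0 < d" for t0 d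
  proof -
    have "AE t in lborel. t \<in> {max 0 (t0 - d)<..<min T (t0 + d)} \<longrightarrow> t \<in> Good"
      using aeG by eventually_elim auto
    then obtain t where "t \<in> {max 0 (t0 - d)<..<min T (t0 + d)}" "t \<in> Good"
      by (rule AE_interval_ex) (use t0 d T in auto)
    then show ?thesis by (intro bexI[of _ t]) auto
  qed
  have "\<exists>w. sq_integrable lborel w \<and>
      (\<forall>e>0. \<exists>d>0. \<forall>t\<in>Good. \<bar>t - t0\<bar> < d \<longrightarrow> norm2 lborel (\<lambda>x. u t x - w x) \<le> e)"
    if t0: "t0 \<in> {0..T}" for t0
  proof -
    have "\<exists>t. t \<in> Good \<and> \<bar>t - t0\<bar> < inverse (Suc n)" for n using dense[OF t0, of "inverse (Suc n)"] by auto
    then obtain \<tau> where \<tau>: "\<And>n. \<tau> n \<in> Good" "\<And>n. \<bar>\<tau> n - t0\<bar> < inverse (Suc n)" by metis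
    have \<tau>close: "\<exists>N. \<forall>n\<ge>N. \<bar>\<tau> n - t0\<bar> < d" if d: "0 < d" for d
    proof -
      obtain N where N: "inverse (real (Suc N)) < d" using reals_Archimedean[OF d] by blast
      have "\<bar>\<tau> n - t0\<bar> < d" if "n \<ge> N" for n
        by (rule less_trans[OF less_le_trans[OF \<tau>(2)] N]) (use that in \<open>auto intro!: le_imp_inverse_le\<close>)
      then show ?thesis by blast
    qed
    \<comment> \<open>A sequence of good times is used only to produce the limit; convergence along
      all good times follows from the uniform Cauchy property.\<close>
    obtain w where w: "sq_integrable lborel w" "(\<lambda>n. norm2 lborel (\<lambda>x. u (\<tau> n) x - w x)) \<longlonglongrightarrow> 0"
    proof (rule norm2_complete[of lborel "\<lambda>n. u (\<tau> n)"])
      fix e :: real assume e: "0 < e"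
      obtain d where d: "0 < d" "\<And>t t'. t \<in> Good \<Longrightarrow> t' \<in> Good \<Longrightarrow> \<bar>t - t0\<bar> < d \<Longrightarrow> \<bar>t' - t0\<bar> < d \<Longrightarrow>
          norm2 lborel (\<lambda>x. u t x - u t' x) \<le> e"
        using near[OF t0 e] by blast
      obtain N where N: "\<And>n. n \<ge> N \<Longrightarrow> \<bar>\<tau> n - t0\<bar> < d" using \<tau>close[OF d(1)] by blast
      show "\<exists>N. \<forall>m\<ge>N. \<forall>n\<ge>N. norm2 lborel (\<lambda>x. u (\<tau> m) x - u (\<tau> n) x) \<le> e"
        using d(2)[OF \<tau>(1) \<tau>(1)] N by (intro exI[of _ N]) auto
    qed (auto intro: us \<tau>)
    have "\<exists>d>0. \<forall>t\<in>Good. \<bar>t - t0\<bar> < d \<longrightarrow> norm2 lborel (\<lambda>x. u t x - w x) \<le> e" if e: "0 < e" for e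
    proof -
      have e2: "0 < e / 2" using e by simp
      obtain d where d: "0 < d" "\<And>t t'. t \<in> Good \<Longrightarrow> t' \<in> Good \<Longrightarrow> \<bar>t - t0\<bar> < d \<Longrightarrow> \<bar>t' - t0\<bar> < d \<Longrightarrow>
          norm2 lborel (\<lambda>x. u t x - u t' x) \<le> e / 2"
        using near[OF t0 e2] by blast
      obtain N where N: "\<And>n. n \<ge> N \<Longrightarrow> \<bar>\<tau> n - t0\<bar> < d" using \<tau>close[OF d(1)] by blast
      have "\<forall>\<^sub>F n in sequentially. norm2 lborel (\<lambda>x. u (\<tau> n) x - w x) < e / 2"
        by (rule order_tendstoD(2)[OF w(2) e2])
      then obtain M where M: "\<And>n. n \<ge> M \<Longrightarrow> norm2 lborel (\<lambda>x. u (\<tau> n) x - w x) < e / 2"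
        unfolding eventually_sequentially by blast
      define n where "n = max M N"
      have "norm2 lborel (\<lambda>x. u t x - w x) \<le> e" if t: "t \<in> Good" "\<bar>t - t0\<bar> < d" for t
        using norm2_triangle_via[OF us[OF t(1)] us[OF \<tau>(1)[of n]] w(1)] d(2)[OF t(1) \<tau>(1)[of n] t(2) N[of n]] M[of n]
        by (simp add: n_def)
      then show ?thesis using d(1) by blast
    qed
    then show ?thesis using w(1) by blast
  qed
  then have "\<forall>t0\<in>{0..T}. \<exists>w. sq_integrable lborel w \<and>
      (\<forall>e>0. \<exists>d>0. \<forall>t\<in>Good. \<bar>t - t0\<bar> < d \<longrightarrow> norm2 lborel (\<lambda>x. u t x - w x) \<le> e)" by (rule ballI)
  from bchoice[OF this] obtain w where w: "\<And>t0. t0 \<in> {0..T} \<Longrightarrow> sq_integrable lborel (w t0)"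
    "\<And>t0 e. t0 \<in> {0..T} \<Longrightarrow> 0 < e \<Longrightarrow> \<exists>d>0. \<forall>t\<in>Good. \<bar>t - t0\<bar> < d \<longrightarrow> norm2 lborel (\<lambda>x. u t x - w t0 x) \<le> e"
    by blast
  show ?thesis
  proof (rule that[of w])
    show "sq_integrable lborel (w t)" if "t \<in> {0..T}" for t by (rule w(1)[OF that])
    show "((\<lambda>s. norm2 lborel (\<lambda>x. w s x - w t x)) \<longlongrightarrow> 0) (at t within {0..T})" if t: "t \<in> {0..T}" for t
    proof (rule tendstoI)
      fix e :: real assume e: "0 < e"
      then have e3: "0 < e / 3" by simp
      obtain d where d: "0 < d" "\<And>r. r \<in> Good \<Longrightarrow> \<bar>r - t\<bar> < d \<Longrightarrow> norm2 lborel (\<lambda>x. u r x - w t x) \<le> e / 3"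
        using w(2)[OF t e3] by blast
      have "norm2 lborel (\<lambda>x. w s x - w t x) < e" if s: "s \<in> {0..T}" "\<bar>s - t\<bar> < d / 2" for s
      proof -
        obtain d' where d': "0 < d'" "\<And>r. r \<in> Good \<Longrightarrow> \<bar>r - s\<bar> < d' \<Longrightarrow> norm2 lborel (\<lambda>x. u r x - w s x) \<le> e / 3"
          using w(2)[OF s(1) e3] by blast
        obtain r where r: "r \<in> Good" "\<bar>r - s\<bar> < min d' (d / 2)"
          using dense[OF s(1), of "min d' (d / 2)"] d(1) d'(1) by auto
        have "\<bar>r - t\<bar> < d" using r(2) s(2) by linarith
        then have "norm2 lborel (\<lambda>x. u r x - w t x) \<le> e / 3" by (rule d(2)[OF r(1)])
        moreover have "norm2 lborel (\<lambda>x. w s x - u r x) \<le> e / 3"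
          using d'(2)[OF r(1)] r(2) norm2_minus_commute[of lborel "w s" "u r"] by simp
        ultimately show ?thesis
          using norm2_triangle_via[OF w(1)[OF s(1)] us[OF r(1)] w(1)[OF t]] e by linarith
      qed
      then show "\<forall>\<^sub>F s in at t within {0..T}. dist (norm2 lborel (\<lambda>x. w s x - w t x)) 0 < e"
        unfolding eventually_at using d(1) by (intro exI[of _ "d / 2"]) (auto simp: dist_real_def norm2_nonneg)
    qed
    show "AE t in lborel. t \<in> {0<..<T} \<longrightarrow> (AE x in lborel. w t x = fst (U (t, x)))"
      using aeG
    proof eventually_elim
      case (elim t)
      show ?case
      proof
        assume t: "t \<in> {0<..<T}"
        then have tG: "t \<in> Good" and t': "t \<in> {0..T}" using elim by auto
        have sq: "sq_integrable lborel (\<lambda>x. u t x - w t x)" by (intro sq_integrable_diff us tG w(1) t')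
        have "norm2 lborel (\<lambda>x. u t x - w t x) \<le> e" if "0 < e" for e
          using w(2)[OF t' that] tG by auto
        then have "norm2 lborel (\<lambda>x. u t x - w t x) \<le> 0" by (rule field_le_epsilon[of _ 0, simplified])
        then have "(norm2 lborel (\<lambda>x. u t x - w t x))\<^sup>2 = 0"
          using norm2_nonneg[of lborel "\<lambda>x. u t x - w t x"] by simp
        then have "AE x in lborel. (norm (u t x - w t x))\<^sup>2 = 0"
          unfolding norm2_power2 using sq_integrableD(2)[OF sq]
          by (subst (asm) integral_nonneg_eq_0_iff_AE) auto
        then show "AE x in lborel. w t x = fst (U (t, x))"
          by eventually_elim (simp add: u_def)
      qed
    qed
  qed
qed

section \<open>Square roots of matrices\<close>

definition op_bound :: "real ^ 'n ^ 'n \<Rightarrow> real \<Rightarrow> bool" where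
  "op_bound X r \<longleftrightarrow> (\<forall>y. norm (X *v y) \<le> r * norm y)"

lemma op_boundD: "op_bound X r \<Longrightarrow> norm (X *v y) \<le> r * norm y"
  by (simp add: op_bound_def)

lemma op_bound_mult:
  assumes "op_bound X r" "op_bound Y s" "0 \<le> r"
  shows "op_bound (X ** Y) (r * s)"
  unfolding op_bound_def
proof
  fix y
  have "norm (X *v (Y *v y)) \<le> r * norm (Y *v y)" by (rule op_boundD[OF assms(1)])
  also have "\<dots> \<le> r * (s * norm y)" by (intro mult_left_mono op_boundD[OF assms(2)] assms(3))
  finally show "norm ((X ** Y) *v y) \<le> r * s * norm y" by (simp add: matrix_vector_mul_assoc mult.assoc)
qed

lemma op_bound_add:
  assumes "op_bound X r" "op_bound Y s"
  shows "op_bound (X + Y) (r + s)"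
  unfolding op_bound_def
proof
  fix y
  have "norm ((X + Y) *v y) \<le> norm (X *v y) + norm (Y *v y)"
    unfolding matrix_vector_mult_add_rdistrib by (rule norm_triangle_ineq)
  also have "\<dots> \<le> r * norm y + s * norm y" by (intro add_mono op_boundD assms)
  finally show "norm ((X + Y) *v y) \<le> (r + s) * norm y" by (simp add: distrib_right)
qed

lemma op_bound_scaleR:
  assumes "op_bound X r"
  shows "op_bound (c *\<^sub>R X) (\<bar>c\<bar> * r)"
  unfolding op_bound_def
proof
  fix y
  have "norm ((c *\<^sub>R X) *v y) = \<bar>c\<bar> * norm (X *v y)" by (simp add: scaleR_matrix_vector_assoc[symmetric])
  also have "\<dots> \<le> \<bar>c\<bar> * (r * norm y)" by (intro mult_left_mono op_boundD assms) simp
  finally show "norm ((c *\<^sub>R X) *v y) \<le> \<bar>c\<bar> * r * norm y" by (simp add: mult.assoc)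
qed

lemma op_bound_entry:
  assumes "op_bound X r"
  shows "\<bar>X $ i $ j\<bar> \<le> r"
proof -
  have "X $ i $ j = (X *v axis j 1) $ i" by (simp add: matrix_vector_mult_basis column_def)
  then have "\<bar>X $ i $ j\<bar> \<le> norm (X *v axis j 1)" using component_le_norm_cart by metis
  also have "\<dots> \<le> r" using op_boundD[OF assms, of "axis j 1"] by simp
  finally show ?thesis .
qed

lemma op_bound_norm: "op_bound X (norm X)"
  unfolding op_bound_def
proof
  fix y
  have "(norm (X *v y))\<^sup>2 = (\<Sum>i\<in>UNIV. (X $ i \<bullet> y)\<^sup>2)"
    unfolding norm_vec_def L2_set_def matrix_vector_mul_component
    by (simp add: sum_nonneg)
  also have "\<dots> \<le> (\<Sum>i\<in>UNIV. (norm (X $ i))\<^sup>2 * (norm y)\<^sup>2)"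
  proof (rule sum_mono)
    fix i
    have "\<bar>X $ i \<bullet> y\<bar>\<^sup>2 \<le> (norm (X $ i) * norm y)\<^sup>2" by (intro power_mono Cauchy_Schwarz_ineq2) simp
    then show "(X $ i \<bullet> y)\<^sup>2 \<le> (norm (X $ i))\<^sup>2 * (norm y)\<^sup>2" by (simp add: power_mult_distrib)
  qed
  also have "\<dots> = (norm X * norm y)\<^sup>2"
    unfolding sum_distrib_right[symmetric] power_mult_distrib
    by (simp add: norm_vec_def[of X] L2_set_def sum_nonneg)
  finally show "norm (X *v y) \<le> norm X * norm y" by (rule power2_le_imp_le) simp
qed

lemma op_bound_tendsto:
  assumes "\<And>k. op_bound (X k) r" "X \<longlonglongrightarrow> L"
  shows "op_bound L r"
  unfolding op_bound_def
proof
  fix y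
  have "(\<lambda>k. X k *v y) \<longlonglongrightarrow> L *v y"
    unfolding matrix_vector_mult_def by (intro tendsto_vec_lambda tendsto_sum tendsto_mult tendsto_const tendsto_vec_nth assms)
  then have "(\<lambda>k. norm (X k *v y)) \<longlonglongrightarrow> norm (L *v y)" by (rule tendsto_norm)
  then show "norm (L *v y) \<le> r * norm y"
    by (rule LIMSEQ_le_const2) (use op_boundD[OF assms(1)] in blast)
qed

text \<open>A limit \<open>X\<close> satisfies \<open>X = (N + X\<^sup>2) / 2\<close>, that is, \<open>(1 - X)\<^sup>2 = 1 - N\<close>.\<close>

primrec sqrt_iter :: "real ^ 'n ^ 'n \<Rightarrow> nat \<Rightarrow> real ^ 'n ^ 'n" where
  "sqrt_iter N 0 = 0"
| "sqrt_iter N (Suc k) = (1 / 2) *\<^sub>R (N + sqrt_iter N k ** sqrt_iter N k)"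

lemma matrix_mult_scaleR_left: "(c *\<^sub>R X) ** Y = c *\<^sub>R (X ** (Y :: real ^ 'n ^ 'n))"
  and matrix_mult_scaleR_right: "X ** (c *\<^sub>R Y) = c *\<^sub>R (X ** (Y :: real ^ 'n ^ 'n))"
  by (auto simp: vec_eq_iff matrix_matrix_mult_def sum_distrib_left mult_ac)

lemma matrix_mult_add_left: "(X + Y) ** Z = X ** Z + Y ** (Z :: real ^ 'n ^ 'n)"
  by (auto simp: vec_eq_iff matrix_matrix_mult_def sum.distrib algebra_simps)

lemma matrix_mult_diff_left: "(X - Y) ** Z = X ** Z - Y ** (Z :: real ^ 'n ^ 'n)"
  and matrix_mult_diff_right: "Z ** (X - Y) = Z ** X - Z ** (Y :: real ^ 'n ^ 'n)"
  by (auto simp: vec_eq_iff matrix_matrix_mult_def sum_subtractf algebra_simps)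

lemma tendsto_matrix_mult:
  fixes X Y :: "nat \<Rightarrow> real ^ 'n ^ 'n"
  assumes "X \<longlonglongrightarrow> A" "Y \<longlonglongrightarrow> B"
  shows "(\<lambda>k. X k ** Y k) \<longlonglongrightarrow> A ** B"
  unfolding matrix_matrix_mult_def
  by (intro tendsto_vec_lambda tendsto_sum tendsto_mult tendsto_vec_nth assms)

lemma sqrt_iter_bound:
  assumes N: "op_bound N q" and q: "0 \<le> q" "q \<le> 1"
  shows "op_bound (sqrt_iter N k) q"
proof (induction k)
  case 0
  show ?case using q by (simp add: op_bound_def)
next
  case (Suc k)
  have "op_bound ((1 / 2) *\<^sub>R (N + sqrt_iter N k ** sqrt_iter N k)) (\<bar>1 / 2\<bar> * (q + q * q))"
    by (intro op_bound_scaleR op_bound_add op_bound_mult N Suc q)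
  moreover have "\<bar>1 / 2\<bar> * (q + q * q) \<le> q" using mult_left_mono[OF q(2) q(1)] by simp
  ultimately show ?case unfolding op_bound_def sqrt_iter.simps
    by (meson mult_right_mono norm_ge_zero order_trans)
qed

text \<open>The noncommutative factorisation X^2 - Y^2 = X (X - Y) + (X - Y) Y together with the
  bound q on both iterates gives contraction by q, the factor 1/2 of the iteration absorbing the two
  summands.\<close>

lemma sqrt_iter_step:
  assumes N: "op_bound N q" and q: "0 \<le> q" "q \<le> 1"
  shows "op_bound (sqrt_iter N (Suc k) - sqrt_iter N k) (q ^ k)"
proof (induction k)
  case 0
  have "op_bound ((1 / 2) *\<^sub>R N) (\<bar>1 / 2\<bar> * q)" by (intro op_bound_scaleR N)
  moreover have "\<bar>1 / 2\<bar> * q \<le> 1" using q by simp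
  ultimately have "op_bound ((1 / 2) *\<^sub>R N) 1" unfolding op_bound_def
    by (meson mult_right_mono norm_ge_zero order_trans)
  then show ?case by simp
next
  case (Suc k)
  define X where "X = sqrt_iter N (Suc k)"
  define Y where "Y = sqrt_iter N k"
  have b: "op_bound X q" "op_bound Y q" "op_bound (X - Y) (q ^ k)"
    unfolding X_def Y_def by (rule sqrt_iter_bound[OF N q] Suc)+
  have "sqrt_iter N (Suc (Suc k)) - sqrt_iter N (Suc k) = (1 / 2) *\<^sub>R (N + X ** X) - (1 / 2) *\<^sub>R (N + Y ** Y)"
    by (simp add: X_def Y_def)
  also have "\<dots> = (1 / 2) *\<^sub>R (X ** (X - Y) + (X - Y) ** Y)"
    by (simp add: matrix_mult_diff_left matrix_mult_diff_right scaleR_diff_right scaleR_add_right)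
  finally have e: "sqrt_iter N (Suc (Suc k)) - sqrt_iter N (Suc k) = (1 / 2) *\<^sub>R (X ** (X - Y) + (X - Y) ** Y)" .
  have "op_bound ((1 / 2) *\<^sub>R (X ** (X - Y) + (X - Y) ** Y)) (\<bar>1 / 2\<bar> * (q * q ^ k + q ^ k * q))"
    by (intro op_bound_scaleR op_bound_add op_bound_mult b q) (use q in auto)
  moreover have "\<bar>1 / 2\<bar> * (q * q ^ k + q ^ k * q) = q ^ Suc k" by simp
  ultimately show ?case unfolding e by simp
qed

lemma sqrt_iter_convergent:
  fixes N :: "real ^ 'n ^ 'n"
  assumes N: "op_bound N q" and q: "0 \<le> q" "q < 1"
  obtains X where "sqrt_iter N \<longlonglongrightarrow> X" "2 *\<^sub>R X = N + X ** X" "op_bound X q"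
proof -
  have "\<exists>l. (\<lambda>k. sqrt_iter N k $ i $ j) \<longlonglongrightarrow> l" for i j
  proof -
    have "summable (\<lambda>k. sqrt_iter N (Suc k) $ i $ j - sqrt_iter N k $ i $ j)"
    proof (rule summable_comparison_test'[of "\<lambda>k. q ^ k" 0])
      show "summable (\<lambda>k. q ^ k)" using q by (intro summable_geometric) simp
      show "norm (sqrt_iter N (Suc k) $ i $ j - sqrt_iter N k $ i $ j) \<le> q ^ k" for k
        using op_bound_entry[OF sqrt_iter_step[OF N q(1) less_imp_le[OF q(2)], of k], of i j] by simp
    qed
    then have "(\<lambda>n. \<Sum>k<n. sqrt_iter N (Suc k) $ i $ j - sqrt_iter N k $ i $ j) \<longlonglongrightarrow>
        suminf (\<lambda>k. sqrt_iter N (Suc k) $ i $ j - sqrt_iter N k $ i $ j)" by (rule summable_LIMSEQ)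
    moreover have "(\<Sum>k<n. sqrt_iter N (Suc k) $ i $ j - sqrt_iter N k $ i $ j) = sqrt_iter N n $ i $ j" for n
      using sum_lessThan_telescope[of "\<lambda>k. sqrt_iter N k $ i $ j" n] by simp
    ultimately show ?thesis by auto
  qed
  \<comment> \<open>Convergence is obtained entry by entry from a telescoping series with geometric
    bounds.\<close>
  then obtain l where l: "\<And>i j. (\<lambda>k. sqrt_iter N k $ i $ j) \<longlonglongrightarrow> l i j" by metis
  define X where "X = (\<chi> i j. l i j)"
  have lim: "sqrt_iter N \<longlonglongrightarrow> X"
    by (intro vec_tendstoI) (simp add: X_def l)
  have "(\<lambda>k. sqrt_iter N (Suc k)) \<longlonglongrightarrow> (1 / 2) *\<^sub>R (N + X ** X)"
    unfolding sqrt_iter.simps by (intro tendsto_intros tendsto_matrix_mult lim)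
  then have "X = (1 / 2) *\<^sub>R (N + X ** X)"
    using LIMSEQ_unique[OF LIMSEQ_Suc[OF lim]] by blast
  then have "2 *\<^sub>R X = 2 *\<^sub>R ((1 / 2) *\<^sub>R (N + X ** X))" by (rule arg_cong)
  then have "2 *\<^sub>R X = N + X ** X" by simp
  moreover have "op_bound X q"
    by (rule op_bound_tendsto[OF sqrt_iter_bound[OF N q(1) less_imp_le[OF q(2)]] lim])
  ultimately show ?thesis using that lim by blast
qed

lemma transpose_add: "transpose (X + Y) = transpose X + transpose (Y :: real ^ 'n ^ 'n)"
  and transpose_diff: "transpose (X - Y) = transpose X - transpose (Y :: real ^ 'n ^ 'n)"
  and transpose_scaleR: "transpose (c *\<^sub>R X) = c *\<^sub>R transpose (X :: real ^ 'n ^ 'n)"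
  by (auto simp: transpose_def vec_eq_iff)

lemma sqrt_iter_symmetric: "transpose N = N \<Longrightarrow> transpose (sqrt_iter N k) = sqrt_iter N k"
  by (induction k) (auto simp: transpose_add transpose_scaleR matrix_transpose_mul, simp add: transpose_def vec_eq_iff)

text \<open>Needed for uniqueness: a second square root commutes with M, hence with all iterates and
  with their limit.\<close>

lemma sqrt_iter_commute:
  fixes N :: "real ^ 'n ^ 'n"
  assumes "Z ** N = N ** Z"
  shows "Z ** sqrt_iter N k = sqrt_iter N k ** Z"
proof (induction k)
  case 0
  show ?case by (simp add: matrix_matrix_mult_def vec_eq_iff)
next
  case (Suc k)
  have "Z ** (sqrt_iter N k ** sqrt_iter N k) = (sqrt_iter N k ** sqrt_iter N k) ** Z"
    by (metis Suc matrix_mul_assoc)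
  then show ?case
    by (simp add: matrix_mult_scaleR_left matrix_mult_scaleR_right matrix_add_ldistrib matrix_mult_add_left assms)
qed

text \<open>With N = 1 - M / c the limit X satisfies (1 - X)^2 = M / c. As a limit of polynomials in
  M with one fixed c, this formula is measurable in M, which the definite description of
  \<open>mat_sqrt\<close> does not show.\<close>

definition sqrt_limit :: "real \<Rightarrow> real ^ 'n ^ 'n \<Rightarrow> real ^ 'n ^ 'n" where
  "sqrt_limit c M = sqrt c *\<^sub>R (mat 1 - lim (sqrt_iter (mat 1 - (1 / c) *\<^sub>R M)))"

definition spd :: "real \<Rightarrow> real \<Rightarrow> real ^ 'n ^ 'n \<Rightarrow> bool" where
  "spd \<alpha> C M \<longleftrightarrow> transpose M = M \<and> (\<forall>y. \<alpha> * (norm y)\<^sup>2 \<le> y \<bullet> (M *v y)) \<and> op_bound M C"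

lemma sym_inner:
  fixes B :: "real ^ 'n ^ 'n"
  assumes "transpose B = B"
  shows "(B *v x) \<bullet> y = x \<bullet> (B *v y)"
  using dot_lmul_matrix[of x B y] assms by (metis transpose_matrix_vector)

text \<open>Expanding the square bounds the operator norm of 1 - M / c by the root of 1 - 2 \<alpha>
  / c + C^2 / c^2. The choice c = C^2 / \<alpha> minimises this expression and makes it less than
  1.\<close>

lemma spd_residual_bound:
  fixes M :: "real ^ 'n ^ 'n"
  assumes M: "spd \<alpha> C M" and \<alpha>: "0 < \<alpha>" "\<alpha> \<le> C"
  shows "op_bound (mat 1 - (1 / (C\<^sup>2 / \<alpha>)) *\<^sub>R M) (sqrt (1 - \<alpha>\<^sup>2 / C\<^sup>2))"
  unfolding op_bound_def
proof
  fix y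
  define c where "c = C\<^sup>2 / \<alpha>"
  have C: "0 < C" using \<alpha> by simp
  have c: "0 < c" using C \<alpha> by (simp add: c_def)
  have q: "0 \<le> 1 - \<alpha>\<^sup>2 / C\<^sup>2" using \<alpha> C by (simp add: power_mono)
  have e: "(mat 1 - (1 / c) *\<^sub>R M) *v y = y - (1 / c) *\<^sub>R (M *v y)"
    by (simp add: matrix_vector_mult_diff_rdistrib scaleR_matrix_vector_assoc)
  have "(norm (y - (1 / c) *\<^sub>R (M *v y)))\<^sup>2 =
      (norm y)\<^sup>2 - 2 / c * (y \<bullet> (M *v y)) + (1 / c)\<^sup>2 * (norm (M *v y))\<^sup>2"
    unfolding power2_norm_eq_inner by (simp add: inner_simps inner_commute[of "M *v y" y] power2_eq_square diff_divide_distrib)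
  also have "\<dots> \<le> (norm y)\<^sup>2 - 2 / c * (\<alpha> * (norm y)\<^sup>2) + (1 / c)\<^sup>2 * (C * norm y)\<^sup>2"
  proof -
    have "2 / c * (\<alpha> * (norm y)\<^sup>2) \<le> 2 / c * (y \<bullet> (M *v y))"
      using M c unfolding spd_def by (intro mult_left_mono) auto
    moreover have "(1 / c)\<^sup>2 * (norm (M *v y))\<^sup>2 \<le> (1 / c)\<^sup>2 * (C * norm y)\<^sup>2"
      using M op_boundD[of M C y] unfolding spd_def by (intro mult_left_mono power_mono) auto
    ultimately show ?thesis by linarith
  qed
  also have "\<dots> = (1 - \<alpha>\<^sup>2 / C\<^sup>2) * (norm y)\<^sup>2"
    unfolding c_def using C \<alpha> by (simp add: field_simps power2_eq_square)
  also have "\<dots> = (sqrt (1 - \<alpha>\<^sup>2 / C\<^sup>2) * norm y)\<^sup>2" using q by (simp add: power_mult_distrib)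
  finally show "norm ((mat 1 - (1 / (C\<^sup>2 / \<alpha>)) *\<^sub>R M) *v y) \<le> sqrt (1 - \<alpha>\<^sup>2 / C\<^sup>2) * norm y"
    unfolding c_def[symmetric] e by (rule power2_le_imp_le) (use q in simp)
qed

text \<open>The limit B is a strictly positive symmetric root. A second root B' commutes with it, so
  (B' + B) (B' - B) = 0, and B' + B is injective because B is strictly positive and B'
  nonnegative.\<close>

lemma mat_sqrt_eq_limit:
  fixes M :: "real ^ 'n ^ 'n"
  assumes M: "spd \<alpha> C M" and \<alpha>: "0 < \<alpha>" "\<alpha> \<le> C"
  shows "mat_sqrt M = sqrt_limit (C\<^sup>2 / \<alpha>) M"
    and "transpose (mat_sqrt M) = mat_sqrt M" and "mat_sqrt M ** mat_sqrt M = M"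
proof -
  define c where "c = C\<^sup>2 / \<alpha>"
  define q where "q = sqrt (1 - \<alpha>\<^sup>2 / C\<^sup>2)"
  have C: "0 < C" using \<alpha> by simp
  have c: "0 < c" using C \<alpha> by (simp add: c_def)
  have q: "0 \<le> q" "q < 1" using \<alpha> C by (auto simp: q_def power_mono)
  define N where "N = mat 1 - (1 / c) *\<^sub>R M"
  have N: "op_bound N q" unfolding N_def q_def c_def by (rule spd_residual_bound[OF M \<alpha>])
  obtain X where X: "sqrt_iter N \<longlonglongrightarrow> X" "2 *\<^sub>R X = N + X ** X" "op_bound X q"
    by (rule sqrt_iter_convergent[OF N q])
  define B where "B = sqrt c *\<^sub>R (mat 1 - X)"
  have BL: "B = sqrt_limit c M" unfolding B_def sqrt_limit_def N_def[symmetric] using limI[OF X(1)] by simp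
  have tM: "transpose M = M" using M by (simp add: spd_def)
  have tN: "transpose N = N" by (simp add: N_def transpose_diff transpose_scaleR tM)
  have tX: "transpose X = X"
  proof -
    have "(\<lambda>k. transpose (sqrt_iter N k)) \<longlonglongrightarrow> transpose X"
      unfolding transpose_def by (intro tendsto_vec_lambda tendsto_vec_nth X(1))
    then have "sqrt_iter N \<longlonglongrightarrow> transpose X" by (simp add: sqrt_iter_symmetric[OF tN])
    then show ?thesis using X(1) by (rule LIMSEQ_unique)
  qed
  have tB: "transpose B = B" by (simp add: B_def transpose_diff transpose_scaleR tX)
  \<comment> \<open>Strict positivity comes from the operator norm of X being at most q < 1;
    uniqueness rests on it.\<close>
  have Bpos: "sqrt c * (1 - q) * (norm y)\<^sup>2 \<le> y \<bullet> (B *v y)" for y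
  proof -
    have "y \<bullet> (X *v y) \<le> norm y * norm (X *v y)" using Cauchy_Schwarz_ineq2[of y "X *v y"] by linarith
    also have "\<dots> \<le> norm y * (q * norm y)" by (intro mult_left_mono op_boundD X) simp
    finally have "(1 - q) * (norm y)\<^sup>2 \<le> y \<bullet> y - y \<bullet> (X *v y)"
      by (simp add: power2_norm_eq_inner[symmetric] power2_eq_square algebra_simps)
    then have "sqrt c * ((1 - q) * (norm y)\<^sup>2) \<le> sqrt c * (y \<bullet> y - y \<bullet> (X *v y))"
      using c by (intro mult_left_mono) auto
    also have "\<dots> = y \<bullet> (B *v y)"
      unfolding B_def by (simp add: scaleR_matrix_vector_assoc[symmetric] matrix_vector_mult_diff_rdistrib inner_diff_right)
    finally show ?thesis by (simp add: mult.assoc)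
  qed
  have BB: "B ** B = M"
  proof -
    have "B ** B = (sqrt c * sqrt c) *\<^sub>R ((mat 1 - X) ** (mat 1 - X))"
      unfolding B_def by (simp add: matrix_mult_scaleR_left matrix_mult_scaleR_right)
    also have "(mat 1 - X) ** (mat 1 - X) = mat 1 - 2 *\<^sub>R X + X ** X"
      by (simp add: matrix_mult_diff_left matrix_mult_diff_right scaleR_2)
    also have "\<dots> = mat 1 - N" unfolding X(2) by simp
    also have "\<dots> = (1 / c) *\<^sub>R M" by (simp add: N_def)
    finally show ?thesis using c by simp
  qed
  have uniq: "B' = B" if B': "transpose B' = B' \<and> (\<forall>y. 0 \<le> y \<bullet> (B' *v y)) \<and> B' ** B' = M" for B'
  proof -
    have "B' ** M = M ** B'" using B' by (metis matrix_mul_assoc)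
    then have "B' ** N = N ** B'"
      by (simp add: N_def matrix_mult_diff_left matrix_mult_diff_right matrix_mult_scaleR_left matrix_mult_scaleR_right)
    then have com: "B' ** sqrt_iter N k = sqrt_iter N k ** B'" for k by (rule sqrt_iter_commute)
    have l1: "(\<lambda>k. B' ** sqrt_iter N k) \<longlonglongrightarrow> B' ** X"
      by (intro tendsto_matrix_mult tendsto_const X(1))
    have l2: "(\<lambda>k. B' ** sqrt_iter N k) \<longlonglongrightarrow> X ** B'"
      unfolding com by (intro tendsto_matrix_mult tendsto_const X(1))
    from l1 l2 have "B' ** X = X ** B'" by (rule LIMSEQ_unique)
    then have comm: "B' ** B = B ** B'"
      by (simp add: B_def matrix_mult_diff_left matrix_mult_diff_right matrix_mult_scaleR_left matrix_mult_scaleR_right)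
    have z: "(B' + B) ** (B' - B) = 0"
      using B' BB comm by (simp add: matrix_mult_add_left matrix_mult_diff_right)
    have "(B' - B) *v y = 0" for y
    proof -
      define w where "w = (B' - B) *v y"
      have "(B' + B) *v w = 0" unfolding w_def matrix_vector_mul_assoc z by simp
      then have "w \<bullet> (B' *v w) + w \<bullet> (B *v w) = 0"
        by (simp add: matrix_vector_mult_add_rdistrib inner_add_right[symmetric])
      moreover have "0 \<le> w \<bullet> (B' *v w)" using B' by blast
      ultimately have "sqrt c * (1 - q) * (norm w)\<^sup>2 \<le> 0" using Bpos[of w] by linarith
      moreover have "0 < sqrt c * (1 - q)" using c q by simp
      ultimately have "(norm w)\<^sup>2 \<le> 0" using c q by (simp add: mult_le_0_iff)
      then show ?thesis by (simp add: w_def)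
    qed
    then have "B' - B = 0" by (simp add: matrix_eq)
    then show ?thesis by simp
  qed
  have Bnn: "0 \<le> y \<bullet> (B *v y)" for y
    by (rule order_trans[OF _ Bpos]) (use c q in auto)
  have "mat_sqrt M = B"
    unfolding mat_sqrt_def by (rule the_equality) (use tB Bnn BB uniq in auto)
  then show "mat_sqrt M = sqrt_limit (C\<^sup>2 / \<alpha>) M" "transpose (mat_sqrt M) = mat_sqrt M" "mat_sqrt M ** mat_sqrt M = M"
    using BL tB BB by (auto simp: c_def)
qed

text \<open>Allows C to be replaced by the maximum of \<alpha> and C, which supplies the side
  condition \<alpha> \<le> C of the root construction.\<close>

lemma spd_mono: "spd \<alpha> C M \<Longrightarrow> C \<le> C' \<Longrightarrow> spd \<alpha> C' M"
  unfolding spd_def op_bound_def by (meson mult_right_mono norm_ge_zero order_trans)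

lemma mat_sqrt_flux:
  fixes M :: "real ^ 'n ^ 'n"
  assumes M: "spd \<alpha> C M" and \<alpha>: "0 < \<alpha>"
  defines "B \<equiv> mat_sqrt M"
  shows "(matrix_inv B *v \<sigma>) \<bullet> (B *v g) = \<sigma> \<bullet> g"
    "\<alpha> * (norm (matrix_inv B *v \<sigma>))\<^sup>2 \<le> (norm \<sigma>)\<^sup>2" "(norm \<sigma>)\<^sup>2 \<le> C * (norm (matrix_inv B *v \<sigma>))\<^sup>2"
    "\<alpha> * (norm g)\<^sup>2 \<le> (norm (B *v g))\<^sup>2" "(norm (B *v g))\<^sup>2 \<le> C * (norm g)\<^sup>2"
    "det B \<noteq> 0" "B *v (matrix_inv B *v \<sigma>) = \<sigma>"
proof -
  have s: "transpose B = B" "B ** B = M"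
    unfolding B_def using mat_sqrt_eq_limit(2,3)[OF spd_mono[OF M, of "max \<alpha> C"] \<alpha>] by auto
  \<comment> \<open>All bounds come from this identity, those for the inverse by putting y equal to
    the inverse applied to \<sigma>.\<close>
  have nB: "(norm (B *v y))\<^sup>2 = y \<bullet> (M *v y)" for y
    unfolding power2_norm_eq_inner sym_inner[OF s(1)] s(2)[symmetric] by (simp add: matrix_vector_mul_assoc)
  have lower: "\<alpha> * (norm y)\<^sup>2 \<le> (norm (B *v y))\<^sup>2" for y
    unfolding nB using M by (simp add: spd_def)
  have upper: "(norm (B *v y))\<^sup>2 \<le> C * (norm y)\<^sup>2" for y
  proof -
    have "y \<bullet> (M *v y) \<le> norm y * norm (M *v y)" using Cauchy_Schwarz_ineq2[of y "M *v y"] by linarith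
    also have "\<dots> \<le> norm y * (C * norm y)" using M by (intro mult_left_mono op_boundD) (auto simp: spd_def)
    finally show ?thesis unfolding nB by (simp add: power2_eq_square mult_ac)
  qed
  have "y = 0" if "B *v y = 0" for y
  proof -
    have "\<alpha> * (norm y)\<^sup>2 \<le> 0" using lower[of y] that by simp
    then show ?thesis using \<alpha> by (simp add: mult_le_0_iff)
  qed
  then have inv: "invertible B"
    by (simp add: invertible_left_inverse matrix_left_invertible_ker)
  then show "det B \<noteq> 0" by (simp add: invertible_det_nz)
  have Bp: "B *v (matrix_inv B *v \<sigma>) = \<sigma>"
  proof -
    have "\<exists>A'. B ** A' = mat 1 \<and> A' ** B = mat 1" using inv by (simp add: invertible_def)
    from someI_ex[OF this] have "B ** matrix_inv B = mat 1" by (simp add: matrix_inv_def)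
    then show ?thesis by (simp add: matrix_vector_mul_assoc)
  qed
  then show "B *v (matrix_inv B *v \<sigma>) = \<sigma>" .
  show "(matrix_inv B *v \<sigma>) \<bullet> (B *v g) = \<sigma> \<bullet> g"
    using sym_inner[OF s(1), of "matrix_inv B *v \<sigma>" g] Bp by simp
  show "\<alpha> * (norm (matrix_inv B *v \<sigma>))\<^sup>2 \<le> (norm \<sigma>)\<^sup>2" "(norm \<sigma>)\<^sup>2 \<le> C * (norm (matrix_inv B *v \<sigma>))\<^sup>2"
    using lower[of "matrix_inv B *v \<sigma>"] upper[of "matrix_inv B *v \<sigma>"] unfolding Bp by auto
  show "\<alpha> * (norm g)\<^sup>2 \<le> (norm (B *v g))\<^sup>2" "(norm (B *v g))\<^sup>2 \<le> C * (norm g)\<^sup>2"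
    by (rule lower upper)+
qed

section \<open>Measurability of matrix expressions\<close>

lemma borel_measurable_vecI:
  fixes f :: "'a \<Rightarrow> 'b::euclidean_space ^ 'n"
  assumes "\<And>i. (\<lambda>x. f x $ i) \<in> borel_measurable M"
  shows "f \<in> borel_measurable M"
proof (subst borel_measurable_euclidean_space, intro ballI)
  fix v :: "'b ^ 'n" assume "v \<in> Basis"
  then obtain i b where v: "v = axis i b" by (auto simp: Basis_vec_def)
  have "(\<lambda>x. f x $ i \<bullet> b) \<in> borel_measurable M" using assms[of i] by measurable
  then show "(\<lambda>x. f x \<bullet> v) \<in> borel_measurable M" by (simp add: v inner_axis)
qed

lemma borel_measurable_vec_nth:
  fixes f :: "'a \<Rightarrow> 'b::euclidean_space ^ 'n"
  assumes "f \<in> borel_measurable M"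
  shows "(\<lambda>x. f x $ i) \<in> borel_measurable M"
proof -
  have "continuous_on UNIV (\<lambda>x::'b ^ 'n. x $ i)" by (intro continuous_intros)
  from measurable_compose[OF assms borel_measurable_continuous_onI[OF this]] show ?thesis .
qed

lemma borel_measurable_matrix_vector_mult:
  fixes A :: "'a \<Rightarrow> real ^ 'n ^ 'n" and v :: "'a \<Rightarrow> real ^ 'n"
  assumes "A \<in> borel_measurable M" "v \<in> borel_measurable M"
  shows "(\<lambda>x. A x *v v x) \<in> borel_measurable M"
  by (intro borel_measurable_vecI)
    (simp add: matrix_vector_mult_def, intro borel_measurable_sum borel_measurable_times borel_measurable_vec_nth assms)

lemma borel_measurable_matrix_mult:
  fixes A B :: "'a \<Rightarrow> real ^ 'n ^ 'n"
  assumes "A \<in> borel_measurable M" "B \<in> borel_measurable M"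
  shows "(\<lambda>x. A x ** B x) \<in> borel_measurable M"
  by (intro borel_measurable_vecI)
    (simp add: matrix_matrix_mult_def, intro borel_measurable_sum borel_measurable_times borel_measurable_vec_nth assms)

lemma borel_measurable_det:
  fixes A :: "'a \<Rightarrow> real ^ 'n ^ 'n"
  assumes "\<And>i j. (\<lambda>x. A x $ i $ j) \<in> borel_measurable M"
  shows "(\<lambda>x. det (A x)) \<in> borel_measurable M"
  unfolding det_def by (intro borel_measurable_sum borel_measurable_times borel_measurable_prod borel_measurable_const assms)

lemma borel_measurable_sqrt_limit:
  fixes A :: "'a \<Rightarrow> real ^ 'n ^ 'n"
  assumes A: "A \<in> borel_measurable M"
  shows "(\<lambda>x. sqrt_limit c (A x)) \<in> borel_measurable M"
proof -
  have "(\<lambda>x. sqrt_iter (mat 1 - (1 / c) *\<^sub>R A x) k) \<in> borel_measurable M" for k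
  proof (induction k)
    case (Suc k)
    show ?case unfolding sqrt_iter.simps
      by (intro borel_measurable_scaleR borel_measurable_const borel_measurable_add borel_measurable_diff
          borel_measurable_matrix_mult A Suc)
  qed simp
  then have "(\<lambda>x. lim (\<lambda>k. sqrt_iter (mat 1 - (1 / c) *\<^sub>R A x) k)) \<in> borel_measurable M"
    by (rule borel_measurable_lim_metric)
  then show ?thesis unfolding sqrt_limit_def
    by (intro borel_measurable_scaleR borel_measurable_const borel_measurable_diff) simp
qed

text \<open>Completeness of Lebesgue measure: the formulas for roots and inverses hold only where A
  is symmetric and elliptic, that is almost everywhere, and measurability passes to the expressions
  in the definitions.\<close>

lemma borel_measurable_lebesgue_on_AE:
  fixes f g :: "'a::euclidean_space \<Rightarrow> 'b::euclidean_space"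
  assumes f: "f \<in> borel_measurable (lebesgue_on S)" and S: "S \<in> sets lebesgue"
    and ae: "AE x in lebesgue_on S. f x = g x"
  shows "g \<in> borel_measurable (lebesgue_on S)"
proof -
  have "(\<lambda>x. if x \<in> S then f x else 0) \<in> borel_measurable lebesgue"
    using borel_measurable_if[OF S] f by blast
  moreover have "AE x in lebesgue. (if x \<in> S then f x else 0) = (if x \<in> S then g x else 0)"
    using ae S by (subst (asm) AE_restrict_space_iff) (auto elim: eventually_mono)
  ultimately have "(\<lambda>x. if x \<in> S then g x else 0) \<in> borel_measurable lebesgue"
    by (rule borel_measurable_AE)
  then show ?thesis using borel_measurable_if[OF S] by blast
qed

lemma flux_measurable:
  fixes A :: "'a::euclidean_space \<Rightarrow> real ^ 'n ^ 'n"
  assumes S: "S \<in> sets lebesgue" and A: "A \<in> borel_measurable (lebesgue_on S)"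
    and spd: "AE x in lebesgue_on S. spd \<alpha> C (A x)" and \<alpha>: "0 < \<alpha>"
    and \<sigma>: "\<sigma> \<in> borel_measurable (lebesgue_on S)"
  shows "(\<lambda>x. mat_sqrt (A x) *v \<sigma> x) \<in> borel_measurable (lebesgue_on S)"
    "(\<lambda>x. matrix_inv (mat_sqrt (A x)) *v \<sigma> x) \<in> borel_measurable (lebesgue_on S)"
proof -
  have "AE x in lebesgue_on S. sqrt_limit ((max \<alpha> C)\<^sup>2 / \<alpha>) (A x) = mat_sqrt (A x)"
    using spd
  proof eventually_elim
    case (elim x)
    have "spd \<alpha> (max \<alpha> C) (A x)" using elim by (rule spd_mono) simp
    from mat_sqrt_eq_limit(1)[OF this \<alpha>] show ?case by simp
  qed
  then have B: "(\<lambda>x. mat_sqrt (A x)) \<in> borel_measurable (lebesgue_on S)"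
    by (rule borel_measurable_lebesgue_on_AE[OF borel_measurable_sqrt_limit[OF A] S])
  show "(\<lambda>x. mat_sqrt (A x) *v \<sigma> x) \<in> borel_measurable (lebesgue_on S)"
    by (rule borel_measurable_matrix_vector_mult[OF B \<sigma>])
  \<comment> \<open>Cramer's rule: the inverse applied to \<sigma> is a quotient of determinants and
    so measurable, without a discussion of \<open>matrix_inv\<close> at singular matrices.\<close>
  define p where "p x = (\<chi> k. det (\<chi> i j. if j = k then \<sigma> x $ i else mat_sqrt (A x) $ i $ j) / det (mat_sqrt (A x)))" for x
  have Bij: "(\<lambda>x. mat_sqrt (A x) $ i $ j) \<in> borel_measurable (lebesgue_on S)" for i j
    by (intro borel_measurable_vec_nth B)
  have "p \<in> borel_measurable (lebesgue_on S)"
  proof (rule borel_measurable_vecI)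
    fix k
    have "(\<lambda>x. det (\<chi> i j. if j = k then \<sigma> x $ i else mat_sqrt (A x) $ i $ j)) \<in> borel_measurable (lebesgue_on S)"
    proof (rule borel_measurable_det)
      show "(\<lambda>x. (\<chi> i j. if j = k then \<sigma> x $ i else mat_sqrt (A x) $ i $ j) $ i $ j) \<in> borel_measurable (lebesgue_on S)" for i j
        using Bij borel_measurable_vec_nth[OF \<sigma>] by (cases "j = k") auto
    qed
    then show "(\<lambda>x. p x $ k) \<in> borel_measurable (lebesgue_on S)"
      unfolding p_def vec_lambda_beta by (rule borel_measurable_divide[OF _ borel_measurable_det[OF Bij]])
  qed
  moreover have "AE x in lebesgue_on S. p x = matrix_inv (mat_sqrt (A x)) *v \<sigma> x"
    using spd
  proof eventually_elim
    case (elim x)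
    note f = mat_sqrt_flux(6,7)[OF elim \<alpha>]
    show ?case unfolding p_def using cramer[OF f(1), of "matrix_inv (mat_sqrt (A x)) *v \<sigma> x" "\<sigma> x"] f(2) by simp
  qed
  ultimately show "(\<lambda>x. matrix_inv (mat_sqrt (A x)) *v \<sigma> x) \<in> borel_measurable (lebesgue_on S)"
    by (rule borel_measurable_lebesgue_on_AE[OF _ S])
qed

section \<open>Borel representatives and weak gradients\<close>

text \<open>Fubini for products of \<open>lborel\<close> and translations require Borel functions on
  the whole space. Vanishing outside S turns integrals over S into integrals over the whole space,
  and pointwise operations preserve the relation.\<close>

definition borel_rep :: "'a::euclidean_space set \<Rightarrow> ('a \<Rightarrow> 'b::euclidean_space) \<Rightarrow> ('a \<Rightarrow> 'b) \<Rightarrow> bool" where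
  "borel_rep S f g \<longleftrightarrow> g \<in> borel_measurable borel \<and> (\<forall>x. x \<notin> S \<longrightarrow> g x = 0) \<and>
     f \<in> borel_measurable (lebesgue_on S) \<and> (AE x in lebesgue_on S. f x = g x)"

text \<open>Lebesgue measurability provides continuous functions converging off a negligible set.
  Their limit operator is Borel everywhere, whatever its value where the sequence diverges.\<close>

lemma borel_rep_exists:
  fixes f :: "'a::euclidean_space \<Rightarrow> 'b::euclidean_space"
  assumes f: "f \<in> borel_measurable (lebesgue_on S)" and S: "S \<in> sets borel"
  obtains g where "borel_rep S f g"
proof -
  have SL: "S \<in> sets lebesgue" using S by simp
  then have "f measurable_on S" using f measurable_on_iff_borel_measurable by blast
  then obtain N h where N: "negligible N" and h: "\<And>n. continuous_on UNIV (h n)"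
    and lim: "\<And>x. x \<notin> N \<Longrightarrow> (\<lambda>n. h n x) \<longlonglongrightarrow> (if x \<in> S then f x else 0)"
    unfolding measurable_on_def by blast
  define g where "g x = indicator S x *\<^sub>R lim (\<lambda>n. h n x)" for x
  have "h n \<in> borel_measurable borel" for n by (rule borel_measurable_continuous_onI[OF h])
  then have "(\<lambda>x. lim (\<lambda>n. h n x)) \<in> borel_measurable borel" by (rule borel_measurable_lim_metric)
  then have g: "g \<in> borel_measurable borel" unfolding g_def[abs_def] using S by measurable
  have eq: "f x = g x" if "x \<notin> N" "x \<in> S" for x
    using limI[OF lim[OF that(1)]] that(2) by (simp add: g_def)
  have "AE x in lebesgue. x \<notin> N" using N by (intro AE_not_in) (simp add: negligible_iff_null_sets)
  then have "AE x in lebesgue_on S. f x = g x"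
    using SL eq by (subst AE_restrict_space_iff) (auto elim: eventually_mono)
  then have "borel_rep S f g" using f g by (simp add: borel_rep_def g_def)
  then show ?thesis by (rule that)
qed

lemma borel_repD:
  assumes "borel_rep S f g"
  shows "g \<in> borel_measurable borel" "\<And>x. x \<notin> S \<Longrightarrow> g x = 0" "f \<in> borel_measurable (lebesgue_on S)"
    "AE x in lebesgue_on S. f x = g x" "g \<in> borel_measurable (lebesgue_on S)"
proof -
  show g: "g \<in> borel_measurable borel" "\<And>x. x \<notin> S \<Longrightarrow> g x = 0" "f \<in> borel_measurable (lebesgue_on S)"
    "AE x in lebesgue_on S. f x = g x" using assms by (auto simp: borel_rep_def)
  show "g \<in> borel_measurable (lebesgue_on S)"
    by (intro measurable_restrict_space1 measurable_completion) (use g(1) in simp)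
qed

lemma borel_rep_integral:
  assumes "borel_rep S f g" and S: "S \<in> sets borel"
  shows "integral\<^sup>L (lebesgue_on S) f = integral\<^sup>L lborel g" "integrable (lebesgue_on S) f \<longleftrightarrow> integrable lborel g"
proof -
  note r = borel_repD[OF assms(1)]
  have "integral\<^sup>L (lebesgue_on S) f = integral\<^sup>L (lebesgue_on S) g" by (rule integral_cong_AE[OF r(3,5,4)])
  also have "\<dots> = integral\<^sup>L lborel g" by (rule integral_lebesgue_on_eq_lborel(1)[OF S r(1,2)])
  finally show "integral\<^sup>L (lebesgue_on S) f = integral\<^sup>L lborel g" .
  have "integrable (lebesgue_on S) f \<longleftrightarrow> integrable (lebesgue_on S) g" by (rule integrable_cong_AE[OF r(3,5,4)])
  also have "\<dots> \<longleftrightarrow> integrable lborel g" by (rule integral_lebesgue_on_eq_lborel(2)[OF S r(1,2)])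
  finally show "integrable (lebesgue_on S) f \<longleftrightarrow> integrable lborel g" .
qed

lemma borel_rep_map:
  assumes "borel_rep S f g" and "H \<in> borel_measurable borel" and "H 0 = 0"
  shows "borel_rep S (\<lambda>x. H (f x)) (\<lambda>x. H (g x))"
  unfolding borel_rep_def
proof (intro conjI allI impI)
  note r = borel_repD[OF assms(1)]
  show "(\<lambda>x. H (g x)) \<in> borel_measurable borel" "(\<lambda>x. H (f x)) \<in> borel_measurable (lebesgue_on S)"
    using measurable_compose[OF r(1) assms(2)] measurable_compose[OF r(3) assms(2)] by auto
  show "AE x in lebesgue_on S. H (f x) = H (g x)" using r(4) by eventually_elim simp
  show "H (g x) = 0" if "x \<notin> S" for x using r(2)[OF that] assms(3) by simp
qed

lemma borel_rep_inner:
  assumes "borel_rep S f g" "borel_rep S f' g'"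
  shows "borel_rep S (\<lambda>x. f x \<bullet> f' x) (\<lambda>x. g x \<bullet> g' x)"
  unfolding borel_rep_def
proof (intro conjI allI impI)
  note r = borel_repD[OF assms(1)] and r' = borel_repD[OF assms(2)]
  note [measurable] = r(1,3) r'(1,3)
  show "(\<lambda>x. g x \<bullet> g' x) \<in> borel_measurable borel" "(\<lambda>x. f x \<bullet> f' x) \<in> borel_measurable (lebesgue_on S)" by measurable
  show "AE x in lebesgue_on S. f x \<bullet> f' x = g x \<bullet> g' x" using r(4) r'(4) by eventually_elim simp
  show "g x \<bullet> g' x = 0" if "x \<notin> S" for x using r(2)[OF that] by simp
qed

lemma borel_rep_diff:
  assumes "borel_rep S f g" "borel_rep S f' g'"
  shows "borel_rep S (\<lambda>x. f x - f' x) (\<lambda>x. g x - g' x)"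
  unfolding borel_rep_def
proof (intro conjI allI impI)
  note r = borel_repD[OF assms(1)] and r' = borel_repD[OF assms(2)]
  note [measurable] = r(1,3) r'(1,3)
  show "(\<lambda>x. g x - g' x) \<in> borel_measurable borel" "(\<lambda>x. f x - f' x) \<in> borel_measurable (lebesgue_on S)" by measurable
  show "AE x in lebesgue_on S. f x - f' x = g x - g' x" using r(4) r'(4) by eventually_elim simp
  show "g x - g' x = 0" if "x \<notin> S" for x using r(2)[OF that] r'(2)[OF that] by simp
qed

lemma borel_rep_refl:
  assumes "f \<in> borel_measurable borel" "\<And>x. x \<notin> S \<Longrightarrow> f x = 0"
  shows "borel_rep S f f"
  unfolding borel_rep_def using assms
  by (auto intro!: measurable_restrict_space1 measurable_completion)

lemma borel_rep_sq_integrable: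
  assumes r: "borel_rep S f g" and S: "S \<in> sets borel"
  shows "sq_integrable (lebesgue_on S) f \<longleftrightarrow> sq_integrable lborel g" "norm2 (lebesgue_on S) f = norm2 lborel g"
proof -
  have n: "borel_rep S (\<lambda>x. (norm (f x))\<^sup>2) (\<lambda>x. (norm (g x))\<^sup>2)"
    by (rule borel_rep_map[OF r, of "\<lambda>y. (norm y)\<^sup>2"]) auto
  show "sq_integrable (lebesgue_on S) f \<longleftrightarrow> sq_integrable lborel g"
    using borel_rep_integral(2)[OF n S] borel_repD(1,3)[OF r] by (simp add: sq_integrable_def)
  show "norm2 (lebesgue_on S) f = norm2 lborel g"
    using borel_rep_integral(1)[OF n S] by (simp add: norm2_def)
qed

lemma borel_rep_l2inner:
  assumes "borel_rep S f g" "borel_rep S f' g'" "S \<in> sets borel"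
  shows "l2inner S f f' = (LBINT x. g x \<bullet> g' x)"
  unfolding l2inner_def by (rule borel_rep_integral(1)[OF borel_rep_inner[OF assms(1,2)] assms(3)])

lemma sq_integrable_finite_imp_integrable:
  fixes g :: "'a::euclidean_space \<Rightarrow> 'b::euclidean_space"
  assumes g: "sq_integrable lborel g" and S: "bounded S" "S \<in> sets borel" and z: "\<And>x. x \<notin> S \<Longrightarrow> g x = 0"
  shows "integrable lborel g"
proof (rule Bochner_Integration.integrable_bound)
  show "integrable lborel (\<lambda>x. indicator S x * 1 + (norm (g x))\<^sup>2)"
    by (intro Bochner_Integration.integrable_add integrable_indicator_bounded sq_integrableD(2)[OF g] S)
  show "g \<in> borel_measurable lborel" by (rule sq_integrableD(1)[OF g])
  show "AE x in lborel. norm (g x) \<le> norm (indicator S x * 1 + (norm (g x))\<^sup>2)"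
  proof (rule AE_I2)
    fix x
    have "norm (g x) + norm (g x) \<le> 1 + (norm (g x))\<^sup>2" using sum_squares_bound[of 1 "norm (g x)"] by simp
    then have "norm (g x) \<le> 1 + (norm (g x))\<^sup>2" using norm_ge_zero[of "g x"] by linarith
    then show "norm (g x) \<le> norm (indicator S x * 1 + (norm (g x))\<^sup>2)"
      using z[of x] by (cases "x \<in> S") auto
  qed
qed

section \<open>Test functions, weak gradients and H_0^1\<close>

lemma test_functions_sq_integrable:
  assumes "\<phi> \<in> test_functions S"
  shows "sq_integrable lborel \<phi>" "sq_integrable lborel (grad \<phi>)" "borel_rep S \<phi> \<phi>" "borel_rep S (grad \<phi>) (grad \<phi>)"
proof -
  obtain K where K: "compact K" "\<And>x. x \<notin> K \<Longrightarrow> \<phi> x = 0" "\<And>x. x \<notin> K \<Longrightarrow> grad \<phi> x = 0"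
    using test_functions_support[OF assms] by metis
  note c = test_functionsD(3,4)[OF assms, of UNIV]
  have m: "\<phi> \<in> borel_measurable borel" "grad \<phi> \<in> borel_measurable borel"
    using c by (auto intro: borel_measurable_continuous_onI)
  have "integrable lborel (\<lambda>x. (norm (\<phi> x))\<^sup>2)"
    by (rule integrable_compact_support[OF _ K(1)]) (use K(2) in \<open>auto intro!: continuous_intros c\<close>)
  then show "sq_integrable lborel \<phi>" using m by (simp add: sq_integrable_def)
  have "integrable lborel (\<lambda>x. (norm (grad \<phi> x))\<^sup>2)"
    by (rule integrable_compact_support[OF _ K(1)]) (use K(3) in \<open>auto intro!: continuous_intros c\<close>)
  then show "sq_integrable lborel (grad \<phi>)" using m by (simp add: sq_integrable_def)
  show "borel_rep S \<phi> \<phi>" "borel_rep S (grad \<phi>) (grad \<phi>)"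
    using m test_functions_outside[OF assms] by (auto intro!: borel_rep_refl)
qed

lemma test_functions_L2:
  assumes "\<phi> \<in> test_functions S" "S \<in> sets borel"
  shows "L2 S \<phi>" "L2 S (grad \<phi>)"
  using test_functions_sq_integrable[OF assms(1)] borel_rep_sq_integrable(1)[OF _ assms(2)]
  unfolding L2_iff by blast+

lemma integrable_scaleR_sq_integrable:
  fixes g :: "'a \<Rightarrow> real" and f :: "'a \<Rightarrow> 'b::euclidean_space"
  assumes "sq_integrable M g" "sq_integrable M f"
  shows "integrable M (\<lambda>x. g x *\<^sub>R f x)"
proof -
  have n: "sq_integrable M (\<lambda>x. norm (f x))" using assms(2) by (auto simp: sq_integrable_def)
  show ?thesis
  proof (rule Bochner_Integration.integrable_bound[OF sq_integrable_inner(2)[OF assms(1) n]])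
  show "(\<lambda>x. g x *\<^sub>R f x) \<in> borel_measurable M"
    using sq_integrableD(1)[OF assms(1)] sq_integrableD(1)[OF assms(2)] by measurable
  qed simp
qed

text \<open>The fundamental lemma is applied to each coordinate of the difference; boundedness of S
  makes a square integrable function integrable, as that lemma requires.\<close>

lemma weak_gradient_unique:
  fixes g h :: "'a::euclidean_space \<Rightarrow> 'a"
  assumes S: "open S" "bounded S" and g: "L2 S g" "weak_gradient S u g" and h: "L2 S h" "weak_gradient S u h"
  shows "AE x in lebesgue_on S. g x = h x"
proof -
  have SB: "S \<in> sets borel" using S(1) by simp
  have d: "sq_integrable (lebesgue_on S) (\<lambda>x. g x - h x)"
    using g(1) h(1) unfolding L2_iff by (rule sq_integrable_diff)
  obtain D where D: "borel_rep S (\<lambda>x. g x - h x) D"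
    using borel_rep_exists[OF sq_integrableD(1)[OF d] SB] by blast
  note Dr = borel_repD[OF D]
  have Ds: "sq_integrable lborel D" using d borel_rep_sq_integrable(1)[OF D SB] by blast
  have Di: "integrable lborel D" by (rule sq_integrable_finite_imp_integrable[OF Ds S(2) SB Dr(2)])
  have "AE x in lborel. x \<in> S \<longrightarrow> D x \<bullet> i = 0" for i
  proof (rule fundamental_lemma)
    show "integrable lborel (\<lambda>x. D x \<bullet> i)" using Di by simp
    fix \<phi> assume \<phi>: "\<phi> \<in> test_functions S"
    have p: "sq_integrable (lebesgue_on S) \<phi>" using test_functions_L2(1)[OF \<phi> SB] by (simp add: L2_iff)
    note r = borel_repD[OF test_functions_sq_integrable(3)[OF \<phi>]]
    have ig: "integrable (lebesgue_on S) (\<lambda>x. \<phi> x *\<^sub>R g x)" "integrable (lebesgue_on S) (\<lambda>x. \<phi> x *\<^sub>R h x)"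
      using g(1) h(1) p unfolding L2_iff by (auto intro: integrable_scaleR_sq_integrable)
    have "(LINT x|lebesgue_on S. \<phi> x *\<^sub>R g x) = (LINT x|lebesgue_on S. \<phi> x *\<^sub>R h x)"
      using g(2) h(2) \<phi> unfolding weak_gradient_def by (metis neg_equal_iff_equal)
    then have "(LINT x|lebesgue_on S. \<phi> x *\<^sub>R (g x - h x)) = 0"
      using ig by (simp add: scaleR_diff_right)
    moreover have "integrable (lebesgue_on S) (\<lambda>x. \<phi> x *\<^sub>R (g x - h x))"
      using ig by (simp add: scaleR_diff_right)
    ultimately have z: "(LINT x|lebesgue_on S. (\<phi> x *\<^sub>R (g x - h x)) \<bullet> i) = 0"
      by (subst integral_inner_left) simp_all
    have "borel_rep S (\<lambda>x. (\<phi> x *\<^sub>R (g x - h x)) \<bullet> i) (\<lambda>x. \<phi> x * (D x \<bullet> i))"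
      unfolding borel_rep_def
    proof (intro conjI allI impI)
      note [measurable] = r(1,3) Dr(1,3)
      show "(\<lambda>x. \<phi> x * (D x \<bullet> i)) \<in> borel_measurable borel" by measurable
      show "(\<lambda>x. (\<phi> x *\<^sub>R (g x - h x)) \<bullet> i) \<in> borel_measurable (lebesgue_on S)" by measurable
      show "AE x in lebesgue_on S. (\<phi> x *\<^sub>R (g x - h x)) \<bullet> i = \<phi> x * (D x \<bullet> i)"
        using Dr(4) by eventually_elim simp
    qed (simp add: Dr(2))
    then show "(LBINT x. \<phi> x * (D x \<bullet> i)) = 0"
      using borel_rep_integral(1)[OF _ SB] z by metis
  qed (rule S)
  then have "AE x in lborel. \<forall>i\<in>Basis. x \<in> S \<longrightarrow> D x \<bullet> i = 0"
    by (intro AE_finite_allI finite_Basis)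
  then have "AE x in lebesgue. x \<in> S \<longrightarrow> D x = 0"
    unfolding AE_completion_iff by eventually_elim (auto simp: euclidean_eq_iff[where 'a = 'a])
  then have "AE x in lebesgue_on S. D x = 0" using SB by (simp add: AE_restrict_space_iff)
  then show ?thesis using Dr(4) by eventually_elim simp
qed

text \<open>The product rule and the vanishing integral of the gradient of the test function \<phi>
  \<eta>.\<close>

lemma weak_gradient_test_function:
  assumes S: "open S" and \<phi>: "\<phi> \<in> test_functions S"
  shows "weak_gradient S \<phi> (grad \<phi>)"
  unfolding weak_gradient_def
proof
  fix \<eta> assume \<eta>: "\<eta> \<in> test_functions S"
  have SB: "S \<in> sets borel" using S by simp
  note p = test_functions_sq_integrable[OF \<phi>] and e = test_functions_sq_integrable[OF \<eta>]
  have i: "integrable lborel (\<lambda>x. \<phi> x *\<^sub>R grad \<eta> x)" "integrable lborel (\<lambda>x. \<eta> x *\<^sub>R grad \<phi> x)"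
    by (intro integrable_scaleR_sq_integrable p e)+
  have m: "(\<lambda>x. \<phi> x *\<^sub>R grad \<eta> x) \<in> borel_measurable borel" "(\<lambda>x. \<eta> x *\<^sub>R grad \<phi> x) \<in> borel_measurable borel"
    using i by auto
  have c: "(LINT x|lebesgue_on S. \<phi> x *\<^sub>R grad \<eta> x) = (LBINT x. \<phi> x *\<^sub>R grad \<eta> x)"
    "(LINT x|lebesgue_on S. \<eta> x *\<^sub>R grad \<phi> x) = (LBINT x. \<eta> x *\<^sub>R grad \<phi> x)"
    using test_functions_outside[OF \<phi>] test_functions_outside[OF \<eta>]
    by (auto intro!: integral_lebesgue_on_eq_lborel(1)[OF SB] m)
  have "(LBINT x. \<phi> x *\<^sub>R grad \<eta> x) + (LBINT x. \<eta> x *\<^sub>R grad \<phi> x) =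
      (LBINT x. grad (\<lambda>x. \<phi> x * \<eta> x) x)"
    using i grad_mult[OF test_functionsD(2)[OF \<phi>] test_functionsD(2)[OF \<eta>]] by simp
  also have "\<dots> = 0"
  proof (rule euclidean_eqI)
    fix j :: 'a assume "j \<in> Basis"
    have t: "(\<lambda>x. \<phi> x * \<eta> x) \<in> test_functions S"
      by (rule test_functions_mult[OF \<eta> test_functionsD(1)[OF \<phi>]])
    have "integrable lborel (grad (\<lambda>x. \<phi> x * \<eta> x))"
      using i grad_mult[OF test_functionsD(2)[OF \<phi>] test_functionsD(2)[OF \<eta>]] by (simp add: fun_eq_iff cong: Bochner_Integration.integrable_cong)
    then show "(LBINT x. grad (\<lambda>x. \<phi> x * \<eta> x) x) \<bullet> j = 0 \<bullet> j"
      using integral_grad_eq_0[OF t, of j] by simp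
  qed
  finally show "(LINT x|lebesgue_on S. \<phi> x *\<^sub>R grad \<eta> x) = - (LINT x|lebesgue_on S. \<eta> x *\<^sub>R grad \<phi> x)"
    unfolding c by (simp add: eq_neg_iff_add_eq_0)
qed

lemma weak_gradient_linear:
  assumes S: "open S" and u: "L2 S u" "L2 S g" "weak_gradient S u g" and v: "L2 S v" "L2 S h" "weak_gradient S v h"
  shows "weak_gradient S (\<lambda>x. r * u x + s * v x) (\<lambda>x. r *\<^sub>R g x + s *\<^sub>R h x)"
  unfolding weak_gradient_def
proof
  fix \<phi> assume \<phi>: "\<phi> \<in> test_functions S"
  have SB: "S \<in> sets borel" using S by simp
  have p: "sq_integrable (lebesgue_on S) \<phi>" "sq_integrable (lebesgue_on S) (grad \<phi>)"
    using test_functions_L2[OF \<phi> SB] by (simp_all add: L2_iff)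
  have i: "integrable (lebesgue_on S) (\<lambda>x. u x *\<^sub>R grad \<phi> x)" "integrable (lebesgue_on S) (\<lambda>x. v x *\<^sub>R grad \<phi> x)"
    "integrable (lebesgue_on S) (\<lambda>x. \<phi> x *\<^sub>R g x)" "integrable (lebesgue_on S) (\<lambda>x. \<phi> x *\<^sub>R h x)"
    using u v p unfolding L2_iff by (auto intro: integrable_scaleR_sq_integrable)
  have "(LINT x|lebesgue_on S. (r * u x + s * v x) *\<^sub>R grad \<phi> x) =
      (LINT x|lebesgue_on S. r *\<^sub>R (u x *\<^sub>R grad \<phi> x) + s *\<^sub>R (v x *\<^sub>R grad \<phi> x))"
    by (simp add: scaleR_add_left)
  also have "\<dots> = r *\<^sub>R (LINT x|lebesgue_on S. u x *\<^sub>R grad \<phi> x) + s *\<^sub>R (LINT x|lebesgue_on S. v x *\<^sub>R grad \<phi> x)"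
    using i by (simp del: scaleR_scaleR)
  also have "\<dots> = - (r *\<^sub>R (LINT x|lebesgue_on S. \<phi> x *\<^sub>R g x) + s *\<^sub>R (LINT x|lebesgue_on S. \<phi> x *\<^sub>R h x))"
    using u(3) v(3) \<phi> unfolding weak_gradient_def by simp
  also have "r *\<^sub>R (LINT x|lebesgue_on S. \<phi> x *\<^sub>R g x) + s *\<^sub>R (LINT x|lebesgue_on S. \<phi> x *\<^sub>R h x) =
      (LINT x|lebesgue_on S. r *\<^sub>R (\<phi> x *\<^sub>R g x) + s *\<^sub>R (\<phi> x *\<^sub>R h x))"
    using i by (simp del: scaleR_scaleR)
  also have "\<dots> = (LINT x|lebesgue_on S. \<phi> x *\<^sub>R (r *\<^sub>R g x + s *\<^sub>R h x))"
    by (simp add: scaleR_add_right mult.commute)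
  finally show "(LINT x|lebesgue_on S. (r * u x + s * v x) *\<^sub>R grad \<phi> x) =
      - (LINT x|lebesgue_on S. \<phi> x *\<^sub>R (r *\<^sub>R g x + s *\<^sub>R h x))" .
qed

lemma norm2_linear_tendsto:
  fixes f g :: "nat \<Rightarrow> 'a \<Rightarrow> 'b::euclidean_space"
  assumes f: "\<And>n. sq_integrable M (f n)" "sq_integrable M f'" "(\<lambda>n. norm2 M (\<lambda>x. f n x - f' x)) \<longlonglongrightarrow> 0"
    and g: "\<And>n. sq_integrable M (g n)" "sq_integrable M g'" "(\<lambda>n. norm2 M (\<lambda>x. g n x - g' x)) \<longlonglongrightarrow> 0"
  shows "(\<lambda>n. norm2 M (\<lambda>x. (r *\<^sub>R f n x + s *\<^sub>R g n x) - (r *\<^sub>R f' x + s *\<^sub>R g' x))) \<longlonglongrightarrow> 0"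
proof -
  have "(\<lambda>n. \<bar>r\<bar> * norm2 M (\<lambda>x. f n x - f' x) + \<bar>s\<bar> * norm2 M (\<lambda>x. g n x - g' x)) \<longlonglongrightarrow> \<bar>r\<bar> * 0 + \<bar>s\<bar> * 0"
    by (intro tendsto_intros f(3) g(3))
  then have lim: "(\<lambda>n. \<bar>r\<bar> * norm2 M (\<lambda>x. f n x - f' x) + \<bar>s\<bar> * norm2 M (\<lambda>x. g n x - g' x)) \<longlonglongrightarrow> 0" by simp
  have b: "norm2 M (\<lambda>x. (r *\<^sub>R f n x + s *\<^sub>R g n x) - (r *\<^sub>R f' x + s *\<^sub>R g' x)) \<le>
      \<bar>r\<bar> * norm2 M (\<lambda>x. f n x - f' x) + \<bar>s\<bar> * norm2 M (\<lambda>x. g n x - g' x)" for n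
  proof -
    have "norm2 M (\<lambda>x. r *\<^sub>R (f n x - f' x) + s *\<^sub>R (g n x - g' x)) \<le>
        norm2 M (\<lambda>x. r *\<^sub>R (f n x - f' x)) + norm2 M (\<lambda>x. s *\<^sub>R (g n x - g' x))"
      by (intro norm2_triangle sq_integrable_scaleR sq_integrable_diff f g)
    moreover have "(r *\<^sub>R f n x + s *\<^sub>R g n x) - (r *\<^sub>R f' x + s *\<^sub>R g' x) =
        r *\<^sub>R (f n x - f' x) + s *\<^sub>R (g n x - g' x)" for x by (simp add: algebra_simps)
    ultimately show ?thesis by (simp only: norm2_scaleR)
  qed
  show ?thesis
    by (rule Lim_null_comparison[OF always_eventually lim]) (use b in \<open>simp add: norm2_nonneg\<close>)
qed

lemma H10_linear:
  assumes S: "open S" and u: "u \<in> H10 S" and v: "v \<in> H10 S"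
  shows "(\<lambda>x. r * u x + s * v x) \<in> H10 S"
proof -
  have SB: "S \<in> sets borel" using S by simp
  obtain g \<phi> where u2: "L2 S u" and g: "L2 S g" "weak_gradient S u g"
    and \<phi>: "\<And>n::nat. \<phi> n \<in> test_functions S" "(\<lambda>n. l2norm S (\<lambda>x. \<phi> n x - u x)) \<longlonglongrightarrow> 0"
      "(\<lambda>n. l2norm S (\<lambda>x. grad (\<phi> n) x - g x)) \<longlonglongrightarrow> 0"
    using u unfolding H10_def by blast
  obtain h \<eta> where v2: "L2 S v" and h: "L2 S h" "weak_gradient S v h"
    and \<eta>: "\<And>n::nat. \<eta> n \<in> test_functions S" "(\<lambda>n. l2norm S (\<lambda>x. \<eta> n x - v x)) \<longlonglongrightarrow> 0"
      "(\<lambda>n. l2norm S (\<lambda>x. grad (\<eta> n) x - h x)) \<longlonglongrightarrow> 0"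
    using v unfolding H10_def by blast
  define \<theta> where "\<theta> n x = r * \<phi> n x + s * \<eta> n x" for n x
  have \<theta>: "\<theta> n \<in> test_functions S" for n
    unfolding \<theta>_def by (intro test_functions_add test_functions_scale \<phi> \<eta>)
  have gr: "grad (\<theta> n) x = r *\<^sub>R grad (\<phi> n) x + s *\<^sub>R grad (\<eta> n) x" for n x
    unfolding \<theta>_def[abs_def]
    by (subst grad_add, (rule test_functionsD(2)[OF test_functions_scale[OF \<phi>(1)]] test_functionsD(2)[OF test_functions_scale[OF \<eta>(1)]])+)
      (simp add: grad_scale test_functionsD(2)[OF \<phi>(1)] test_functionsD(2)[OF \<eta>(1)])
  note sq = test_functions_L2[OF \<phi>(1) SB] test_functions_L2[OF \<eta>(1) SB]
  have "(\<lambda>n. norm2 (lebesgue_on S) (\<lambda>x. (r *\<^sub>R \<phi> n x + s *\<^sub>R \<eta> n x) - (r *\<^sub>R u x + s *\<^sub>R v x))) \<longlonglongrightarrow> 0"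
    using sq u2 v2 \<phi>(2) \<eta>(2) unfolding L2_iff l2norm_eq by (intro norm2_linear_tendsto)
  then have 1: "(\<lambda>n. l2norm S (\<lambda>x. \<theta> n x - (r * u x + s * v x))) \<longlonglongrightarrow> 0"
    by (simp add: l2norm_eq \<theta>_def)
  have "(\<lambda>n. norm2 (lebesgue_on S) (\<lambda>x. (r *\<^sub>R grad (\<phi> n) x + s *\<^sub>R grad (\<eta> n) x) - (r *\<^sub>R g x + s *\<^sub>R h x))) \<longlonglongrightarrow> 0"
    using sq g(1) h(1) \<phi>(3) \<eta>(3) unfolding L2_iff l2norm_eq by (intro norm2_linear_tendsto)
  then have 2: "(\<lambda>n. l2norm S (\<lambda>x. grad (\<theta> n) x - (r *\<^sub>R g x + s *\<^sub>R h x))) \<longlonglongrightarrow> 0"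
    by (simp add: l2norm_eq gr)
  have 3: "L2 S (\<lambda>x. r * u x + s * v x)" "L2 S (\<lambda>x. r *\<^sub>R g x + s *\<^sub>R h x)"
    using u2 v2 g(1) h(1) unfolding L2_iff
    by (auto intro!: sq_integrable_add sq_integrable_mult sq_integrable_scaleR)
  have 4: "weak_gradient S (\<lambda>x. r * u x + s * v x) (\<lambda>x. r *\<^sub>R g x + s *\<^sub>R h x)"
    by (rule weak_gradient_linear[OF S u2 g v2 h])
  show ?thesis
    unfolding H10_def mem_Collect_eq
    by (intro conjI 3(1) exI[of _ "\<lambda>x. r *\<^sub>R g x + s *\<^sub>R h x"] 3(2) 4 exI[of _ \<theta>] allI \<theta> 1 2)
qed

lemma test_function_H10:
  assumes S: "open S" and \<phi>: "\<phi> \<in> test_functions S"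
  shows "\<phi> \<in> H10 S"
proof -
  have SB: "S \<in> sets borel" using S by simp
  show ?thesis
    unfolding H10_def mem_Collect_eq
    by (intro conjI exI[of _ "grad \<phi>"] exI[of _ "\<lambda>n. \<phi>"] test_functions_L2[OF \<phi> SB] weak_gradient_test_function[OF S \<phi>] allI \<phi>)
      (simp_all add: l2norm_def)
qed

lemma AE_cylinder_slices:
  fixes \<Omega> :: "'x::euclidean_space set"
  assumes \<Omega>: "open \<Omega>" and ae: "AE z in lebesgue_on (cylinder T \<Omega>). P z"
  shows "AE t in lborel. t \<in> {0<..<T} \<longrightarrow> (AE x in lebesgue_on \<Omega>. P (t, x))"
proof -
  have Q: "cylinder T \<Omega> \<in> sets borel" unfolding cylinder_def using \<Omega> by (simp add: open_Times)
  have "AE z in lebesgue. z \<in> cylinder T \<Omega> \<longrightarrow> P z"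
    using ae Q by (simp add: AE_restrict_space_iff)
  then have "AE z in (lborel :: real measure) \<Otimes>\<^sub>M lborel. z \<in> cylinder T \<Omega> \<longrightarrow> P z"
    unfolding AE_completion_iff lborel_prod .
  from lborel_pair.AE_pair[OF this] show ?thesis
  proof eventually_elim
    case (elim t)
    show ?case
    proof
      assume t: "t \<in> {0<..<T}"
      have "AE x in lborel. x \<in> \<Omega> \<longrightarrow> P (t, x)"
        using elim by eventually_elim (use t in \<open>auto simp: cylinder_def\<close>)
      then show "AE x in lebesgue_on \<Omega>. P (t, x)"
        using \<Omega> by (simp add: AE_restrict_space_iff AE_completion_iff)
    qed
  qed
qed

lemma AE_lebesgue_on_interval:
  "(AE t in lebesgue_on {0<..<T::real}. P t) \<longleftrightarrow> (AE t in lborel. t \<in> {0<..<T} \<longrightarrow> P t)"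
  by (subst AE_restrict_space_iff) (simp_all add: AE_completion_iff)

section \<open>The function spaces\<close>

definition test_pairs :: "'x::euclidean_space set \<Rightarrow> ('x \<Rightarrow> real \<times> 'x) set" where
  "test_pairs \<Omega> = (\<lambda>\<phi> x. (\<phi> x, grad \<phi> x)) ` test_functions \<Omega>"

lemma test_pairs_sq_integrable: "\<kappa> \<in> test_pairs \<Omega> \<Longrightarrow> sq_integrable lborel \<kappa>"
  unfolding test_pairs_def using test_functions_sq_integrable(1,2) sq_integrable_Pair(1) by fastforce

lemma borel_rep_Pair:
  assumes "borel_rep S f f'" "borel_rep S g g'"
  shows "borel_rep S (\<lambda>x. (f x, g x)) (\<lambda>x. (f' x, g' x))"
  unfolding borel_rep_def
proof (intro conjI allI impI)
  note r = borel_repD[OF assms(1)] and r' = borel_repD[OF assms(2)]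
  note [measurable] = r(1,3) r'(1,3)
  have "(\<lambda>x. (f' x, g' x)) \<in> borel \<rightarrow>\<^sub>M borel \<Otimes>\<^sub>M borel" "(\<lambda>x. (f x, g x)) \<in> lebesgue_on S \<rightarrow>\<^sub>M borel \<Otimes>\<^sub>M borel"
    by measurable
  then show "(\<lambda>x. (f' x, g' x)) \<in> borel_measurable borel" "(\<lambda>x. (f x, g x)) \<in> borel_measurable (lebesgue_on S)"
    by (simp_all add: borel_prod)
  show "AE x in lebesgue_on S. (f x, g x) = (f' x, g' x)" using r(4) r'(4) by eventually_elim simp
  show "(f' x, g' x) = 0" if "x \<notin> S" for x using r(2)[OF that] r'(2)[OF that] by (simp add: zero_prod_def)
qed

lemma borel_rep_add:
  assumes "borel_rep S f g" "borel_rep S f' g'"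
  shows "borel_rep S (\<lambda>x. f x + f' x) (\<lambda>x. g x + g' x)"
  using borel_rep_diff[OF assms(1) borel_rep_map[OF assms(2), of uminus]] by simp

lemma borel_rep_cong_AE:
  assumes "borel_rep S f g" "AE x in lebesgue_on S. f x = f' x" "S \<in> sets borel"
  shows "borel_rep S f' g"
proof -
  note r = borel_repD[OF assms(1)]
  have "f' \<in> borel_measurable (lebesgue_on S)"
    by (rule borel_measurable_lebesgue_on_AE[OF r(3) _ assms(2)]) (use assms(3) in simp)
  moreover have "AE x in lebesgue_on S. f' x = g x" using r(4) assms(2) by eventually_elim simp
  ultimately show ?thesis using r(1,2) by (simp add: borel_rep_def)
qed

locale space_time =
  fixes T :: real and \<Omega> :: "(real ^ 'd) set"
  assumes T: "0 < T" and \<Omega>: "open \<Omega>" "bounded \<Omega>"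
begin

abbreviation "Q \<equiv> cylinder T \<Omega>"

lemma \<Omega>_borel: "\<Omega> \<in> sets borel" and Q_borel: "Q \<in> sets borel" and Q_lebesgue: "Q \<in> sets lebesgue"
proof -
  show "\<Omega> \<in> sets borel" using \<Omega> by simp
  show "Q \<in> sets borel" unfolding cylinder_def using \<Omega> by (simp add: open_Times)
  then show "Q \<in> sets lebesgue" by simp
qed

lemma borel_rep_slices:
  assumes "borel_rep Q f g"
  shows "AE t in lborel. t \<in> {0<..<T} \<longrightarrow> borel_rep \<Omega> (\<lambda>x. f (t, x)) (\<lambda>x. g (t, x))"
  using AE_cylinder_slices[OF \<Omega>(1) borel_repD(4)[OF assms]]
proof eventually_elim
  case (elim t)
  show ?case
  proof
    assume t: "t \<in> {0<..<T}"
    have ae: "AE x in lebesgue_on \<Omega>. g (t, x) = f (t, x)" using elim t by (auto elim: eventually_mono)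
    have g: "(\<lambda>x. g (t, x)) \<in> borel_measurable borel"
      using borel_repD(1)[OF assms] by measurable
    have z: "g (t, x) = 0" if "x \<notin> \<Omega>" for x
      using borel_repD(2)[OF assms, of "(t, x)"] that by (simp add: cylinder_def)
    show "borel_rep \<Omega> (\<lambda>x. f (t, x)) (\<lambda>x. g (t, x))"
      by (rule borel_rep_cong_AE[OF borel_rep_refl[OF g z] ae \<Omega>_borel])
  qed
qed

lemma L2_rep:
  assumes "L2 Q f"
  obtains g where "borel_rep Q f g" "sq_integrable lborel g"
proof -
  obtain g where g: "borel_rep Q f g"
    using borel_rep_exists[OF _ Q_borel] assms unfolding L2_def by blast
  then show ?thesis using that assms borel_rep_sq_integrable(1)[OF g Q_borel] unfolding L2_iff by blast
qed

lemma L2_slices: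
  assumes "L2 Q f"
  shows "AE t in lborel. t \<in> {0<..<T} \<longrightarrow> L2 \<Omega> (\<lambda>x. f (t, x))"
proof -
  obtain g where g: "borel_rep Q f g" "sq_integrable lborel g" using L2_rep[OF assms] .
  show ?thesis
    using borel_rep_slices[OF g(1)] slice_sq_integrable(1)[OF g(2)]
    by eventually_elim (use borel_rep_sq_integrable(1)[OF _ \<Omega>_borel] in \<open>auto simp: L2_iff\<close>)
qed

text \<open>Weak gradients are unique on almost every slice, but slicewise equality alone says
  nothing about Q. A jointly Borel representative of the difference has slices of norm 0, and Fubini
  then makes its space-time norm 0.\<close>

lemma is_grad_x_unique:
  assumes v: "is_grad_x T \<Omega> v g" "is_grad_x T \<Omega> v h"
  shows "AE z in lebesgue_on Q. g z = h z"
proof -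
  have L: "L2 Q g" "L2 Q h" using v by (simp_all add: is_grad_x_def)
  obtain g' where g': "borel_rep Q g g'" "sq_integrable lborel g'" using L2_rep[OF L(1)] .
  obtain h' where h': "borel_rep Q h h'" "sq_integrable lborel h'" using L2_rep[OF L(2)] .
  define d where "d z = g' z - h' z" for z
  have d: "sq_integrable lborel d" unfolding d_def by (intro sq_integrable_diff g' h')
  have r: "borel_rep Q (\<lambda>z. g z - h z) d" unfolding d_def by (rule borel_rep_diff[OF g'(1) h'(1)])
  have "AE t in lborel. norm2 lborel (\<lambda>x. d (t, x)) = 0"
    using borel_rep_slices[OF r] L2_slices[OF L(1)] L2_slices[OF L(2)]
      v[unfolded is_grad_x_def AE_lebesgue_on_interval, THEN conjunct2]
  proof eventually_elim
    case (elim t)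
    show ?case
    proof (cases "t \<in> {0<..<T}")
      case True
      then have "AE x in lebesgue_on \<Omega>. g (t, x) = h (t, x)"
        using elim by (intro weak_gradient_unique[OF \<Omega>]) auto
      then have "norm2 (lebesgue_on \<Omega>) (\<lambda>x. g (t, x) - h (t, x)) = norm2 (lebesgue_on \<Omega>) (\<lambda>x. 0 :: real ^ 'd)"
        using borel_repD(3)[of \<Omega> "\<lambda>x. g (t, x) - h (t, x)"] elim(1) True
        by (intro norm2_cong_AE) (auto elim: eventually_mono)
      moreover have "norm2 lborel (\<lambda>x. d (t, x)) = norm2 (lebesgue_on \<Omega>) (\<lambda>x. g (t, x) - h (t, x))"
        using borel_rep_sq_integrable(2)[OF _ \<Omega>_borel] elim(1) True by metis
      ultimately show ?thesis by (simp add: norm2_def)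
    next
      case False
      then have "d (t, x) = 0" for x using borel_repD(2)[OF r, of "(t, x)"] by (auto simp: cylinder_def)
      then show ?thesis by (simp add: norm2_def)
    qed
  qed
  then have "(LBINT t. (norm2 lborel (\<lambda>x. d (t, x)))\<^sup>2) = 0"
    by (intro integral_eq_zero_AE) (auto elim: eventually_mono)
  then have "(LBINT z. (norm (d z))\<^sup>2) = 0"
    using slice_sq_integrable(3)[OF d] by (simp add: norm2_power2)
  then have "AE z in lborel. (norm (d z))\<^sup>2 = 0"
    using sq_integrableD(2)[OF d] by (subst (asm) integral_nonneg_eq_0_iff_AE) auto
  then have "AE z in lebesgue. z \<in> Q \<longrightarrow> d z = 0"
    unfolding AE_completion_iff by eventually_elim simp
  then have "AE z in lebesgue_on Q. d z = 0" using Q_lebesgue by (simp add: AE_restrict_space_iff)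
  then show ?thesis using borel_repD(4)[OF r] by eventually_elim simp
qed

section \<open>The space V and its dual\<close>

lemma V_spaceD:
  assumes "v \<in> V_space T \<Omega>"
  shows "L2 Q v" "AE t in lborel. t \<in> {0<..<T} \<longrightarrow> (\<lambda>x. v (t, x)) \<in> H10 \<Omega>"
    "is_grad_x T \<Omega> v (grad_x T \<Omega> v)" "L2 Q (grad_x T \<Omega> v)"
proof -
  show "L2 Q v" "AE t in lborel. t \<in> {0<..<T} \<longrightarrow> (\<lambda>x. v (t, x)) \<in> H10 \<Omega>"
    using assms by (simp_all add: V_space_def AE_lebesgue_on_interval)
  have "\<exists>g. is_grad_x T \<Omega> v g" using assms by (simp add: V_space_def)
  then show "is_grad_x T \<Omega> v (grad_x T \<Omega> v)" unfolding grad_x_def by (rule someI_ex)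
  then show "L2 Q (grad_x T \<Omega> v)" by (simp add: is_grad_x_def)
qed

lemma is_grad_x_linear:
  assumes v: "L2 Q v" "is_grad_x T \<Omega> v g" and w: "L2 Q w" "is_grad_x T \<Omega> w h"
  shows "is_grad_x T \<Omega> (\<lambda>z. r * v z + s * w z) (\<lambda>z. r *\<^sub>R g z + s *\<^sub>R h z)"
  unfolding is_grad_x_def AE_lebesgue_on_interval
proof
  have L: "L2 Q g" "L2 Q h" using v w by (simp_all add: is_grad_x_def)
  then show "L2 Q (\<lambda>z. r *\<^sub>R g z + s *\<^sub>R h z)"
    unfolding L2_iff by (intro sq_integrable_add sq_integrable_scaleR)
  show "AE t in lborel. t \<in> {0<..<T} \<longrightarrow> weak_gradient \<Omega> (\<lambda>x. r * v (t, x) + s * w (t, x)) (\<lambda>x. r *\<^sub>R g (t, x) + s *\<^sub>R h (t, x))"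
    using L2_slices[OF v(1)] L2_slices[OF w(1)] L2_slices[OF L(1)] L2_slices[OF L(2)]
      v(2)[unfolded is_grad_x_def AE_lebesgue_on_interval, THEN conjunct2]
      w(2)[unfolded is_grad_x_def AE_lebesgue_on_interval, THEN conjunct2]
    by eventually_elim (auto intro: weak_gradient_linear[OF \<Omega>(1)])
qed

lemma V_space_linear:
  assumes v: "v \<in> V_space T \<Omega>" and w: "w \<in> V_space T \<Omega>"
  shows "(\<lambda>z. r * v z + s * w z) \<in> V_space T \<Omega>"
    "AE z in lebesgue_on Q. grad_x T \<Omega> (\<lambda>z. r * v z + s * w z) z = r *\<^sub>R grad_x T \<Omega> v z + s *\<^sub>R grad_x T \<Omega> w z"
proof -
  note v' = V_spaceD[OF v] and w' = V_spaceD[OF w]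
  have g: "is_grad_x T \<Omega> (\<lambda>z. r * v z + s * w z) (\<lambda>z. r *\<^sub>R grad_x T \<Omega> v z + s *\<^sub>R grad_x T \<Omega> w z)"
    by (rule is_grad_x_linear[OF v'(1,3) w'(1,3)])
  have "L2 Q (\<lambda>z. r * v z + s * w z)"
    using v'(1) w'(1) unfolding L2_iff by (intro sq_integrable_add sq_integrable_mult)
  moreover have "AE t in lborel. t \<in> {0<..<T} \<longrightarrow> (\<lambda>x. r * v (t, x) + s * w (t, x)) \<in> H10 \<Omega>"
    using v'(2) w'(2) by eventually_elim (auto intro: H10_linear[OF \<Omega>(1)])
  ultimately show V: "(\<lambda>z. r * v z + s * w z) \<in> V_space T \<Omega>"
    using g by (auto simp: V_space_def AE_lebesgue_on_interval)
  show "AE z in lebesgue_on Q. grad_x T \<Omega> (\<lambda>z. r * v z + s * w z) z = r *\<^sub>R grad_x T \<Omega> v z + s *\<^sub>R grad_x T \<Omega> w z"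
    by (rule is_grad_x_unique[OF V_spaceD(3)[OF V] g])
qed

text \<open>An element of the dual acts on functions of space-time and has no values at single
  times. The square integrable field G has time slices, which makes the functional part of an
  evolution equation.\<close>

lemma V_dual_representation:
  assumes l: "l \<in> V_dual T \<Omega>"
  obtains G where "L2 Q G" "\<And>v. v \<in> V_space T \<Omega> \<Longrightarrow> l v = l2inner Q G (grad_x T \<Omega> v)"
proof (cases "V_space T \<Omega> = {}")
  case True
  then show ?thesis using that[of "\<lambda>z. 0"] by (simp add: L2_iff sq_integrable_zero)
next
  case False
  obtain C where C: "\<And>v. v \<in> V_space T \<Omega> \<Longrightarrow> \<bar>l v\<bar> \<le> C * V_norm T \<Omega> v"
    using l unfolding V_dual_def by blast
  obtain G where "sq_integrable (lebesgue_on Q) G"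
    "\<And>v. v \<in> V_space T \<Omega> \<Longrightarrow> l v = (LINT z|lebesgue_on Q. G z \<bullet> grad_x T \<Omega> v z)"
  proof (rule Riesz_representation[where X = "V_space T \<Omega>" and pls = "\<lambda>v w z. v z + w z" and scl = "\<lambda>r v z. r * v z"
        and D = "grad_x T \<Omega>" and L = l and M = "lebesgue_on Q" and C = C])
    show "sq_integrable (lebesgue_on Q) (grad_x T \<Omega> v)" if "v \<in> V_space T \<Omega>" for v
      using V_spaceD(4)[OF that] by (simp add: L2_iff)
    fix v w r assume v: "v \<in> V_space T \<Omega>"
    show "(\<lambda>z. r * v z) \<in> V_space T \<Omega>" "AE x in lebesgue_on Q. grad_x T \<Omega> (\<lambda>z. r * v z) x = r *\<^sub>R grad_x T \<Omega> v x"
      using V_space_linear[OF v v, of r 0] by simp_all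
    show "l (\<lambda>z. r * v z) = r * l v" using l v unfolding V_dual_def by blast
    show "\<bar>l v\<bar> \<le> C * norm2 (lebesgue_on Q) (grad_x T \<Omega> v)" using C[OF v] by (simp add: V_norm_def l2norm_eq)
    assume w: "w \<in> V_space T \<Omega>"
    show "(\<lambda>z. v z + w z) \<in> V_space T \<Omega>" "AE x in lebesgue_on Q. grad_x T \<Omega> (\<lambda>z. v z + w z) x = grad_x T \<Omega> v x + grad_x T \<Omega> w x"
      using V_space_linear[OF v w, of 1 1] by simp_all
    show "l (\<lambda>z. v z + w z) = l v + l w" using l v w unfolding V_dual_def by blast
  qed (rule False, blast)
  then show ?thesis using that by (simp add: L2_iff l2inner_def)
qed

lemma tensor_V_space:
  assumes \<psi>: "\<psi> \<in> test_functions {0<..<T}" and \<phi>: "\<phi> \<in> test_functions \<Omega>"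
  shows "(\<lambda>z. \<psi> (fst z) * \<phi> (snd z)) \<in> V_space T \<Omega>"
    "borel_rep Q (grad_x T \<Omega> (\<lambda>z. \<psi> (fst z) * \<phi> (snd z))) (\<lambda>z. \<psi> (fst z) *\<^sub>R grad \<phi> (snd z))"
    "borel_rep Q (\<lambda>z. \<psi> (fst z) * \<phi> (snd z)) (\<lambda>z. \<psi> (fst z) * \<phi> (snd z))"
    "sq_integrable lborel (\<lambda>z. \<psi> (fst z) *\<^sub>R grad \<phi> (snd z))" "sq_integrable lborel (\<lambda>z. \<psi> (fst z) * \<phi> (snd z))"
proof -
  note p = test_functions_sq_integrable[OF \<psi>] and q = test_functions_sq_integrable[OF \<phi>]
  show sq: "sq_integrable lborel (\<lambda>z. \<psi> (fst z) *\<^sub>R grad \<phi> (snd z))" "sq_integrable lborel (\<lambda>z. \<psi> (fst z) * \<phi> (snd z))"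
    using tensor_sq_integrable[OF p(1) q(1)] tensor_sq_integrable[OF p(1) q(2)] by simp_all
  have out: "\<psi> (fst z) * \<phi> (snd z) = 0" "\<psi> (fst z) *\<^sub>R grad \<phi> (snd z) = 0" if "z \<notin> Q" for z
  proof -
    have "fst z \<notin> {0<..<T} \<or> snd z \<notin> \<Omega>" using that by (cases z) (auto simp: cylinder_def)
    then show "\<psi> (fst z) * \<phi> (snd z) = 0" "\<psi> (fst z) *\<^sub>R grad \<phi> (snd z) = 0"
      using test_functions_outside(1)[OF \<psi>] test_functions_outside[OF \<phi>] by auto
  qed
  have rg: "borel_rep Q (\<lambda>z. \<psi> (fst z) *\<^sub>R grad \<phi> (snd z)) (\<lambda>z. \<psi> (fst z) *\<^sub>R grad \<phi> (snd z))"
    by (rule borel_rep_refl) (use sq_integrableD(1)[OF sq(1)] out in auto)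
  show rv: "borel_rep Q (\<lambda>z. \<psi> (fst z) * \<phi> (snd z)) (\<lambda>z. \<psi> (fst z) * \<phi> (snd z))"
    by (rule borel_rep_refl) (use sq_integrableD(1)[OF sq(2)] out in auto)
  have gr: "grad (\<lambda>x. \<psi> t * \<phi> x) = (\<lambda>x. \<psi> t *\<^sub>R grad \<phi> x)" for t
    using grad_scale[OF test_functionsD(2)[OF \<phi>]] by (simp add: fun_eq_iff)
  have t: "(\<lambda>x. \<psi> t * \<phi> x) \<in> test_functions \<Omega>" for t by (rule test_functions_scale[OF \<phi>])
  have g: "is_grad_x T \<Omega> (\<lambda>z. \<psi> (fst z) * \<phi> (snd z)) (\<lambda>z. \<psi> (fst z) *\<^sub>R grad \<phi> (snd z))"
    unfolding is_grad_x_def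
  proof
    show "L2 Q (\<lambda>z. \<psi> (fst z) *\<^sub>R grad \<phi> (snd z))"
      unfolding L2_iff using borel_rep_sq_integrable(1)[OF rg Q_borel] sq(1) by blast
    show "AE t in lebesgue_on {0<..<T}. weak_gradient \<Omega> (\<lambda>x. \<psi> (fst (t, x)) * \<phi> (snd (t, x))) (\<lambda>x. \<psi> (fst (t, x)) *\<^sub>R grad \<phi> (snd (t, x)))"
      using weak_gradient_test_function[OF \<Omega>(1) t] by (simp add: gr)
  qed
  have "L2 Q (\<lambda>z. \<psi> (fst z) * \<phi> (snd z))"
    unfolding L2_iff using borel_rep_sq_integrable(1)[OF rv Q_borel] sq(2) by blast
  then show V: "(\<lambda>z. \<psi> (fst z) * \<phi> (snd z)) \<in> V_space T \<Omega>"
    using g test_function_H10[OF \<Omega>(1) t] by (auto simp: V_space_def)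
  show "borel_rep Q (grad_x T \<Omega> (\<lambda>z. \<psi> (fst z) * \<phi> (snd z))) (\<lambda>z. \<psi> (fst z) *\<^sub>R grad \<phi> (snd z))"
    by (rule borel_rep_cong_AE[OF rg is_grad_x_unique[OF g V_spaceD(3)[OF V]] Q_borel])
qed

text \<open>Links the definition of H_0^1 by approximation with the closure used in the evolution
  equation, slice by slice.\<close>

lemma V_space_in_closure:
  assumes v: "v \<in> V_space T \<Omega>" and rv: "borel_rep Q v v'" and rg: "borel_rep Q (grad_x T \<Omega> v) g'"
  shows "AE t in lborel. t \<in> {0<..<T} \<longrightarrow> in_closure (test_pairs \<Omega>) (\<lambda>x. (v' (t, x), g' (t, x)))"
  using V_spaceD(2)[OF v] borel_rep_slices[OF rv] borel_rep_slices[OF rg] L2_slices[OF V_spaceD(4)[OF v]]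
    V_spaceD(3)[OF v, unfolded is_grad_x_def AE_lebesgue_on_interval, THEN conjunct2]
proof eventually_elim
  case (elim t)
  show ?case
  proof
    assume t: "t \<in> {0<..<T}"
    let ?v = "\<lambda>x. v (t, x)" and ?g = "\<lambda>x. grad_x T \<Omega> v (t, x)" and ?v' = "\<lambda>x. v' (t, x)" and ?g' = "\<lambda>x. g' (t, x)"
    have H: "?v \<in> H10 \<Omega>" and r1: "borel_rep \<Omega> ?v ?v'" and r2: "borel_rep \<Omega> ?g ?g'" and Lg: "L2 \<Omega> ?g" and w: "weak_gradient \<Omega> ?v ?g"
      using elim t by auto
    obtain h \<phi> where Lv: "L2 \<Omega> ?v" and h: "L2 \<Omega> h" "weak_gradient \<Omega> ?v h"
      and \<phi>: "\<And>n::nat. \<phi> n \<in> test_functions \<Omega>" "(\<lambda>n. l2norm \<Omega> (\<lambda>x. \<phi> n x - ?v x)) \<longlonglongrightarrow> 0"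
      "(\<lambda>n. l2norm \<Omega> (\<lambda>x. grad (\<phi> n) x - h x)) \<longlonglongrightarrow> 0"
      using H unfolding H10_def by blast
    \<comment> \<open>The gradient h delivered by membership in H_0^1 may differ from the slice of
      the chosen space-time gradient; uniqueness of weak gradients identifies them.\<close>
    have r3: "borel_rep \<Omega> h ?g'"
      by (rule borel_rep_cong_AE[OF r2 weak_gradient_unique[OF \<Omega> Lg w h] \<Omega>_borel])
    note p = test_functions_sq_integrable[OF \<phi>(1)]
    have s: "sq_integrable lborel ?v'" "sq_integrable lborel ?g'"
      using Lv Lg borel_rep_sq_integrable(1)[OF r1 \<Omega>_borel] borel_rep_sq_integrable(1)[OF r2 \<Omega>_borel] by (auto simp: L2_iff)
    have l1: "(\<lambda>n. norm2 lborel (\<lambda>x. \<phi> n x - ?v' x)) \<longlonglongrightarrow> 0"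
      using \<phi>(2) unfolding l2norm_eq borel_rep_sq_integrable(2)[OF borel_rep_diff[OF p(3) r1] \<Omega>_borel] .
    have l2: "(\<lambda>n. norm2 lborel (\<lambda>x. grad (\<phi> n) x - ?g' x)) \<longlonglongrightarrow> 0"
      using \<phi>(3) unfolding l2norm_eq borel_rep_sq_integrable(2)[OF borel_rep_diff[OF p(4) r3] \<Omega>_borel] .
    have "(\<lambda>n. sqrt ((norm2 lborel (\<lambda>x. \<phi> n x - ?v' x))\<^sup>2 + (norm2 lborel (\<lambda>x. grad (\<phi> n) x - ?g' x))\<^sup>2)) \<longlonglongrightarrow> sqrt (0\<^sup>2 + 0\<^sup>2)"
      by (intro tendsto_intros l1 l2)
    moreover have "norm2 lborel (\<lambda>x. (\<phi> n x, grad (\<phi> n) x) - (?v' x, ?g' x)) =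
        sqrt ((norm2 lborel (\<lambda>x. \<phi> n x - ?v' x))\<^sup>2 + (norm2 lborel (\<lambda>x. grad (\<phi> n) x - ?g' x))\<^sup>2)" for n
      unfolding sq_integrable_Pair(2)[OF sq_integrable_diff[OF p(1) s(1)] sq_integrable_diff[OF p(2) s(2)], symmetric]
      by (simp add: norm2_nonneg)
    ultimately have "(\<lambda>n. norm2 lborel (\<lambda>x. (\<phi> n x, grad (\<phi> n) x) - (?v' x, ?g' x))) \<longlonglongrightarrow> 0"
      by (simp only:) simp
    then show "in_closure (test_pairs \<Omega>) (\<lambda>x. (v' (t, x), g' (t, x)))"
      unfolding in_closure_def test_pairs_def using \<phi>(1)
      by (intro conjI sq_integrable_Pair(1) s exI[of _ "\<lambda>n x. (\<phi> n x, grad (\<phi> n) x)"]) auto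
  qed
qed

lemma integral_tensor_slices:
  fixes F :: "real \<times> (real ^ 'd) \<Rightarrow> 'b::euclidean_space"
  assumes F: "sq_integrable lborel F" and a: "sq_integrable lborel a" and b: "sq_integrable lborel b"
  shows "(LBINT z. F z \<bullet> (a (fst z) *\<^sub>R b (snd z))) =
    (LBINT t. a t * (LBINT x. F (t, x) \<bullet> b x))"
  using slice_integrable(3)[OF sq_integrable_inner(1)[OF F tensor_sq_integrable[OF a b]]] by simp

text \<open>The relation defining the residual is tested with \<psi>(t) \<phi>(x). Since l acts on
  it as G against its space gradient, the dual variable simply joins the flux: the equation has
  right-hand side (f, \<sigma> + G).\<close>

lemma U_space_evolution:
  assumes U: "(u, \<sigma>, l) \<in> U_space T \<Omega>"
    and G: "L2 Q G" "\<And>v. v \<in> V_space T \<Omega> \<Longrightarrow> l v = l2inner Q G (grad_x T \<Omega> v)"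
    and ru: "borel_rep Q u u'" and rp: "borel_rep Q (grad_x T \<Omega> u) p'" and rf: "borel_rep Q (div_residual T \<Omega> (u, \<sigma>, l)) f'"
    and r\<sigma>: "borel_rep Q \<sigma> \<sigma>'" and rG: "borel_rep Q G G'"
  shows "weak_evolution T (test_pairs \<Omega>) (\<lambda>z. (u' z, p' z)) (\<lambda>z. (f' z, \<sigma>' z + G' z))"
proof -
  have u: "u \<in> V_space T \<Omega>" and \<sigma>: "L2 Q \<sigma>" and ex: "\<exists>f. is_div_residual T \<Omega> (u, \<sigma>, l) f"
    using U by (auto simp: U_space_def)
  define f where "f = div_residual T \<Omega> (u, \<sigma>, l)"
  have f: "is_div_residual T \<Omega> (u, \<sigma>, l) f" unfolding f_def div_residual_def by (rule someI_ex[OF ex])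
  have Lf: "L2 Q f" and rep: "\<And>\<phi>. \<phi> \<in> test_functions Q \<Longrightarrow> distr_div Q (\<lambda>z. (u z, \<sigma> z)) \<phi> - l \<phi> = l2inner Q f \<phi>"
    using f by (auto simp: represents_def)
  note V = V_spaceD[OF u]
  have su: "sq_integrable lborel u'" and sp: "sq_integrable lborel p'" and sf: "sq_integrable lborel f'"
    and s\<sigma>: "sq_integrable lborel \<sigma>'" and sG: "sq_integrable lborel G'"
    using V(1,4) Lf \<sigma> G(1) borel_rep_sq_integrable(1)[OF ru Q_borel] borel_rep_sq_integrable(1)[OF rp Q_borel]
      borel_rep_sq_integrable(1)[OF rf Q_borel] borel_rep_sq_integrable(1)[OF r\<sigma> Q_borel] borel_rep_sq_integrable(1)[OF rG Q_borel]
    unfolding L2_iff f_def by blast+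
  have weak: "(LBINT t. grad \<psi> t * (LBINT x. u' (t, x) * \<phi> x)) =
      - (LBINT t. \<psi> t * (LBINT x. (f' (t, x), \<sigma>' (t, x) + G' (t, x)) \<bullet> (\<phi> x, grad \<phi> x)))"
    if \<psi>: "\<psi> \<in> test_functions {0<..<T}" and \<phi>: "\<phi> \<in> test_functions \<Omega>" for \<psi> \<phi>
  proof -
    let ?\<Phi> = "\<lambda>z. \<psi> (fst z) * \<phi> (snd z)"
    note tp = test_functions_sq_integrable[OF \<psi>] and tq = test_functions_sq_integrable[OF \<phi>]
    have \<Phi>: "?\<Phi> \<in> test_functions Q" unfolding cylinder_def by (rule test_functions_tensor(1)[OF \<psi> \<phi>])
    note tV = tensor_V_space[OF \<psi> \<phi>]
    have g\<Phi>: "grad ?\<Phi> = (\<lambda>z. (\<phi> (snd z) *\<^sub>R grad \<psi> (fst z), \<psi> (fst z) *\<^sub>R grad \<phi> (snd z)))"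
      using test_functions_tensor(2)[OF \<psi> \<phi>] by (simp add: fun_eq_iff)
    define I1 where "I1 = (LBINT z. u' z \<bullet> (grad \<psi> (fst z) *\<^sub>R \<phi> (snd z)))"
    define I2 where "I2 = (LBINT z. \<sigma>' z \<bullet> (\<psi> (fst z) *\<^sub>R grad \<phi> (snd z)))"
    define I3 where "I3 = (LBINT z. G' z \<bullet> (\<psi> (fst z) *\<^sub>R grad \<phi> (snd z)))"
    define I4 where "I4 = (LBINT z. f' z \<bullet> (\<psi> (fst z) *\<^sub>R \<phi> (snd z)))"
    have i: "integrable lborel (\<lambda>z. u' z \<bullet> (grad \<psi> (fst z) *\<^sub>R \<phi> (snd z)))" "integrable lborel (\<lambda>z. \<sigma>' z \<bullet> (\<psi> (fst z) *\<^sub>R grad \<phi> (snd z)))"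
      by (intro sq_integrable_inner(1) su s\<sigma> tensor_sq_integrable tp tq)+
    have "distr_div Q (\<lambda>z. (u z, \<sigma> z)) ?\<Phi> = - (LBINT z. (u' z, \<sigma>' z) \<bullet> grad ?\<Phi> z)"
      unfolding distr_div_def
      by (simp add: borel_rep_l2inner[OF borel_rep_Pair[OF ru r\<sigma>] test_functions_sq_integrable(4)[OF \<Phi>] Q_borel])
    also have "(LBINT z. (u' z, \<sigma>' z) \<bullet> grad ?\<Phi> z) =
        (LBINT z. u' z \<bullet> (grad \<psi> (fst z) *\<^sub>R \<phi> (snd z)) + \<sigma>' z \<bullet> (\<psi> (fst z) *\<^sub>R grad \<phi> (snd z)))"
      unfolding g\<Phi> by (simp add: inner_prod_def mult_ac)
    also have "\<dots> = I1 + I2" unfolding I1_def I2_def by (rule Bochner_Integration.integral_add[OF i])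
    finally have 1: "distr_div Q (\<lambda>z. (u z, \<sigma> z)) ?\<Phi> = - (I1 + I2)" .
    have 2: "l ?\<Phi> = I3"
      unfolding G(2)[OF tV(1)] borel_rep_l2inner[OF rG tV(2) Q_borel] I3_def ..
    have 3: "l2inner Q f ?\<Phi> = I4"
      unfolding f_def borel_rep_l2inner[OF rf tV(3) Q_borel] I4_def by simp
    \<comment> \<open>This is -(I1 + I2) - I3 = I4, the definition of the residual for this product,
      solved for the time derivative term.\<close>
    have main: "I1 = - (I4 + (I2 + I3))" using rep[OF \<Phi>] unfolding 1 2 3 by linarith
    have sk: "sq_integrable lborel (\<lambda>z. (f' z, \<sigma>' z + G' z))"
      by (intro sq_integrable_Pair(1) sq_integrable_add sf s\<sigma> sG)
    have "(LBINT t. \<psi> t * (LBINT x. (f' (t, x), \<sigma>' (t, x) + G' (t, x)) \<bullet> (\<phi> x, grad \<phi> x))) =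
        (LBINT z. (f' z, \<sigma>' z + G' z) \<bullet> (\<psi> (fst z) *\<^sub>R (\<phi> (snd z), grad \<phi> (snd z))))"
      by (rule integral_tensor_slices[OF sk tp(1) sq_integrable_Pair(1)[OF tq(1,2)], symmetric])
    also have "\<dots> = (LBINT z. f' z \<bullet> (\<psi> (fst z) *\<^sub>R \<phi> (snd z)) +
        (\<sigma>' z \<bullet> (\<psi> (fst z) *\<^sub>R grad \<phi> (snd z)) + G' z \<bullet> (\<psi> (fst z) *\<^sub>R grad \<phi> (snd z))))"
      by (simp add: inner_prod_def inner_add_left distrib_left)
    also have "\<dots> = I4 + (I2 + I3)"
      unfolding I2_def I3_def I4_def
      by (subst Bochner_Integration.integral_add;
          (subst Bochner_Integration.integral_add)?;
          (intro refl Bochner_Integration.integrable_add sq_integrable_inner(1) sf s\<sigma> sG tensor_sq_integrable tp tq)?)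
    finally have 4: "(LBINT t. \<psi> t * (LBINT x. (f' (t, x), \<sigma>' (t, x) + G' (t, x)) \<bullet> (\<phi> x, grad \<phi> x))) = I4 + (I2 + I3)" .
    have "(LBINT t. grad \<psi> t * (LBINT x. u' (t, x) * \<phi> x)) = I1"
      unfolding I1_def integral_tensor_slices[OF su tp(2) tq(1)] by simp
    then show ?thesis unfolding 4 main .
  qed
  show ?thesis
    unfolding weak_evolution_def
  proof (intro conjI T ballI allI impI)
    show "sq_integrable lborel \<kappa>" if "\<kappa> \<in> test_pairs \<Omega>" for \<kappa> by (rule test_pairs_sq_integrable[OF that])
    show "sq_integrable lborel (\<lambda>z. (u' z, p' z))" by (rule sq_integrable_Pair(1)[OF su sp])
    show "sq_integrable lborel (\<lambda>z. (f' z, \<sigma>' z + G' z))" by (intro sq_integrable_Pair(1) sq_integrable_add sf s\<sigma> sG)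
    fix t x assume "t \<notin> {0<..<T}"
    then have "(t, x) \<notin> Q" by (auto simp: cylinder_def)
    then show "(u' (t, x), p' (t, x)) = 0" "(f' (t, x), \<sigma>' (t, x) + G' (t, x)) = 0"
      using borel_repD(2)[OF ru] borel_repD(2)[OF rp] borel_repD(2)[OF rf] borel_repD(2)[OF r\<sigma>] borel_repD(2)[OF rG]
      by (simp_all add: zero_prod_def)
  next
    show "AE t in lborel. t \<in> {0<..<T} \<longrightarrow> in_closure (test_pairs \<Omega>) (\<lambda>x. (u' (t, x), p' (t, x)))"
      by (rule V_space_in_closure[OF u ru rp])
  next
    fix \<kappa> \<psi> assume "\<kappa> \<in> test_pairs \<Omega>" and \<psi>: "\<psi> \<in> test_functions {0<..<T}"
    then obtain \<phi> where \<phi>: "\<phi> \<in> test_functions \<Omega>" "\<kappa> = (\<lambda>x. (\<phi> x, grad \<phi> x))" by (auto simp: test_pairs_def)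
    show "(LBINT t. grad \<psi> t * (LBINT x. fst (u' (t, x), p' (t, x)) * fst (\<kappa> x))) =
        - (LBINT t. \<psi> t * (LBINT x. (f' (t, x), \<sigma>' (t, x) + G' (t, x)) \<bullet> \<kappa> x))"
      using weak[OF \<psi> \<phi>(1)] unfolding \<phi>(2) by simp
  qed
qed

end

section \<open>Energy identity and convection term\<close>

lemma norm2_AE_bound:
  fixes h :: "'a \<Rightarrow> 'b::euclidean_space" and k :: "'a \<Rightarrow> 'c::euclidean_space"
  assumes k: "sq_integrable M k" and h: "h \<in> borel_measurable M" and b: "AE x in M. norm (h x) \<le> B * norm (k x)" and B: "0 \<le> B"
  shows "sq_integrable M h" "norm2 M h \<le> B * norm2 M k"
proof -
  have i: "integrable M (\<lambda>x. B\<^sup>2 * (norm (k x))\<^sup>2)" using sq_integrableD(2)[OF k] by simp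
  have le: "AE x in M. (norm (h x))\<^sup>2 \<le> B\<^sup>2 * (norm (k x))\<^sup>2"
    using b by eventually_elim (metis norm_ge_zero power_mono power_mult_distrib)
  have "integrable M (\<lambda>x. (norm (h x))\<^sup>2)"
    by (rule Bochner_Integration.integrable_bound[OF i]) (use h le in \<open>auto elim: eventually_mono\<close>)
  then show s: "sq_integrable M h" using h by (simp add: sq_integrable_def)
  have "(norm2 M h)\<^sup>2 \<le> (B * norm2 M k)\<^sup>2"
    using integral_mono_AE[OF sq_integrableD(2)[OF s] i le] by (simp add: norm2_power2 power_mult_distrib)
  then show "norm2 M h \<le> B * norm2 M k" by (rule power2_le_imp_le) (simp add: B norm2_nonneg)
qed

text \<open>Some nonnegative essential bound, fixed by choice; it depends on the coefficient alone,
  so the constants built from it do not depend on u and v.\<close>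

definition Linf_bound :: "'a::euclidean_space set \<Rightarrow> ('a \<Rightarrow> 'b::euclidean_space) \<Rightarrow> real" where
  "Linf_bound S f = (SOME C. 0 \<le> C \<and> (AE x in lebesgue_on S. norm (f x) \<le> C))"

lemma Linf_boundD:
  assumes "Linf S f"
  shows "0 \<le> Linf_bound S f" "AE x in lebesgue_on S. norm (f x) \<le> Linf_bound S f"
proof -
  obtain C where C: "AE x in lebesgue_on S. norm (f x) \<le> C" using assms unfolding Linf_def by blast
  have "AE x in lebesgue_on S. norm (f x) \<le> \<bar>C\<bar>" using C by eventually_elim simp
  then have "\<exists>C. 0 \<le> C \<and> (AE x in lebesgue_on S. norm (f x) \<le> C)" by (intro exI[of _ "\<bar>C\<bar>"]) simp
  from someI_ex[OF this] show "0 \<le> Linf_bound S f" "AE x in lebesgue_on S. norm (f x) \<le> Linf_bound S f"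
    by (simp_all add: Linf_bound_def)
qed

lemma Linf_inner:
  fixes f y :: "'a::euclidean_space \<Rightarrow> 'b::euclidean_space"
  assumes f: "Linf S f" and y: "sq_integrable (lebesgue_on S) y"
  shows "norm2 (lebesgue_on S) (\<lambda>z. f z \<bullet> y z) \<le> Linf_bound S f * norm2 (lebesgue_on S) y"
    "sq_integrable (lebesgue_on S) (\<lambda>z. f z \<bullet> y z)"
proof -
  have [measurable]: "f \<in> borel_measurable (lebesgue_on S)" using f by (simp add: Linf_def)
  note [measurable] = sq_integrableD(1)[OF y]
  have m: "(\<lambda>z. f z \<bullet> y z) \<in> borel_measurable (lebesgue_on S)" by measurable
  have b: "AE z in lebesgue_on S. norm (f z \<bullet> y z) \<le> Linf_bound S f * norm (y z)"
    using Linf_boundD(2)[OF f]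
  proof eventually_elim
    case (elim z)
    have "\<bar>f z \<bullet> y z\<bar> \<le> norm (f z) * norm (y z)" by (rule Cauchy_Schwarz_ineq2)
    also have "\<dots> \<le> Linf_bound S f * norm (y z)" using elim by (intro mult_right_mono) auto
    finally show ?case by simp
  qed
  show "norm2 (lebesgue_on S) (\<lambda>z. f z \<bullet> y z) \<le> Linf_bound S f * norm2 (lebesgue_on S) y"
    "sq_integrable (lebesgue_on S) (\<lambda>z. f z \<bullet> y z)"
    using norm2_AE_bound[OF y m b Linf_boundD(1)[OF f]] by simp_all
qed

lemma norm2_restrict:
  fixes f :: "'a::euclidean_space \<Rightarrow> 'b::euclidean_space"
  assumes f: "sq_integrable lborel f" and S: "S \<in> sets borel"
  shows "sq_integrable (lebesgue_on S) f" "norm2 (lebesgue_on S) f \<le> norm2 lborel f"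
proof -
  define g where "g x = indicator S x *\<^sub>R f x" for x
  have fm [measurable]: "f \<in> borel_measurable borel" using sq_integrableD(1)[OF f] by simp
  have gm: "g \<in> borel_measurable borel" unfolding g_def[abs_def] using S by measurable
  have "AE x in lebesgue_on S. g x = f x"
    using S by (subst AE_restrict_space_iff) (auto simp: g_def)
  then have r: "borel_rep S f g"
    using gm by (intro borel_rep_cong_AE[OF borel_rep_refl]) (auto simp: g_def S)
  have gl: "g \<in> borel_measurable lborel" using gm by simp
  have b: "AE x in lborel. norm (g x) \<le> 1 * norm (f x)" by (auto simp: g_def indicator_def)
  have "sq_integrable lborel g" "norm2 lborel g \<le> 1 * norm2 lborel f"
    by (rule norm2_AE_bound[OF f gl b]; simp)+
  then show "sq_integrable (lebesgue_on S) f" "norm2 (lebesgue_on S) f \<le> norm2 lborel f"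
    using borel_rep_sq_integrable[OF r S] by auto
qed

context space_time
begin

lemma Q_bounded: "bounded Q"
  unfolding cylinder_def using \<Omega> by (intro bounded_Times) auto

lemma Linf_rep:
  assumes "Linf Q f"
  obtains g C where "borel_rep Q f g" "0 \<le> C" "\<And>z. norm (g z) \<le> C" "sq_integrable lborel g"
proof -
  obtain C where C: "AE z in lebesgue_on Q. norm (f z) \<le> C" and fm: "f \<in> borel_measurable (lebesgue_on Q)"
    using assms unfolding Linf_def by blast
  obtain g where g: "borel_rep Q f g" using borel_rep_exists[OF fm Q_borel] .
  note r = borel_repD[OF g]
  \<comment> \<open>Larger values occur only on a null set; removing them makes the bound hold
    everywhere, in particular on every slice.\<close>
  define g' where "g' z = (if norm (g z) \<le> C then g z else 0)" for z
  have [measurable]: "g \<in> borel_measurable borel" by (rule r(1))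
  have m: "g' \<in> borel_measurable borel" unfolding g'_def[abs_def] by measurable
  have "AE z in lebesgue_on Q. g' z = f z"
    using C r(4) by eventually_elim (auto simp: g'_def)
  then have rep: "borel_rep Q f g'"
    using m r(2) by (intro borel_rep_cong_AE[OF borel_rep_refl _ Q_borel]) (auto simp: g'_def)
  have b: "norm (g' z) \<le> \<bar>C\<bar>" for z by (auto simp: g'_def)
  have "sq_integrable lborel g'"
    by (rule norm2_AE_bound(1)[OF indicator_sq_integrable[OF Q_borel Q_bounded], of _ "\<bar>C\<bar>"])
      (use m b borel_repD(2)[OF rep] in \<open>auto simp: indicator_def\<close>)
  then show ?thesis using that[OF rep _ b] by simp
qed

text \<open>\<open>time_value\<close> is a choice, so it has its properties as soon as one
  continuous representative exists. It may differ from the one constructed; later arguments use only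
  \<open>is_cont_rep\<close>.\<close>

lemma time_value_rep:
  assumes ev: "weak_evolution T (test_pairs \<Omega>) (\<lambda>z. (u' z, p' z)) k" and ru: "borel_rep Q u u'"
  shows "is_cont_rep T \<Omega> u (time_value T \<Omega> u)"
proof -
  obtain w where w: "\<And>t. t \<in> {0..T} \<Longrightarrow> sq_integrable lborel (w t)"
    "\<And>t. t \<in> {0..T} \<Longrightarrow> ((\<lambda>s. norm2 lborel (\<lambda>x. w s x - w t x)) \<longlongrightarrow> 0) (at t within {0..T})"
    "AE t in lborel. t \<in> {0<..<T} \<longrightarrow> (AE x in lborel. w t x = fst (u' (t, x), p' (t, x)))"
    by (rule continuous_representative[OF ev]) blast
  have "is_cont_rep T \<Omega> u w"
    unfolding is_cont_rep_def
  proof (intro conjI ballI)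
    show "L2 \<Omega> (w t)" if "t \<in> {0..T}" for t
      unfolding L2_iff by (rule norm2_restrict(1)[OF w(1)[OF that] \<Omega>_borel])
    show "((\<lambda>s. l2norm \<Omega> (\<lambda>x. w s x - w t x)) \<longlongrightarrow> 0) (at t within {0..T})" if t: "t \<in> {0..T}" for t
    proof (rule Lim_null_comparison[OF _ w(2)[OF t]])
      show "\<forall>\<^sub>F s in at t within {0..T}. norm (l2norm \<Omega> (\<lambda>x. w s x - w t x)) \<le> norm2 lborel (\<lambda>x. w s x - w t x)"
        unfolding eventually_at_filter l2norm_eq
        using norm2_restrict(2)[OF sq_integrable_diff[OF w(1) w(1)[OF t]] \<Omega>_borel]
        by (intro always_eventually) (simp add: norm2_nonneg)
    qed
    show "AE t in lebesgue_on {0<..<T}. AE x in lebesgue_on \<Omega>. w t x = u (t, x)"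
      unfolding AE_lebesgue_on_interval
      using w(3) borel_rep_slices[OF ru]
    proof eventually_elim
      case (elim t)
      show ?case
      proof
        assume t: "t \<in> {0<..<T}"
        have "AE x in lebesgue_on \<Omega>. w t x = u' (t, x)"
          using elim(1) t \<Omega>_borel by (auto simp: AE_restrict_space_iff AE_completion_iff elim: eventually_mono)
        moreover have "AE x in lebesgue_on \<Omega>. u (t, x) = u' (t, x)" using elim(2) t by (simp add: borel_rep_def)
        ultimately show "AE x in lebesgue_on \<Omega>. w t x = u (t, x)" by eventually_elim simp
      qed
    qed
  qed
  then have "\<exists>w. is_cont_rep T \<Omega> u w" by (rule exI[of "is_cont_rep T \<Omega> u"])
  then show ?thesis unfolding time_value_def by (rule someI_ex)
qed

lemma continuous_rep_inner_tendsto: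
  assumes wu: "is_cont_rep T \<Omega> u wu" and wv: "is_cont_rep T \<Omega> v wv"
    and s: "\<And>n. s n \<in> {0..T}" "\<And>n. s n \<noteq> a" "s \<longlonglongrightarrow> a" and a: "a \<in> {0..T}"
  shows "(\<lambda>n. l2inner \<Omega> (wu (s n)) (wv (s n))) \<longlonglongrightarrow> l2inner \<Omega> (wu a) (wv a)"
proof -
  have f: "filterlim s (at a within {0..T}) sequentially" using s by (auto simp: filterlim_at)
  have "(\<lambda>n. norm2 (lebesgue_on \<Omega>) (\<lambda>x. w (s n) x - w a x)) \<longlonglongrightarrow> 0" if "is_cont_rep T \<Omega> y w" for y w
    using filterlim_compose[OF _ f] that a unfolding is_cont_rep_def l2norm_eq by blast
  moreover have "sq_integrable (lebesgue_on \<Omega>) (w t)" if "is_cont_rep T \<Omega> y w" "t \<in> {0..T}" for y w t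
    using that unfolding is_cont_rep_def L2_iff by blast
  ultimately show ?thesis
    unfolding l2inner_def using wu wv s(1) a by (intro tendsto_integral_inner) blast+
qed

text \<open>The energy identity is known at almost every time only. The endpoints are reached along
  good times tending to 0 and to T: the products converge by continuity of the representatives, the
  integral of D tends to 0 and to the whole integral.\<close>

lemma energy_boundary_identity:
  assumes evu: "weak_evolution T (test_pairs \<Omega>) (\<lambda>z. (u' z, p' z)) k" and evv: "weak_evolution T (test_pairs \<Omega>) (\<lambda>z. (v' z, q' z)) l"
    and ru: "borel_rep Q u u'" and rv: "borel_rep Q v v'"
  shows "l2inner \<Omega> (time_value T \<Omega> u T) (time_value T \<Omega> v T) - l2inner \<Omega> (time_value T \<Omega> u 0) (time_value T \<Omega> v 0) =
    (LBINT z. k z \<bullet> (v' z, q' z)) + (LBINT z. l z \<bullet> (u' z, p' z))"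
proof -
  define U where "U z = (u' z, p' z)" for z
  define V where "V z = (v' z, q' z)" for z
  have eU: "weak_evolution T (test_pairs \<Omega>) U k" and eV: "weak_evolution T (test_pairs \<Omega>) V l"
    using evu evv by (simp_all add: U_def[abs_def] V_def[abs_def])
  note sU = weak_evolutionD(3)[OF eU] and sk = weak_evolutionD(4)[OF eU] and sV = weak_evolutionD(3)[OF eV] and sl = weak_evolutionD(4)[OF eV]
  define D where "D r = slice_inner k V r + slice_inner l U r" for r
  have D: "integrable lborel D"
    unfolding D_def by (intro Bochner_Integration.integrable_add slice_inner_integrable sU sk sV sl)
  have [measurable]: "D \<in> borel_measurable borel" using D by auto
  have D0: "D r = 0" if "r \<notin> {0<..<T}" for r
    using weak_evolutionD(5)[OF eU that] weak_evolutionD(5)[OF eV that] by (simp add: D_def slice_inner_def)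
  define wu where "wu = time_value T \<Omega> u"
  define wv where "wv = time_value T \<Omega> v"
  have wu: "is_cont_rep T \<Omega> u wu" unfolding wu_def by (rule time_value_rep[OF evu ru])
  have wv: "is_cont_rep T \<Omega> v wv" unfolding wv_def by (rule time_value_rep[OF evv rv])
  define E where "E t = l2inner \<Omega> (wu t) (wv t)" for t
  obtain c where c: "AE t in lborel. t \<in> {0<..<T} \<longrightarrow> energy U V t = c + (LBINT r. indicator {0..t} r * D r)"
    using energy_identity[OF eU eV] unfolding D_def by blast
  have ae: "AE t in lborel. t \<in> {0<..<T} \<longrightarrow> E t = c + (LBINT r. indicator {0..t} r * D r)"
    using c borel_rep_slices[OF ru] borel_rep_slices[OF rv]
      wu[unfolded is_cont_rep_def AE_lebesgue_on_interval, THEN conjunct2, THEN conjunct2]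
      wv[unfolded is_cont_rep_def AE_lebesgue_on_interval, THEN conjunct2, THEN conjunct2]
  proof eventually_elim
    case (elim t)
    show ?case
    proof
      assume t: "t \<in> {0<..<T}"
      have r1: "borel_rep \<Omega> (wu t) (\<lambda>x. u' (t, x))"
        by (rule borel_rep_cong_AE[OF _ _ \<Omega>_borel, of "\<lambda>x. u (t, x)"]) (use elim t in \<open>auto elim: eventually_mono\<close>)
      have r2: "borel_rep \<Omega> (wv t) (\<lambda>x. v' (t, x))"
        by (rule borel_rep_cong_AE[OF _ _ \<Omega>_borel, of "\<lambda>x. v (t, x)"]) (use elim t in \<open>auto elim: eventually_mono\<close>)
      have "E t = energy U V t"
        unfolding E_def borel_rep_l2inner[OF r1 r2 \<Omega>_borel] by (simp add: energy_def U_def V_def)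
      then show "E t = c + (LBINT r. indicator {0..t} r * D r)" using elim(1) t by simp
    qed
  qed
  define h where "h n = inverse (real (Suc n))" for n
  have h: "h \<longlonglongrightarrow> 0" "\<And>n. 0 < h n" unfolding h_def[abs_def] using LIMSEQ_inverse_real_of_nat by auto
  have "\<exists>s. s \<in> {0<..<T} \<and> s < h n \<and> E s = c + (LBINT r. indicator {0..s} r * D r)" for n
  proof -
    have "AE t in lborel. t \<in> {0<..<min T (h n)} \<longrightarrow> E t = c + (LBINT r. indicator {0..t} r * D r)"
      using ae by eventually_elim auto
    then obtain s where "s \<in> {0<..<min T (h n)}" "E s = c + (LBINT r. indicator {0..s} r * D r)"
      by (rule AE_interval_ex) (use T h(2)[of n] in auto)
    then show ?thesis by auto
  qed
  then obtain s where s: "\<And>n. s n \<in> {0<..<T}" "\<And>n. s n < h n" "\<And>n. E (s n) = c + (LBINT r. indicator {0..s n} r * D r)"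
    by metis
  have "\<exists>s. s \<in> {0<..<T} \<and> T - h n < s \<and> E s = c + (LBINT r. indicator {0..s} r * D r)" for n
  proof -
    have "AE t in lborel. t \<in> {max 0 (T - h n)<..<T} \<longrightarrow> E t = c + (LBINT r. indicator {0..t} r * D r)"
      using ae by eventually_elim auto
    then obtain s where "s \<in> {max 0 (T - h n)<..<T}" "E s = c + (LBINT r. indicator {0..s} r * D r)"
      by (rule AE_interval_ex) (use T h(2)[of n] in auto)
    then show ?thesis by auto
  qed
  then obtain s' where s': "\<And>n. s' n \<in> {0<..<T}" "\<And>n. T - h n < s' n" "\<And>n. E (s' n) = c + (LBINT r. indicator {0..s' n} r * D r)"
    by metis
  have sl0: "s \<longlonglongrightarrow> 0"
    by (rule tendsto_sandwich[OF _ _ tendsto_const h(1)]) (use s in \<open>auto intro!: always_eventually less_imp_le\<close>)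
  have slT: "s' \<longlonglongrightarrow> T"
  proof (rule tendsto_sandwich[OF _ _ _ tendsto_const])
    show "(\<lambda>n. T - h n) \<longlonglongrightarrow> T" using tendsto_diff[OF tendsto_const h(1), of T] by simp
  qed (use s' in \<open>auto intro!: always_eventually less_imp_le\<close>)
  have sn: "s n \<in> {0..T}" "s n \<noteq> 0" "s' n \<in> {0..T}" "s' n \<noteq> T" for n
    using s(1)[of n] s'(1)[of n] by auto
  have "(\<lambda>n. E (s n)) \<longlonglongrightarrow> E 0"
    unfolding E_def by (rule continuous_rep_inner_tendsto[OF wu wv sn(1,2) sl0]) (use T in simp)
  moreover have "(\<lambda>n. E (s n)) \<longlonglongrightarrow> c + integral\<^sup>L lborel (\<lambda>r::real. 0)"
    unfolding s(3)
  proof (intro tendsto_add tendsto_const integral_dominated_convergence[where w = "\<lambda>r. \<bar>D r\<bar>"])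
    show "AE r in lborel. (\<lambda>n. indicator {0..s n} r * D r) \<longlonglongrightarrow> 0"
    proof (rule AE_I2)
      fix r
      show "(\<lambda>n. indicator {0..s n} r * D r) \<longlonglongrightarrow> 0"
      proof (cases "r \<in> {0<..<T}")
        case True
        then have "\<forall>\<^sub>F n in sequentially. s n < r" by (intro order_tendstoD(2)[OF sl0]) simp
        then show ?thesis by (intro tendsto_eventually, eventually_elim) auto
      next
        case False
        then show ?thesis using D0 by simp
      qed
    qed
  qed (use D in \<open>auto simp: indicator_def\<close>)
  \<comment> \<open>The unknown constant of the energy identity is the product of the initial
    values.\<close>
  ultimately have E0: "E 0 = c" using LIMSEQ_unique by fastforce
  have "(\<lambda>n. E (s' n)) \<longlonglongrightarrow> E T"
    unfolding E_def by (rule continuous_rep_inner_tendsto[OF wu wv sn(3,4) slT]) (use T in simp)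
  moreover have "(\<lambda>n. E (s' n)) \<longlonglongrightarrow> c + integral\<^sup>L lborel D"
    unfolding s'(3)
  proof (intro tendsto_add tendsto_const integral_dominated_convergence[where w = "\<lambda>r. \<bar>D r\<bar>"])
    show "AE r in lborel. (\<lambda>n. indicator {0..s' n} r * D r) \<longlonglongrightarrow> D r"
    proof (rule AE_I2)
      fix r
      show "(\<lambda>n. indicator {0..s' n} r * D r) \<longlonglongrightarrow> D r"
      proof (cases "r \<in> {0<..<T}")
        case True
        then have "\<forall>\<^sub>F n in sequentially. r < s' n" by (intro order_tendstoD(1)[OF slT]) simp
        then show ?thesis by (intro tendsto_eventually, eventually_elim) (use True in auto)
      next
        case False
        then show ?thesis using D0 by simp
      qed
    qed
  qed (use D in \<open>auto simp: indicator_def\<close>)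
  ultimately have ET: "E T = c + integral\<^sup>L lborel D" by (rule LIMSEQ_unique)
  have "integral\<^sup>L lborel D = (LBINT z. k z \<bullet> V z) + (LBINT z. l z \<bullet> U z)"
    unfolding D_def using slice_inner_integrable[OF sk sV] slice_inner_integrable[OF sl sU] by simp
  then show ?thesis using E0 ET by (simp add: E_def wu_def wv_def U_def V_def)
qed

lemma div_residual_L2:
  assumes "(u, \<sigma>, l) \<in> U_space T \<Omega>"
  shows "L2 Q (div_residual T \<Omega> (u, \<sigma>, l))"
proof -
  have "\<exists>f. is_div_residual T \<Omega> (u, \<sigma>, l) f" using assms by (auto simp: U_space_def)
  then have "is_div_residual T \<Omega> (u, \<sigma>, l) (div_residual T \<Omega> (u, \<sigma>, l))"
    unfolding div_residual_def by (rule someI_ex)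
  then show ?thesis by simp
qed

text \<open>The boundary identity for the right-hand sides (f, \<sigma> + G) and (h, \<tau> + H);
  the contributions of G and H are l v and m u, and solving for them expresses the dual terms by
  quantities that the norm controls.\<close>

lemma parabolic_identity:
  assumes U: "(u, \<sigma>, l) \<in> U_space T \<Omega>" and V: "(v, \<tau>, m) \<in> U_space T \<Omega>"
  shows "l v + m u = l2inner \<Omega> (time_value T \<Omega> u T) (time_value T \<Omega> v T) - l2inner \<Omega> (time_value T \<Omega> u 0) (time_value T \<Omega> v 0)
    - l2inner Q (div_residual T \<Omega> (u, \<sigma>, l)) v - l2inner Q (div_residual T \<Omega> (v, \<tau>, m)) u
    - l2inner Q \<sigma> (grad_x T \<Omega> v) - l2inner Q \<tau> (grad_x T \<Omega> u)"
proof -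
  have u: "u \<in> V_space T \<Omega>" "L2 Q \<sigma>" "l \<in> V_dual T \<Omega>" "\<exists>f. is_div_residual T \<Omega> (u, \<sigma>, l) f"
    and v: "v \<in> V_space T \<Omega>" "L2 Q \<tau>" "m \<in> V_dual T \<Omega>" "\<exists>f. is_div_residual T \<Omega> (v, \<tau>, m) f"
    using U V by (auto simp: U_space_def)
  obtain G where G: "L2 Q G" "\<And>w. w \<in> V_space T \<Omega> \<Longrightarrow> l w = l2inner Q G (grad_x T \<Omega> w)"
    using V_dual_representation[OF u(3)] by blast
  obtain H where H: "L2 Q H" "\<And>w. w \<in> V_space T \<Omega> \<Longrightarrow> m w = l2inner Q H (grad_x T \<Omega> w)"
    using V_dual_representation[OF v(3)] by blast
  have Lf: "L2 Q (div_residual T \<Omega> (u, \<sigma>, l))" "L2 Q (div_residual T \<Omega> (v, \<tau>, m))"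
    using div_residual_L2 U V by blast+
  obtain u' where ru: "borel_rep Q u u'" "sq_integrable lborel u'" using L2_rep[OF V_spaceD(1)[OF u(1)]] .
  obtain v' where rv: "borel_rep Q v v'" "sq_integrable lborel v'" using L2_rep[OF V_spaceD(1)[OF v(1)]] .
  obtain p where rp: "borel_rep Q (grad_x T \<Omega> u) p" "sq_integrable lborel p" using L2_rep[OF V_spaceD(4)[OF u(1)]] .
  obtain q where rq: "borel_rep Q (grad_x T \<Omega> v) q" "sq_integrable lborel q" using L2_rep[OF V_spaceD(4)[OF v(1)]] .
  obtain \<sigma>' where r\<sigma>: "borel_rep Q \<sigma> \<sigma>'" "sq_integrable lborel \<sigma>'" using L2_rep[OF u(2)] .
  obtain \<tau>' where r\<tau>: "borel_rep Q \<tau> \<tau>'" "sq_integrable lborel \<tau>'" using L2_rep[OF v(2)] .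
  obtain G' where rG: "borel_rep Q G G'" "sq_integrable lborel G'" using L2_rep[OF G(1)] .
  obtain H' where rH: "borel_rep Q H H'" "sq_integrable lborel H'" using L2_rep[OF H(1)] .
  obtain f where rf: "borel_rep Q (div_residual T \<Omega> (u, \<sigma>, l)) f" "sq_integrable lborel f" using L2_rep[OF Lf(1)] .
  obtain h where rh: "borel_rep Q (div_residual T \<Omega> (v, \<tau>, m)) h" "sq_integrable lborel h" using L2_rep[OF Lf(2)] .
  note evu = U_space_evolution[OF U G ru(1) rp(1) rf(1) r\<sigma>(1) rG(1)]
  note evv = U_space_evolution[OF V H rv(1) rq(1) rh(1) r\<tau>(1) rH(1)]
  have split: "(LBINT z. (f z, \<sigma> z + G z) \<bullet> (v z, q z)) =
      (LBINT z. f z \<bullet> v z) + (LBINT z. \<sigma> z \<bullet> q z) + (LBINT z. G z \<bullet> q z)"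
    if "sq_integrable lborel f" "sq_integrable lborel v" "sq_integrable lborel \<sigma>" "sq_integrable lborel G" "sq_integrable lborel q"
    for f v :: "real \<times> (real ^ 'd) \<Rightarrow> real" and \<sigma> G q :: "real \<times> (real ^ 'd) \<Rightarrow> real ^ 'd"
    using sq_integrable_inner(1)[OF that(1,2)] sq_integrable_inner(1)[OF that(3,5)] sq_integrable_inner(1)[OF that(4,5)]
    by (simp add: inner_prod_def inner_add_left)
  show ?thesis
    using energy_boundary_identity[OF evu evv ru(1) rv(1)]
    unfolding split[OF rf(2) rv(2) r\<sigma>(2) rG(2) rq(2)] split[OF rh(2) ru(2) r\<tau>(2) rH(2) rp(2)]
      G(2)[OF v(1)] H(2)[OF u(1)]
      borel_rep_l2inner[OF rG(1) rq(1) Q_borel] borel_rep_l2inner[OF rH(1) rp(1) Q_borel]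
      borel_rep_l2inner[OF rf(1) rv(1) Q_borel] borel_rep_l2inner[OF rh(1) ru(1) Q_borel]
      borel_rep_l2inner[OF r\<sigma>(1) rq(1) Q_borel] borel_rep_l2inner[OF r\<tau>(1) rp(1) Q_borel]
    by linarith
qed

text \<open>On almost every time slice the relation between \<open>g\<close>, \<open>b\<close> and \<open>c\<close> may be tested with \<open>\<phi>\<^sup>2\<close>;
  then let \<open>\<phi>\<close> tend to the slice of \<open>u\<close> in \<open>H\<^sub>0\<^sup>1\<close>.\<close>

lemma convection_identity:
  assumes b: "Linf Q b" and c: "Linf Q c" and g: "Linf Q g"
    and rep: "represents Q g (\<lambda>\<phi>. - 1 / 2 * distr_div Q (\<lambda>z. (0, b z)) \<phi> + l2inner Q c \<phi>)"
    and u: "u \<in> V_space T \<Omega>"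
  shows "l2inner Q (\<lambda>z. b z \<bullet> grad_x T \<Omega> u z + c z * u z) u = l2inner Q (\<lambda>z. g z * u z) u"
proof -
  obtain b' Cb where rb: "borel_rep Q b b'" and Cb: "0 \<le> Cb" "\<And>z. norm (b' z) \<le> Cb" and sb: "sq_integrable lborel b'"
    using Linf_rep[OF b] by blast
  obtain c' Cc where rc: "borel_rep Q c c'" and Cc: "0 \<le> Cc" "\<And>z. norm (c' z) \<le> Cc" and sc: "sq_integrable lborel c'"
    using Linf_rep[OF c] by blast
  obtain g' Cg where rg: "borel_rep Q g g'" and Cg: "0 \<le> Cg" "\<And>z. norm (g' z) \<le> Cg" and sg: "sq_integrable lborel g'"
    using Linf_rep[OF g] by blast
  obtain u' where ru: "borel_rep Q u u'" "sq_integrable lborel u'" using L2_rep[OF V_spaceD(1)[OF u]] .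
  obtain p where rp: "borel_rep Q (grad_x T \<Omega> u) p" "sq_integrable lborel p" using L2_rep[OF V_spaceD(4)[OF u]] .
  \<comment> \<open>The relation between g, b and c says that this pair is orthogonal to every
    (\<phi>, \<nabla>\<phi>), the weak form of c - g = 1/2 div b.\<close>
  define G where "G z = (c' z - g' z, (1 / 2) *\<^sub>R b' z)" for z
  have sG: "sq_integrable lborel G"
    unfolding G_def by (intro sq_integrable_Pair(1) sq_integrable_diff sq_integrable_scaleR sc sg sb)
  have zG: "G (t, x) = 0" if "t \<notin> {0<..<T}" for t x
    using borel_repD(2)[OF rb, of "(t, x)"] borel_repD(2)[OF rc, of "(t, x)"] borel_repD(2)[OF rg, of "(t, x)"] that
    by (auto simp: G_def cylinder_def zero_prod_def)
  have orth: "AE t in lborel. t \<in> {0<..<T} \<longrightarrow> (\<forall>\<kappa>\<in>test_pairs \<Omega>. (LBINT x. G (t, x) \<bullet> \<kappa> x) = 0)"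
  proof (rule slice_orthogonal[OF sG zG test_pairs_sq_integrable])
    fix \<kappa> \<psi> assume "\<kappa> \<in> test_pairs \<Omega>" and \<psi>: "\<psi> \<in> test_functions {0<..<T}"
    then obtain \<phi> where \<phi>: "\<phi> \<in> test_functions \<Omega>" "\<kappa> = (\<lambda>x. (\<phi> x, grad \<phi> x))" by (auto simp: test_pairs_def)
    let ?\<Phi> = "\<lambda>z. \<psi> (fst z) * \<phi> (snd z)"
    note tp = test_functions_sq_integrable[OF \<psi>] and tq = test_functions_sq_integrable[OF \<phi>(1)]
    have \<Phi>: "?\<Phi> \<in> test_functions Q" unfolding cylinder_def by (rule test_functions_tensor(1)[OF \<psi> \<phi>(1)])
    note tV = tensor_V_space[OF \<psi> \<phi>(1)]
    have g\<Phi>: "grad ?\<Phi> = (\<lambda>z. (\<phi> (snd z) *\<^sub>R grad \<psi> (fst z), \<psi> (fst z) *\<^sub>R grad \<phi> (snd z)))"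
      using test_functions_tensor(2)[OF \<psi> \<phi>(1)] by (simp add: fun_eq_iff)
    have r0: "borel_rep Q (\<lambda>z. 0 :: real) (\<lambda>z. 0)" by (rule borel_rep_refl) auto
    have i: "integrable lborel (\<lambda>z. c' z \<bullet> ?\<Phi> z)" "integrable lborel (\<lambda>z. g' z \<bullet> ?\<Phi> z)" "integrable lborel (\<lambda>z. b' z \<bullet> (\<psi> (fst z) *\<^sub>R grad \<phi> (snd z)))"
      by (intro sq_integrable_inner(1) sc sg sb tV(4,5))+
    have "distr_div Q (\<lambda>z. (0, b z)) ?\<Phi> = - (LBINT z. b' z \<bullet> (\<psi> (fst z) *\<^sub>R grad \<phi> (snd z)))"
    proof -
      have "distr_div Q (\<lambda>z. (0, b z)) ?\<Phi> = - (LBINT z. (0, b' z) \<bullet> grad ?\<Phi> z)"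
        unfolding distr_div_def
        by (simp add: borel_rep_l2inner[OF borel_rep_Pair[OF r0 rb] test_functions_sq_integrable(4)[OF \<Phi>] Q_borel])
      then show ?thesis unfolding g\<Phi> by (simp add: inner_prod_def)
    qed
    moreover have "- 1 / 2 * distr_div Q (\<lambda>z. (0, b z)) ?\<Phi> + l2inner Q c ?\<Phi> = l2inner Q g ?\<Phi>"
      using rep \<Phi> unfolding represents_def by blast
    ultimately have eq: "1 / 2 * (LBINT z. b' z \<bullet> (\<psi> (fst z) *\<^sub>R grad \<phi> (snd z))) +
        (LBINT z. c' z \<bullet> ?\<Phi> z) - (LBINT z. g' z \<bullet> ?\<Phi> z) = 0"
      unfolding borel_rep_l2inner[OF rc tV(3) Q_borel] borel_rep_l2inner[OF rg tV(3) Q_borel] by linarith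
    have "(LBINT t. \<psi> t * (LBINT x. G (t, x) \<bullet> \<kappa> x)) =
        (LBINT z. G z \<bullet> (\<psi> (fst z) *\<^sub>R \<kappa> (snd z)))"
      unfolding \<phi>(2) by (rule integral_tensor_slices[OF sG tp(1) sq_integrable_Pair(1)[OF tq(1,2)], symmetric])
    also have "\<dots> = (LBINT z. 1 / 2 * (b' z \<bullet> (\<psi> (fst z) *\<^sub>R grad \<phi> (snd z))) + c' z \<bullet> ?\<Phi> z - g' z \<bullet> ?\<Phi> z)"
      by (intro Bochner_Integration.integral_cong refl) (simp add: G_def \<phi>(2) inner_prod_def algebra_simps)
    also have "\<dots> = 1 / 2 * (LBINT z. b' z \<bullet> (\<psi> (fst z) *\<^sub>R grad \<phi> (snd z))) +
        (LBINT z. c' z \<bullet> ?\<Phi> z) - (LBINT z. g' z \<bullet> ?\<Phi> z)"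
    proof -
      have "(LBINT z. 1 / 2 * A z + B z - C z) = 1 / 2 * integral\<^sup>L lborel A + integral\<^sup>L lborel B - integral\<^sup>L lborel C"
        if "integrable lborel A" "integrable lborel B" "integrable lborel C" for A B C :: "real \<times> (real ^ 'd) \<Rightarrow> real"
        using that by simp
      from this[OF i(3) i(1) i(2)] show ?thesis .
    qed
    finally show "(LBINT t. \<psi> t * (LBINT x. G (t, x) \<bullet> \<kappa> x)) = 0" using eq by simp
  qed
  \<comment> \<open>The gradient of \<phi>^2 is 2 \<phi> \<nabla>\<phi>, so testing with \<phi>^2
    cancels the factor 1/2 and leaves \<phi> times L applied to (\<phi>, \<nabla>\<phi>). L is
    linear and bounded, hence the product passes to the limit.\<close>
  define L where "L z y = (c' z - g' z) * fst y + b' z \<bullet> snd y" for z and y :: "real \<times> (real ^ 'd)"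
  define B where "B = Cc + Cg + Cb"
  have B: "0 \<le> B" using Cb Cc Cg by (simp add: B_def)
  have Lb: "norm (L z y) \<le> B * norm y" for z y
  proof -
    have "\<bar>L z y\<bar> \<le> \<bar>c' z - g' z\<bar> * \<bar>fst y\<bar> + norm (b' z) * norm (snd y)"
      unfolding L_def using Cauchy_Schwarz_ineq2[of "b' z" "snd y"] abs_triangle_ineq[of "(c' z - g' z) * fst y" "b' z \<bullet> snd y"]
      by (simp add: abs_mult)
    also have "\<dots> \<le> (Cc + Cg) * norm y + Cb * norm y"
    proof (intro add_mono mult_mono)
      show "\<bar>c' z - g' z\<bar> \<le> Cc + Cg" using Cc(2)[of z] Cg(2)[of z] by simp
      show "\<bar>fst y\<bar> \<le> norm y" using norm_fst_le[of "fst y" "snd y"] by simp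
      show "norm (snd y) \<le> norm y" using norm_snd_le[of "snd y" "fst y"] by simp
    qed (use Cb Cc Cg in auto)
    finally show ?thesis by (simp add: B_def distrib_right)
  qed
  have Lmeas: "(\<lambda>x. L (t, x) (y x)) \<in> borel_measurable lborel" if "sq_integrable lborel y" for t and y :: "real ^ 'd \<Rightarrow> real \<times> (real ^ 'd)"
  proof -
    note [measurable] = borel_repD(1)[OF rb] borel_repD(1)[OF rc] borel_repD(1)[OF rg]
      sq_integrableD(1)[OF sq_integrable_fst[OF that]] sq_integrableD(1)[OF sq_integrable_snd[OF that]]
    show ?thesis unfolding L_def by measurable
  qed
  have slice0: "AE t in lborel. (LBINT x. u' (t, x) \<bullet> L (t, x) (u' (t, x), p (t, x))) = 0"
    using orth V_space_in_closure[OF u ru(1) rp(1)]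
  proof eventually_elim
    case (elim t)
    show ?case
    proof (cases "t \<in> {0<..<T}")
      case False
      then have "u' (t, x) = 0" for x using borel_repD(2)[OF ru(1), of "(t, x)"] by (auto simp: cylinder_def)
      then show ?thesis by simp
    next
      case True
      define w where "w x = (u' (t, x), p (t, x))" for x
      have "in_closure (test_pairs \<Omega>) w" using elim(2) True by (simp add: w_def[abs_def])
      then obtain \<kappa> where w: "sq_integrable lborel w" and \<kappa>: "\<And>n::nat. \<kappa> n \<in> test_pairs \<Omega>" and lim: "(\<lambda>n. norm2 lborel (\<lambda>x. \<kappa> n x - w x)) \<longlonglongrightarrow> 0"
        unfolding in_closure_def by blast
      have s\<kappa>: "sq_integrable lborel (\<kappa> n)" for n by (rule test_pairs_sq_integrable[OF \<kappa>])
      have zero: "(LBINT x. fst (\<kappa> n x) \<bullet> L (t, x) (\<kappa> n x)) = 0" for n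
      proof -
        obtain \<phi> where \<phi>: "\<phi> \<in> test_functions \<Omega>" "\<kappa> n = (\<lambda>x. (\<phi> x, grad \<phi> x))" using \<kappa>[of n] by (auto simp: test_pairs_def)
        have t2: "(\<lambda>x. \<phi> x * \<phi> x) \<in> test_functions \<Omega>" by (rule test_functions_mult[OF \<phi>(1) test_functionsD(1)[OF \<phi>(1)]])
        then have "(\<lambda>x. (\<phi> x * \<phi> x, grad (\<lambda>x. \<phi> x * \<phi> x) x)) \<in> test_pairs \<Omega>" by (auto simp: test_pairs_def)
        from bspec[OF mp[OF elim(1) True] this] have "(LBINT x. G (t, x) \<bullet> (\<phi> x * \<phi> x, grad (\<lambda>x. \<phi> x * \<phi> x) x)) = 0"
          by simp
        moreover have "G (t, x) \<bullet> (\<phi> x * \<phi> x, grad (\<lambda>x. \<phi> x * \<phi> x) x) = fst (\<kappa> n x) \<bullet> L (t, x) (\<kappa> n x)" for x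
          unfolding grad_mult[OF test_functionsD(2)[OF \<phi>(1)] test_functionsD(2)[OF \<phi>(1)]] G_def L_def \<phi>(2)
            inner_Pair fst_conv snd_conv inner_add_right inner_scaleR_right inner_scaleR_left inner_real_def
          by (simp add: algebra_simps)
        ultimately show ?thesis by (simp only:)
      qed
      have "(\<lambda>n. (LBINT x. fst (\<kappa> n x) \<bullet> L (t, x) (\<kappa> n x))) \<longlonglongrightarrow> (LBINT x. fst (w x) \<bullet> L (t, x) (w x))"
      proof (rule tendsto_integral_inner)
        show "sq_integrable lborel (\<lambda>x. fst (\<kappa> n x))" "sq_integrable lborel (\<lambda>x. fst (w x))" for n
          by (intro sq_integrable_fst s\<kappa> w)+
        show "sq_integrable lborel (\<lambda>x. L (t, x) (\<kappa> n x))" for n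
          by (rule norm2_AE_bound(1)[OF s\<kappa>[of n] Lmeas[OF s\<kappa>] _ B]) (use Lb in simp)
        show "sq_integrable lborel (\<lambda>x. L (t, x) (w x))"
          by (rule norm2_AE_bound(1)[OF w Lmeas[OF w] _ B]) (use Lb in simp)
        have "norm2 lborel (\<lambda>x. fst (\<kappa> n x) - fst (w x)) \<le> norm2 lborel (\<lambda>x. \<kappa> n x - w x)" for n
          using norm2_fst_le[OF sq_integrable_diff[OF s\<kappa>[of n] w]] by simp
        then show "(\<lambda>n. norm2 lborel (\<lambda>x. fst (\<kappa> n x) - fst (w x))) \<longlonglongrightarrow> 0"
          by (intro Lim_null_comparison[OF always_eventually lim]) (simp add: norm2_nonneg)
        have "L (t, x) (\<kappa> n x) - L (t, x) (w x) = L (t, x) (\<kappa> n x - w x)" for n x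
          by (simp add: L_def inner_diff_right algebra_simps)
        then have "norm2 lborel (\<lambda>x. L (t, x) (\<kappa> n x) - L (t, x) (w x)) \<le> B * norm2 lborel (\<lambda>x. \<kappa> n x - w x)" for n
          using norm2_AE_bound(2)[OF sq_integrable_diff[OF s\<kappa>[of n] w] Lmeas[OF sq_integrable_diff[OF s\<kappa>[of n] w]] _ B] Lb by simp
        then show "(\<lambda>n. norm2 lborel (\<lambda>x. L (t, x) (\<kappa> n x) - L (t, x) (w x))) \<longlonglongrightarrow> 0"
          by (intro Lim_null_comparison[OF always_eventually tendsto_mult_right_zero[OF lim, of B]]) (simp add: norm2_nonneg)
      qed
      then show ?thesis unfolding zero by (simp add: LIMSEQ_const_iff w_def)
    qed
  qed
  have w2: "sq_integrable lborel (\<lambda>z. (u' z, p z))" by (intro sq_integrable_Pair(1) ru rp)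
  have sL: "sq_integrable lborel (\<lambda>z. L z (u' z, p z))"
  proof (rule norm2_AE_bound(1)[OF w2 _ _ B])
    note [measurable] = borel_repD(1)[OF rb] borel_repD(1)[OF rc] borel_repD(1)[OF rg] borel_repD(1)[OF ru(1)] borel_repD(1)[OF rp(1)]
    show "(\<lambda>z. L z (u' z, p z)) \<in> borel_measurable lborel" unfolding L_def by simp
  qed (use Lb in simp)
  have "(LBINT z. u' z \<bullet> L z (u' z, p z)) =
      (LBINT t. (LBINT x. u' (t, x) \<bullet> L (t, x) (u' (t, x), p (t, x))))"
    by (rule slice_integrable(3)[OF sq_integrable_inner(1)[OF ru(2) sL], symmetric])
  also have "\<dots> = 0" by (rule integral_eq_zero_AE[OF slice0])
  finally have "(LBINT z. u' z \<bullet> L z (u' z, p z)) = 0" .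
  moreover have r: "borel_rep Q (\<lambda>z. u z \<bullet> (((b z \<bullet> grad_x T \<Omega> u z) + c z \<bullet> u z) - g z \<bullet> u z))
      (\<lambda>z. u' z \<bullet> (((b' z \<bullet> p z) + c' z \<bullet> u' z) - g' z \<bullet> u' z))"
    by (intro borel_rep_inner borel_rep_diff borel_rep_add rb rc rg ru(1) rp(1))
  moreover have "u' z \<bullet> L z (u' z, p z) = u' z \<bullet> (((b' z \<bullet> p z) + c' z \<bullet> u' z) - g' z \<bullet> u' z)" for z
    by (simp add: L_def algebra_simps)
  ultimately have z: "(LINT z|lebesgue_on Q. u z \<bullet> (((b z \<bullet> grad_x T \<Omega> u z) + c z \<bullet> u z) - g z \<bullet> u z)) = 0"
    using borel_rep_integral(1)[OF r Q_borel] by (simp only:)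
  have su: "sq_integrable (lebesgue_on Q) u" and sp: "sq_integrable (lebesgue_on Q) (grad_x T \<Omega> u)"
    using V_spaceD(1,4)[OF u] by (simp_all add: L2_iff)
  have i1: "integrable (lebesgue_on Q) (\<lambda>z. (b z \<bullet> grad_x T \<Omega> u z + c z * u z) \<bullet> u z)"
    using sq_integrable_inner(1)[OF sq_integrable_add[OF Linf_inner(2)[OF b sp] Linf_inner(2)[OF c su]] su] by simp
  have i2: "integrable (lebesgue_on Q) (\<lambda>z. (g z * u z) \<bullet> u z)"
    using sq_integrable_inner(1)[OF Linf_inner(2)[OF g su] su] by simp
  have "l2inner Q (\<lambda>z. b z \<bullet> grad_x T \<Omega> u z + c z * u z) u - l2inner Q (\<lambda>z. g z * u z) u =
      (LINT z|lebesgue_on Q. u z \<bullet> (((b z \<bullet> grad_x T \<Omega> u z) + c z \<bullet> u z) - g z \<bullet> u z))"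
    unfolding l2inner_def Bochner_Integration.integral_diff[OF i1 i2, symmetric]
    by (intro Bochner_Integration.integral_cong refl) (simp add: algebra_simps)
  then show ?thesis using z by simp
qed

end

section \<open>Boundedness and coercivity\<close>

text \<open>The variables \<open>r\<close>, \<open>p\<close>, \<open>s\<close>, \<open>f\<close>, \<open>n0\<close>, \<open>nT\<close> stand for the norms of the residual, \<open>\<nabla>\<^sub>x u\<close>, \<open>\<sigma>\<close>, the
  residual of the divergence, \<open>u(0)\<close> and \<open>u(T)\<close>, \<open>F\<close> for the squared norm of the flux residual, and \<open>fu\<close>,
  \<open>sp\<close> for \<open>(f, u)\<close> and \<open>(\<sigma>, \<nabla>\<^sub>x u)\<close>.\<close>

lemma coercivity_arithmetic:
  fixes r p s n0 nT f \<alpha> \<Lambda> k B C :: real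
  assumes \<alpha>: "0 < \<alpha>" and k: "0 < k" "k\<^sup>2 \<le> \<Lambda>" and C: "0 < C"
    and f: "0 \<le> f" "f \<le> r + B * p"
    and fu: "fu \<le> r * (k * p)"
    and F: "sp + s\<^sup>2 / (2 * C) + \<alpha> / 2 * p\<^sup>2 \<le> F"
    and l: "2 * l = nT\<^sup>2 - n0\<^sup>2 - 2 * fu - 2 * sp"
  shows "p\<^sup>2 + n0\<^sup>2 + nT\<^sup>2 + s\<^sup>2 + f\<^sup>2 \<le>
    ((1 + 2 * B\<^sup>2) * (6 / \<alpha>) + 2 + 2 * C + 8 * \<alpha> / \<Lambda>) * (inverse \<alpha> * \<Lambda> * r\<^sup>2 + F + n0\<^sup>2 + l)" (is "?U \<le> ?C * ?a")
proof -
  have \<Lambda>: "0 < \<Lambda>" using k by (metis less_le_trans zero_less_power)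
  define K where "K = inverse \<alpha> * \<Lambda>"
  have K: "0 < K" using \<alpha> \<Lambda> by (simp add: K_def)
  \<comment> \<open>Young's inequality with weights chosen to leave something of both squares: 1/4
    of K r^2, and \<alpha>/2 - \<alpha>/3 = \<alpha>/6 of p^2. Four times the product of the weights
    is \<Lambda> \<ge> k^2.\<close>
  have y: "r * (k * p) \<le> 3 / 4 * K * r\<^sup>2 + \<alpha> / 3 * p\<^sup>2"
  proof -
    have "0 \<le> (3 * k * r - 2 * \<alpha> * p)\<^sup>2" by simp
    then have "12 * \<alpha> * (r * (k * p)) \<le> 9 * k\<^sup>2 * r\<^sup>2 + 4 * \<alpha>\<^sup>2 * p\<^sup>2"
      by (simp add: power2_eq_square algebra_simps)
    also have "\<dots> \<le> 9 * \<Lambda> * r\<^sup>2 + 4 * \<alpha>\<^sup>2 * p\<^sup>2" using k by (simp add: mult_right_mono)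
    also have "\<dots> = 12 * \<alpha> * (3 / 4 * K * r\<^sup>2 + \<alpha> / 3 * p\<^sup>2)"
      using \<alpha> by (simp add: K_def field_simps power2_eq_square)
    finally show ?thesis using \<alpha> by simp
  qed
  \<comment> \<open>What remains of the form after absorption. The initial value keeps one half,
    because the boundary identity takes the other half away.\<close>
  define m where "m = 1 / 4 * K * r\<^sup>2 + \<alpha> / 6 * p\<^sup>2 + s\<^sup>2 / (2 * C) + n0\<^sup>2 / 2 + nT\<^sup>2 / 2"
  have m: "m \<le> ?a"
    using F l fu y unfolding m_def K_def[symmetric] by linarith
  have part: "1 / 4 * K * r\<^sup>2 \<le> m" "\<alpha> / 6 * p\<^sup>2 \<le> m" "s\<^sup>2 / (2 * C) \<le> m" "n0\<^sup>2 / 2 + nT\<^sup>2 / 2 \<le> m"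
    using K \<alpha> C unfolding m_def by auto
  have "f\<^sup>2 \<le> (r + B * p)\<^sup>2" using f by (intro power_mono) auto
  also have "\<dots> \<le> 2 * r\<^sup>2 + 2 * B\<^sup>2 * p\<^sup>2"
    using zero_le_power2[of "r - B * p"] by (simp add: power2_sum power2_diff power_mult_distrib)
  finally have "?U \<le> (1 + 2 * B\<^sup>2) * p\<^sup>2 + (n0\<^sup>2 + nT\<^sup>2) + s\<^sup>2 + 2 * r\<^sup>2" by (simp add: algebra_simps)
  \<comment> \<open>Every term is rewritten as a multiple of a summand of m; these factors add up to
    the coercivity constant.\<close>
  also have "\<dots> = (1 + 2 * B\<^sup>2) * (6 / \<alpha>) * (\<alpha> / 6 * p\<^sup>2) + 2 * (n0\<^sup>2 / 2 + nT\<^sup>2 / 2) + 2 * C * (s\<^sup>2 / (2 * C)) +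
      8 / K * (1 / 4 * K * r\<^sup>2)"
    using \<alpha> C K by simp
  also have "\<dots> \<le> (1 + 2 * B\<^sup>2) * (6 / \<alpha>) * m + 2 * m + 2 * C * m + 8 / K * m"
    by (intro add_mono mult_left_mono part) (use \<alpha> C K in auto)
  also have "\<dots> = ?C * m" using \<alpha> \<Lambda> by (simp add: K_def field_simps)
  also have "\<dots> \<le> ?C * ?a" by (intro mult_left_mono m) (use \<alpha> \<Lambda> C in auto)
  finally show ?thesis .
qed

lemma l2inner_commute: "l2inner S f g = l2inner S g f"
  by (simp add: l2inner_def inner_commute)

lemma l2norm_power2: "(l2norm S f)\<^sup>2 = l2inner S f f"
  by (simp add: l2norm_eq norm2_power2_inner l2inner_def)

lemma l2inner_Cauchy_Schwarz:
  assumes "L2 S f" "L2 S g"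
  shows "\<bar>l2inner S f g\<bar> \<le> l2norm S f * l2norm S g"
  using Cauchy_Schwarz_norm2 assms by (simp add: L2_iff l2norm_eq l2inner_def)

lemma l2norm_nonneg: "0 \<le> l2norm S f"
  by (simp add: l2norm_eq norm2_nonneg)

text \<open>Here g is the function - 1/2 div b + c, given through its distributional relation to b
  and c, and k is a Friedrichs constant.\<close>

locale parabolic_coefficients = space_time T \<Omega> for T :: real and \<Omega> :: "(real ^ 'd) set" +
  fixes A :: "real \<times> (real ^ 'd) \<Rightarrow> real ^ 'd ^ 'd" and b :: "real \<times> (real ^ 'd) \<Rightarrow> real ^ 'd"
    and c g :: "real \<times> (real ^ 'd) \<Rightarrow> real" and \<alpha> \<Lambda> k :: real
  assumes A: "Linf Q A" "AE z in lebesgue_on Q. transpose (A z) = A z"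
      "AE z in lebesgue_on Q. \<forall>y. \<alpha> * (norm y)\<^sup>2 \<le> y \<bullet> (A z *v y)"
    and b: "Linf Q b" and c: "Linf Q c"
    and g: "Linf Q g" "AE z in lebesgue_on Q. 0 \<le> g z"
      "represents Q g (\<lambda>\<phi>. - 1 / 2 * distr_div Q (\<lambda>z. (0, b z)) \<phi> + l2inner Q c \<phi>)"
    and \<alpha>: "0 < \<alpha>" and friedrichs: "friedrichs_constant T \<Omega> k" and \<Lambda>: "k\<^sup>2 \<le> \<Lambda>"
begin

text \<open>The added 1 makes the bound strictly positive, as it is divided by.\<close>

definition "A_bound = Linf_bound Q A + 1"

text \<open>By Friedrichs' inequality this multiple of |\<nabla>u| dominates the lower order terms b
  \<cdot> \<nabla>u + c u.\<close>

definition "lower_order_bound = Linf_bound Q b + Linf_bound Q c * k"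

lemma A_bound_pos: "0 < A_bound"
  using Linf_boundD(1)[OF A(1)] by (simp add: A_bound_def)

lemma k_pos: "0 < k" and \<Lambda>_pos: "0 < \<Lambda>"
proof -
  show "0 < k" using friedrichs by (simp add: friedrichs_constant_def)
  then show "0 < \<Lambda>" using \<Lambda> by (metis less_le_trans zero_less_power)
qed

lemma lower_order_bound_nonneg: "0 \<le> lower_order_bound"
  using Linf_boundD(1)[OF b] Linf_boundD(1)[OF c] k_pos by (simp add: lower_order_bound_def)

lemma spd_A: "AE z in lebesgue_on Q. spd \<alpha> A_bound (A z)"
  using A(2,3) Linf_boundD(2)[OF A(1)]
proof eventually_elim
  case (elim z)
  have "norm (A z *v y) \<le> A_bound * norm y" for y
  proof -
    have "norm (A z *v y) \<le> norm (A z) * norm y" by (rule op_boundD[OF op_bound_norm])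
    also have "\<dots> \<le> A_bound * norm y" using elim(3) by (intro mult_right_mono) (auto simp: A_bound_def)
    finally show ?thesis .
  qed
  then show ?case using elim by (simp add: spd_def op_bound_def)
qed

lemma V_space_friedrichs:
  assumes "u \<in> V_space T \<Omega>"
  shows "l2norm Q u \<le> k * l2norm Q (grad_x T \<Omega> u)"
  using friedrichs assms by (simp add: friedrichs_constant_def)

text \<open>Full residual and residual of the divergence differ by the lower order terms, so each
  bounds the other up to a multiple of |\<nabla>u|: one direction serves boundedness, the other
  coercivity. The last inequality is the sign of the convection and reaction part.\<close>

lemma residual_bounds:
  assumes U: "(u, \<sigma>, l) \<in> U_space T \<Omega>"
  defines "f \<equiv> div_residual T \<Omega> (u, \<sigma>, l)" and "R \<equiv> residual T \<Omega> b c (u, \<sigma>, l)" and "p \<equiv> grad_x T \<Omega> u"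
  shows "L2 Q R" "l2norm Q R \<le> l2norm Q f + lower_order_bound * l2norm Q p"
    "l2norm Q f \<le> l2norm Q R + lower_order_bound * l2norm Q p" "l2inner Q f u \<le> l2inner Q R u"
proof -
  have u: "u \<in> V_space T \<Omega>" using U by (simp add: U_space_def)
  have sf: "sq_integrable (lebesgue_on Q) f" using div_residual_L2[OF U] by (simp add: f_def L2_iff)
  have sp: "sq_integrable (lebesgue_on Q) p" and su: "sq_integrable (lebesgue_on Q) u"
    using V_spaceD(1,4)[OF u] by (simp_all add: p_def L2_iff)
  define h where "h z = b z \<bullet> p z + c z * u z" for z
  note B = Linf_inner[OF b sp] and C = Linf_inner[OF c su, unfolded inner_real_def]
  have sh: "sq_integrable (lebesgue_on Q) h" unfolding h_def by (intro sq_integrable_add B(2) C(2))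
  have "norm2 (lebesgue_on Q) h \<le> Linf_bound Q b * norm2 (lebesgue_on Q) p + Linf_bound Q c * norm2 (lebesgue_on Q) u"
    unfolding h_def using norm2_triangle[OF B(2) C(2)] B(1) C(1) by linarith
  also have "\<dots> \<le> Linf_bound Q b * norm2 (lebesgue_on Q) p + Linf_bound Q c * (k * norm2 (lebesgue_on Q) p)"
    using V_space_friedrichs[OF u] Linf_boundD(1)[OF c] by (intro add_left_mono mult_left_mono) (auto simp: l2norm_eq p_def)
  finally have nh: "norm2 (lebesgue_on Q) h \<le> lower_order_bound * norm2 (lebesgue_on Q) p"
    by (simp add: lower_order_bound_def algebra_simps)
  have R: "R = (\<lambda>z. f z + h z)" by (auto simp: R_def f_def h_def p_def fun_eq_iff)
  have f: "f = (\<lambda>z. R z - h z)" by (simp add: R)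
  show sR: "L2 Q R" unfolding L2_iff R by (intro sq_integrable_add sf sh)
  show "l2norm Q R \<le> l2norm Q f + lower_order_bound * l2norm Q p"
    using norm2_triangle[OF sf sh] nh unfolding l2norm_eq R by linarith
  have "norm2 (lebesgue_on Q) f \<le> norm2 (lebesgue_on Q) R + norm2 (lebesgue_on Q) h"
    using norm2_triangle_diff[OF sR[unfolded L2_iff] sh] unfolding f[symmetric] .
  then show "l2norm Q f \<le> l2norm Q R + lower_order_bound * l2norm Q p"
    using nh unfolding l2norm_eq by linarith
  have "l2inner Q R u = l2inner Q f u + l2inner Q h u"
    unfolding l2inner_def R inner_add_left
    by (rule Bochner_Integration.integral_add[OF sq_integrable_inner(1)[OF sf su] sq_integrable_inner(1)[OF sh su]])
  moreover have "l2inner Q h u = l2inner Q (\<lambda>z. g z * u z) u"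
    using convection_identity[OF b c g(1,3) u] unfolding h_def[abs_def] p_def .
  moreover have "0 \<le> l2inner Q (\<lambda>z. g z * u z) u"
    unfolding l2inner_def using g(2) by (intro integral_nonneg_AE) (auto elim!: eventually_mono simp: mult.assoc)
  ultimately show "l2inner Q f u \<le> l2inner Q R u" by linarith
qed

lemma flux_residual_bounds:
  assumes U: "(u, \<sigma>, l) \<in> U_space T \<Omega>"
  defines "F \<equiv> flux_residual T \<Omega> A (u, \<sigma>, l)" and "p \<equiv> grad_x T \<Omega> u"
  shows "L2 Q F" "l2norm Q F \<le> 1 / sqrt \<alpha> * l2norm Q \<sigma> + sqrt A_bound * l2norm Q p"
    "l2inner Q \<sigma> p + (l2norm Q \<sigma>)\<^sup>2 / (2 * A_bound) + \<alpha> / 2 * (l2norm Q p)\<^sup>2 \<le> (l2norm Q F)\<^sup>2"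
proof -
  have u: "u \<in> V_space T \<Omega>" and s\<sigma>: "sq_integrable (lebesgue_on Q) \<sigma>" using U by (simp_all add: U_space_def L2_iff)
  have sp: "sq_integrable (lebesgue_on Q) p" using V_spaceD(4)[OF u] by (simp add: p_def L2_iff)
  have Am: "A \<in> borel_measurable (lebesgue_on Q)" using A(1) by (simp add: Linf_def)
  define P where "P z = matrix_inv (mat_sqrt (A z)) *v \<sigma> z" for z
  define q where "q z = mat_sqrt (A z) *v p z" for z
  have Pm: "P \<in> borel_measurable (lebesgue_on Q)" and qm: "q \<in> borel_measurable (lebesgue_on Q)"
    unfolding P_def[abs_def] q_def[abs_def]
    by (rule flux_measurable(2)[OF Q_lebesgue Am spd_A \<alpha> sq_integrableD(1)[OF s\<sigma>]]
        flux_measurable(1)[OF Q_lebesgue Am spd_A \<alpha> sq_integrableD(1)[OF sp]])+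
  have bP: "AE z in lebesgue_on Q. norm (P z) \<le> 1 / sqrt \<alpha> * norm (\<sigma> z)"
    using spd_A
  proof eventually_elim
    case (elim z)
    have "(norm (P z))\<^sup>2 \<le> (1 / sqrt \<alpha> * norm (\<sigma> z))\<^sup>2"
      using mat_sqrt_flux(2)[OF elim \<alpha>, of "\<sigma> z"] \<alpha> by (simp add: P_def power_mult_distrib power_divide field_simps)
    then show ?case by (rule power2_le_imp_le) (use \<alpha> in simp)
  qed
  have bq: "AE z in lebesgue_on Q. norm (q z) \<le> sqrt A_bound * norm (p z)"
    using spd_A
  proof eventually_elim
    case (elim z)
    have "(norm (q z))\<^sup>2 \<le> (sqrt A_bound * norm (p z))\<^sup>2"
      using mat_sqrt_flux(5)[OF elim \<alpha>, of "p z"] A_bound_pos by (simp add: q_def power_mult_distrib)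
    then show ?case by (rule power2_le_imp_le) (use A_bound_pos in simp)
  qed
  have "0 \<le> 1 / sqrt \<alpha>" "0 \<le> sqrt A_bound" using \<alpha> A_bound_pos by simp_all
  note nP = norm2_AE_bound[OF s\<sigma> Pm bP this(1)] and nq = norm2_AE_bound[OF sp qm bq this(2)]
  have F: "F = (\<lambda>z. P z + q z)" by (auto simp: F_def P_def q_def p_def fun_eq_iff)
  have sF: "sq_integrable (lebesgue_on Q) F" unfolding F by (rule sq_integrable_add[OF nP(1) nq(1)])
  then show "L2 Q F" by (simp add: L2_iff)
  show "l2norm Q F \<le> 1 / sqrt \<alpha> * l2norm Q \<sigma> + sqrt A_bound * l2norm Q p"
    using norm2_triangle[OF nP(1) nq(1)] nP(2) nq(2) unfolding l2norm_eq F by linarith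
  have i: "integrable (lebesgue_on Q) (\<lambda>z. \<sigma> z \<bullet> p z)" "integrable (lebesgue_on Q) (\<lambda>z. 1 / (2 * A_bound) * (norm (\<sigma> z))\<^sup>2)"
      "integrable (lebesgue_on Q) (\<lambda>z. \<alpha> / 2 * (norm (p z))\<^sup>2)"
    by (intro sq_integrable_inner(1) s\<sigma> sp integrable_mult_right sq_integrableD(2))+
  have "l2inner Q \<sigma> p + (l2norm Q \<sigma>)\<^sup>2 / (2 * A_bound) + \<alpha> / 2 * (l2norm Q p)\<^sup>2 =
      (LINT z|lebesgue_on Q. \<sigma> z \<bullet> p z + 1 / (2 * A_bound) * (norm (\<sigma> z))\<^sup>2 + \<alpha> / 2 * (norm (p z))\<^sup>2)"
    unfolding Bochner_Integration.integral_add[OF Bochner_Integration.integrable_add[OF i(1,2)] i(3)]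
      Bochner_Integration.integral_add[OF i(1,2)]
    by (simp add: l2inner_def l2norm_eq norm2_power2)
  also have "\<dots> \<le> (LINT z|lebesgue_on Q. (norm (F z))\<^sup>2)"
  proof (rule integral_mono_AE[OF _ sq_integrableD(2)[OF sF]])
    show "AE z in lebesgue_on Q. \<sigma> z \<bullet> p z + 1 / (2 * A_bound) * (norm (\<sigma> z))\<^sup>2 + \<alpha> / 2 * (norm (p z))\<^sup>2 \<le> (norm (F z))\<^sup>2"
      using spd_A
    proof eventually_elim
      case (elim z)
      \<comment> \<open>The roots cancel in the cross term. The claimed inequality drops half of
        |F|^2, which is nonnegative, and bounds half of |P|^2 + |q|^2 below.\<close>
      have Fz: "(norm (F z))\<^sup>2 = (norm (P z))\<^sup>2 + 2 * (\<sigma> z \<bullet> p z) + (norm (q z))\<^sup>2"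
        unfolding F power2_norm_eq_inner using mat_sqrt_flux(1)[OF elim \<alpha>, of "\<sigma> z" "p z"]
        by (simp add: inner_add_left inner_add_right inner_commute P_def q_def)
      have "1 / A_bound * (norm (\<sigma> z))\<^sup>2 \<le> (norm (P z))\<^sup>2"
        using mat_sqrt_flux(3)[OF elim \<alpha>, of "\<sigma> z"] A_bound_pos by (simp add: P_def field_simps)
      moreover have "\<alpha> * (norm (p z))\<^sup>2 \<le> (norm (q z))\<^sup>2"
        using mat_sqrt_flux(4)[OF elim \<alpha>, of "p z"] by (simp add: q_def)
      moreover have "1 / (2 * A_bound) * (norm (\<sigma> z))\<^sup>2 = 1 / 2 * (1 / A_bound * (norm (\<sigma> z))\<^sup>2)" by simp
      moreover have "\<alpha> / 2 * (norm (p z))\<^sup>2 = 1 / 2 * (\<alpha> * (norm (p z))\<^sup>2)" by simp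
      moreover have "0 \<le> (norm (F z))\<^sup>2" by simp
      ultimately show ?case using Fz by linarith
    qed
  qed (intro Bochner_Integration.integrable_add i)
  finally show "l2inner Q \<sigma> p + (l2norm Q \<sigma>)\<^sup>2 / (2 * A_bound) + \<alpha> / 2 * (l2norm Q p)\<^sup>2 \<le> (l2norm Q F)\<^sup>2"
    by (simp add: l2norm_eq norm2_power2)
qed

lemma U_norm_power2:
  "(U_norm T \<Omega> (u, \<sigma>, l))\<^sup>2 = (l2norm Q (grad_x T \<Omega> u))\<^sup>2 + (l2norm \<Omega> (time_value T \<Omega> u 0))\<^sup>2 +
    (l2norm \<Omega> (time_value T \<Omega> u T))\<^sup>2 + (l2norm Q \<sigma>)\<^sup>2 + (l2norm Q (div_residual T \<Omega> (u, \<sigma>, l)))\<^sup>2"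
  by (simp add: V_norm_def)

lemma U_norm_ge:
  shows "0 \<le> U_norm T \<Omega> (u, \<sigma>, l)" "l2norm Q (grad_x T \<Omega> u) \<le> U_norm T \<Omega> (u, \<sigma>, l)"
    "l2norm \<Omega> (time_value T \<Omega> u 0) \<le> U_norm T \<Omega> (u, \<sigma>, l)" "l2norm \<Omega> (time_value T \<Omega> u T) \<le> U_norm T \<Omega> (u, \<sigma>, l)"
    "l2norm Q \<sigma> \<le> U_norm T \<Omega> (u, \<sigma>, l)" "l2norm Q (div_residual T \<Omega> (u, \<sigma>, l)) \<le> U_norm T \<Omega> (u, \<sigma>, l)"
proof -
  show n: "0 \<le> U_norm T \<Omega> (u, \<sigma>, l)" by simp
  show "l2norm Q (grad_x T \<Omega> u) \<le> U_norm T \<Omega> (u, \<sigma>, l)"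
    "l2norm \<Omega> (time_value T \<Omega> u 0) \<le> U_norm T \<Omega> (u, \<sigma>, l)" "l2norm \<Omega> (time_value T \<Omega> u T) \<le> U_norm T \<Omega> (u, \<sigma>, l)"
    "l2norm Q \<sigma> \<le> U_norm T \<Omega> (u, \<sigma>, l)" "l2norm Q (div_residual T \<Omega> (u, \<sigma>, l)) \<le> U_norm T \<Omega> (u, \<sigma>, l)"
    by (rule power2_le_imp_le[OF _ n]; simp only: U_norm_power2; simp)+
qed

lemma time_value_L2:
  assumes U: "(u, \<sigma>, l) \<in> U_space T \<Omega>" and t: "t \<in> {0..T}"
  shows "L2 \<Omega> (time_value T \<Omega> u t)"
proof -
  have u: "u \<in> V_space T \<Omega>" "L2 Q \<sigma>" "l \<in> V_dual T \<Omega>" using U by (auto simp: U_space_def)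
  obtain G where G: "L2 Q G" "\<And>w. w \<in> V_space T \<Omega> \<Longrightarrow> l w = l2inner Q G (grad_x T \<Omega> w)"
    using V_dual_representation[OF u(3)] by blast
  obtain u' where ru: "borel_rep Q u u'" "sq_integrable lborel u'" using L2_rep[OF V_spaceD(1)[OF u(1)]] .
  obtain p where rp: "borel_rep Q (grad_x T \<Omega> u) p" "sq_integrable lborel p" using L2_rep[OF V_spaceD(4)[OF u(1)]] .
  obtain \<sigma>' where r\<sigma>: "borel_rep Q \<sigma> \<sigma>'" "sq_integrable lborel \<sigma>'" using L2_rep[OF u(2)] .
  obtain G' where rG: "borel_rep Q G G'" "sq_integrable lborel G'" using L2_rep[OF G(1)] .
  obtain f where rf: "borel_rep Q (div_residual T \<Omega> (u, \<sigma>, l)) f" "sq_integrable lborel f" using L2_rep[OF div_residual_L2[OF U]] .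
  have "is_cont_rep T \<Omega> u (time_value T \<Omega> u)"
    by (rule time_value_rep[OF U_space_evolution[OF U G ru(1) rp(1) rf(1) r\<sigma>(1) rG(1)] ru(1)])
  then show ?thesis using t by (simp add: is_cont_rep_def)
qed

lemma a_form_coercive:
  assumes U: "(u, \<sigma>, l) \<in> U_space T \<Omega>"
  shows "(U_norm T \<Omega> (u, \<sigma>, l))\<^sup>2 \<le>
    ((1 + 2 * lower_order_bound\<^sup>2) * (6 / \<alpha>) + 2 + 2 * A_bound + 8 * \<alpha> / \<Lambda>) * a_form T \<Omega> A b c \<alpha> \<Lambda> (u, \<sigma>, l) (u, \<sigma>, l)"
proof -
  have u: "u \<in> V_space T \<Omega>" using U by (simp add: U_space_def)
  note R = residual_bounds[OF U] and F = flux_residual_bounds[OF U]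
  have Ru: "l2inner Q (div_residual T \<Omega> (u, \<sigma>, l)) u \<le> l2norm Q (residual T \<Omega> b c (u, \<sigma>, l)) * (k * l2norm Q (grad_x T \<Omega> u))"
  proof -
    have "l2inner Q (residual T \<Omega> b c (u, \<sigma>, l)) u \<le> l2norm Q (residual T \<Omega> b c (u, \<sigma>, l)) * l2norm Q u"
      using l2inner_Cauchy_Schwarz[OF R(1) V_spaceD(1)[OF u]] by linarith
    also have "\<dots> \<le> l2norm Q (residual T \<Omega> b c (u, \<sigma>, l)) * (k * l2norm Q (grad_x T \<Omega> u))"
      by (intro mult_left_mono V_space_friedrichs[OF u] l2norm_nonneg)
    finally show ?thesis using R(4) by linarith
  qed
  have l: "2 * l u = (l2norm \<Omega> (time_value T \<Omega> u T))\<^sup>2 - (l2norm \<Omega> (time_value T \<Omega> u 0))\<^sup>2 -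
      2 * l2inner Q (div_residual T \<Omega> (u, \<sigma>, l)) u - 2 * l2inner Q \<sigma> (grad_x T \<Omega> u)"
    using parabolic_identity[OF U U] unfolding l2norm_power2 by linarith
  have a: "a_form T \<Omega> A b c \<alpha> \<Lambda> (u, \<sigma>, l) (u, \<sigma>, l) = inverse \<alpha> * \<Lambda> * (l2norm Q (residual T \<Omega> b c (u, \<sigma>, l)))\<^sup>2 +
      (l2norm Q (flux_residual T \<Omega> A (u, \<sigma>, l)))\<^sup>2 + (l2norm \<Omega> (time_value T \<Omega> u 0))\<^sup>2 + l u"
    unfolding a_form.simps l2norm_power2 by simp
  show ?thesis
    unfolding U_norm_power2 a
    by (rule coercivity_arithmetic[OF \<alpha> k_pos \<Lambda> A_bound_pos l2norm_nonneg R(3) Ru F(3) l])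
qed

text \<open>Of the dual terms only the sum l v + m u is controlled, through the parabolic identity;
  every other term is a product of norms that occur in the norm of U, up to constants.\<close>

lemma a_form_bounded:
  assumes U: "(u, \<sigma>, l) \<in> U_space T \<Omega>" and V: "(v, \<tau>, m) \<in> U_space T \<Omega>"
  shows "\<bar>a_form T \<Omega> A b c \<alpha> \<Lambda> (u, \<sigma>, l) (v, \<tau>, m)\<bar> \<le>
    (inverse \<alpha> * \<Lambda> * (1 + lower_order_bound)\<^sup>2 + (1 / sqrt \<alpha> + sqrt A_bound)\<^sup>2 + 1 + (2 + k)) *
      U_norm T \<Omega> (u, \<sigma>, l) * U_norm T \<Omega> (v, \<tau>, m)"
proof -
  have u: "u \<in> V_space T \<Omega>" "L2 Q \<sigma>" and v: "v \<in> V_space T \<Omega>" "L2 Q \<tau>" using U V by (simp_all add: U_space_def)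
  define X where "X = U_norm T \<Omega> (u, \<sigma>, l)"
  define Y where "Y = U_norm T \<Omega> (v, \<tau>, m)"
  note x = U_norm_ge[where u = u and \<sigma> = \<sigma> and l = l, folded X_def]
    and y = U_norm_ge[where u = v and \<sigma> = \<tau> and l = m, folded Y_def]
  have prod: "\<bar>l2inner S f h\<bar> \<le> d * e * (X * Y)" if "L2 S f" "L2 S h" "l2norm S f \<le> d * X" "l2norm S h \<le> e * Y" "0 \<le> d" "0 \<le> e"
    for S :: "'z::euclidean_space set" and f h :: "'z \<Rightarrow> 'y::euclidean_space" and d e
  proof -
    have "\<bar>l2inner S f h\<bar> \<le> l2norm S f * l2norm S h" by (rule l2inner_Cauchy_Schwarz[OF that(1,2)])
    also have "\<dots> \<le> (d * X) * (e * Y)" by (intro mult_mono that(3,4) l2norm_nonneg mult_nonneg_nonneg that(5) x(1))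
    finally show ?thesis by (simp add: mult_ac)
  qed
  have res: "l2norm Q (residual T \<Omega> b c (w, \<rho>, n)) \<le> (1 + lower_order_bound) * U_norm T \<Omega> (w, \<rho>, n)"
    "l2norm Q (flux_residual T \<Omega> A (w, \<rho>, n)) \<le> (1 / sqrt \<alpha> + sqrt A_bound) * U_norm T \<Omega> (w, \<rho>, n)"
    "l2norm Q w \<le> k * U_norm T \<Omega> (w, \<rho>, n)" if W: "(w, \<rho>, n) \<in> U_space T \<Omega>" for w \<rho> n
  proof -
    note w = U_norm_ge[where u = w and \<sigma> = \<rho> and l = n]
    have "lower_order_bound * l2norm Q (grad_x T \<Omega> w) \<le> lower_order_bound * U_norm T \<Omega> (w, \<rho>, n)"
      by (intro mult_left_mono w lower_order_bound_nonneg)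
    then show "l2norm Q (residual T \<Omega> b c (w, \<rho>, n)) \<le> (1 + lower_order_bound) * U_norm T \<Omega> (w, \<rho>, n)"
      using residual_bounds(2)[OF W] w(6) unfolding distrib_right by linarith
    have "1 / sqrt \<alpha> * l2norm Q \<rho> \<le> 1 / sqrt \<alpha> * U_norm T \<Omega> (w, \<rho>, n)"
      "sqrt A_bound * l2norm Q (grad_x T \<Omega> w) \<le> sqrt A_bound * U_norm T \<Omega> (w, \<rho>, n)"
      by (intro mult_left_mono w; use \<alpha> A_bound_pos in simp)+
    then show "l2norm Q (flux_residual T \<Omega> A (w, \<rho>, n)) \<le> (1 / sqrt \<alpha> + sqrt A_bound) * U_norm T \<Omega> (w, \<rho>, n)"
      using flux_residual_bounds(2)[OF W] unfolding distrib_right by linarith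
    have "w \<in> V_space T \<Omega>" using W by (simp add: U_space_def)
    then have "l2norm Q w \<le> k * l2norm Q (grad_x T \<Omega> w)" by (rule V_space_friedrichs)
    also have "\<dots> \<le> k * U_norm T \<Omega> (w, \<rho>, n)" by (intro mult_left_mono w) (use k_pos in simp)
    finally show "l2norm Q w \<le> k * U_norm T \<Omega> (w, \<rho>, n)" .
  qed
  note ru = res[OF U, folded X_def] and rv = res[OF V, folded Y_def]
  have T0: "0 \<in> {0..T}" "T \<in> {0..T}" using T by auto
  have B: "0 \<le> 1 + lower_order_bound" "0 \<le> 1 / sqrt \<alpha> + sqrt A_bound" "0 \<le> k"
    using lower_order_bound_nonneg \<alpha> A_bound_pos k_pos by auto
  have 1: "\<bar>l2inner Q (residual T \<Omega> b c (u, \<sigma>, l)) (residual T \<Omega> b c (v, \<tau>, m))\<bar> \<le> (1 + lower_order_bound)\<^sup>2 * (X * Y)"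
    using prod[OF residual_bounds(1)[OF U] residual_bounds(1)[OF V] ru(1) rv(1) B(1,1)] by (simp add: power2_eq_square)
  have 2: "\<bar>l2inner Q (flux_residual T \<Omega> A (u, \<sigma>, l)) (flux_residual T \<Omega> A (v, \<tau>, m))\<bar> \<le> (1 / sqrt \<alpha> + sqrt A_bound)\<^sup>2 * (X * Y)"
    using prod[OF flux_residual_bounds(1)[OF U] flux_residual_bounds(1)[OF V] ru(2) rv(2) B(2,2)] by (simp add: power2_eq_square)
  have 3: "\<bar>l2inner \<Omega> (time_value T \<Omega> u 0) (time_value T \<Omega> v 0)\<bar> \<le> X * Y"
    using prod[OF time_value_L2[OF U T0(1)] time_value_L2[OF V T0(1)], of 1 1] x(3) y(3) by simp
  have 4: "\<bar>l2inner \<Omega> (time_value T \<Omega> u T) (time_value T \<Omega> v T)\<bar> \<le> X * Y"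
    using prod[OF time_value_L2[OF U T0(2)] time_value_L2[OF V T0(2)], of 1 1] x(4) y(4) by simp
  have 5: "\<bar>l2inner Q (div_residual T \<Omega> (u, \<sigma>, l)) v\<bar> \<le> k * (X * Y)"
    using prod[OF div_residual_L2[OF U] V_spaceD(1)[OF v(1)], of 1 k] x(6) rv(3) B(3) by simp
  have "\<bar>l2inner Q u (div_residual T \<Omega> (v, \<tau>, m))\<bar> \<le> k * (X * Y)"
    using prod[OF V_spaceD(1)[OF u(1)] div_residual_L2[OF V], of k 1] y(6) ru(3) B(3) by simp
  then have 6: "\<bar>l2inner Q (div_residual T \<Omega> (v, \<tau>, m)) u\<bar> \<le> k * (X * Y)" by (simp add: l2inner_commute)
  have 7: "\<bar>l2inner Q \<sigma> (grad_x T \<Omega> v)\<bar> \<le> X * Y"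
    using prod[OF u(2) V_spaceD(4)[OF v(1)], of 1 1] x(5) y(2) by simp
  have "\<bar>l2inner Q (grad_x T \<Omega> u) \<tau>\<bar> \<le> X * Y"
    using prod[OF V_spaceD(4)[OF u(1)] v(2), of 1 1] x(2) y(5) by simp
  then have 8: "\<bar>l2inner Q \<tau> (grad_x T \<Omega> u)\<bar> \<le> X * Y" by (simp add: l2inner_commute)
  \<comment> \<open>Two boundary products and two flux products give 4; the two products of a
    residual with a function cost a Friedrichs constant each. Half of this is the summand 2 + k of
    the constant.\<close>
  have 9: "\<bar>l v + m u\<bar> \<le> 4 * (X * Y) + 2 * (k * (X * Y))"
    unfolding parabolic_identity[OF U V] using 3 4 5 6 7 8 by linarith
  have abs: "\<bar>w + x + y + 1 / 2 * p + 1 / 2 * q\<bar> \<le> \<bar>w\<bar> + \<bar>x\<bar> + \<bar>y\<bar> + 1 / 2 * \<bar>p + q\<bar>" for w x y p q :: real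
  proof -
    have "\<bar>w + x + y + (1 / 2 * p + 1 / 2 * q)\<bar> \<le> \<bar>w\<bar> + \<bar>x\<bar> + \<bar>y\<bar> + \<bar>1 / 2 * p + 1 / 2 * q\<bar>" by linarith
    also have "\<bar>1 / 2 * p + 1 / 2 * q\<bar> = 1 / 2 * \<bar>p + q\<bar>" unfolding distrib_left[symmetric] abs_mult by simp
    finally show ?thesis by (simp only: add.assoc)
  qed
  have "\<bar>a_form T \<Omega> A b c \<alpha> \<Lambda> (u, \<sigma>, l) (v, \<tau>, m)\<bar> \<le>
      \<bar>inverse \<alpha> * \<Lambda> * l2inner Q (residual T \<Omega> b c (u, \<sigma>, l)) (residual T \<Omega> b c (v, \<tau>, m))\<bar> +
      \<bar>l2inner Q (flux_residual T \<Omega> A (u, \<sigma>, l)) (flux_residual T \<Omega> A (v, \<tau>, m))\<bar> +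
      \<bar>l2inner \<Omega> (time_value T \<Omega> u 0) (time_value T \<Omega> v 0)\<bar> + 1 / 2 * \<bar>l v + m u\<bar>"
    unfolding a_form.simps by (rule abs)
  also have "\<dots> \<le> inverse \<alpha> * \<Lambda> * ((1 + lower_order_bound)\<^sup>2 * (X * Y)) + (1 / sqrt \<alpha> + sqrt A_bound)\<^sup>2 * (X * Y) + X * Y +
      1 / 2 * (4 * (X * Y) + 2 * (k * (X * Y)))"
  proof (intro add_mono mult_left_mono 2 3 9)
    have "inverse \<alpha> * \<Lambda> * \<bar>l2inner Q (residual T \<Omega> b c (u, \<sigma>, l)) (residual T \<Omega> b c (v, \<tau>, m))\<bar> \<le>
        inverse \<alpha> * \<Lambda> * ((1 + lower_order_bound)\<^sup>2 * (X * Y))"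
      by (intro mult_left_mono 1) (use \<alpha> \<Lambda>_pos in simp)
    then show "\<bar>inverse \<alpha> * \<Lambda> * l2inner Q (residual T \<Omega> b c (u, \<sigma>, l)) (residual T \<Omega> b c (v, \<tau>, m))\<bar> \<le>
        inverse \<alpha> * \<Lambda> * ((1 + lower_order_bound)\<^sup>2 * (X * Y))"
      using \<alpha> \<Lambda>_pos by (simp add: abs_mult)
  qed simp
  also have "\<dots> = (inverse \<alpha> * \<Lambda> * (1 + lower_order_bound)\<^sup>2 + (1 / sqrt \<alpha> + sqrt A_bound)\<^sup>2 + 1 + (2 + k)) * X * Y"
    by (simp only: distrib_right distrib_left mult.assoc)
  finally show ?thesis unfolding X_def Y_def .
qed

lemma a_form_symmetric_bounded_coercive:
  "(\<forall>u\<in>U_space T \<Omega>. \<forall>v\<in>U_space T \<Omega>. a_form T \<Omega> A b c \<alpha> \<Lambda> u v = a_form T \<Omega> A b c \<alpha> \<Lambda> v u) \<and>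
   (\<exists>C\<^sub>1>0. \<exists>C\<^sub>2>0.
      (\<forall>u\<in>U_space T \<Omega>. \<forall>v\<in>U_space T \<Omega>. \<bar>a_form T \<Omega> A b c \<alpha> \<Lambda> u v\<bar> \<le> C\<^sub>1 * U_norm T \<Omega> u * U_norm T \<Omega> v) \<and>
      (\<forall>u\<in>U_space T \<Omega>. (U_norm T \<Omega> u)\<^sup>2 \<le> C\<^sub>2 * a_form T \<Omega> A b c \<alpha> \<Lambda> u u))"
proof (intro conjI ballI exI)
  fix u v :: "'d triple" assume U: "u \<in> U_space T \<Omega>" and V: "v \<in> U_space T \<Omega>"
  obtain u0 \<sigma> l where u: "u = (u0, \<sigma>, l)" by (rule prod_cases3)
  obtain v0 \<tau> m where v: "v = (v0, \<tau>, m)" by (rule prod_cases3)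
  show "a_form T \<Omega> A b c \<alpha> \<Lambda> u v = a_form T \<Omega> A b c \<alpha> \<Lambda> v u"
    unfolding u v a_form.simps
    by (simp only: l2inner_commute[of Q "residual T \<Omega> b c (u0, \<sigma>, l)"] l2inner_commute[of Q "flux_residual T \<Omega> A (u0, \<sigma>, l)"]
        l2inner_commute[of \<Omega> "time_value T \<Omega> u0 0"])
  show "\<bar>a_form T \<Omega> A b c \<alpha> \<Lambda> u v\<bar> \<le>
    (inverse \<alpha> * \<Lambda> * (1 + lower_order_bound)\<^sup>2 + (1 / sqrt \<alpha> + sqrt A_bound)\<^sup>2 + 1 + (2 + k)) * U_norm T \<Omega> u * U_norm T \<Omega> v"
    using U V unfolding u v by (rule a_form_bounded)
next
  fix u :: "'d triple" assume U: "u \<in> U_space T \<Omega>"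
  obtain u0 \<sigma> l where u: "u = (u0, \<sigma>, l)" by (rule prod_cases3)
  show "(U_norm T \<Omega> u)\<^sup>2 \<le>
      ((1 + 2 * lower_order_bound\<^sup>2) * (6 / \<alpha>) + 2 + 2 * A_bound + 8 * \<alpha> / \<Lambda>) * a_form T \<Omega> A b c \<alpha> \<Lambda> u u"
    using U unfolding u by (rule a_form_coercive)
next
  show "0 < inverse \<alpha> * \<Lambda> * (1 + lower_order_bound)\<^sup>2 + (1 / sqrt \<alpha> + sqrt A_bound)\<^sup>2 + 1 + (2 + k)"
    using \<alpha> \<Lambda>_pos k_pos by (intro add_nonneg_pos) auto
  show "0 < (1 + 2 * lower_order_bound\<^sup>2) * (6 / \<alpha>) + 2 + 2 * A_bound + 8 * \<alpha> / \<Lambda>"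
    using \<alpha> \<Lambda>_pos A_bound_pos by (intro add_nonneg_pos) auto
qed

end

theorem lemma4:
  fixes T \<alpha> \<Lambda> c\<^sub>F :: real
    and \<Omega> :: "(real ^ 'd) set"
    and A :: "real \<times> (real ^ 'd) \<Rightarrow> real ^ 'd ^ 'd"
    and b :: "real \<times> (real ^ 'd) \<Rightarrow> real ^ 'd"
    and c g :: "real \<times> (real ^ 'd) \<Rightarrow> real"
  assumes dim: "CARD('d) \<in> {1, 2, 3}"
    and domain: "bounded_lipschitz_domain \<Omega>"
    and T_pos: "0 < T"
    and A_bounded: "Linf (cylinder T \<Omega>) A"
    and A_sym: "AE z in lebesgue_on (cylinder T \<Omega>). transpose (A z) = A z"
    and b_bounded: "Linf (cylinder T \<Omega>) b"
    and c_bounded: "Linf (cylinder T \<Omega>) c"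
    and g_bounded: "Linf (cylinder T \<Omega>) g"
    and g_eq: "represents (cylinder T \<Omega>) g
      (\<lambda>\<phi>. - 1 / 2 * distr_div (cylinder T \<Omega>) (\<lambda>z. (0, b z)) \<phi> + l2inner (cylinder T \<Omega>) c \<phi>)"
    and g_nonneg: "AE z in lebesgue_on (cylinder T \<Omega>). 0 \<le> g z"
    and alpha_pos: "0 < \<alpha>"
    and elliptic: "AE z in lebesgue_on (cylinder T \<Omega>). \<forall>y. \<alpha> * (norm y)\<^sup>2 \<le> y \<bullet> (A z *v y)"
    and c\<^sub>F: "friedrichs_constant T \<Omega> c\<^sub>F"
    and c\<^sub>F_least: "\<And>C. friedrichs_constant T \<Omega> C \<Longrightarrow> c\<^sub>F \<le> C"
    and Lambda: "c\<^sub>F\<^sup>2 \<le> \<Lambda>"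
  shows "(\<forall>u\<in>U_space T \<Omega>. \<forall>v\<in>U_space T \<Omega>.
            a_form T \<Omega> A b c \<alpha> \<Lambda> u v = a_form T \<Omega> A b c \<alpha> \<Lambda> v u) \<and>
         (\<exists>C\<^sub>1>0. \<exists>C\<^sub>2>0.
            (\<forall>u\<in>U_space T \<Omega>. \<forall>v\<in>U_space T \<Omega>.
               \<bar>a_form T \<Omega> A b c \<alpha> \<Lambda> u v\<bar> \<le> C\<^sub>1 * U_norm T \<Omega> u * U_norm T \<Omega> v) \<and>
            (\<forall>u\<in>U_space T \<Omega>.
               (U_norm T \<Omega> u)\<^sup>2 \<le> C\<^sub>2 * a_form T \<Omega> A b c \<alpha> \<Lambda> u u))"
proof -
  have "open \<Omega>" "bounded \<Omega>" using domain by (simp_all add: bounded_lipschitz_domain_def)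
  then interpret parabolic_coefficients T \<Omega> A b c g \<alpha> \<Lambda> c\<^sub>F
    using assms by unfold_locales auto
  show ?thesis by (rule a_form_symmetric_bounded_coercive)
qed

end
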